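(* Let $S^3$ be the unit 3-sphere (constant curvature $1$), and let $E_{a,b}$ denote the irreducible component of type $\rho_a\widehat{\otimes}\rho_b$ of the $Spin(4)=SU(2)\times SU(2)$-representation $L^2(S^3,\mathbf{S}_m)$. The components that occur, each once, are: for $m=2p+1$, $E_{k,k+2s+1}$ and $E_{k+2s+1,k}$ with $0\le s\le p$, $k\ge p-s$; for $m=2p$, $E_{k,k+2s}$ and $E_{k+2s,k}$ with $1\le s\le p$, $k\ge p-s$, together with $E_{k,k}$, $k\ge p$ (the case $s=0$ below). Then: (1) The eigenvalues of the self-adjoint operator $D_m^0$ on $S^3$ are as follows. (a) For $m=2p+1$: $(2s+1)(k+\frac{2s+3}{2})$ on $E_{k+2s+1,k}$, and $-(2s+1)(k+\frac{2s+3}{2})$ on $E_{k,k+2s+1}$. In particular, $\ker D_{2p+1}^0=0$ for each $p$. (b) For $m=2p$: $2s(k+s+1)$ on $E_{k+2s,k}$, $-2s(k+s+1)$ on $E_{k,k+2s}$, and $0$ on $E_{k,k}$. (2) The eigenvalues of the second order operator $D_{m-2}^+D_m^-$ on $S^3$ are as follows. (a) For $m=2p+1$: $4(p-s)(k+1-(p-s))(p+s+1)(k+p+s+2)$ on $E_{k+2s+1,k}$ or $E_{k,k+2s+1}$. (b) For $m=2p$: $4(p-s)(k+1-(p-s))(p+s)(k+p+s+1)$ on $E_{k+2s,k}$ or $E_{k,k+2s}$. (3) The eigenvalues of the second order elliptic operator $D_{m+2}^-D_m^+$ on $S^3$ are as follows. (a) For $m=2p+1$: $4(p-s+1)(k-(p-s))(p+s+2)(k+p+s+3)$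 on $E_{k+2s+1,k}$ or $E_{k,k+2s+1}$. (b) For $m=2p$: $4(p-s+1)(k-(p-s))(p+s+1)(k+p+s+2)$ on $E_{k+2s,k}$ or $E_{k,k+2s}$. In particular, $\dim\ker D_m^+=\frac16(m+1)(m+2)(m+3)$.
   Context: Representations: for an integer $m\ge 0$, $V_m$ is the complex vector space of polynomials of degree $\le m$ in one variable $z_m$, with the Hermitian inner product for which $(z_m^k,z_m^l)=k!(m-k)!\,\delta_{kl}$. $SU(2)$ acts unitarily and irreducibly by $\rho_m(h)z_m^k=(bz_m+d)^{m-k}(az_m+c)^k$ for $h=\begin{pmatrix}a&b\\c&d\end{pmatrix}$. Put $V_{-1}=V_{-2}=0$ (all maps into or out of these are $0$). $\mathbf{R}^3$ (standard basis $e_1,e_2,e_3$, standard inner product) is identified with $\mathfrak{su}(2)$ by $e_i\leftrightarrow\sigma_i$, where $\sigma_1=\begin{pmatrix}i&0\\0&-i\end{pmatrix}$, $\sigma_2=\begin{pmatrix}0&1\\-1&0\end{pmatrix}$, $\sigma_3=\begin{pmatrix}0&i\\i&0\end{pmatrix}$. Clifford homomorphisms: for $X\in\mathbf{R}^3$ the maps $\rho_m^0(X):V_m\to V_m$ and $\rho_m^{\pm}(X):V_m\to V_{m\pm2}$ are linear in $X$ and (after complex-linear extension in $X$) given by $\rho_m^0(\frac{e_1}{2})z_m^k=i(k-\frac m2)z_m^k$, $\rho_m^0(\frac{e_2}{2}+i\frac{e_3}{2})z_m^k=-kz_m^{k-1}$, $\rho_m^0(\frac{e_2}{2}-i\frac{e_3}{2})z_m^k=(m-k)z_m^{k+1}$;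 $\rho_m^+(\frac{e_1}{2})z_m^k=iz_{m+2}^{k+1}$, $\rho_m^+(\frac{e_2}{2}+i\frac{e_3}{2})z_m^k=-z_{m+2}^k$, $\rho_m^+(\frac{e_2}{2}-i\frac{e_3}{2})z_m^k=-z_{m+2}^{k+2}$; $\rho_m^-(\frac{e_1}{2})z_m^k=ik(m-k)z_{m-2}^{k-1}$, $\rho_m^-(\frac{e_2}{2}+i\frac{e_3}{2})z_m^k=k(k-1)z_{m-2}^{k-2}$, $\rho_m^-(\frac{e_2}{2}-i\frac{e_3}{2})z_m^k=(m-k)(m-k-1)z_{m-2}^k$. The sphere: $S^3\ni x=(x_1,x_2,x_3,x_4)$ is identified with $SU(2)$ by $x\mapsto\begin{pmatrix}x_4+ix_1&x_2+ix_3\\-x_2+ix_3&x_4-ix_1\end{pmatrix}$. $Spin(4)=SU(2)\times SU(2)$ acts by $(p,q)\cdot h=phq^{-1}$, with isotropy group at the identity the diagonal $SU(2)=Spin(3)$. The principal spin bundle is $\mathbf{Spin}(S^3)=Spin(4)$ with projection $(p,q)\mapsto pq^{-1}$ and structure group the diagonal $SU(2)$ acting by right multiplication; $T(S^3)=Spin(4)\times_{\mathrm{Ad}}\mathfrak{su}(2)$ via $[(p,q),X]\mapsto\frac{d}{dt}|_{t=0}\,p\exp(tX)q^{-1}$, and the orientation is the one induced from the basis $\sigma_1,\sigma_2,\sigma_3$. The bundle $\mathbf{S}_m=Spin(4)\times_{\rho_m}V_m$ is homogeneous (with $\mathbf{S}_{-1}=\mathbf{S}_{-2}=0$), so $L^2(S^3,\mathbf{S}_m)$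 is a representation of $Spin(4)$ (induced by left multiplication $g_0[g,v]=[g_0g,v]$). $\rho_a\widehat{\otimes}\rho_b$ is the exterior tensor product representation of $SU(2)\times SU(2)$ (first factor acting by $\rho_a$, second by $\rho_b$), of dimension $(a+1)(b+1)$. Higher spin Dirac operators: the Clifford homomorphisms are $SU(2)$-equivariant and induce bundle maps $\rho_m^0(X)\in\mathrm{End}(\mathbf{S}_m)$, $\rho_m^\pm(X)\in\mathrm{Hom}(\mathbf{S}_m,\mathbf{S}_{m\pm2})$ for tangent vectors $X$. With $\nabla$ the covariant derivative on $\mathbf{S}_m$ induced by the Levi-Civita connection and $\{e_i\}$ a local positively oriented orthonormal frame, $D_m^0=\sum_i\rho_m^0(e_i)\nabla_{e_i}$ on $\Gamma(S^3,\mathbf{S}_m)$ and $D_m^\pm=\sum_i\rho_m^\pm(e_i)\nabla_{e_i}:\Gamma(S^3,\mathbf{S}_m)\to\Gamma(S^3,\mathbf{S}_{m\pm2})$. *)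

theory Defs
  imports
    "HOL-Analysis.Analysis"
    "HOL-Computational_Algebra.Polynomial"
    "HOL-Library.Function_Algebras"
begin

section \<open>Representations of SU(2) and Clifford homomorphisms\<close>

type_synonym mat2 = "complex ^ 2 ^ 2"

definition mat_of :: "complex \<Rightarrow> complex \<Rightarrow> complex \<Rightarrow> complex \<Rightarrow> mat2" where
  "mat_of a b c d = vector [vector [a, b], vector [c, d]]"

definition adjoint_mat :: "mat2 \<Rightarrow> mat2" where
  "adjoint_mat h = (\<chi> i j. cnj (h $ j $ i))"

definition SU2 :: "mat2 set" where
  "SU2 = {h. h ** adjoint_mat h = mat 1 \<and> det h = 1}"

definition su2 :: "mat2 set" where
  "su2 = {X. adjoint_mat X = - X \<and> trace X = 0}"

definition su2_of :: "real ^ 3 \<Rightarrow> mat2" where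
  "su2_of X = X $ 1 *\<^sub>R mat_of \<i> 0 0 (- \<i>)
            + X $ 2 *\<^sub>R mat_of 0 1 (- 1) 0
            + X $ 3 *\<^sub>R mat_of 0 \<i> \<i> 0"

text \<open>The index \<open>m\<close> is an integer so that \<open>V\<^sub>m = 0\<close> for negative \<open>m\<close>.\<close>

definition V :: "int \<Rightarrow> complex poly set" where
  "V m = {f. \<forall>k. m < int k \<longrightarrow> coeff f k = 0}"

definition herm :: "int \<Rightarrow> complex poly \<Rightarrow> complex poly \<Rightarrow> complex" where
  "herm m f g = (\<Sum>k\<le>nat m. fact k * fact (nat m - k) * coeff f k * cnj (coeff g k))"

definition lin_ext :: "(nat \<Rightarrow> complex poly) \<Rightarrow> complex poly \<Rightarrow> complex poly" where
  "lin_ext T f = (\<Sum>k\<le>degree f. smult (coeff f k) (T k))"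

definition rho :: "int \<Rightarrow> mat2 \<Rightarrow> complex poly \<Rightarrow> complex poly" where
  "rho m h = lin_ext (\<lambda>k.
     [:h $ 2 $ 2, h $ 1 $ 2:] ^ (nat m - k) * [:h $ 2 $ 1, h $ 1 $ 1:] ^ k)"

text \<open>
  The Clifford homomorphisms are prescribed on the basis \<open>e\<^sub>1/2\<close>, \<open>e\<^sub>2/2 + i e\<^sub>3/2\<close>,
  \<open>e\<^sub>2/2 - i e\<^sub>3/2\<close> of the complexification of \<open>R\<^sup>3\<close>. In this basis
  \<open>X = 2 X\<^sub>1 (e\<^sub>1/2) + (X\<^sub>2 - i X\<^sub>3) (e\<^sub>2/2 + i e\<^sub>3/2) + (X\<^sub>2 + i X\<^sub>3) (e\<^sub>2/2 - i e\<^sub>3/2)\<close>.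
  Where a truncated exponent such as \<open>k - 1\<close> at \<open>k = 0\<close> occurs, its coefficient vanishes.
\<close>

definition cliff_ext ::
  "(nat \<Rightarrow> complex poly) \<Rightarrow> (nat \<Rightarrow> complex poly) \<Rightarrow> (nat \<Rightarrow> complex poly)
    \<Rightarrow> real ^ 3 \<Rightarrow> complex poly \<Rightarrow> complex poly" where
  "cliff_ext H A B X = lin_ext (\<lambda>k.
      smult (complex_of_real (2 * X $ 1)) (H k)
    + smult (Complex (X $ 2) (- (X $ 3))) (A k)
    + smult (Complex (X $ 2) (X $ 3)) (B k))"

definition rho_zero :: "int \<Rightarrow> real ^ 3 \<Rightarrow> complex poly \<Rightarrow> complex poly" where
  "rho_zero m = cliff_ext
     (\<lambda>k. monom (\<i> * (of_nat k - of_int m / 2)) k)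
     (\<lambda>k. monom (- of_nat k) (k - 1))
     (\<lambda>k. monom (of_int m - of_nat k) (k + 1))"

definition rho_plus :: "int \<Rightarrow> real ^ 3 \<Rightarrow> complex poly \<Rightarrow> complex poly" where
  "rho_plus m = cliff_ext
     (\<lambda>k. monom \<i> (k + 1))
     (\<lambda>k. monom (- 1) k)
     (\<lambda>k. monom (- 1) (k + 2))"

definition rho_minus :: "int \<Rightarrow> real ^ 3 \<Rightarrow> complex poly \<Rightarrow> complex poly" where
  "rho_minus m = cliff_ext
     (\<lambda>k. monom (\<i> * of_nat k * (of_int m - of_nat k)) (k - 1))
     (\<lambda>k. monom (of_nat k * (of_nat k - 1)) (k - 2))
     (\<lambda>k. monom ((of_int m - of_nat k) * (of_int m - of_nat k - 1)) k)"


section \<open>Smooth functions on subsets of normed spaces\<close>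

fun Ck_on :: "nat \<Rightarrow> 'a::real_normed_vector set \<Rightarrow> ('a \<Rightarrow> 'b::real_normed_vector) \<Rightarrow> bool" where
  "Ck_on 0 U f \<longleftrightarrow> continuous_on U f"
| "Ck_on (Suc n) U f \<longleftrightarrow>
     (\<forall>x\<in>U. f differentiable (at x)) \<and> (\<forall>v. Ck_on n U (\<lambda>x. frechet_derivative f (at x) v))"

text \<open>
  Smoothness on a submanifold \<open>S\<close> of a finite-dimensional space: local extendability to a
  smooth function on an open set of the ambient space.
\<close>

definition smooth_on :: "'a::real_normed_vector set \<Rightarrow> ('a \<Rightarrow> 'b::real_normed_vector) \<Rightarrow> bool" where
  "smooth_on S f \<longleftrightarrow> (\<forall>x\<in>S. \<exists>U F. open U \<and> x \<in> U \<and> (\<forall>n. Ck_on n U F) \<and> (\<forall>y\<in>U \<inter> S. F y = f y))"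


section \<open>The sphere and its spin bundle\<close>

definition S3 :: "(real ^ 4) set" where
  "S3 = sphere 0 1"

definition mat4 :: "real ^ 4 \<Rightarrow> mat2" where
  "mat4 x = mat_of (Complex (x $ 4) (x $ 1)) (Complex (x $ 2) (x $ 3))
                   (Complex (- (x $ 2)) (x $ 3)) (Complex (x $ 4) (- (x $ 1)))"

definition Spin4 :: "(mat2 \<times> mat2) set" where
  "Spin4 = SU2 \<times> SU2"

definition spin_proj :: "mat2 \<times> mat2 \<Rightarrow> real ^ 4" where
  "spin_proj = (\<lambda>(p, q). inv mat4 (p ** matrix_inv q))"

text \<open>
  The tangent vector \<open>[(p, q), X]\<close> at \<open>spin_proj (p, q)\<close>, that is, the derivative of
  \<open>p exp(tX) q\<^sup>-\<^sup>1\<close> at \<open>t = 0\<close>, as a vector of \<open>R\<^sup>4\<close>. For fixed \<open>g\<close>, the vectors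
  \<open>spin_frame g (axis i 1)\<close> form the positively oriented orthonormal frame determined by \<open>g\<close>.
\<close>

definition spin_frame :: "mat2 \<times> mat2 \<Rightarrow> real ^ 3 \<Rightarrow> real ^ 4" where
  "spin_frame = (\<lambda>(p, q) X. inv mat4 (p ** su2_of X ** matrix_inv q))"

definition tangent_Spin4 :: "mat2 \<times> mat2 \<Rightarrow> (mat2 \<times> mat2) set" where
  "tangent_Spin4 = (\<lambda>(p, q). {(p ** A, q ** B) | A B. A \<in> su2 \<and> B \<in> su2})"

text \<open>
  The Frechet derivative within \<open>Spin4\<close> is only determined on vectors tangent to \<open>Spin4\<close>; it is
  only ever applied to those.
\<close>

definition dSpin :: "(mat2 \<times> mat2 \<Rightarrow> 'b::real_normed_vector) \<Rightarrow> mat2 \<times> mat2 \<Rightarrow> mat2 \<times> mat2 \<Rightarrow> 'b" where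
  "dSpin F g \<xi> = frechet_derivative F (at g within Spin4) \<xi>"


section \<open>The Levi-Civita connection\<close>

text \<open>
  The Levi-Civita derivative along a curve in the unit sphere is the tangential part of the
  derivative in \<open>R\<^sup>4\<close>. A tangent vector of \<open>Spin4\<close> is horizontal for the induced connection iff
  the spin frame is parallel to first order in its direction.
\<close>

definition tangential_part :: "real ^ 4 \<Rightarrow> real ^ 4 \<Rightarrow> real ^ 4" where
  "tangential_part x v = v - (v \<bullet> x) *\<^sub>R x"

definition horizontal :: "mat2 \<times> mat2 \<Rightarrow> mat2 \<times> mat2 \<Rightarrow> bool" where
  "horizontal g \<xi> \<longleftrightarrow> \<xi> \<in> tangent_Spin4 g \<and>
     (\<forall>X. tangential_part (spin_proj g) (dSpin (\<lambda>g'. spin_frame g' X) g \<xi>) = 0)"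

definition horizontal_lift :: "mat2 \<times> mat2 \<Rightarrow> real ^ 4 \<Rightarrow> mat2 \<times> mat2" where
  "horizontal_lift g v = (THE \<xi>. horizontal g \<xi> \<and> dSpin spin_proj g \<xi> = v)"


section \<open>Sections of the bundles \<open>S\<^sub>m\<close>\<close>

text \<open>
  A section \<open>x \<mapsto> [g, \<phi> g]\<close> of \<open>S\<^sub>m = Spin4 \<times>\<^sub>\<rho> V\<^sub>m\<close> is given by its equivariant function
  \<open>\<phi>\<close> on \<open>Spin4\<close>, extended by \<open>0\<close> outside \<open>Spin4\<close> so that equality of functions is equality of
  sections.
\<close>

type_synonym sect = "mat2 \<times> mat2 \<Rightarrow> complex poly"

definition sections :: "int \<Rightarrow> sect set" where
  "sections m = {\<phi>.
     (\<forall>g. g \<notin> Spin4 \<longrightarrow> \<phi> g = 0) \<and>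
     (\<forall>g\<in>Spin4. \<phi> g \<in> V m) \<and>
     (\<forall>p\<in>SU2. \<forall>q\<in>SU2. \<forall>h\<in>SU2. \<phi> (p ** h, q ** h) = rho m (matrix_inv h) (\<phi> (p, q)))}"

definition smooth_sections :: "int \<Rightarrow> sect set" where
  "smooth_sections m = {\<phi> \<in> sections m. \<forall>k. smooth_on Spin4 (\<lambda>g. coeff (\<phi> g) k)}"

definition sec_scale :: "complex \<Rightarrow> sect \<Rightarrow> sect" where
  "sec_scale c \<phi> = (\<lambda>g. smult c (\<phi> g))"

global_interpretation sec: vector_space sec_scale
  by unfold_locales
    (auto simp: sec_scale_def fun_eq_iff smult_add_right smult_add_left)

text \<open>\<open>nabla m \<phi> g v\<close> represents the covariant derivative \<open>\<nabla>\<^sub>v \<phi>\<close> with respect to the spin frame \<open>g\<close>.\<close>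

definition nabla :: "int \<Rightarrow> sect \<Rightarrow> mat2 \<times> mat2 \<Rightarrow> real ^ 4 \<Rightarrow> complex poly" where
  "nabla m \<phi> g v = (\<Sum>k\<le>nat m. monom (dSpin (\<lambda>g'. coeff (\<phi> g') k) g (horizontal_lift g v)) k)"

text \<open>
  The tangent vector \<open>[g, X]\<close> acts on \<open>[g, v]\<close> by \<open>[g, R X v]\<close>. The sum of all \<open>R(e\<^sub>i) \<nabla>\<^bsub>e_i\<^esub>\<close> is taken
  at each \<open>g\<close> over the positively oriented orthonormal frame determined by \<open>g\<close>; it does not
  depend on the choice of the orthonormal frame.
\<close>

definition dirac_of ::
  "(real ^ 3 \<Rightarrow> complex poly \<Rightarrow> complex poly) \<Rightarrow> int \<Rightarrow> sect \<Rightarrow> sect" where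
  "dirac_of R m \<phi> = (\<lambda>g. if g \<in> Spin4
     then \<Sum>i\<in>UNIV. R (axis i 1) (nabla m \<phi> g (spin_frame g (axis i 1))) else 0)"

definition D_zero :: "int \<Rightarrow> sect \<Rightarrow> sect" where
  "D_zero m = dirac_of (rho_zero m) m"

definition D_plus :: "int \<Rightarrow> sect \<Rightarrow> sect" where
  "D_plus m = dirac_of (rho_plus m) m"

definition D_minus :: "int \<Rightarrow> sect \<Rightarrow> sect" where
  "D_minus m = dirac_of (rho_minus m) m"


section \<open>Square-integrable sections\<close>

text \<open>
  The Riemannian volume of a Borel subset \<open>A\<close> of the unit sphere of \<open>R\<^sup>4\<close> is four times the
  Lebesgue measure of the cone \<open>{t x | x \<in> A, 0 < t \<le> 1}\<close>.
\<close>

definition sphere_measure :: "(real ^ 4) measure" where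
  "sphere_measure =
     density (distr (restrict_space lborel (cball 0 1 - {0})) borel (\<lambda>x. x /\<^sub>R norm x)) (\<lambda>_. 4)"

text \<open>
  Sections are evaluated at \<open>x\<close> using the point \<open>(mat4 x, 1)\<close> of \<open>Spin4\<close> above \<open>x\<close>; since \<open>rho m\<close>
  is unitary, pointwise inner products do not depend on this choice.
\<close>

definition at_point :: "sect \<Rightarrow> real ^ 4 \<Rightarrow> complex poly" where
  "at_point \<phi> x = \<phi> (mat4 x, mat 1)"

text \<open>
  \<open>L2 m\<close> consists of functions, not of classes; elements of the Hilbert space are its elements
  up to \<open>ae_eq\<close>.
\<close>

definition L2 :: "int \<Rightarrow> sect set" where
  "L2 m = {\<phi> \<in> sections m.
     (\<forall>k. (\<lambda>x. coeff (at_point \<phi> x) k) \<in> borel_measurable sphere_measure) \<and>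
     integrable sphere_measure (\<lambda>x. herm m (at_point \<phi> x) (at_point \<phi> x))}"

definition ae_eq :: "sect \<Rightarrow> sect \<Rightarrow> bool" where
  "ae_eq \<phi> \<psi> \<longleftrightarrow> (AE x in sphere_measure. at_point \<phi> x = at_point \<psi> x)"

definition L2_inner :: "int \<Rightarrow> sect \<Rightarrow> sect \<Rightarrow> complex" where
  "L2_inner m \<phi> \<psi> = (LINT x|sphere_measure. herm m (at_point \<phi> x) (at_point \<psi> x))"

definition L2_norm :: "int \<Rightarrow> sect \<Rightarrow> real" where
  "L2_norm m \<phi> = sqrt (Re (L2_inner m \<phi> \<phi>))"

text \<open>\<open>g\<^sub>0 [g, v] = [g\<^sub>0 g, v]\<close> turns into \<open>(g\<^sub>0 \<phi>) g = \<phi> (g\<^sub>0\<^sup>-\<^sup>1 g)\<close> for equivariant functions.\<close>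

definition spin_act :: "mat2 \<Rightarrow> mat2 \<Rightarrow> sect \<Rightarrow> sect" where
  "spin_act p0 q0 \<phi> = (\<lambda>(p, q). \<phi> (matrix_inv p0 ** p, matrix_inv q0 ** q))"

text \<open>
  \<open>component m a b E\<close>: the subspace \<open>E\<close> of \<open>L2 m\<close> (a union of classes) is a subrepresentation
  isomorphic to the exterior tensor product of \<open>rho a\<close> and \<open>rho b\<close>. The isomorphism from
  \<open>V a \<otimes> V b\<close> is given by the corresponding bilinear map \<open>\<beta>\<close>.
\<close>

definition component :: "int \<Rightarrow> nat \<Rightarrow> nat \<Rightarrow> sect set \<Rightarrow> bool" where
  "component m a b E \<longleftrightarrow> (\<exists>\<beta>.
     (\<forall>v\<in>V (int a). \<forall>w\<in>V (int b). \<beta> v w \<in> L2 m) \<and>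
     (\<forall>v\<in>V (int a). \<forall>v'\<in>V (int a). \<forall>w\<in>V (int b). ae_eq (\<beta> (v + v') w) (\<beta> v w + \<beta> v' w)) \<and>
     (\<forall>v\<in>V (int a). \<forall>w\<in>V (int b). \<forall>w'\<in>V (int b). ae_eq (\<beta> v (w + w')) (\<beta> v w + \<beta> v w')) \<and>
     (\<forall>c. \<forall>v\<in>V (int a). \<forall>w\<in>V (int b).
        ae_eq (\<beta> (smult c v) w) (sec_scale c (\<beta> v w)) \<and>
        ae_eq (\<beta> v (smult c w)) (sec_scale c (\<beta> v w))) \<and>
     (\<forall>p\<in>SU2. \<forall>q\<in>SU2. \<forall>v\<in>V (int a). \<forall>w\<in>V (int b).
        ae_eq (\<beta> (rho (int a) p v) (rho (int b) q w)) (spin_act p q (\<beta> v w))) \<and>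
     (\<forall>c. ae_eq (\<Sum>k\<le>a. \<Sum>l\<le>b. sec_scale (c k l) (\<beta> (monom 1 k) (monom 1 l))) 0
        \<longrightarrow> (\<forall>k\<le>a. \<forall>l\<le>b. c k l = 0)) \<and>
     E = {\<psi> \<in> L2 m. \<exists>c. ae_eq \<psi> (\<Sum>k\<le>a. \<Sum>l\<le>b. sec_scale (c k l) (\<beta> (monom 1 k) (monom 1 l)))})"

text \<open>
  The components of \<open>L2 m\<close> are those of type \<open>(a, b) \<in> T\<close>, each with multiplicity one, and
  \<open>L2 m\<close> is their orthogonal Hilbert sum.
\<close>

definition decomposes :: "int \<Rightarrow> (nat \<times> nat) set \<Rightarrow> bool" where
  "decomposes m T \<longleftrightarrow>
     (\<forall>(a, b) \<in> T. \<exists>!E. component m a b E) \<and>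
     (\<forall>a b. (a, b) \<notin> T \<longrightarrow> \<not> (\<exists>E. component m a b E)) \<and>
     (\<forall>a b a' b' E E'. component m a b E \<and> component m a' b' E' \<and> (a, b) \<noteq> (a', b')
        \<longrightarrow> (\<forall>\<phi>\<in>E. \<forall>\<psi>\<in>E'. L2_inner m \<phi> \<psi> = 0)) \<and>
     (\<forall>\<phi>\<in>L2 m. \<forall>\<epsilon>>0. \<exists>\<psi> \<in> sec.span (\<Union>{E. \<exists>a b. component m a b E}). L2_norm m (\<phi> - \<psi>) < \<epsilon>)"


section \<open>Operators on smooth sections\<close>

definition eigenvalues :: "int \<Rightarrow> (sect \<Rightarrow> sect) \<Rightarrow> complex set" where
  "eigenvalues m P = {\<mu>. \<exists>\<phi>\<in>smooth_sections m. \<phi> \<noteq> 0 \<and> P \<phi> = sec_scale \<mu> \<phi>}"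

text \<open>
  \<open>P\<close> is the scalar \<open>\<mu>\<close> on the component of type \<open>(a, b)\<close>, whose classes all have smooth
  representatives.
\<close>

definition eigenvalue_on :: "int \<Rightarrow> (sect \<Rightarrow> sect) \<Rightarrow> nat \<Rightarrow> nat \<Rightarrow> real \<Rightarrow> bool" where
  "eigenvalue_on m P a b \<mu> \<longleftrightarrow> (\<forall>E. component m a b E \<longrightarrow>
     (\<forall>\<psi>\<in>E. \<exists>\<phi>\<in>E \<inter> smooth_sections m. ae_eq \<phi> \<psi>) \<and>
     (\<forall>\<phi>\<in>E \<inter> smooth_sections m. P \<phi> = sec_scale (complex_of_real \<mu>) \<phi>))"

definition op_kernel :: "int \<Rightarrow> (sect \<Rightarrow> sect) \<Rightarrow> sect set" where
  "op_kernel m P = {\<phi> \<in> smooth_sections m. P \<phi> = 0}"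

text \<open>
  A differential operator \<open>P\<close> on smooth sections is self-adjoint as an operator in \<open>L2\<close> if its
  closure (right-hand side) is its adjoint (left-hand side).
\<close>

definition self_adjoint :: "int \<Rightarrow> (sect \<Rightarrow> sect) \<Rightarrow> bool" where
  "self_adjoint m P \<longleftrightarrow> (\<forall>\<psi>\<in>L2 m. \<forall>\<eta>\<in>L2 m.
     (\<forall>\<phi>\<in>smooth_sections m. L2_inner m (P \<phi>) \<psi> = L2_inner m \<phi> \<eta>) \<longleftrightarrow>
     (\<exists>F. (\<forall>n. F n \<in> smooth_sections m) \<and>
        (\<lambda>n. L2_norm m (F n - \<psi>)) \<longlonglongrightarrow> 0 \<and> (\<lambda>n. L2_norm m (P (F n) - \<eta>)) \<longlonglongrightarrow> 0))"

text \<open>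
  The principal symbol of a second order operator \<open>P\<close> at the covector \<open>df\<^sub>x\<close>, where \<open>f x = 0\<close>, maps
  \<open>\<phi> x\<close> to \<open>P (f\<^sup>2 \<phi>) x / 2\<close>. Ellipticity means invertibility, that is injectivity, of this
  endomorphism of the fibre whenever \<open>df\<^sub>x \<noteq> 0\<close>.
\<close>

definition elliptic2 :: "int \<Rightarrow> (sect \<Rightarrow> sect) \<Rightarrow> bool" where
  "elliptic2 m P \<longleftrightarrow> (\<forall>g\<in>Spin4. \<forall>f :: real ^ 4 \<Rightarrow> real. \<forall>\<phi>\<in>smooth_sections m.
     smooth_on S3 f \<and> f (spin_proj g) = 0 \<and>
     (\<exists>v. v \<bullet> spin_proj g = 0 \<and> frechet_derivative f (at (spin_proj g) within S3) v \<noteq> 0) \<and>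
     P (\<lambda>g'. smult (complex_of_real ((f (spin_proj g'))\<^sup>2)) (\<phi> g')) g = 0
     \<longrightarrow> \<phi> g = 0)"

end

theory Submission
  imports Defs
begin

text \<open>
  Since \<open>Spin(4) = SU(2) \<times> SU(2)\<close> acts transitively on the sphere, everything can be computed from
  equivariant polynomial sections. For \<open>A + B = m\<close> and \<open>r \<ge> 0\<close> there is an \<open>SU(2)\<close>-equivariant bilinear map
  \<open>V\<^bsub>A+r\<^esub> \<times> V\<^bsub>B+r\<^esub> \<rightarrow> V\<^sub>m\<close>, the \<open>r\<close>-th transvectant of classical invariant theory; composed with
  \<open>f \<mapsto> \<rho>(p\<^sup>-\<^sup>1) f\<close> and \<open>g \<mapsto> \<rho>(q\<^sup>-\<^sup>1) g\<close> it turns a pair \<open>(f, g)\<close> into a section \<open>bsec A B r f g\<close> of \<open>S\<^sub>m\<close>, and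
  these sections span a copy of the representation of type \<open>(A + r, B + r)\<close>. The labels of the theorem are
  these pairs: \<open>m = 2p + 1\<close> gives \<open>{A, B} = {p + s + 1, p - s}\<close>, \<open>m = 2p\<close> gives \<open>{A, B} = {p + s, p - s}\<close>, and
  \<open>r = k - (p - s)\<close>.

  The decomposition rests on two facts. Schur's lemma (\<open>schur_distinct\<close>, \<open>schur_same\<close>), here in the form that an
  invariant sesquilinear form on \<open>V\<^sub>a \<times> V\<^sub>b\<close> is zero or a multiple of the inner product, makes sections of
  different types orthogonal and makes two intertwining maps of the same type proportional. Completeness
  (\<open>polysec_dense\<close>) is the density of polynomial functions in \<open>L2\<close> of the sphere, together with the fact that
  each section with polynomial coefficients is a combination of the \<open>bsec\<close>; the latter is the
  Clebsch-Gordan series, proved through Gordan's expansion of bihomogeneous forms (\<open>gordan_bimono\<close>). So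
  the sections \<open>bsec A B r z\<^sup>k z\<^sup>l\<close> form a complete orthogonal system, which determines the components and
  their multiplicities (\<open>component_cases\<close>, \<open>decomposition\<close>).

  For the operators, the horizontal lift of the frame vector given by \<open>X\<close> at \<open>(p, q)\<close> is
  \<open>(p X / 2, - q X / 2) = (p X, 0) - (p X, q X) / 2\<close>. The second summand is vertical, so that the covariant
  derivative is the derivative along \<open>(p X, 0)\<close> plus \<open>\<rho>\<^sup>0(X) / 2\<close> (\<open>nabla_frame\<close>). On \<open>bsec A B r f g\<close> the
  derivative along \<open>(p X, 0)\<close> only acts on \<open>f\<close>, through \<open>- \<rho>\<^sup>0(X)\<close>, and the Dirac operators become
  \<open>SU(2)\<close>-equivariant operations on transvectants. Hence they map blocks to blocks: \<open>D\<^sup>0\<close> is the scalar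
  \<open>(A - B) (A + B + 2 r + 2) / 2\<close> on a block, \<open>D\<^sup>+\<close> maps the block \<open>(A, B, r)\<close> to \<open>(A + 1, B + 1, r - 1)\<close>, \<open>D\<^sup>-\<close> maps it to
  \<open>(A - 1, B - 1, r + 1)\<close> (read as zero if an entry is negative), and the constants follow by evaluation on powers of linear forms.

  An operator that is symmetric and diagonal in a complete orthogonal system of smooth sections has
  precisely the diagonal entries as eigenvalues and is essentially self-adjoint. Symmetry comes from
  integration by parts: the integral of a left-invariant derivative vanishes, because the measure is
  invariant under rotations (\<open>integral_left_derivative\<close>), and \<open>\<rho>\<^sup>-\<close> is minus the adjoint of \<open>\<rho>\<^sup>+\<close>. The kernel of
  \<open>D\<^sup>+\<close> consists of the blocks with \<open>r = 0\<close>. Finally \<open>\<rho>\<^sup>+(X)\<close> is multiplication by a nonzero quadratic polynomial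
  for \<open>X \<noteq> 0\<close>, so that the symbol \<open>\<rho>\<^sup>-(X) \<rho>\<^sup>+(X) = - \<rho>\<^sup>+(X)\<^sup>\<dagger> \<rho>\<^sup>+(X)\<close> is injective.
\<close>

section \<open>Matrices in SU(2)\<close>

lemma mat_of_nth [simp]:
  "mat_of a b c d $ 1 $ 1 = a" "mat_of a b c d $ 1 $ 2 = b"
  "mat_of a b c d $ 2 $ 1 = c" "mat_of a b c d $ 2 $ 2 = d"
  by (simp_all add: mat_of_def)

lemma mat2_eq_iff:
  "(M :: mat2) = N \<longleftrightarrow> M $ 1 $ 1 = N $ 1 $ 1 \<and> M $ 1 $ 2 = N $ 1 $ 2 \<and> M $ 2 $ 1 = N $ 2 $ 1 \<and> M $ 2 $ 2 = N $ 2 $ 2"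
  by (auto simp: vec_eq_iff forall_2)

lemma mat2_mult_nth: "((M :: mat2) ** N) $ i $ j = M $ i $ 1 * N $ 1 $ j + M $ i $ 2 * N $ 2 $ j"
  by (simp add: matrix_matrix_mult_def sum_2)

lemma adjoint_mat_nth [simp]: "adjoint_mat M $ i $ j = cnj (M $ j $ i)"
  by (simp add: adjoint_mat_def)

lemma mat2_one_nth [simp]:
  "(mat 1 :: mat2) $ 1 $ 1 = 1" "(mat 1 :: mat2) $ 1 $ 2 = 0"
  "(mat 1 :: mat2) $ 2 $ 1 = 0" "(mat 1 :: mat2) $ 2 $ 2 = 1"
  by (simp_all add: mat_def)

lemma SU2_iff:
  "h \<in> SU2 \<longleftrightarrow> h $ 2 $ 2 = cnj (h $ 1 $ 1) \<and> h $ 2 $ 1 = - cnj (h $ 1 $ 2) \<and>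
     h $ 1 $ 1 * cnj (h $ 1 $ 1) + h $ 1 $ 2 * cnj (h $ 1 $ 2) = 1" (is "_ \<longleftrightarrow> ?R")
proof
  assume h: "h \<in> SU2"
  let ?a = "h $ 1 $ 1" and ?b = "h $ 1 $ 2" and ?c = "h $ 2 $ 1" and ?d = "h $ 2 $ 2"
  have 1: "?a * cnj ?a + ?b * cnj ?b = 1" and 2: "?a * cnj ?c + ?b * cnj ?d = 0"
    and 3: "?c * cnj ?a + ?d * cnj ?b = 0" and 4: "?a * ?d - ?b * ?c = 1"
    using h by (auto simp: SU2_def mat2_eq_iff mat2_mult_nth det_2)
  have "?d = (?a * cnj ?a + ?b * cnj ?b) * ?d" using 1 by simp
  also have "\<dots> = cnj ?a * (?a * ?d - ?b * ?c) + ?b * (?c * cnj ?a + ?d * cnj ?b)" by (simp add: algebra_simps)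
  finally have d: "?d = cnj ?a" using 3 4 by simp
  have "?c = (?a * cnj ?a + ?b * cnj ?b) * ?c" using 1 by simp
  also have "\<dots> = ?a * (?c * cnj ?a + ?d * cnj ?b) - cnj ?b * (?a * ?d - ?b * ?c)" by (simp add: algebra_simps)
  finally have c: "?c = - cnj ?b" using 3 4 by simp
  show ?R using 1 c d by simp
next
  assume ?R
  then show "h \<in> SU2" by (auto simp: SU2_def mat2_eq_iff mat2_mult_nth det_2 algebra_simps)
qed

lemma SU2_adjoint_right: "h \<in> SU2 \<Longrightarrow> h ** adjoint_mat h = mat 1"
  by (simp add: SU2_def)

lemma SU2_adjoint_left: "h \<in> SU2 \<Longrightarrow> adjoint_mat h ** h = mat 1"
  using SU2_adjoint_right matrix_left_right_inverse by blast

lemma SU2_matrix_inv: "h \<in> SU2 \<Longrightarrow> matrix_inv h = adjoint_mat h"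
  unfolding matrix_inv_def
proof (rule some_equality)
  fix B assume h: "h \<in> SU2" and B: "h ** B = mat 1 \<and> B ** h = mat 1"
  have "B = (adjoint_mat h ** h) ** B" using h by (simp add: SU2_adjoint_left)
  also have "\<dots> = adjoint_mat h ** (h ** B)" by (simp add: matrix_mul_assoc)
  finally show "B = adjoint_mat h" using B by simp
qed (simp add: SU2_adjoint_left SU2_adjoint_right)

lemma SU2_one [simp]: "mat 1 \<in> SU2"
  by (simp add: SU2_iff)

lemma adjoint_mat_adjoint [simp]: "adjoint_mat (adjoint_mat h) = h"
  by (simp add: mat2_eq_iff)

lemma adjoint_mat_mult: "adjoint_mat (g ** h) = adjoint_mat h ** adjoint_mat g"
  by (simp add: mat2_eq_iff mat2_mult_nth algebra_simps)

lemma adjoint_mat_one [simp]: "adjoint_mat (mat 1) = mat 1"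
  by (simp add: mat2_eq_iff)

lemma SU2_adjoint [simp]: "h \<in> SU2 \<Longrightarrow> adjoint_mat h \<in> SU2"
  by (auto simp: SU2_iff mult.commute)

lemma SU2_det: "h \<in> SU2 \<Longrightarrow> h $ 1 $ 1 * h $ 2 $ 2 - h $ 1 $ 2 * h $ 2 $ 1 = 1"
  by (simp add: SU2_def det_2)

lemma SU2_mult [simp]: "g \<in> SU2 \<Longrightarrow> h \<in> SU2 \<Longrightarrow> g ** h \<in> SU2"
proof -
  assume g: "g \<in> SU2" and h: "h \<in> SU2"
  have "(g ** h) ** adjoint_mat (g ** h) = g ** (h ** adjoint_mat h) ** adjoint_mat g"
    by (simp add: adjoint_mat_mult matrix_mul_assoc)
  also have "\<dots> = mat 1" using g h by (simp add: SU2_adjoint_right)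
  finally show ?thesis using g h by (simp add: SU2_def det_mul)
qed

section \<open>Linear maps on polynomials\<close>

definition plin :: "(complex poly \<Rightarrow> complex poly) \<Rightarrow> bool" where
  "plin L \<longleftrightarrow> (\<forall>f g. L (f + g) = L f + L g) \<and> (\<forall>c f. L (smult c f) = smult c (L f))"

lemma plin_add: "plin L \<Longrightarrow> L (f + g) = L f + L g"
  and plin_smult: "plin L \<Longrightarrow> L (smult c f) = smult c (L f)"
  by (auto simp: plin_def)

lemma plin_zero: "plin L \<Longrightarrow> L 0 = 0"
  using plin_smult[of L 0 0] by simp

lemma plin_sum: "plin L \<Longrightarrow> L (sum f I) = (\<Sum>i\<in>I. L (f i))"
  by (induction I rule: infinite_finite_induct) (auto simp: plin_zero plin_add)

lemma smult_sum_right: "smult c (sum f I) = (\<Sum>i\<in>I. smult c (f i))"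
  by (induction I rule: infinite_finite_induct) (auto simp: smult_add_right)

lemma plin_ident: "plin (\<lambda>f. f)"
  and plin_zero_map: "plin (\<lambda>f. 0)"
  and plin_pderiv: "plin pderiv"
  and plin_mult: "plin (\<lambda>f. g * f)"
  by (auto simp: plin_def pderiv_add pderiv_smult algebra_simps)

lemma plin_compose: "plin K \<Longrightarrow> plin L \<Longrightarrow> plin (\<lambda>f. K (L f))"
  and plin_sum_map: "plin K \<Longrightarrow> plin L \<Longrightarrow> plin (\<lambda>f. K f + L f)"
  and plin_diff_map: "plin K \<Longrightarrow> plin L \<Longrightarrow> plin (\<lambda>f. K f - L f)"
  and plin_smult_map: "plin K \<Longrightarrow> plin (\<lambda>f. smult c (K f))"
  and plin_mult_map: "plin K \<Longrightarrow> plin (\<lambda>f. g * K f)"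
  and plin_mult_map2: "plin K \<Longrightarrow> plin (\<lambda>f. K f * g)"
  unfolding plin_def by (simp_all add: smult_add_right smult_diff_right distrib_left distrib_right mult.commute)

lemma plin_sum_maps: "(\<And>i. i \<in> I \<Longrightarrow> plin (K i)) \<Longrightarrow> plin (\<lambda>f. \<Sum>i\<in>I. K i f)"
  by (induction I rule: infinite_finite_induct) (auto simp: plin_sum_map plin_zero_map)

lemmas plin_intros = plin_ident plin_zero_map plin_compose[OF plin_pderiv] plin_sum_map plin_diff_map
  plin_smult_map plin_mult_map plin_mult_map2 plin_sum_maps

lemma V_iff_degree: "f \<in> V (int n) \<longleftrightarrow> degree f \<le> n"
  by (auto simp: V_def coeff_eq_0 intro: degree_le)

lemma V_coeff_zero: "f \<in> V (int n) \<Longrightarrow> n < k \<Longrightarrow> coeff f k = 0"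
  by (simp add: V_def)

lemma V_zero [simp]: "0 \<in> V m"
  and V_add: "(f :: complex poly) \<in> V m \<Longrightarrow> g \<in> V m \<Longrightarrow> f + g \<in> V m"
  and V_smult: "(f :: complex poly) \<in> V m \<Longrightarrow> smult c f \<in> V m"
  and V_diff: "f \<in> V m \<Longrightarrow> g \<in> V m \<Longrightarrow> f - g \<in> V m"
  unfolding V_def by auto

lemma V_sum: "(\<And>i. i \<in> I \<Longrightarrow> f i \<in> V m) \<Longrightarrow> sum f I \<in> V m"
  by (induction I rule: infinite_finite_induct) (auto simp: V_add)

lemma V_monom: "int k \<le> m \<Longrightarrow> monom c k \<in> V m"
  by (auto simp: V_def)

lemma V_neg: "m < 0 \<Longrightarrow> f \<in> V m \<longleftrightarrow> f = 0"
  by (auto simp: V_def poly_eq_iff)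

lemma V_expand: "f \<in> V (int n) \<Longrightarrow> f = (\<Sum>k\<le>n. smult (coeff f k) (monom 1 k))"
  by (intro poly_eqI) (auto simp: coeff_sum coeff_monom if_distrib[where f="\<lambda>x. _ * x"] V_coeff_zero
      cong: if_cong)

lemma plin_expand: "plin L \<Longrightarrow> f \<in> V (int n) \<Longrightarrow> L f = (\<Sum>k\<le>n. smult (coeff f k) (L (monom 1 k)))"
  by (subst V_expand, assumption) (simp add: plin_sum plin_smult)

lemma plin_eqI:
  assumes "plin L" "plin L'" "\<And>k. L (monom 1 k) = L' (monom 1 k)"
  shows "L f = L' f"
  using plin_expand[OF assms(1), of f "degree f"] plin_expand[OF assms(2), of f "degree f"] assms(3)
  by (simp add: V_iff_degree)

lemma plin_eq_on_VI:
  assumes "plin L" "plin L'" "\<And>k. k \<le> n \<Longrightarrow> L (monom 1 k) = L' (monom 1 k)" "f \<in> V (int n)"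
  shows "L f = L' f"
  using plin_expand[OF assms(1), of f n] plin_expand[OF assms(2), of f n] assms(3,4)
  by simp

lemma plin_in_V:
  assumes "plin L" "\<And>k. k \<le> n \<Longrightarrow> L (monom 1 k) \<in> V m" "f \<in> V (int n)"
  shows "L f \<in> V m"
  by (subst plin_expand[OF assms(1,3)]) (auto intro!: V_sum V_smult assms(2))

lemma lin_ext_sum: "degree f \<le> N \<Longrightarrow> lin_ext T f = (\<Sum>k\<le>N. smult (coeff f k) (T k))"
  unfolding lin_ext_def by (rule sum.mono_neutral_left) (auto simp: coeff_eq_0)

lemma plin_lin_ext: "plin (lin_ext T)"
  unfolding plin_def
proof (intro conjI allI)
  fix f g :: "complex poly"
  let ?N = "max (degree f) (degree g)"
  show "lin_ext T (f + g) = lin_ext T f + lin_ext T g"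
    by (subst (1 2 3) lin_ext_sum[where N = ?N])
      (auto intro: degree_add_le simp: smult_add_left sum.distrib)
next
  fix c and f :: "complex poly"
  show "lin_ext T (smult c f) = smult c (lin_ext T f)"
    by (subst (1 2) lin_ext_sum[where N = "degree f"])
      (auto simp: smult_sum_right)
qed

lemma lin_ext_monom: "lin_ext T (monom c k) = smult c (T k)"
  by (subst lin_ext_sum[where N = k])
    (auto simp: degree_monom_le coeff_monom if_distrib[where f="\<lambda>x. smult x _"] cong: if_cong)

lemma plin_rho: "plin (rho m h)"
  by (simp add: rho_def plin_lin_ext)

section \<open>Power vectors\<close>

text \<open>
  The power vector \<open>(u z + v)\<^sup>n\<close>. On power vectors \<open>rho\<close> acts by the matrix on \<open>(u, v)\<close>; this, and the fact that they
  span \<open>V\<^sub>n\<close>, reduces most identities between linear maps to identities between numbers.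
\<close>

definition pw :: "nat \<Rightarrow> complex \<Rightarrow> complex \<Rightarrow> complex poly" where
  "pw n u v = [:v, u:] ^ n"

lemma linear_form_power:
  "([:v, u:] :: complex poly) ^ n = (\<Sum>k\<le>n. smult (of_nat (n choose k) * u ^ k * v ^ (n - k)) (monom 1 k))"
proof -
  have "[:v, u:] = monom u 1 + [:v:]"
    by (simp add: monom_altdef)
  then have "[:v, u:] ^ n = (\<Sum>k\<le>n. of_nat (n choose k) * monom u 1 ^ k * [:v:] ^ (n - k))"
    by (simp only: binomial_ring)
  also have "\<dots> = (\<Sum>k\<le>n. smult (of_nat (n choose k) * u ^ k * v ^ (n - k)) (monom 1 k))"
    by (intro sum.cong refl) (simp add: monom_power of_nat_poly smult_monom poly_const_pow mult_ac)
  finally show ?thesis .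
qed

lemma coeff_linear_form_power:
  "coeff (([:v, u:] :: complex poly) ^ n) k = of_nat (n choose k) * u ^ k * v ^ (n - k)"
proof (cases "k \<le> n")
  case True
  then show ?thesis
    by (simp add: linear_form_power coeff_sum coeff_monom if_distrib[where f="\<lambda>x. _ * x"] cong: if_cong)
next
  case False
  then have "degree ([:v, u:] ^ n) < k"
    using degree_power_le[of "[:v, u:]" n] by (auto simp: not_le split: if_splits)
  then show ?thesis using False by (simp add: coeff_eq_0)
qed

lemma pw_in_V [simp]: "pw n u v \<in> V (int n)"
  by (auto simp: V_def pw_def coeff_linear_form_power)

lemma coeff_pw: "coeff (pw n u v) k = of_nat (n choose k) * u ^ k * v ^ (n - k)"
  by (simp add: pw_def coeff_linear_form_power)

lemma poly_coeffs_zero: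
  fixes x :: "nat \<Rightarrow> complex"
  assumes "\<And>t. (\<Sum>k\<le>n. x k * t ^ k) = 0" "k \<le> n"
  shows "x k = 0"
  using assms zero_polynom_imp_zero_coeffs by blast

text \<open>
  The powers \<open>(t z + 1)\<^sup>n\<close> span \<open>V\<^sub>n\<close>: a linear functional that vanishes on all of them is a polynomial in \<open>t\<close>
  whose coefficients are, up to binomial factors, its values on monomials.
\<close>

lemma plin_eq_on_pw:
  assumes L: "plin L" "plin L'" and eq: "\<And>t. L (pw n t 1) = L' (pw n t 1)" and f: "f \<in> V (int n)"
  shows "L f = L' f"
proof (rule plin_eq_on_VI[OF L _ f])
  fix k assume k: "k \<le> n"
  show "L (monom 1 k) = L' (monom 1 k)"
  proof (rule poly_eqI)
    fix i
    let ?x = "\<lambda>k. of_nat (n choose k) * (coeff (L (monom 1 k)) i - coeff (L' (monom 1 k)) i)"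
    have "(\<Sum>k\<le>n. ?x k * t ^ k) = 0" for t
    proof -
      have "coeff (L (pw n t 1)) i - coeff (L' (pw n t 1)) i = 0" using eq by simp
      then show ?thesis
        using L by (simp add: pw_def linear_form_power plin_sum plin_smult coeff_sum algebra_simps sum_subtractf)
    qed
    then have "?x k = 0" by (rule poly_coeffs_zero) (rule k)
    then show "coeff (L (monom 1 k)) i = coeff (L' (monom 1 k)) i" using k by simp
  qed
qed

lemma rho_monom:
  "rho (int n) h (monom 1 k) = [:h $ 2 $ 2, h $ 1 $ 2:] ^ (n - k) * [:h $ 2 $ 1, h $ 1 $ 1:] ^ k"
  by (simp add: rho_def lin_ext_monom)

lemma rho_pw: "rho (int n) h (pw n u v) = pw n (h $ 1 $ 1 * u + h $ 1 $ 2 * v) (h $ 2 $ 1 * u + h $ 2 $ 2 * v)"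
proof -
  have "rho (int n) h (pw n u v) = (\<Sum>k\<le>n. of_nat (n choose k) *
      smult u [:h $ 2 $ 1, h $ 1 $ 1:] ^ k * smult v [:h $ 2 $ 2, h $ 1 $ 2:] ^ (n - k))"
    unfolding pw_def linear_form_power
    by (simp add: plin_sum[OF plin_rho] plin_smult[OF plin_rho] rho_monom smult_power of_nat_poly mult_ac del: smult_pCons)
  also have "\<dots> = (smult u [:h $ 2 $ 1, h $ 1 $ 1:] + smult v [:h $ 2 $ 2, h $ 1 $ 2:]) ^ n"
    by (simp only: binomial_ring)
  finally show ?thesis by (simp add: pw_def mult_ac)
qed

lemma linear_form_power_V: "([:v, u:] :: complex poly) ^ n \<in> V (int n)"
  using pw_in_V by (simp add: pw_def)

lemma V_mult: "f \<in> V (int a) \<Longrightarrow> g \<in> V (int b) \<Longrightarrow> f * g \<in> V (int a + int b)"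
  using degree_mult_le[of f g] by (simp add: V_iff_degree flip: of_nat_add)

lemma rho_in_V: "f \<in> V (int n) \<Longrightarrow> rho (int n) h f \<in> V (int n)"
proof (rule plin_in_V[OF plin_rho])
  fix k assume "k \<le> n"
  then show "rho (int n) h (monom 1 k) \<in> V (int n)"
    unfolding rho_monom
    using V_mult[OF linear_form_power_V linear_form_power_V, of _ _ "n - k" _ _ k] by (simp add: of_nat_diff)
qed

lemma rho_comp: "f \<in> V (int n) \<Longrightarrow> rho (int n) (g ** h) f = rho (int n) g (rho (int n) h f)"
  by (rule plin_eq_on_pw[OF plin_rho plin_compose[OF plin_rho plin_rho]])
    (simp_all add: rho_pw mat2_mult_nth algebra_simps)

lemma rho_one: "f \<in> V (int n) \<Longrightarrow> rho (int n) (mat 1) f = f"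
  by (rule plin_eq_on_pw[OF plin_rho plin_ident]) (simp_all add: rho_pw)

lemma rho_prod:
  assumes f: "f \<in> V (int a)" and g: "g \<in> V (int b)"
  shows "rho (int (a + b)) h (f * g) = rho (int a) h f * rho (int b) h g"
proof (rule plin_eq_on_VI[where L = "\<lambda>f. rho (int (a + b)) h (f * g)" and L' = "\<lambda>f. rho (int a) h f * rho (int b) h g", OF _ _ _ f])
  show "plin (\<lambda>f. rho (int (a + b)) h (f * g))" "plin (\<lambda>f. rho (int a) h f * rho (int b) h g)"
    by (intro plin_compose[OF plin_rho] plin_intros plin_rho)+
  fix k assume k: "k \<le> a"
  show "rho (int (a + b)) h (monom 1 k * g) = rho (int a) h (monom 1 k) * rho (int b) h g"
  proof (rule plin_eq_on_VI[OF _ _ _ g])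
    show "plin (\<lambda>g. rho (int (a + b)) h (monom 1 k * g))" "plin (\<lambda>g. rho (int a) h (monom 1 k) * rho (int b) h g)"
      by (intro plin_compose[OF plin_rho] plin_intros plin_rho)+
    fix l assume l: "l \<le> b"
    have e: "a + b - (k + l) = (a - k) + (b - l)" using k l by simp
    show "rho (int (a + b)) h (monom 1 k * monom 1 l) = rho (int a) h (monom 1 k) * rho (int b) h (monom 1 l)"
      unfolding mult_monom mult_1 rho_monom e power_add by (simp only: mult_ac)
  qed
qed

section \<open>Invariant inner product\<close>

lemma herm_sum: "herm (int n) f g = (\<Sum>k\<le>n. fact k * fact (n - k) * coeff f k * cnj (coeff g k))"
  by (simp add: herm_def)

lemma herm_add_left: "herm m (f + f') g = herm m f g + herm m f' g"
  and herm_add_right: "herm m f (g + g') = herm m f g + herm m f g'"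
  and herm_smult_left: "herm m (smult c f) g = c * herm m f g"
  and herm_smult_right: "herm m f (smult c g) = cnj c * herm m f g"
  and herm_diff_left: "herm m (f - f') g = herm m f g - herm m f' g"
  and herm_diff_right: "herm m f (g - g') = herm m f g - herm m f g'"
  and herm_zero_left [simp]: "herm m 0 g = 0"
  and herm_zero_right [simp]: "herm m f 0 = 0"
  and herm_commute: "herm m g f = cnj (herm m f g)"
  by (simp_all add: herm_def sum.distrib sum_distrib_left sum_subtractf algebra_simps)

lemma herm_sum_left: "herm m (sum f I) g = (\<Sum>i\<in>I. herm m (f i) g)"
  by (induction I rule: infinite_finite_induct) (auto simp: herm_add_left)

lemma herm_sum_right: "herm m g (sum f I) = (\<Sum>i\<in>I. herm m g (f i))"
  by (induction I rule: infinite_finite_induct) (auto simp: herm_add_right)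

lemma herm_pw_gen:
  assumes "f \<in> V (int n)"
  shows "herm (int n) f (pw n u v) = fact n * (\<Sum>k\<le>n. coeff f k * cnj u ^ k * cnj v ^ (n - k))"
proof -
  have key: "fact k * fact (n - k) * coeff f k * (of_nat (n choose k) * cnj u ^ k * cnj v ^ (n - k)) =
    fact n * (coeff f k * cnj u ^ k * cnj v ^ (n - k))" if "k \<le> n" for k
  proof -
    have "fact k * fact (n - k) * (of_nat (n choose k) :: complex) = fact n"
      using binomial_fact_lemma[OF that] by (metis of_nat_fact of_nat_mult)
    moreover have "fact k * fact (n - k) * coeff f k * (of_nat (n choose k) * cnj u ^ k * cnj v ^ (n - k)) =
      (fact k * fact (n - k) * of_nat (n choose k)) * (coeff f k * cnj u ^ k * cnj v ^ (n - k))"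
      by (simp only: mult_ac)
    ultimately show ?thesis by simp
  qed
  show ?thesis
    unfolding herm_sum coeff_pw sum_distrib_left complex_cnj_mult complex_cnj_power complex_cnj_of_nat
    by (intro sum.cong refl key) simp
qed

text \<open>Up to a factor, power vectors reproduce point evaluation.\<close>

lemma herm_pw:
  assumes "f \<in> V (int n)"
  shows "herm (int n) f (pw n t 1) = fact n * poly f (cnj t)"
proof -
  have "poly f (cnj t) = (\<Sum>k\<le>n. coeff f k * cnj t ^ k)"
    by (subst V_expand[OF assms]) (simp add: poly_sum poly_monom)
  then show ?thesis by (simp add: herm_pw_gen assms)
qed

lemma herm_pw_pw: "herm (int n) (pw n u v) (pw n u' v') = fact n * (u * cnj u' + v * cnj v') ^ n"
  by (simp add: herm_pw_gen coeff_pw binomial_ring power_mult_distrib mult_ac)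

definition sesq :: "(complex poly \<Rightarrow> complex poly \<Rightarrow> complex) \<Rightarrow> nat \<Rightarrow> nat \<Rightarrow> bool" where
  "sesq S a b \<longleftrightarrow>
     (\<forall>f\<in>V (int a). \<forall>f'\<in>V (int a). \<forall>g\<in>V (int b). S (f + f') g = S f g + S f' g) \<and>
     (\<forall>f\<in>V (int a). \<forall>g\<in>V (int b). \<forall>g'\<in>V (int b). S f (g + g') = S f g + S f g') \<and>
     (\<forall>c. \<forall>f\<in>V (int a). \<forall>g\<in>V (int b). S (smult c f) g = c * S f g \<and> S f (smult c g) = cnj c * S f g)"

lemma sesq_sum_left:
  assumes "sesq S a b" "finite I" "\<And>i. i \<in> I \<Longrightarrow> f i \<in> V (int a)" "g \<in> V (int b)"
  shows "S (\<Sum>i\<in>I. smult (c i) (f i)) g = (\<Sum>i\<in>I. c i * S (f i) g)"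
  using assms(2,3)
proof (induction I rule: finite_induct)
  case empty
  have "S (smult 0 0) g = 0 * S 0 g" using assms(1,4) unfolding sesq_def by (meson V_zero)
  then show ?case by simp
next
  case (insert x I)
  have "(\<Sum>i\<in>I. smult (c i) (f i)) \<in> V (int a)" using insert by (auto intro!: V_sum V_smult)
  moreover have "smult (c x) (f x) \<in> V (int a)" using insert by (auto intro: V_smult)
  ultimately show ?case using insert assms(1,4) unfolding sesq_def by auto
qed

lemma sesq_sum_right:
  assumes "sesq S a b" "finite I" "\<And>i. i \<in> I \<Longrightarrow> g i \<in> V (int b)" "f \<in> V (int a)"
  shows "S f (\<Sum>i\<in>I. smult (c i) (g i)) = (\<Sum>i\<in>I. cnj (c i) * S f (g i))"
  using assms(2,3)
proof (induction I rule: finite_induct)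
  case empty
  have "S f (smult 0 0) = cnj 0 * S f 0" using assms(1,4) unfolding sesq_def by (meson V_zero)
  then show ?case by simp
next
  case (insert x I)
  have "(\<Sum>i\<in>I. smult (c i) (g i)) \<in> V (int b)" using insert by (auto intro!: V_sum V_smult)
  moreover have "smult (c x) (g x) \<in> V (int b)" using insert by (auto intro: V_smult)
  ultimately show ?case using insert assms(1,4) unfolding sesq_def by auto
qed

lemma sesq_expand:
  assumes "sesq S a b" "f \<in> V (int a)" "g \<in> V (int b)"
  shows "S f g = (\<Sum>k\<le>a. \<Sum>l\<le>b. coeff f k * cnj (coeff g l) * S (monom 1 k) (monom 1 l))"
proof -
  have "S f g = S (\<Sum>k\<le>a. smult (coeff f k) (monom 1 k)) (\<Sum>l\<le>b. smult (coeff g l) (monom 1 l))"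
    using V_expand assms by simp
  also have "\<dots> = (\<Sum>k\<le>a. coeff f k * S (monom 1 k) (\<Sum>l\<le>b. smult (coeff g l) (monom 1 l)))"
    by (rule sesq_sum_left[OF assms(1)]) (auto intro!: V_monom V_sum V_smult)
  also have "\<dots> = (\<Sum>k\<le>a. coeff f k * (\<Sum>l\<le>b. cnj (coeff g l) * S (monom 1 k) (monom 1 l)))"
    by (intro sum.cong refl arg_cong2[where f="(*)"] sesq_sum_right[OF assms(1)]) (auto intro!: V_monom)
  finally show ?thesis by (simp add: sum_distrib_left mult_ac)
qed

lemma sesq_herm: "sesq (herm (int n)) n n"
  by (simp add: sesq_def herm_add_left herm_add_right herm_smult_left herm_smult_right)

text \<open>
  By linearity it suffices to compare two power vectors, where \<open>herm_pw_pw\<close> expresses the inner product through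
  that of \<open>\<complex>\<^sup>2\<close>.
\<close>

lemma herm_rho:
  assumes h: "h \<in> SU2" and f: "f \<in> V (int n)" and g: "g \<in> V (int n)"
  shows "herm (int n) (rho (int n) h f) (rho (int n) h g) = herm (int n) f g"
proof -
  have inner: "(h $ 1 $ 1 * u + h $ 1 $ 2 * v) * cnj (h $ 1 $ 1 * u' + h $ 1 $ 2 * v')
     + (h $ 2 $ 1 * u + h $ 2 $ 2 * v) * cnj (h $ 2 $ 1 * u' + h $ 2 $ 2 * v') = u * cnj u' + v * cnj v'" for u v u' v'
  proof -
    let ?a = "h $ 1 $ 1" and ?b = "h $ 1 $ 2"
    have e: "h $ 2 $ 1 = - cnj ?b" "h $ 2 $ 2 = cnj ?a" "?a * cnj ?a + ?b * cnj ?b = 1"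
      using h by (auto simp: SU2_iff)
    have "(?a * u + ?b * v) * cnj (?a * u' + ?b * v')
     + (- cnj ?b * u + cnj ?a * v) * cnj (- cnj ?b * u' + cnj ?a * v') =
       (?a * cnj ?a + ?b * cnj ?b) * (u * cnj u' + v * cnj v')"
      by (simp add: algebra_simps)
    then show ?thesis using e by simp
  qed
  let ?L = "\<lambda>f g. [:herm (int n) (rho (int n) h f) (rho (int n) h g) - herm (int n) f g:]"
  have 1: "?L f (pw n t 1) = 0" if f: "f \<in> V (int n)" for f t
  proof -
    have "?L f (pw n t 1) = (\<lambda>f. 0) f"
    proof (rule plin_eq_on_pw[where L = "\<lambda>f. ?L f (pw n t 1)", OF _ plin_zero_map _ f])
      show "plin (\<lambda>f. ?L f (pw n t 1))"
        by (simp add: plin_def plin_add[OF plin_rho] plin_smult[OF plin_rho] herm_add_left herm_smult_left algebra_simps)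
    qed (simp only: rho_pw herm_pw_pw inner; simp)
    then show ?thesis by simp
  qed
  let ?K = "\<lambda>g. [:cnj (herm (int n) (rho (int n) h f) (rho (int n) h g) - herm (int n) f g):]"
  have "?K g = (\<lambda>f. 0) g"
  proof (rule plin_eq_on_pw[where L = ?K, OF _ plin_zero_map _ g])
    show "plin ?K"
      by (simp add: plin_def plin_add[OF plin_rho] plin_smult[OF plin_rho] herm_add_right herm_smult_right algebra_simps)
    fix t show "?K (pw n t 1) = 0" using 1[OF f, of t] by simp
  qed
  then show ?thesis by simp
qed

section \<open>Schur's lemma\<close>

lemma poly_zero_on_reals:
  assumes "\<And>t::real. poly p (complex_of_real t) = 0"
  shows "p = 0"
proof (rule ccontr)
  assume "p \<noteq> 0"
  then have "finite {x. poly p x = 0}" by (rule poly_roots_finite)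
  moreover have "range complex_of_real \<subseteq> {x. poly p x = 0}" using assms by auto
  moreover have "infinite (range complex_of_real)"
    by (simp add: finite_image_iff infinite_UNIV_char_0 inj_on_def)
  ultimately show False using finite_subset by blast
qed

text \<open>
  Real and imaginary part of \<open>u\<close> are independent variables: both may be given complex values, after which
  \<open>u\<close> and its conjugate can be prescribed separately.
\<close>

lemma poly_conj_coeffs_zero:
  fixes x :: "nat \<Rightarrow> nat \<Rightarrow> complex"
  assumes zero: "\<And>u. (\<Sum>k\<le>a. \<Sum>l\<le>b. x k l * u ^ k * cnj u ^ l) = 0" and kl: "k \<le> a" "l \<le> b"
  shows "x k l = 0"
proof -
  \<comment> \<open>the value at \<open>u = t + i y\<close> as a polynomial in \<open>t\<close>\<close>
  define P where "P y = (\<Sum>k\<le>a. \<Sum>l\<le>b. smult (x k l) ([:\<i> * y, 1:] ^ k * [:- \<i> * y, 1:] ^ l))" for y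
  have P: "poly (P y) t = (\<Sum>k\<le>a. \<Sum>l\<le>b. x k l * (t + \<i> * y) ^ k * (t - \<i> * y) ^ l)" for y t
    by (simp add: P_def poly_sum algebra_simps)
  have 1: "P (complex_of_real y) = 0" for y
  proof (rule poly_zero_on_reals)
    fix t :: real
    show "poly (P (complex_of_real y)) (complex_of_real t) = 0"
      using zero[of "complex_of_real t + \<i> * complex_of_real y"] by (simp add: P)
  qed
  define P' where "P' t = (\<Sum>k\<le>a. \<Sum>l\<le>b. smult (x k l) ([:t, \<i>:] ^ k * [:t, - \<i>:] ^ l))" for t
  have P': "poly (P' t) y = poly (P y) t" for t y
    by (simp add: P'_def P poly_sum algebra_simps)
  have "P' t = 0" for t
    by (rule poly_zero_on_reals) (simp add: P' 1)
  then have zero2: "poly (P y) t = 0" for t y using P'[of t y] by simp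
  have zero3: "(\<Sum>k\<le>a. (\<Sum>l\<le>b. x k l * s ^ l) * u ^ k) = 0" for u s
  proof -
    have e: "(u + s) / 2 + \<i> * ((u - s) / (2 * \<i>)) = u" "(u + s) / 2 - \<i> * ((u - s) / (2 * \<i>)) = s"
      by (simp_all add: field_simps)
    have "(\<Sum>k\<le>a. (\<Sum>l\<le>b. x k l * s ^ l) * u ^ k) = (\<Sum>k\<le>a. \<Sum>l\<le>b. x k l * u ^ k * s ^ l)"
      by (simp add: sum_distrib_left mult_ac)
    also have "\<dots> = 0"
      using zero2[of "(u - s) / (2 * \<i>)" "(u + s) / 2"] unfolding P e .
    finally show ?thesis .
  qed
  have "(\<Sum>l\<le>b. x k l * s ^ l) = 0" for s
    by (rule poly_coeffs_zero[where x = "\<lambda>k. \<Sum>l\<le>b. x k l * s ^ l", OF zero3 kl(1)])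
  then show ?thesis by (rule poly_coeffs_zero) (rule kl(2))
qed

lemma pw_scale: "pw n (c * u) (c * v) = smult (c ^ n) (pw n u v)"
  using smult_power[of c "[:v, u:]" n] by (simp add: pw_def)

lemma pw_top: "pw n 1 0 = monom 1 n"
  by (simp add: pw_def monom_altdef)

lemma pw_scale_top: "pw n c 0 = smult (c ^ n) (monom 1 n)"
  using pw_scale[of n c 1 0] by (simp add: pw_top)

definition rho_inv :: "(complex poly \<Rightarrow> complex poly \<Rightarrow> complex) \<Rightarrow> nat \<Rightarrow> nat \<Rightarrow> bool" where
  "rho_inv S a b \<longleftrightarrow> (\<forall>h\<in>SU2. \<forall>f\<in>V (int a). \<forall>g\<in>V (int b). S (rho (int a) h f) (rho (int b) h g) = S f g)"

text \<open>
  \<open>SU(2)\<close> moves the highest weight vector \<open>z\<^sup>n\<close> to every power vector up to a factor, simultaneously in both arguments.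
  So an invariant form that vanishes on highest weight vectors vanishes on all pairs of power vectors with
  the same parameter \<open>u\<close>, that is, a polynomial in \<open>u\<close> and its conjugate vanishes identically.
\<close>

lemma invariant_form_zero:
  assumes S: "sesq S a b" and inv: "rho_inv S a b" and top: "S (monom 1 a) (monom 1 b) = 0"
    and f: "f \<in> V (int a)" and g: "g \<in> V (int b)"
  shows "S f g = 0"
proof -
  have scale: "S (smult c f) (smult d g) = c * cnj d * S f g" if "f \<in> V (int a)" "g \<in> V (int b)" for c d f g
    using S that by (simp add: sesq_def V_smult)
  have diag: "S (pw a u 1) (pw b u 1) = 0" for u
  proof -
    define r where "r = complex_of_real (sqrt ((cmod u)\<^sup>2 + 1))"
    have pos: "0 < (cmod u)\<^sup>2 + 1" by (simp add: add_nonneg_pos)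
    then have r0: "r \<noteq> 0" and rr: "r * r = u * cnj u + 1" and rc: "cnj r = r"
      using complex_norm_square[of u] by (simp_all add: r_def flip: of_real_mult)
    define h where "h = mat_of (u / r) (- 1 / r) (1 / r) (cnj u / r)"
    have "1 + u * cnj u \<noteq> 0" using r0 rr by (metis add.commute mult_eq_0_iff)
    then have h: "h \<in> SU2" using r0 rr rc by (simp add: SU2_iff h_def field_simps)
    have "S (pw a (u / r) (1 / r)) (pw b (u / r) (1 / r)) = S (rho (int a) h (pw a 1 0)) (rho (int b) h (pw b 1 0))"
      by (simp add: rho_pw h_def)
    also have "\<dots> = 0" using inv h top by (simp add: rho_inv_def pw_top[symmetric])
    finally have 0: "S (pw a (u / r) (1 / r)) (pw b (u / r) (1 / r)) = 0" .
    have "pw a u 1 = smult (r ^ a) (pw a (u / r) (1 / r))" "pw b u 1 = smult (r ^ b) (pw b (u / r) (1 / r))"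
      using r0 by (simp_all flip: pw_scale)
    then show ?thesis using 0 by (simp add: scale)
  qed
  have "S (monom 1 k) (monom 1 l) = 0" if kl: "k \<le> a" "l \<le> b" for k l
  proof -
    have "of_nat (a choose k) * of_nat (b choose l) * S (monom 1 k) (monom 1 l) = 0"
    proof (rule poly_conj_coeffs_zero[OF _ kl])
      fix u
      show "(\<Sum>k\<le>a. \<Sum>l\<le>b. of_nat (a choose k) * of_nat (b choose l) * S (monom 1 k) (monom 1 l) * u ^ k * cnj u ^ l) = 0"
        using diag[of u] sesq_expand[OF S pw_in_V pw_in_V, of u 1 u 1] by (simp add: coeff_pw mult_ac)
    qed
    then show ?thesis using kl by simp
  qed
  then show ?thesis by (simp add: sesq_expand[OF S f g])
qed

text \<open>A diagonal element of \<open>SU(2)\<close> scales the value on highest weight vectors by a factor that can be made \<open>- 1\<close>.\<close>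

lemma schur_distinct:
  assumes S: "sesq S a b" and inv: "rho_inv S a b" and ab: "a \<noteq> b"
    and f: "f \<in> V (int a)" and g: "g \<in> V (int b)"
  shows "S f g = 0"
proof (rule invariant_form_zero[OF S inv _ f g])
  \<comment> \<open>chosen such that \<open>w\<^bsup>a - b\<^esup> = - 1\<close>\<close>
  define w where "w = cis (pi / (real a - real b))"
  have w: "w * cnj w = 1" by (simp add: w_def cis_cnj cis_mult)
  let ?h = "mat_of w 0 0 (cnj w)"
  have h: "?h \<in> SU2" using w by (simp add: SU2_iff)
  have "S (monom 1 a) (monom 1 b) = S (rho (int a) ?h (pw a 1 0)) (rho (int b) ?h (pw b 1 0))"
    using inv h by (simp add: rho_inv_def pw_top[symmetric])
  also have "\<dots> = S (smult (w ^ a) (monom 1 a)) (smult (w ^ b) (monom 1 b))"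
    unfolding rho_pw by (simp add: pw_scale_top)
  also have "\<dots> = w ^ a * cnj w ^ b * S (monom 1 a) (monom 1 b)"
    using S by (simp add: sesq_def V_smult V_monom)
  also have "w ^ a * cnj w ^ b = cis (real a * (pi / (real a - real b)) - real b * (pi / (real a - real b)))"
    by (simp add: w_def cis_cnj Complex.DeMoivre cis_mult)
  also have "real a * (pi / (real a - real b)) - real b * (pi / (real a - real b)) = pi"
    using ab left_diff_distrib[of "real a" "real b" "pi / (real a - real b)"] by simp
  finally show "S (monom 1 a) (monom 1 b) = 0" by simp
qed

lemma herm_top: "herm (int n) (monom 1 n) (monom 1 n) = fact n"
  by (simp add: herm_sum coeff_monom if_distrib[where f="\<lambda>x. _ * x"] if_distrib[where f=cnj] cong: if_cong)

lemma rho_inv_herm: "rho_inv (herm (int n)) n n"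
  by (simp add: rho_inv_def herm_rho)

text \<open>Subtract the multiple of the inner product that agrees with the form on highest weight vectors.\<close>

lemma schur_same:
  assumes S: "sesq S n n" and inv: "rho_inv S n n"
    and f: "f \<in> V (int n)" and g: "g \<in> V (int n)"
  shows "S f g = S (monom 1 n) (monom 1 n) / fact n * herm (int n) f g"
proof -
  define c where "c = S (monom 1 n) (monom 1 n) / fact n"
  let ?S = "\<lambda>f g. S f g - c * herm (int n) f g"
  have "?S f g = 0"
  proof (rule invariant_form_zero[OF _ _ _ f g])
    show "sesq ?S n n" using S sesq_herm[of n] unfolding sesq_def by (simp add: algebra_simps)
    show "rho_inv ?S n n" using inv rho_inv_herm[of n] unfolding rho_inv_def by simp
    show "?S (monom 1 n) (monom 1 n) = 0" by (simp add: c_def herm_top)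
  qed
  then show ?thesis by (simp add: c_def)
qed

section \<open>Transvectants\<close>

text \<open>
  The coefficients with respect to the binomially normalised monomials, in which the power vector
  \<open>(u z + v)\<^sup>n\<close> has the coefficients \<open>u\<^sup>k v\<^bsup>n-k\<^esup>\<close>.
\<close>

definition ncoeff :: "nat \<Rightarrow> complex poly \<Rightarrow> nat \<Rightarrow> complex" where
  "ncoeff n f k = coeff f k / of_nat (n choose k)"

text \<open>
  A multiple of the classical \<open>r\<close>-th transvectant, obtained by expanding the formula of \<open>transvectant_pw\<close>,
  its characterisation on power vectors, and reading off normalised coefficients.
\<close>

definition transvectant :: "nat \<Rightarrow> nat \<Rightarrow> nat \<Rightarrow> complex poly \<Rightarrow> complex poly \<Rightarrow> complex poly" where
  "transvectant A B r f g = (\<Sum>j\<le>r. \<Sum>i\<le>A. \<Sum>l\<le>B.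
     monom ((- 1) ^ j * of_nat (r choose j) * of_nat (A choose i) * of_nat (B choose l)
        * ncoeff (A + r) f (r - j + i) * ncoeff (B + r) g (j + l)) (i + l))"

lemma transvectant_add_left: "transvectant A B r (f + f') g = transvectant A B r f g + transvectant A B r f' g"
  and transvectant_add_right: "transvectant A B r f (g + g') = transvectant A B r f g + transvectant A B r f g'"
  by (simp_all add: transvectant_def ncoeff_def sum.distrib[symmetric] add_monom add_divide_distrib algebra_simps)

lemma transvectant_smult_left: "transvectant A B r (smult c f) g = smult c (transvectant A B r f g)"
  and transvectant_smult_right: "transvectant A B r f (smult c g) = smult c (transvectant A B r f g)"
  by (simp_all add: transvectant_def ncoeff_def smult_sum_right smult_monom mult_ac)

lemma plin_transvectant_left: "plin (\<lambda>f. transvectant A B r f g)"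
  and plin_transvectant_right: "plin (transvectant A B r f)"
  by (simp_all add: plin_def transvectant_add_left transvectant_add_right transvectant_smult_left transvectant_smult_right)

lemma transvectant_in_V: "transvectant A B r f g \<in> V (int (A + B))"
  unfolding transvectant_def by (intro V_sum V_monom) auto

lemma ncoeff_pw: "k \<le> n \<Longrightarrow> ncoeff n (pw n u v) k = u ^ k * v ^ (n - k)"
  by (simp add: ncoeff_def coeff_pw)

lemma transvectant_pw:
  "transvectant A B r (pw (A + r) u v) (pw (B + r) u' v') =
     smult ((u * v' - u' * v) ^ r) ([:v, u:] ^ A * [:v', u':] ^ B)"
proof -
  have trm: "monom ((- 1) ^ j * of_nat (r choose j) * of_nat (A choose i) * of_nat (B choose l)
        * ncoeff (A + r) (pw (A + r) u v) (r - j + i) * ncoeff (B + r) (pw (B + r) u' v') (j + l)) (i + l)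
      = [:of_nat (r choose j) * (- (u' * v)) ^ j * (u * v') ^ (r - j):] *
        (smult (of_nat (A choose i) * u ^ i * v ^ (A - i)) (monom 1 i) *
         smult (of_nat (B choose l) * u' ^ l * v' ^ (B - l)) (monom 1 l))"
    if le: "j \<le> r" "i \<le> A" "l \<le> B" for i j l
  proof -
    obtain r' A' B' where e: "r = j + r'" "A = i + A'" "B = l + B'"
      using le unfolding le_iff_add by blast
    have "(- (u' * v)) ^ j = (- 1) ^ j * u' ^ j * v ^ j"
      by (metis mult_minus1 power_mult_distrib mult.assoc)
    then show ?thesis
      by (simp add: ncoeff_pw e power_add power_mult_distrib mult_monom smult_monom mult_ac)
  qed
  have "transvectant A B r (pw (A + r) u v) (pw (B + r) u' v') =
     (\<Sum>j\<le>r. [:of_nat (r choose j) * (- (u' * v)) ^ j * (u * v') ^ (r - j):] *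
       ((\<Sum>i\<le>A. smult (of_nat (A choose i) * u ^ i * v ^ (A - i)) (monom 1 i)) *
        (\<Sum>l\<le>B. smult (of_nat (B choose l) * u' ^ l * v' ^ (B - l)) (monom 1 l))))"
    unfolding transvectant_def sum_product unfolding sum_distrib_left by (intro sum.cong refl trm) auto
  also have "\<dots> = (\<Sum>j\<le>r. [:of_nat (r choose j) * (- (u' * v)) ^ j * (u * v') ^ (r - j):]) * ([:v, u:] ^ A * [:v', u':] ^ B)"
    by (simp only: linear_form_power sum_distrib_right)
  also have "(\<Sum>j\<le>r. [:of_nat (r choose j) * (- (u' * v)) ^ j * (u * v') ^ (r - j):]) = [:(- (u' * v) + u * v') ^ r:]"
    by (simp only: binomial_ring) (simp add: poly_eq_iff coeff_sum coeff_pCons split: nat.split)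
  finally show ?thesis by simp
qed

lemma plin2_eq_on_pw:
  assumes "\<And>g. plin (\<lambda>f. L f g)" "\<And>f. plin (L f)" "\<And>g. plin (\<lambda>f. L' f g)" "\<And>f. plin (L' f)"
    and eq: "\<And>t s. L (pw a t 1) (pw b s 1) = L' (pw a t 1) (pw b s 1)" and f: "f \<in> V (int a)" and g: "g \<in> V (int b)"
  shows "L f g = L' f g"
proof -
  have "L f (pw b s 1) = L' f (pw b s 1)" for s
    by (rule plin_eq_on_pw[OF assms(1,3) eq f])
  then show ?thesis by (rule plin_eq_on_pw[OF assms(2,4) _ g])
qed

text \<open>
  On power vectors the transvectant is built from the determinant of the two parameter vectors, which
  \<open>SU(2)\<close> preserves, and from products of power vectors.
\<close>

lemma transvectant_equivariant:
  assumes h: "h \<in> SU2" and f: "f \<in> V (int (A + r))" and g: "g \<in> V (int (B + r))"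
  shows "transvectant A B r (rho (int (A + r)) h f) (rho (int (B + r)) h g) = rho (int (A + B)) h (transvectant A B r f g)"
proof (rule plin2_eq_on_pw[where L = "\<lambda>f g. transvectant A B r (rho (int (A + r)) h f) (rho (int (B + r)) h g)"
      and L' = "\<lambda>f g. rho (int (A + B)) h (transvectant A B r f g)", OF _ _ _ _ _ f g])
  fix t s
  let ?a = "h $ 1 $ 1" and ?b = "h $ 1 $ 2" and ?c = "h $ 2 $ 1" and ?d = "h $ 2 $ 2"
  have "(?a * t + ?b) * (?c * s + ?d) - (?a * s + ?b) * (?c * t + ?d) = (?a * ?d - ?b * ?c) * (t - s)"
    by (simp add: algebra_simps)
  then have det: "(?a * t + ?b) * (?c * s + ?d) - (?a * s + ?b) * (?c * t + ?d) = t - s"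
    using SU2_det[OF h] by simp
  have "rho (int (A + B)) h ([:1, t:] ^ A * [:1, s:] ^ B) = rho (int A) h (pw A t 1) * rho (int B) h (pw B s 1)"
    using rho_prod[OF pw_in_V pw_in_V, of A B h t 1 s 1] by (simp add: pw_def)
  then show "transvectant A B r (rho (int (A + r)) h (pw (A + r) t 1)) (rho (int (B + r)) h (pw (B + r) s 1)) =
      rho (int (A + B)) h (transvectant A B r (pw (A + r) t 1) (pw (B + r) s 1))"
    unfolding rho_pw transvectant_pw plin_smult[OF plin_rho] by (simp add: det) (simp add: pw_def)
qed (rule plin_compose[OF plin_transvectant_left plin_rho] plin_compose[OF plin_transvectant_right plin_rho]
    plin_compose[OF plin_rho plin_transvectant_left] plin_compose[OF plin_rho plin_transvectant_right])+

section \<open>Clifford homomorphisms as differential operators\<close>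

lemma cliff_ext_add: "cliff_ext H A B (X + Y) f = cliff_ext H A B X f + cliff_ext H A B Y f"
proof -
  have e: "Complex (x + x') (- (y + y')) = Complex x (- y) + Complex x' (- y')"
    "Complex (x + x') (y + y') = Complex x y + Complex x' y'" for x x' y y'
    by (simp_all add: complex_eq_iff)
  show ?thesis
    unfolding cliff_ext_def
    by (rule plin_eqI[OF plin_lin_ext plin_sum_map[OF plin_lin_ext plin_lin_ext]])
      (simp add: e lin_ext_monom distrib_left smult_add_left del: minus_add_distrib)
qed

lemma cliff_ext_scaleR: "cliff_ext H A B (r *\<^sub>R X) f = smult (complex_of_real r) (cliff_ext H A B X f)"
proof -
  have e: "Complex (r * x) (- (r * y)) = complex_of_real r * Complex x (- y)"
    "Complex (r * x) (r * y) = complex_of_real r * Complex x y" for x y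
    by (simp_all add: complex_eq_iff)
  show ?thesis
    unfolding cliff_ext_def
    by (rule plin_eqI[OF plin_lin_ext plin_smult_map[OF plin_lin_ext]])
      (simp add: e lin_ext_monom smult_add_right mult.left_commute)
qed

lemma plin_cliff: "plin (cliff_ext H A B X)"
  by (simp add: cliff_ext_def plin_lin_ext)

lemma plin_rho_zero: "plin (rho_zero m X)"
  and plin_rho_plus: "plin (rho_plus m X)"
  and plin_rho_minus: "plin (rho_minus m X)"
  by (simp_all add: rho_zero_def rho_plus_def rho_minus_def plin_cliff)

abbreviation Cm :: "real ^ 3 \<Rightarrow> complex" where "Cm X \<equiv> Complex (X $ 2) (- (X $ 3))"
abbreviation Cp :: "real ^ 3 \<Rightarrow> complex" where "Cp X \<equiv> Complex (X $ 2) (X $ 3)"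

text \<open>Multiplication by this quadratic polynomial is \<open>\<rho>\<^sup>+(X)\<close>.\<close>

definition quad :: "real ^ 3 \<Rightarrow> complex poly" where
  "quad X = [:- Cm X, 2 * \<i> * complex_of_real (X $ 1), - Cp X:]"

lemma poly_eqI2: "(\<And>z. poly p z = poly q (z :: complex)) \<Longrightarrow> p = q"
  by (simp add: poly_eq_poly_eq_iff[symmetric] fun_eq_iff)

lemma quad_in_V: "quad X \<in> V 2"
  using V_iff_degree[of "quad X" 2] by (simp add: quad_def)

lemma rho_plus_eq: "rho_plus m X f = quad X * f"
  unfolding rho_plus_def cliff_ext_def
  by (rule plin_eqI[OF plin_lin_ext plin_mult])
    (rule poly_eqI2, simp add: lin_ext_monom quad_def poly_monom algebra_simps power2_eq_square)

lemma rho_zero_eq: "rho_zero m X f =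
    smult (\<i> * complex_of_real (X $ 1)) (smult 2 ([:0, 1:] * pderiv f) - smult (of_int m) f)
    - smult (Cm X) (pderiv f) + smult (Cp X) (smult (of_int m) ([:0, 1:] * f) - [:0, 0, 1:] * pderiv f)"
  unfolding rho_zero_def cliff_ext_def
proof (rule plin_eqI[OF plin_lin_ext])
  fix k
  show "lin_ext (\<lambda>k. smult (complex_of_real (2 * X $ 1)) (monom (\<i> * (of_nat k - of_int m / 2)) k) +
                 smult (Cm X) (monom (- of_nat k) (k - 1)) + smult (Cp X) (monom (of_int m - of_nat k) (k + 1))) (monom 1 k) =
     smult (\<i> * complex_of_real (X $ 1)) (smult 2 ([:0, 1:] * pderiv (monom 1 k)) - smult (of_int m) (monom 1 k))
    - smult (Cm X) (pderiv (monom 1 k)) + smult (Cp X) (smult (of_int m) ([:0, 1:] * monom 1 k) - [:0, 0, 1:] * pderiv (monom 1 k))"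
    unfolding lin_ext_monom
    by (rule poly_eqI2, cases k) (simp_all add: poly_monom pderiv_monom algebra_simps power2_eq_square)
qed (intro plin_intros plin_pderiv)

lemma rho_minus_eq: "rho_minus m X f =
    smult (2 * \<i> * complex_of_real (X $ 1)) (smult (of_int m - 1) (pderiv f) - [:0, 1:] * pderiv (pderiv f))
    + smult (Cm X) (pderiv (pderiv f))
    + smult (Cp X) (smult (of_int m * (of_int m - 1)) f - smult (2 * (of_int m - 1)) ([:0, 1:] * pderiv f)
        + [:0, 0, 1:] * pderiv (pderiv f))"
  unfolding rho_minus_def cliff_ext_def
proof (rule plin_eqI[OF plin_lin_ext])
  fix k :: nat
  consider "k = 0" | "k = 1" | j where "k = Suc (Suc j)" by (metis One_nat_def not0_implies_Suc)
  then show "lin_ext (\<lambda>k. smult (complex_of_real (2 * X $ 1)) (monom (\<i> * of_nat k * (of_int m - of_nat k)) (k - 1)) +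
                 smult (Cm X) (monom (of_nat k * (of_nat k - 1)) (k - 2)) +
                 smult (Cp X) (monom ((of_int m - of_nat k) * (of_int m - of_nat k - 1)) k)) (monom 1 k) =
    smult (2 * \<i> * complex_of_real (X $ 1)) (smult (of_int m - 1) (pderiv (monom 1 k)) - [:0, 1:] * pderiv (pderiv (monom 1 k)))
    + smult (Cm X) (pderiv (pderiv (monom 1 k)))
    + smult (Cp X) (smult (of_int m * (of_int m - 1)) (monom 1 k) - smult (2 * (of_int m - 1)) ([:0, 1:] * pderiv (monom 1 k))
        + [:0, 0, 1:] * pderiv (pderiv (monom 1 k)))"
    unfolding lin_ext_monom
    by cases (rule poly_eqI2, simp add: poly_monom pderiv_monom algebra_simps power2_eq_square)+
qed (intro plin_intros plin_pderiv)

text \<open>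
  For \<open>y = (u, v)\<close> this is the determinant of \<open>y\<close> and \<open>X y\<close>, up to sign. It describes \<open>\<rho>\<^sup>-\<close> on power vectors, and its
  invariance under \<open>SU(2)\<close> gives the equivariance of \<open>\<rho>\<^sup>-\<close> and \<open>\<rho>\<^sup>+\<close>.
\<close>

definition Qf :: "real ^ 3 \<Rightarrow> complex \<Rightarrow> complex \<Rightarrow> complex" where
  "Qf X u v = 2 * \<i> * complex_of_real (X $ 1) * u * v + Cm X * u\<^sup>2 + Cp X * v\<^sup>2"

lemma su2_of_nth [simp]:
  "su2_of X $ 1 $ 1 = \<i> * complex_of_real (X $ 1)" "su2_of X $ 1 $ 2 = Cp X"
  "su2_of X $ 2 $ 1 = - Cm X" "su2_of X $ 2 $ 2 = - \<i> * complex_of_real (X $ 1)"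
  by (simp_all add: su2_of_def complex_eq_iff)

lemma pderiv_pw: "pderiv ([:v, u:] ^ Suc n) = smult (of_nat (Suc n) * u) ([:v, u:] ^ n)"
  by (simp add: pderiv_power_Suc pderiv_pCons mult_ac del: power_Suc)

lemma rho_minus_pw:
  "rho_minus (int m) X (pw m u v) = smult (of_nat m * (of_nat m - 1) * Qf X u v) (pw (m - 2) u v)"
proof -
  consider "m = 0" | "m = 1" | n where "m = Suc (Suc n)" by (metis One_nat_def not0_implies_Suc)
  then show ?thesis
  proof cases
    case 3
    have d: "pderiv (pw m u v) = smult (of_nat m * u) ([:v, u:] ^ Suc n)"
      "pderiv (pderiv (pw m u v)) = smult (of_nat m * (of_nat m - 1) * u\<^sup>2) ([:v, u:] ^ n)"
      by (simp_all only: pw_def 3 pderiv_pw pderiv_smult) (simp add: power2_eq_square mult_ac)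
    show ?thesis
      unfolding rho_minus_eq d(2) unfolding d(1) by (rule poly_eqI2) (simp add: pw_def 3 Qf_def algebra_simps power2_eq_square)
  qed (simp_all add: rho_minus_eq pw_def pderiv_pCons)
qed

lemma rho_zero_pw:
  "rho_zero (int m) X (pw m u v) = smult (of_nat m)
     (pw 1 (su2_of X $ 1 $ 1 * u + su2_of X $ 1 $ 2 * v) (su2_of X $ 2 $ 1 * u + su2_of X $ 2 $ 2 * v) * pw (m - 1) u v)"
proof (cases m)
  case (Suc n)
  have d: "pderiv (pw m u v) = smult (of_nat m * u) ([:v, u:] ^ n)"
    by (simp only: pw_def Suc pderiv_pw)
  show ?thesis
    unfolding rho_zero_eq d by (rule poly_eqI2) (simp add: pw_def Suc algebra_simps power2_eq_square)
qed (simp add: rho_zero_eq pw_def)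

lemma rho_zero_in_V: "f \<in> V (int m) \<Longrightarrow> rho_zero (int m) X f \<in> V (int m)"
proof (rule plin_in_V[OF plin_rho_zero])
  fix k assume "k \<le> m"
  then show "rho_zero (int m) X (monom 1 k) \<in> V (int m)"
    by (cases "k = m") (auto simp: rho_zero_def cliff_ext_def lin_ext_monom intro!: V_add V_smult V_monom)
qed

lemma rho_plus_in_V: "f \<in> V (int m) \<Longrightarrow> rho_plus (int m) X f \<in> V (int m + 2)"
  using V_mult[of "quad X" 2 f m] by (simp add: rho_plus_eq quad_in_V add.commute)

lemma rho_minus_in_V: "f \<in> V (int m) \<Longrightarrow> rho_minus (int m) X f \<in> V (int m - 2)"
proof (rule plin_in_V[OF plin_rho_minus])
  fix k assume k: "k \<le> m"
  consider "m = 0" "k = 0" | "m = 1" "k = 0" | "m = 1" "k = 1" | "m \<ge> 2" "k = m" | "m \<ge> 2" "k = m - 1" | "k + 2 \<le> m"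
    using k by linarith
  then show "rho_minus (int m) X (monom 1 k) \<in> V (int m - 2)"
    unfolding rho_minus_def cliff_ext_def lin_ext_monom
    by cases (auto simp: of_nat_diff intro!: V_add V_smult V_monom, presburger?)
qed

lemma rho_minus_small: "m < 2 \<Longrightarrow> f \<in> V (int m) \<Longrightarrow> rho_minus (int m) X f = 0"
  using rho_minus_in_V[of f m X] by (simp add: V_neg)

section \<open>Equivariance and adjoints of the Clifford homomorphisms\<close>

definition Ad :: "mat2 \<Rightarrow> real ^ 3 \<Rightarrow> real ^ 3" where
  "Ad h X = (let M = h ** su2_of X ** adjoint_mat h in vector [Im (M $ 1 $ 1), Re (M $ 1 $ 2), Im (M $ 1 $ 2)])"

lemma su2_of_Ad: "h \<in> SU2 \<Longrightarrow> su2_of (Ad h X) = h ** su2_of X ** adjoint_mat h"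
  by (auto simp: mat2_eq_iff Ad_def Let_def mat2_mult_nth complex_eq_iff SU2_iff algebra_simps)

lemma Qf_eq: "Qf X u v = (su2_of X $ 1 $ 1 * u + su2_of X $ 1 $ 2 * v) * v - (su2_of X $ 2 $ 1 * u + su2_of X $ 2 $ 2 * v) * u"
  by (simp add: Qf_def algebra_simps power2_eq_square)

lemma su2_of_Ad_apply:
  assumes h: "h \<in> SU2"
  shows "su2_of (Ad h X) $ i $ 1 * (h $ 1 $ 1 * u + h $ 1 $ 2 * v) + su2_of (Ad h X) $ i $ 2 * (h $ 2 $ 1 * u + h $ 2 $ 2 * v) =
     h $ i $ 1 * (su2_of X $ 1 $ 1 * u + su2_of X $ 1 $ 2 * v) + h $ i $ 2 * (su2_of X $ 2 $ 1 * u + su2_of X $ 2 $ 2 * v)"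
proof -
  have "su2_of (Ad h X) ** h = h ** su2_of X ** (adjoint_mat h ** h)"
    using h by (simp add: su2_of_Ad matrix_mul_assoc)
  then have e: "su2_of (Ad h X) ** h = h ** su2_of X" using h by (simp add: SU2_adjoint_left)
  have "(su2_of (Ad h X) ** h) $ i $ 1 * u + (su2_of (Ad h X) ** h) $ i $ 2 * v =
     (h ** su2_of X) $ i $ 1 * u + (h ** su2_of X) $ i $ 2 * v" using e by simp
  then show ?thesis unfolding mat2_mult_nth by (simp add: algebra_simps)
qed

lemma Qf_Ad:
  assumes h: "h \<in> SU2"
  shows "Qf (Ad h X) (h $ 1 $ 1 * u + h $ 1 $ 2 * v) (h $ 2 $ 1 * u + h $ 2 $ 2 * v) = Qf X u v"
proof -
  let ?a = "h $ 1 $ 1" and ?b = "h $ 1 $ 2" and ?c = "h $ 2 $ 1" and ?d = "h $ 2 $ 2"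
  let ?p = "su2_of X $ 1 $ 1 * u + su2_of X $ 1 $ 2 * v" and ?q = "su2_of X $ 2 $ 1 * u + su2_of X $ 2 $ 2 * v"
  have "Qf (Ad h X) (?a * u + ?b * v) (?c * u + ?d * v) =
     (?a * ?p + ?b * ?q) * (?c * u + ?d * v) - (?c * ?p + ?d * ?q) * (?a * u + ?b * v)"
    by (simp only: Qf_eq su2_of_Ad_apply[OF h])
  also have "\<dots> = (?a * ?d - ?b * ?c) * (?p * v - ?q * u)" by (simp add: algebra_simps)
  finally show ?thesis by (simp only: SU2_det[OF h] Qf_eq mult_1)
qed

lemma rho_zero_equivariant:
  assumes h: "h \<in> SU2" and f: "f \<in> V (int m)"
  shows "rho_zero (int m) (Ad h X) (rho (int m) h f) = rho (int m) h (rho_zero (int m) X f)"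
proof (rule plin_eq_on_pw[OF plin_compose[OF plin_rho_zero plin_rho] plin_compose[OF plin_rho plin_rho_zero] _ f])
  fix t
  show "rho_zero (int m) (Ad h X) (rho (int m) h (pw m t 1)) = rho (int m) h (rho_zero (int m) X (pw m t 1))"
  proof (cases m)
    case (Suc n)
    have "rho (int (1 + n)) h (pw 1 u v * pw n t 1) = rho (int 1) h (pw 1 u v) * rho (int n) h (pw n t 1)" for u v
      by (rule rho_prod[OF pw_in_V pw_in_V])
    then show ?thesis
      unfolding rho_pw rho_zero_pw su2_of_Ad_apply[OF h] plin_smult[OF plin_rho] Suc by (simp add: rho_pw)
    next
    case 0
    then show ?thesis unfolding rho_pw rho_zero_pw plin_smult[OF plin_rho] by simp
  qed
qed

lemma rho_minus_equivariant:
  assumes h: "h \<in> SU2" and f: "f \<in> V (int m)"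
  shows "rho_minus (int m) (Ad h X) (rho (int m) h f) = rho (int m - 2) h (rho_minus (int m) X f)"
proof (cases "m < 2")
  case True
  then show ?thesis using f by (simp add: rho_minus_small rho_in_V plin_zero[OF plin_rho])
next
  case False
  then have m: "int m - 2 = int (m - 2)" by simp
  show ?thesis unfolding m
    by (rule plin_eq_on_pw[OF plin_compose[OF plin_rho_minus plin_rho] plin_compose[OF plin_rho plin_rho_minus] _ f])
      (simp only: rho_pw rho_minus_pw Qf_Ad[OF h] plin_smult[OF plin_rho])
qed

lemma poly_quad: "poly (quad X) z = - Qf X 1 (- z)"
  by (simp add: quad_def Qf_def algebra_simps power2_eq_square)

lemma rho_quad:
  assumes h: "h \<in> SU2"
  shows "rho (int 2) h (quad X) = quad (Ad h X)"
proof (rule poly_eqI2)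
  fix z
  let ?a = "h $ 1 $ 1" and ?b = "h $ 1 $ 2" and ?c = "h $ 2 $ 1" and ?d = "h $ 2 $ 2"
  have q: "quad X \<in> V (int 2)" by (simp add: quad_in_V)
  have "poly (rho (int 2) h (quad X)) z = - Qf X (?d + ?b * z) (- (?c + ?a * z))"
    unfolding plin_expand[OF plin_rho q] rho_monom
    by (simp add: quad_def Qf_def eval_nat_numeral algebra_simps)
  also have "\<dots> = - Qf (Ad h X) (?a * (?d + ?b * z) + ?b * (- (?c + ?a * z))) (?c * (?d + ?b * z) + ?d * (- (?c + ?a * z)))"
    by (simp only: Qf_Ad[OF h])
  also have "?a * (?d + ?b * z) + ?b * (- (?c + ?a * z)) = ?a * ?d - ?b * ?c" by (simp add: algebra_simps)
  also have "?c * (?d + ?b * z) + ?d * (- (?c + ?a * z)) = - z * (?a * ?d - ?b * ?c)" by (simp add: algebra_simps)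
  finally show "poly (rho (int 2) h (quad X)) z = poly (quad (Ad h X)) z"
    by (simp add: SU2_det[OF h] poly_quad)
qed

lemma rho_plus_equivariant:
  assumes h: "h \<in> SU2" and f: "f \<in> V (int m)"
  shows "rho_plus (int m) (Ad h X) (rho (int m) h f) = rho (int m + 2) h (rho_plus (int m) X f)"
  using rho_prod[of "quad X" 2 f m h] f rho_quad[OF h, of X] quad_in_V
  by (simp add: rho_plus_eq add.commute)

lemma quad_cnj: "poly (quad X) (cnj t) = - cnj (Qf X t 1)"
  by (simp add: quad_def Qf_def algebra_simps power2_eq_square complex_cnj)

lemma herm_plin_right_eqI:
  assumes "plin K" "plin K'" "\<And>t. herm m f (K (pw b t 1)) = herm m' f' (K' (pw b t 1))" "g \<in> V (int b)"
  shows "herm m f (K g) = herm m' f' (K' g)"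
proof -
  have "[:cnj (herm m f (K g)):] = [:cnj (herm m' f' (K' g)):]"
    by (rule plin_eq_on_pw[where L = "\<lambda>g. [:cnj (herm m f (K g)):]" and L' = "\<lambda>g. [:cnj (herm m' f' (K' g)):]", OF _ _ _ assms(4)])
      (simp_all add: assms(3) plin_def plin_add[OF assms(1)] plin_add[OF assms(2)] plin_smult[OF assms(1)] plin_smult[OF assms(2)]
         herm_add_right herm_smult_right)
  then show ?thesis by simp
qed

lemma herm_minus_right: "herm m f (- g) = - herm m f g"
  using herm_smult_right[of m f "-1" g] by simp

lemma rho_plus_adjoint:
  assumes f: "f \<in> V (int m)" and g: "g \<in> V (int m + 2)"
  shows "herm (int m + 2) (rho_plus (int m) X f) g = - herm (int m) f (rho_minus (int m + 2) X g)"
proof -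
  have e: "int m + 2 = int (m + 2)" by simp
  have g': "g \<in> V (int (m + 2))" using g unfolding e .
  have "herm (int (m + 2)) (rho_plus (int m) X f) g = herm (int m) f (smult (- 1) (rho_minus (int (m + 2)) X g))"
  proof (rule herm_plin_right_eqI[OF plin_ident _ _ g', where K' = "\<lambda>g. smult (- 1) (rho_minus (int (m + 2)) X g)"])
    fix t
    have "rho_plus (int m) X f \<in> V (int (m + 2))" using rho_plus_in_V[OF f, of X] unfolding e .
    then have "herm (int (m + 2)) (rho_plus (int m) X f) (pw (m + 2) t 1) = fact (m + 2) * poly (quad X * f) (cnj t)"
      by (simp only: herm_pw rho_plus_eq)
    also have "\<dots> = - cnj (of_nat (m + 2) * (of_nat (m + 2) - 1) * Qf X t 1) * (fact m * poly f (cnj t))"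
      by (simp add: quad_cnj algebra_simps)
    also have "\<dots> = herm (int m) f (smult (- 1) (rho_minus (int (m + 2)) X (pw (m + 2) t 1)))"
      by (simp only: rho_minus_pw herm_smult_right) (simp add: herm_pw f)
    finally show "herm (int (m + 2)) (rho_plus (int m) X f) (pw (m + 2) t 1) =
       herm (int m) f (smult (- 1) (rho_minus (int (m + 2)) X (pw (m + 2) t 1)))" .
  qed (intro plin_smult_map plin_rho_minus)
  then show ?thesis unfolding e by (simp add: herm_minus_right)
qed

lemma rho_zero_adjoint:
  assumes f: "f \<in> V (int m)" and g: "g \<in> V (int m)"
  shows "herm (int m) (rho_zero (int m) X f) g = - herm (int m) f (rho_zero (int m) X g)"
proof -
  let ?x = "\<i> * complex_of_real (X $ 1)"
  have L: "herm (int m) (rho_zero (int m) X (pw m s 1)) (pw m t 1) =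
      fact m * of_nat m * ((?x * s + Cp X) * cnj t + (- Cm X * s - ?x)) * (s * cnj t + 1) ^ (m - 1)" for s t
    unfolding herm_pw[OF rho_zero_in_V[OF pw_in_V]] unfolding rho_zero_pw by (simp add: pw_def algebra_simps)
  have R: "herm (int m) (pw m s 1) (smult (- 1) (rho_zero (int m) X (pw m t 1))) =
     herm (int m) (rho_zero (int m) X (pw m s 1)) (pw m t 1)" for s t
    by (simp only: herm_smult_right herm_commute[of "int m" "pw m s 1"] L)
      (simp add: algebra_simps complex_cnj)
  have "herm (int m) (rho_zero (int m) X f) g = herm (int m) f (smult (- 1) (rho_zero (int m) X g))"
  proof (rule herm_plin_right_eqI[OF plin_ident _ _ g, where K' = "\<lambda>g. smult (- 1) (rho_zero (int m) X g)"])
    fix t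
    have "[:herm (int m) (rho_zero (int m) X f) (pw m t 1):] = [:herm (int m) f (smult (- 1) (rho_zero (int m) X (pw m t 1))):]"
      by (rule plin_eq_on_pw[where L = "\<lambda>f. [:herm (int m) (rho_zero (int m) X f) (pw m t 1):]", OF _ _ _ f])
       (simp_all only: R, auto simp add: plin_def plin_add[OF plin_rho_zero] plin_smult[OF plin_rho_zero] herm_add_left herm_smult_left)
    then show "herm (int m) (rho_zero (int m) X f) (pw m t 1) = herm (int m) f (smult (- 1) (rho_zero (int m) X (pw m t 1)))"
      by simp
  qed (intro plin_smult_map plin_rho_zero)
  then show ?thesis by (simp add: herm_minus_right)
qed

lemma axis3_nth: "(axis i 1 :: real ^ 3) $ j = (if i = j then 1 else 0)"
  by (simp add: axis_def)

lemma Complex_units: "Complex 0 0 = 0" "Complex 1 0 = 1" "Complex 0 1 = \<i>" "Complex 0 (- 1) = - \<i>"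
  by (simp_all add: complex_eq_iff)

lemmas poly_diff_simps = pderiv_add pderiv_diff pderiv_minus pderiv_smult pderiv_mult pderiv_pCons

text \<open>
  The sums of products of two Clifford homomorphisms over the frame are equivariant, so they vanish between
  spaces of different dimension; the scalar in \<open>sum_rho_zero_zero\<close> is that of the Casimir operator.
\<close>

lemma sum_rho_plus_zero: "(\<Sum>i\<in>UNIV. rho_plus m (axis i 1) (rho_zero m (axis i 1) f)) = 0"
  unfolding rho_zero_eq rho_plus_eq sum_3 quad_def
  by (rule poly_eqI2) (simp add: axis3_nth Complex_units algebra_simps power2_eq_square)

lemma sum_rho_minus_zero: "(\<Sum>i\<in>UNIV. rho_minus m (axis i 1) (rho_zero m (axis i 1) f)) = 0"
  unfolding rho_zero_eq rho_minus_eq sum_3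
  by (rule poly_eqI2) (simp add: axis3_nth Complex_units poly_diff_simps algebra_simps power2_eq_square)

lemma sum_rho_zero_zero:
  "(\<Sum>i\<in>UNIV. rho_zero m (axis i 1) (rho_zero m (axis i 1) f)) = smult (- of_int m * (of_int m + 2)) f"
  unfolding rho_zero_eq sum_3
  by (rule poly_eqI2) (simp add: axis3_nth Complex_units poly_diff_simps algebra_simps power2_eq_square)

section \<open>Gordan's theorem on bihomogeneous forms\<close>

definition bimono :: "nat \<Rightarrow> nat \<Rightarrow> nat \<Rightarrow> nat \<Rightarrow> complex \<Rightarrow> complex \<Rightarrow> complex \<Rightarrow> complex \<Rightarrow> complex" where
  "bimono n m i j x y x' y' = x ^ i * y ^ (n - i) * x' ^ j * y' ^ (m - j)"

text \<open>
  Functions of two vectors \<open>(x, y)\<close> and \<open>(x\<^sub>1, y\<^sub>1)\<close> that arise from polarised binary forms (rule \<open>polar\<close>, where \<open>e\<close>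
  selects a coefficient in an auxiliary variable) by linear combination and multiplication by the
  determinant of the two vectors.
\<close>

inductive gordan :: "nat \<Rightarrow> nat \<Rightarrow> (complex \<Rightarrow> complex \<Rightarrow> complex \<Rightarrow> complex \<Rightarrow> complex) \<Rightarrow> bool" where
  polar: "gordan n m (\<lambda>x y x' y'. coeff ([:y, x:] ^ n * [:y', x':] ^ m) e)"
| add: "gordan n m \<Phi> \<Longrightarrow> gordan n m \<Psi> \<Longrightarrow> gordan n m (\<lambda>x y x' y'. \<Phi> x y x' y' + \<Psi> x y x' y')"
| scale: "gordan n m \<Phi> \<Longrightarrow> gordan n m (\<lambda>x y x' y'. c * \<Phi> x y x' y')"
| step: "gordan n m \<Phi> \<Longrightarrow> gordan (Suc n) (Suc m) (\<lambda>x y x' y'. (x' * y - x * y') * \<Phi> x y x' y')"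

lemma gordan_zero: "gordan n m (\<lambda>x y x' y'. 0)"
  using gordan.scale[OF gordan.polar, of n m 0 0] by simp

lemma gordan_sum:
  "finite I \<Longrightarrow> (\<And>a. a \<in> I \<Longrightarrow> c a \<noteq> 0 \<Longrightarrow> gordan n m (\<Phi> a)) \<Longrightarrow>
     gordan n m (\<lambda>x y x' y'. \<Sum>a\<in>I. c a * \<Phi> a x y x' y')"
proof (induction I rule: finite_induct)
  case (insert a I)
  have "gordan n m (\<lambda>x y x' y'. c a * \<Phi> a x y x' y')"
    using insert.prems[of a] by (cases "c a = 0") (auto simp: gordan_zero intro: gordan.scale)
  then show ?case using gordan.add insert by simp
qed (simp add: gordan_zero)

lemma polar_coeff:
  "coeff (([:y, x:] :: complex poly) ^ n * [:y', x':] ^ m) e =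
     (\<Sum>i\<le>e. (of_nat (n choose i) * of_nat (m choose (e - i))) * bimono n m i (e - i) x y x' y')"
  by (simp add: coeff_mult coeff_linear_form_power bimono_def mult_ac)

text \<open>
  Modulo multiples of the determinant, \<open>x y\<^sub>1\<close> may be exchanged for \<open>x\<^sub>1 y\<close>, so all bihomogeneous monomials
  of bidegree \<open>(n, m)\<close> with the same total degree \<open>e\<close> in \<open>x\<close> and \<open>x\<^sub>1\<close> agree. The polarised form of index \<open>e\<close> is a combination
  of them whose total weight is not zero by the Vandermonde convolution.
\<close>

lemma gordan_bimono: "i \<le> n \<Longrightarrow> j \<le> m \<Longrightarrow> gordan n m (bimono n m i j)"
proof (induction n arbitrary: m i j)
  case 0
  have eq: "bimono 0 m i j = (\<lambda>x y x' y'. 1 / of_nat (m choose j) * coeff ([:y, x:] ^ 0 * [:y', x':] ^ m) j)"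
    using 0 by (auto simp: fun_eq_iff bimono_def coeff_linear_form_power)
  show ?case unfolding eq by (rule gordan.scale[OF gordan.polar])
next
  case (Suc n)
  show ?case
  proof (cases m)
    case 0
    have eq: "bimono (Suc n) m i j = (\<lambda>x y x' y'. 1 / of_nat (Suc n choose i) * coeff ([:y, x:] ^ (Suc n) * [:y', x':] ^ m) i)"
      using Suc.prems 0 by (auto simp: fun_eq_iff bimono_def coeff_linear_form_power simp del: power_Suc binomial_Suc_Suc)
    show ?thesis unfolding eq by (rule gordan.scale[OF gordan.polar])
  next
    case (Suc m')
    let ?N = "Suc n"
    define e where "e = i + j"
    let ?b = "\<lambda>t. bimono ?N m t (e - t)"
    \<comment> \<open>one exchange costs a multiple of the determinant\<close>
    have adj: "gordan ?N m (\<lambda>x y x' y'. ?b (Suc t) x y x' y' - ?b t x y x' y')"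
      if t: "t \<le> n" "Suc t \<le> e" "e - Suc t \<le> m'" for t
    proof -
      obtain k where k: "n = t + k" using t(1) by (auto simp: le_iff_add)
      obtain s where s: "e = Suc t + s" using t(2) by (auto simp: le_iff_add)
      obtain l where l: "m' = s + l" using t(3) s by (auto simp: le_iff_add)
      have eq: "(\<lambda>x y x' y'. ?b (Suc t) x y x' y' - ?b t x y x' y') =
        (\<lambda>x y x' y'. - 1 * ((x' * y - x * y') * bimono n m' t s x y x' y'))"
        by (simp add: fun_eq_iff bimono_def k s l Suc Suc_diff_le algebra_simps)
      have "gordan n m' (bimono n m' t s)" using Suc.IH t(1) l by simp
      then show ?thesis unfolding eq unfolding Suc by (rule gordan.scale[OF gordan.step])
    qed
    have le: "gordan ?N m (\<lambda>x y x' y'. ?b i2 x y x' y' - ?b i1 x y x' y')"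
      if "i1 \<le> i2" "i2 \<le> ?N" "i2 \<le> e" "e - i1 \<le> m" for i1 i2
      using that
    proof (induction i2 rule: dec_induct)
      case base
      then show ?case by (simp add: gordan_zero)
    next
      case (step t)
      have 1: "gordan ?N m (\<lambda>x y x' y'. ?b t x y x' y' - ?b i1 x y x' y')" using step by simp
      have 2: "gordan ?N m (\<lambda>x y x' y'. ?b (Suc t) x y x' y' - ?b t x y x' y')"
        by (rule adj) (use step Suc in auto)
      show ?case using gordan.add[OF 2 1] by simp
    qed
    have eq: "gordan ?N m (\<lambda>x y x' y'. ?b t x y x' y' - ?b i x y x' y')"
      if "t \<le> ?N" "t \<le> e" "e - t \<le> m" for t
    proof (cases "i \<le> t")
      case True
      then show ?thesis using le[of i t] that Suc.prems by (simp add: e_def)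
    next
      case False
      then have "gordan ?N m (\<lambda>x y x' y'. ?b i x y x' y' - ?b t x y x' y')"
        using le[of t i] that Suc.prems by (simp add: e_def)
      from gordan.scale[OF this, of "-1"] show ?thesis by simp
    qed
    let ?c = "\<lambda>t. complex_of_nat (?N choose t) * of_nat (m choose (e - t))"
    let ?C = "complex_of_nat ((?N + m) choose e)"
    have C: "(\<Sum>t\<le>e. ?c t) = ?C"
      by (simp only: vandermonde[symmetric] of_nat_sum of_nat_mult)
    have "?C \<noteq> 0" using Suc.prems by (simp add: e_def del: binomial_Suc_Suc)
    have "gordan ?N m (\<lambda>x y x' y'. \<Sum>t\<le>e. ?c t * (?b t x y x' y' - ?b i x y x' y'))"
    proof (rule gordan_sum)
      fix t assume "t \<in> {..e}" "?c t \<noteq> 0"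
      then show "gordan ?N m (\<lambda>x y x' y'. ?b t x y x' y' - ?b i x y x' y')"
        by (intro eq) (auto simp del: binomial_Suc_Suc simp: not_less[symmetric] binomial_eq_0)
    qed simp
    from gordan.scale[OF gordan.add[OF gordan.polar[of ?N m e] gordan.scale[OF this, of "-1"]], of "1 / ?C"]
    have "gordan ?N m (\<lambda>x y x' y'. 1 / ?C * ((\<Sum>t\<le>e. ?c t * ?b t x y x' y')
        + - 1 * (\<Sum>t\<le>e. ?c t * (?b t x y x' y' - ?b i x y x' y'))))"
      by (simp only: polar_coeff)
    moreover have "1 / ?C * ((\<Sum>t\<le>e. ?c t * ?b t x y x' y') + - 1 * (\<Sum>t\<le>e. ?c t * (?b t x y x' y' - ?b i x y x' y')))
       = ?b i x y x' y'" for x y x' y'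
    proof -
      have "(\<Sum>t\<le>e. ?c t * (?b t x y x' y' - ?b i x y x' y')) = (\<Sum>t\<le>e. ?c t * ?b t x y x' y') - ?C * ?b i x y x' y'"
        by (simp only: right_diff_distrib sum_subtractf C[symmetric] sum_distrib_right)
      then show ?thesis using \<open>?C \<noteq> 0\<close> by (simp del: binomial_Suc_Suc)
    qed
    ultimately have "gordan ?N m (\<lambda>x y x' y'. ?b i x y x' y')" by (simp only:)
    then show ?thesis by (simp add: e_def)
  qed
qed

section \<open>The explicit components\<close>

text \<open>The section of \<open>S\<^bsub>A+B\<^esub>\<close> attached to \<open>f \<otimes> g\<close> in the representation of type \<open>(A + r, B + r)\<close>.\<close>

definition bsec :: "nat \<Rightarrow> nat \<Rightarrow> nat \<Rightarrow> complex poly \<Rightarrow> complex poly \<Rightarrow> sect" where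
  "bsec A B r f g = (\<lambda>(p, q). if (p, q) \<in> Spin4
     then transvectant A B r (rho (int (A + r)) (adjoint_mat p) f) (rho (int (B + r)) (adjoint_mat q) g) else 0)"

lemma bsec_apply: "p \<in> SU2 \<Longrightarrow> q \<in> SU2 \<Longrightarrow>
    bsec A B r f g (p, q) = transvectant A B r (rho (int (A + r)) (adjoint_mat p) f) (rho (int (B + r)) (adjoint_mat q) g)"
  by (simp add: bsec_def Spin4_def)

lemma bsec_add_left: "bsec A B r (f + f') g = bsec A B r f g + bsec A B r f' g"
  and bsec_add_right: "bsec A B r f (g + g') = bsec A B r f g + bsec A B r f g'"
  and bsec_smult_left: "bsec A B r (smult c f) g = sec_scale c (bsec A B r f g)"
  and bsec_smult_right: "bsec A B r f (smult c g) = sec_scale c (bsec A B r f g)"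
  by (auto simp: bsec_def fun_eq_iff sec_scale_def plin_add[OF plin_rho] plin_smult[OF plin_rho]
      transvectant_add_left transvectant_add_right transvectant_smult_left transvectant_smult_right)

lemma bsec_sum_left: "finite I \<Longrightarrow> bsec A B r (\<Sum>i\<in>I. f i) g = (\<Sum>i\<in>I. bsec A B r (f i) g)"
proof (induction I rule: finite_induct)
  case empty
  then show ?case using bsec_smult_left[of A B r 0 0 g] by simp
qed (simp add: bsec_add_left)

lemma bsec_sum_right: "finite I \<Longrightarrow> bsec A B r f (\<Sum>i\<in>I. g i) = (\<Sum>i\<in>I. bsec A B r f (g i))"
proof (induction I rule: finite_induct)
  case empty
  then show ?case using bsec_smult_right[of A B r f 0 0] by simp
qed (simp add: bsec_add_right)

lemma bsec_expand:
  assumes "f \<in> V (int (A + r))" "g \<in> V (int (B + r))"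
  shows "bsec A B r f g = (\<Sum>k\<le>A + r. \<Sum>l\<le>B + r. sec_scale (coeff f k * coeff g l) (bsec A B r (monom 1 k) (monom 1 l)))"
proof -
  have "bsec A B r f g = bsec A B r (\<Sum>k\<le>A + r. smult (coeff f k) (monom 1 k)) (\<Sum>l\<le>B + r. smult (coeff g l) (monom 1 l))"
    using V_expand assms by metis
  also have "\<dots> = (\<Sum>k\<le>A + r. \<Sum>l\<le>B + r. sec_scale (coeff f k * coeff g l) (bsec A B r (monom 1 k) (monom 1 l)))"
    unfolding bsec_sum_left[OF finite_atMost] bsec_smult_left
    unfolding bsec_sum_right[OF finite_atMost] bsec_smult_right sec.scale_sum_right sec.scale_scale ..
  finally show ?thesis .
qed

lemma rho_right_translate:
  assumes "p \<in> SU2" "h \<in> SU2" "f \<in> V (int n)"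
  shows "rho (int n) (adjoint_mat (p ** h)) f = rho (int n) (adjoint_mat h) (rho (int n) (adjoint_mat p) f)"
  using assms by (simp add: adjoint_mat_mult rho_comp)

lemma bsec_in_sections:
  assumes f: "f \<in> V (int (A + r))" and g: "g \<in> V (int (B + r))"
  shows "bsec A B r f g \<in> sections (int (A + B))"
  unfolding sections_def
proof (intro CollectI conjI ballI allI impI)
  fix p q h assume "p \<in> SU2" "q \<in> SU2" "h \<in> SU2"
  then show "bsec A B r f g (p ** h, q ** h) = rho (int (A + B)) (matrix_inv h) (bsec A B r f g (p, q))"
    using rho_right_translate[OF _ _ f] rho_right_translate[OF _ _ g]
      transvectant_equivariant[OF SU2_adjoint rho_in_V[OF f] rho_in_V[OF g]]
    by (simp add: bsec_apply SU2_matrix_inv del: of_nat_add)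
qed (auto simp: bsec_def transvectant_in_V simp del: of_nat_add split: prod.splits)

lemma spin_act_bsec:
  assumes p: "p \<in> SU2" and q: "q \<in> SU2" and f: "f \<in> V (int (A + r))" and g: "g \<in> V (int (B + r))"
  shows "spin_act p q (bsec A B r f g) = bsec A B r (rho (int (A + r)) p f) (rho (int (B + r)) q g)"
proof (rule ext, clarify)
  fix p' q'
  have *: "adjoint_mat h ** h' \<in> SU2 \<longleftrightarrow> h' \<in> SU2" if h: "h \<in> SU2" for h h'
  proof
    assume "adjoint_mat h ** h' \<in> SU2"
    then have "h ** (adjoint_mat h ** h') \<in> SU2" using h by simp
    then show "h' \<in> SU2" using h by (simp add: matrix_mul_assoc SU2_adjoint_right)
  qed (use h in simp)
  show "spin_act p q (bsec A B r f g) (p', q') = bsec A B r (rho (int (A + r)) p f) (rho (int (B + r)) q g) (p', q')"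
  proof (cases "p' \<in> SU2 \<and> q' \<in> SU2")
    case True
    then show ?thesis using p q f g
      by (simp add: spin_act_def SU2_matrix_inv bsec_apply adjoint_mat_mult rho_comp del: of_nat_add)
  next
    case False
    then show ?thesis using p q *
      by (auto simp: spin_act_def SU2_matrix_inv bsec_def Spin4_def)
  qed
qed

definition polysec :: "nat \<Rightarrow> sect set" where
  "polysec m = sec.span {bsec A B r f g | A B r f g. A + B = m \<and> f \<in> V (int (A + r)) \<and> g \<in> V (int (B + r))}"

text \<open>
  The section that takes the value \<open>G(x\<^sup>-\<^sup>1)\<close> at the point \<open>x = p q\<^sup>-\<^sup>1\<close>, in the trivialisation of \<open>S\<^sub>m\<close> by the second
  factor of \<open>Spin(4)\<close>.
\<close>

definition psec :: "nat \<Rightarrow> (mat2 \<Rightarrow> complex poly) \<Rightarrow> sect" where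
  "psec m G = (\<lambda>(p, q). if (p, q) \<in> Spin4 then rho (int m) (adjoint_mat q) (G (q ** adjoint_mat p)) else 0)"

lemma psec_cong: "(\<And>h. h \<in> SU2 \<Longrightarrow> G h = G' h) \<Longrightarrow> psec m G = psec m G'"
  by (auto simp: psec_def fun_eq_iff Spin4_def)

lemma psec_add: "psec m (\<lambda>h. G h + G' h) = psec m G + psec m G'"
  and psec_smult: "psec m (\<lambda>h. smult c (G h)) = sec_scale c (psec m G)"
  and psec_zero: "psec m (\<lambda>h. 0) = 0"
  by (auto simp: psec_def fun_eq_iff sec_scale_def plin_add[OF plin_rho] plin_smult[OF plin_rho] plin_zero[OF plin_rho])

text \<open>
  Linear maps \<open>K\<close> from \<open>V\<^sub>n\<close> to \<open>V\<^sub>m\<close> whose composition with the matrix function \<open>h \<mapsto> \<rho>(h) f\<close> is a combination of the explicit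
  sections. The aim is to show that all linear maps are of this kind.
\<close>

definition homs :: "nat \<Rightarrow> nat \<Rightarrow> (complex poly \<Rightarrow> complex poly) set" where
  "homs n m = {K. plin K \<and> (\<forall>f\<in>V (int n). psec m (\<lambda>h. K (rho (int n) h f)) \<in> polysec m)}"

text \<open>The element \<open>q\<close> can be pulled out of the transvectant by equivariance.\<close>

lemma homs_transvectant:
  assumes g: "g \<in> V (int (B + r))"
  shows "(\<lambda>f. transvectant A B r f g) \<in> homs (A + r) (A + B)"
  unfolding homs_def
proof (intro CollectI conjI ballI plin_transvectant_left)
  fix f assume f: "f \<in> V (int (A + r))"
  have "psec (A + B) (\<lambda>h. transvectant A B r (rho (int (A + r)) h f) g) = bsec A B r f g"
  proof (rule ext, clarify)
    fix p q
    show "psec (A + B) (\<lambda>h. transvectant A B r (rho (int (A + r)) h f) g) (p, q) = bsec A B r f g (p, q)"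
    proof (cases "(p, q) \<in> Spin4")
      case True
      then have pq: "p \<in> SU2" "q \<in> SU2" by (auto simp: Spin4_def)
      have "adjoint_mat q ** (q ** adjoint_mat p) = adjoint_mat p"
        using pq by (simp add: matrix_mul_assoc SU2_adjoint_left)
      then have "rho (int (A + r)) (adjoint_mat q) (rho (int (A + r)) (q ** adjoint_mat p) f) = rho (int (A + r)) (adjoint_mat p) f"
        using f by (metis rho_comp)
      then show ?thesis
        using pq transvectant_equivariant[OF SU2_adjoint[OF pq(2)] rho_in_V[OF f] g, symmetric]
        by (simp add: psec_def True bsec_apply del: of_nat_add)
    qed (simp add: psec_def bsec_def)
  qed
  moreover have "bsec A B r f g \<in> polysec (A + B)"
    unfolding polysec_def using f g by (blast intro: sec.span_base)
  ultimately show "psec (A + B) (\<lambda>h. transvectant A B r (rho (int (A + r)) h f) g) \<in> polysec (A + B)"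
    by (simp only:)
qed

lemma homs_add: "K \<in> homs n m \<Longrightarrow> K' \<in> homs n m \<Longrightarrow> (\<lambda>f. K f + K' f) \<in> homs n m"
  and homs_smult: "K \<in> homs n m \<Longrightarrow> (\<lambda>f. smult c (K f)) \<in> homs n m"
  by (auto simp: homs_def psec_add psec_smult polysec_def intro: plin_sum_map plin_smult_map sec.span_add sec.span_scale)

text \<open>
  Gordan's expansion, read as a statement about linear maps from \<open>V\<^bsub>n+s\<^esub>\<close> to \<open>V\<^bsub>m+s\<^esub>\<close>: a polarised form is a
  transvectant with a fixed second argument, and multiplication by the determinant of \<open>(v, - u)\<close> and \<open>(z, 1)\<close>, which is
  \<open>- (u z + v)\<close>, is absorbed in the exponent \<open>s\<close>.
\<close>

lemma gordan_homs:
  assumes "gordan n m \<Phi>"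
  shows "\<exists>K\<in>homs (n + s) (m + s). \<forall>u v z. poly (K (pw (n + s) u v)) z = (u * z + v) ^ s * \<Phi> v (- u) z 1"
  using assms
proof (induction arbitrary: s)
  case (polar n m e)
  define K where "K f = smult ((- 1) ^ n) (transvectant s m n f (monom (of_nat ((m + n) choose e)) e))" for f
  show ?case
  proof (cases "e \<le> m + n")
    case False
    have "coeff ([:- u, v:] ^ n * [:1, z:] ^ m) e = 0" for u v z :: complex
      using False V_mult[OF linear_form_power_V linear_form_power_V, of "- u" v n 1 z m]
      by (auto simp flip: of_nat_add intro!: V_coeff_zero)
    moreover have "(\<lambda>f. smult 0 (transvectant s m n f 0)) \<in> homs (n + s) (m + s)"
      using homs_smult[OF homs_transvectant[of 0 m n s], of 0] by (simp add: add.commute)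
    ultimately show ?thesis by (intro bexI[where x = "\<lambda>f. smult 0 (transvectant s m n f 0)"]) auto
  next
    case True
    have K: "K \<in> homs (n + s) (m + s)"
      using homs_smult[OF homs_transvectant[of "monom (of_nat ((m + n) choose e)) e" m n s], of "(-1) ^ n"] True
      by (simp add: K_def[abs_def] add.commute V_monom)
    have "poly (K (pw (n + s) u v)) z = (u * z + v) ^ s * coeff ([:- u, v:] ^ n * [:1, z:] ^ m) e" for u v z
    proof -
      let ?x = "\<lambda>e. poly (transvectant s m n (pw (s + n) u v) (monom (of_nat ((m + n) choose e)) e)) z
        - (- 1) ^ n * (u * z + v) ^ s * coeff ([:- u, v:] ^ n * [:1, z:] ^ m) e"
      have deg: "[:- u, v:] ^ n * [:1, z:] ^ m \<in> V (int (m + n))"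
        using V_mult[OF linear_form_power_V linear_form_power_V, of "- u" v n 1 z m] by (simp add: add.commute)
      have "?x e = 0"
      proof (rule poly_coeffs_zero[OF _ True])
        fix t :: complex
        have 1: "(\<Sum>e\<le>m + n. poly (transvectant s m n (pw (s + n) u v) (monom (of_nat ((m + n) choose e)) e)) z * t ^ e)
            = poly (transvectant s m n (pw (s + n) u v) (pw (m + n) t 1)) z"
        proof -
          have "pw (m + n) t 1 = (\<Sum>e\<le>m + n. smult (t ^ e) (monom (of_nat ((m + n) choose e)) e))"
            by (simp add: pw_def linear_form_power smult_monom mult_ac)
          then show ?thesis
            by (simp add: plin_sum[OF plin_transvectant_right] transvectant_smult_right poly_sum mult.commute)
        qed
        also have "\<dots> = (u - t * v) ^ n * ((u * z + v) ^ s * (t * z + 1) ^ m)"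
          by (simp only: transvectant_pw) (simp add: algebra_simps)
        finally have 1: "(\<Sum>e\<le>m + n. poly (transvectant s m n (pw (s + n) u v) (monom (of_nat ((m + n) choose e)) e)) z * t ^ e)
            = (u - t * v) ^ n * ((u * z + v) ^ s * (t * z + 1) ^ m)" .
        have 2: "(\<Sum>e\<le>m + n. coeff ([:- u, v:] ^ n * [:1, z:] ^ m) e * t ^ e) = (t * v - u) ^ n * (t * z + 1) ^ m"
        proof -
          have "(\<Sum>e\<le>m + n. coeff ([:- u, v:] ^ n * [:1, z:] ^ m) e * t ^ e) = poly ([:- u, v:] ^ n * [:1, z:] ^ m) t"
            by (subst (2) V_expand[OF deg]) (simp add: poly_sum poly_monom)
          then show ?thesis by (simp add: algebra_simps)
        qed
        have "(u - t * v) ^ n = (- 1) ^ n * (t * v - u) ^ n"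
          by (metis minus_diff_eq mult_minus1 power_mult_distrib)
        then have "(\<Sum>e\<le>m + n. poly (transvectant s m n (pw (s + n) u v) (monom (of_nat ((m + n) choose e)) e)) z * t ^ e)
          - (- 1) ^ n * (u * z + v) ^ s * (\<Sum>e\<le>m + n. coeff ([:- u, v:] ^ n * [:1, z:] ^ m) e * t ^ e) = 0"
          unfolding 1 2 by (simp add: mult_ac)
        then show "(\<Sum>e\<le>m + n. ?x e * t ^ e) = 0"
          by (simp only: left_diff_distrib sum_subtractf sum_distrib_left mult.assoc)
      qed
      then show ?thesis
        by (simp add: K_def add.commute[of n s] flip: mult.assoc power_mult_distrib)
    qed
    then show ?thesis using K by blast
  qed
next
  case (add n m \<Phi> \<Psi>)
  from add.IH(1)[of s] add.IH(2)[of s] obtain K K' where K: "K \<in> homs (n + s) (m + s)" "K' \<in> homs (n + s) (m + s)"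
    "\<And>u v z. poly (K (pw (n + s) u v)) z = (u * z + v) ^ s * \<Phi> v (- u) z 1"
    "\<And>u v z. poly (K' (pw (n + s) u v)) z = (u * z + v) ^ s * \<Psi> v (- u) z 1" by metis
  show ?case by (rule bexI[OF _ homs_add[OF K(1,2)]]) (simp add: K(3,4) algebra_simps)
next
  case (scale n m \<Phi> c)
  from scale.IH[of s] obtain K where K: "K \<in> homs (n + s) (m + s)"
    "\<And>u v z. poly (K (pw (n + s) u v)) z = (u * z + v) ^ s * \<Phi> v (- u) z 1" by metis
  show ?case by (rule bexI[OF _ homs_smult[OF K(1), of c]]) (simp add: K(2))
next
  case (step n m \<Phi>)
  from step.IH[of "Suc s"] obtain K where K: "K \<in> homs (Suc n + s) (Suc m + s)"
    "\<And>u v z. poly (K (pw (Suc n + s) u v)) z = (u * z + v) ^ Suc s * \<Phi> v (- u) z 1" by auto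
  show ?case
  proof (rule bexI[OF _ homs_smult[OF K(1), of "-1"]], intro allI)
    fix u v z
    show "poly (smult (- 1) (K (pw (Suc n + s) u v))) z = (u * z + v) ^ s * ((z * - u - v * 1) * \<Phi> v (- u) z 1)"
      unfolding poly_smult K(2) by (simp add: algebra_simps)
  qed
qed

lemma psec_matrix_coefficient:
  assumes f: "f \<in> V (int n)" and k: "k \<le> m"
  shows "psec m (\<lambda>h. smult (coeff (rho (int n) h f) i) (monom 1 k)) \<in> polysec m"
proof (cases "i \<le> n")
  case False
  then have "coeff (rho (int n) h f) i = 0" for h by (intro V_coeff_zero[OF rho_in_V[OF f]]) simp
  then show ?thesis by (simp add: psec_zero polysec_def sec.span_zero)
next
  case True
  obtain K where K: "K \<in> homs n m" "\<And>u v z. poly (K (pw n u v)) z = bimono n m (n - i) k v (- u) z 1"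
    using gordan_homs[OF gordan_bimono[of "n - i" n k m], of 0] k by auto
  let ?L = "\<lambda>f. smult (coeff f i) (monom 1 k :: complex poly)"
  let ?L' = "\<lambda>f. smult ((- 1) ^ i * of_nat (n choose i)) (K f)"
  have L': "?L' \<in> homs n m" by (rule homs_smult[OF K(1)])
  have eq: "?L f = ?L' f" if "f \<in> V (int n)" for f
  proof (rule plin_eq_on_pw[OF _ _ _ that])
    show "plin ?L" by (simp add: plin_def smult_add_left)
    show "plin ?L'" using L' by (simp add: homs_def)
    fix t
    have "((- 1) :: complex) ^ i * (- t) ^ i = t ^ i" by (simp flip: power_mult_distrib)
    then show "?L (pw n t 1) = ?L' (pw n t 1)"
      using True by (intro poly_eqI2) (simp add: K(2) bimono_def coeff_pw poly_monom mult.assoc[symmetric] mult.commute[of _ "of_nat _"])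
  qed
  have "psec m (\<lambda>h. ?L (rho (int n) h f)) = psec m (\<lambda>h. ?L' (rho (int n) h f))"
    by (rule psec_cong) (simp add: eq rho_in_V f)
  also have "\<dots> \<in> polysec m" using L' f by (simp add: homs_def)
  finally show ?thesis .
qed

text \<open>Coefficient functions of \<open>h\<close> all of whose multiples by monomials yield combinations of the explicit sections.\<close>

definition entry_functions :: "nat \<Rightarrow> (mat2 \<Rightarrow> complex) set" where
  "entry_functions m = {c. \<forall>k\<le>m. psec m (\<lambda>h. smult (c h) (monom 1 k)) \<in> polysec m}"

lemma entry_functions_add: "c \<in> entry_functions m \<Longrightarrow> c' \<in> entry_functions m \<Longrightarrow> (\<lambda>h. c h + c' h) \<in> entry_functions m"
  by (auto simp: entry_functions_def smult_add_left psec_add polysec_def intro: sec.span_add)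

lemma entry_functions_scale: "c \<in> entry_functions m \<Longrightarrow> (\<lambda>h. x * c h) \<in> entry_functions m"
proof -
  have "psec m (\<lambda>h. smult (x * c h) (monom 1 k)) = sec_scale x (psec m (\<lambda>h. smult (c h) (monom 1 k)))" for k
    using psec_smult[of m x "\<lambda>h. smult (c h) (monom 1 k)"] by simp
  then show "c \<in> entry_functions m \<Longrightarrow> (\<lambda>h. x * c h) \<in> entry_functions m"
    by (auto simp: entry_functions_def polysec_def intro: sec.span_scale)
qed

lemma entry_functions_cong: "c \<in> entry_functions m \<Longrightarrow> (\<And>h. h \<in> SU2 \<Longrightarrow> c h = c' h) \<Longrightarrow> c' \<in> entry_functions m"
proof -
  assume c: "c \<in> entry_functions m" and e: "\<And>h. h \<in> SU2 \<Longrightarrow> c h = c' h"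
  have "psec m (\<lambda>h. smult (c' h) (monom 1 k)) = psec m (\<lambda>h. smult (c h) (monom 1 k))" for k
    by (rule psec_cong) (simp add: e)
  then show ?thesis using c by (simp add: entry_functions_def)
qed

text \<open>A polarised form in the two columns of \<open>h\<close> is a matrix coefficient of \<open>\<rho>(h)\<close>, and the determinant of the columns is one.\<close>

lemma gordan_entry_functions:
  "gordan n l \<Phi> \<Longrightarrow> (\<lambda>h. \<Phi> (h $ 1 $ 1) (h $ 2 $ 1) (h $ 1 $ 2) (h $ 2 $ 2)) \<in> entry_functions m"
proof (induction rule: gordan.induct)
  case (polar n l e)
  have e: "rho (int (n + l)) h (monom 1 n) = [:h $ 2 $ 1, h $ 1 $ 1:] ^ n * [:h $ 2 $ 2, h $ 1 $ 2:] ^ l" for h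
    unfolding rho_monom by (simp add: mult.commute)
  have "(monom 1 n :: complex poly) \<in> V (int (n + l))" by (rule V_monom) simp
  from psec_matrix_coefficient[OF this, of _ m e] show ?case
    unfolding e by (simp add: entry_functions_def)
next
  case (step n l \<Phi>)
  show ?case
  proof (rule entry_functions_cong[OF entry_functions_scale[OF step.IH, of "-1"]])
    fix h assume "h \<in> SU2"
    then have "h $ 1 $ 2 * h $ 2 $ 1 - h $ 1 $ 1 * h $ 2 $ 2 = - 1"
      using SU2_det by (metis minus_diff_eq)
    then show "- 1 * \<Phi> (h $ 1 $ 1) (h $ 2 $ 1) (h $ 1 $ 2) (h $ 2 $ 2) =
      (h $ 1 $ 2 * h $ 2 $ 1 - h $ 1 $ 1 * h $ 2 $ 2) * \<Phi> (h $ 1 $ 1) (h $ 2 $ 1) (h $ 1 $ 2) (h $ 2 $ 2)" by simp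
  qed
qed (simp_all add: entry_functions_add entry_functions_scale)

inductive_set entry_polys :: "(mat2 \<Rightarrow> complex) set" where
  mono: "(\<lambda>h. h $ 1 $ 1 ^ i * h $ 2 $ 1 ^ j * h $ 1 $ 2 ^ k * h $ 2 $ 2 ^ l) \<in> entry_polys"
| add: "c \<in> entry_polys \<Longrightarrow> c' \<in> entry_polys \<Longrightarrow> (\<lambda>h. c h + c' h) \<in> entry_polys"
| scale: "c \<in> entry_polys \<Longrightarrow> (\<lambda>h. x * c h) \<in> entry_polys"

lemma entry_polys_in_entry_functions: "c \<in> entry_polys \<Longrightarrow> c \<in> entry_functions m"
proof (induction rule: entry_polys.induct)
  case (mono i j k l)
  show ?case using gordan_entry_functions[OF gordan_bimono[of i "i + j" k "k + l"], of m] by (simp add: bimono_def)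
qed (simp_all add: entry_functions_add entry_functions_scale)

lemma entry_polys_mult: "c \<in> entry_polys \<Longrightarrow> c' \<in> entry_polys \<Longrightarrow> (\<lambda>h. c h * c' h) \<in> entry_polys"
proof (induction arbitrary: c' rule: entry_polys.induct)
  case (mono i j k l)
  from mono show ?case
  proof (induction rule: entry_polys.induct)
    case (mono i' j' k' l')
    have "(\<lambda>h. h $ 1 $ 1 ^ (i + i') * h $ 2 $ 1 ^ (j + j') * h $ 1 $ 2 ^ (k + k') * h $ 2 $ 2 ^ (l + l')) \<in> entry_polys"
      by (rule entry_polys.mono)
    then show ?case by (simp add: power_add mult_ac)
  next
    case (add c c')
    then show ?case using entry_polys.add by (fastforce simp: distrib_left)
  next
    case (scale c x)
    from entry_polys.scale[OF scale.IH, of x] show ?case by (simp add: mult_ac)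
  qed
next
  case (add c1 c2)
  then show ?case using entry_polys.add by (fastforce simp: distrib_right)
next
  case (scale c x)
  from entry_polys.scale[OF scale.IH[OF scale.prems], of x] show ?case by (simp add: mult_ac)
qed

section \<open>Coefficientwise derivatives of curves of polynomials\<close>

text \<open>Coefficientwise derivatives suffice, since the values of sections lie in a finite-dimensional space of polynomials.\<close>

definition pvd :: "(real \<Rightarrow> complex poly) \<Rightarrow> complex poly \<Rightarrow> bool" where
  "pvd P P' \<longleftrightarrow> (\<forall>k. ((\<lambda>t. coeff (P t) k) has_vector_derivative coeff P' k) (at 0))"

lemma pvd_const: "pvd (\<lambda>t. p) 0"
  by (simp add: pvd_def)

lemma pvd_add: "pvd P P' \<Longrightarrow> pvd Q Q' \<Longrightarrow> pvd (\<lambda>t. P t + Q t) (P' + Q')"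
  by (auto simp: pvd_def intro!: has_vector_derivative_add)

lemma pvd_mult: "pvd P P' \<Longrightarrow> pvd Q Q' \<Longrightarrow> pvd (\<lambda>t. P t * Q t) (P 0 * Q' + P' * Q 0)"
  unfolding pvd_def coeff_mult coeff_add
  by (auto simp: sum.distrib[symmetric] intro!: has_vector_derivative_sum has_vector_derivative_mult)

lemma pvd_power: "pvd P P' \<Longrightarrow> pvd (\<lambda>t. P t ^ n) (smult (of_nat n) (P 0 ^ (n - 1) * P'))"
proof (induction n)
  case 0
  then show ?case by (simp add: pvd_def)
next
  case (Suc n)
  have "P 0 * smult (of_nat n) (P 0 ^ (n - 1) * P') + P' * P 0 ^ n = smult (of_nat (Suc n)) (P 0 ^ (Suc n - 1) * P')"
    by (rule poly_eqI2, cases n) (simp_all add: algebra_simps)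
  then show ?case using pvd_mult[OF Suc.prems Suc.IH[OF Suc.prems]] by simp
qed

lemma pvd_linear_form:
  "(a has_vector_derivative a') (at 0) \<Longrightarrow> (b has_vector_derivative b') (at 0) \<Longrightarrow> pvd (\<lambda>t. [:b t, a t:]) [:b', a':]"
  by (auto simp: pvd_def coeff_pCons split: nat.split)

lemma pvd_plin:
  assumes "pvd P P'" "plin L" and V: "\<And>t. P t \<in> V (int n)" "P' \<in> V (int n)"
  shows "pvd (\<lambda>t. L (P t)) (L P')"
  unfolding pvd_def
proof
  fix k
  have "((\<lambda>t. \<Sum>j\<le>n. coeff (P t) j * coeff (L (monom 1 j)) k) has_vector_derivative
      (\<Sum>j\<le>n. coeff P' j * coeff (L (monom 1 j)) k)) (at 0)"
    using assms(1) unfolding pvd_def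
    by (intro has_vector_derivative_sum has_vector_derivative_mult_left) auto
  then show "((\<lambda>t. coeff (L (P t)) k) has_vector_derivative coeff (L P') k) (at 0)"
    by (simp only: plin_expand[OF assms(2) V(1)] plin_expand[OF assms(2) V(2)] coeff_sum coeff_smult)
qed

lemma pvd_unique: "pvd P P' \<Longrightarrow> pvd P P'' \<Longrightarrow> P' = P''"
  by (rule poly_eqI) (auto simp: pvd_def intro: vector_derivative_unique_at)

lemma affine_vector_derivative:
  "((\<lambda>t. c + complex_of_real t * d) has_vector_derivative d) (at 0)"
proof -
  have "((\<lambda>t. c + t *\<^sub>R d) has_vector_derivative d) (at 0)"
    by (auto intro!: derivative_eq_intros)
  then show ?thesis by (simp add: scaleR_conv_of_real)
qed

section \<open>Derivatives of transvectants\<close>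

text \<open>The derivative of \<open>transvectant_pw\<close> in the direction \<open>(w1, w2)\<close> of the parameters \<open>(u, v)\<close>.\<close>

lemma transvectant_derivative:
  fixes u v u' v' w1 w2 :: complex
  defines "\<delta> \<equiv> u * v' - u' * v"
  shows "smult (of_nat (A + r)) (transvectant A B r (pw 1 w1 w2 * pw (A + r - 1) u v) (pw (B + r) u' v')) =
     smult (of_nat r * \<delta> ^ (r - 1) * (w1 * v' - u' * w2)) ([:v, u:] ^ A * [:v', u':] ^ B)
     + smult (of_nat A * \<delta> ^ r) ([:w2, w1:] * [:v, u:] ^ (A - 1) * [:v', u':] ^ B)" (is "?l = ?r")
proof (rule pvd_unique)
  let ?a = "A + r"
  let ?u = "\<lambda>t. u + complex_of_real t * w1" and ?v = "\<lambda>t. v + complex_of_real t * w2"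
  let ?Y = "\<lambda>t. [:?v t, ?u t:]"
  have Y: "pvd ?Y [:w2, w1:]"
    by (intro pvd_linear_form affine_vector_derivative)
  have "pvd (\<lambda>t. pw ?a (?u t) (?v t)) (smult (of_nat ?a) ([:v, u:] ^ (?a - 1) * [:w2, w1:]))"
    using pvd_power[OF Y, of ?a] by (simp add: pw_def)
  moreover have "smult (of_nat ?a) ([:v, u:] ^ (?a - 1) * [:w2, w1:]) \<in> V (int ?a)"
  proof (cases "?a")
    case (Suc n)
    have "[:v, u:] ^ n * [:w2, w1:] ^ 1 \<in> V (int n + int 1)" by (rule V_mult[OF linear_form_power_V linear_form_power_V])
    then show ?thesis by (simp add: Suc V_smult add.commute del: mult_pCons_right)
  qed simp
  ultimately have "pvd (\<lambda>t. transvectant A B r (pw ?a (?u t) (?v t)) (pw (B + r) u' v'))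
     (transvectant A B r (smult (of_nat ?a) ([:v, u:] ^ (?a - 1) * [:w2, w1:])) (pw (B + r) u' v'))"
    by (intro pvd_plin[OF _ plin_transvectant_left pw_in_V]) auto
  then show "pvd (\<lambda>t. transvectant A B r (pw ?a (?u t) (?v t)) (pw (B + r) u' v')) ?l"
    by (simp add: transvectant_smult_left pw_def mult.commute del: mult_pCons_right mult_pCons_left)
  let ?d = "\<lambda>t. [:?u t * v' - u' * ?v t:]"
  have "((\<lambda>t. ?u t * v' - u' * ?v t) has_vector_derivative (w1 * v' - u' * w2)) (at 0)"
    by (intro has_vector_derivative_diff has_vector_derivative_mult_left has_vector_derivative_mult_right affine_vector_derivative)
  then have d: "pvd ?d [:w1 * v' - u' * w2:]"
    by (auto simp: pvd_def coeff_pCons split: nat.split)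
  have "pvd (\<lambda>t. ?d t ^ r * (?Y t ^ A * [:v', u':] ^ B))
    (?d 0 ^ r * (?Y 0 ^ A * 0 + smult (of_nat A) (?Y 0 ^ (A - 1) * [:w2, w1:]) * [:v', u':] ^ B)
     + smult (of_nat r) (?d 0 ^ (r - 1) * [:w1 * v' - u' * w2:]) * (?Y 0 ^ A * [:v', u':] ^ B))"
    by (intro pvd_mult pvd_power pvd_const d Y)
  also have "(\<lambda>t. ?d t ^ r * (?Y t ^ A * [:v', u':] ^ B)) =
     (\<lambda>t. transvectant A B r (pw ?a (?u t) (?v t)) (pw (B + r) u' v'))"
    by (simp add: transvectant_pw poly_const_pow fun_eq_iff)
  also have "?d 0 ^ r * (?Y 0 ^ A * 0 + smult (of_nat A) (?Y 0 ^ (A - 1) * [:w2, w1:]) * [:v', u':] ^ B)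
     + smult (of_nat r) (?d 0 ^ (r - 1) * [:w1 * v' - u' * w2:]) * (?Y 0 ^ A * [:v', u':] ^ B) = ?r"
    by (rule poly_eqI2) (simp add: \<delta>_def algebra_simps)
  finally show "pvd (\<lambda>t. transvectant A B r (pw ?a (?u t) (?v t)) (pw (B + r) u' v')) ?r" .
qed

lemma transvectant_rho_zero:
  fixes X :: "real ^ 3" and u v u' v' :: complex
  defines "\<delta> \<equiv> u * v' - u' * v"
  defines "w1 \<equiv> su2_of X $ 1 $ 1 * u + su2_of X $ 1 $ 2 * v" and "w2 \<equiv> su2_of X $ 2 $ 1 * u + su2_of X $ 2 $ 2 * v"
  shows "transvectant A B r (rho_zero (int (A + r)) X (pw (A + r) u v)) (pw (B + r) u' v') =
     smult (of_nat r * \<delta> ^ (r - 1) * (w1 * v' - u' * w2)) ([:v, u:] ^ A * [:v', u':] ^ B)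
     + smult (of_nat A * \<delta> ^ r) ([:w2, w1:] * [:v, u:] ^ (A - 1) * [:v', u':] ^ B)"
  unfolding rho_zero_pw transvectant_smult_left w1_def[symmetric] w2_def[symmetric] \<delta>_def
  by (rule transvectant_derivative)

text \<open>Evaluation at generic points, where logarithmic derivatives of products of linear forms make sense.\<close>

lemma poly_eqI_generic:
  assumes "q \<noteq> 0" "\<And>z. poly q z \<noteq> 0 \<Longrightarrow> poly p z = poly p' (z :: complex)"
  shows "p = p'"
proof -
  have "poly (q * (p - p')) z = poly 0 z" for z using assms(2)[of z] by (cases "poly q z = 0") auto
  then have "q * (p - p') = 0" by (rule poly_eqI2)
  then show ?thesis using assms(1) by simp
qed

context
  fixes u v u' v' :: complex
begin

lemma poly_pderiv_two_powers:
  assumes "u * z + v \<noteq> 0" "u' * z + v' \<noteq> 0"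
  shows "poly (pderiv ([:v, u:] ^ a * [:v', u':] ^ b)) z =
     (u * z + v) ^ a * (u' * z + v') ^ b * (of_nat a * u / (u * z + v) + of_nat b * u' / (u' * z + v'))"
proof -
  have n: "of_nat n * x ^ (n - 1) = of_nat n * x ^ n / x" if "x \<noteq> 0" for x :: complex and n
    using that by (cases n) auto
  have "poly (pderiv ([:v, u:] ^ a * [:v', u':] ^ b)) z =
     (u * z + v) ^ a * (of_nat b * (u' * z + v') ^ (b - 1)) * u' + (of_nat a * (u * z + v) ^ (a - 1)) * u * (u' * z + v') ^ b"
    by (simp add: pderiv_mult pderiv_power pderiv_pCons mult_ac add_ac)
  then show ?thesis unfolding n[OF assms(1)] n[OF assms(2)] by (simp add: algebra_simps)
qed

lemma poly_pderiv2_two_powers: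
  assumes Y: "u * z + v \<noteq> 0" "u' * z + v' \<noteq> 0"
  shows "poly (pderiv (pderiv ([:v, u:] ^ a * [:v', u':] ^ b))) z =
     (u * z + v) ^ a * (u' * z + v') ^ b * (of_nat a * (of_nat a - 1) * u\<^sup>2 / (u * z + v)\<^sup>2
       + 2 * of_nat a * of_nat b * u * u' / ((u * z + v) * (u' * z + v'))
       + of_nat b * (of_nat b - 1) * u'\<^sup>2 / (u' * z + v')\<^sup>2)"
proof -
  have d: "pderiv ([:v, u:] ^ a * [:v', u':] ^ b) = smult (of_nat a * u) ([:v, u:] ^ (a - 1) * [:v', u':] ^ b)
     + smult (of_nat b * u') ([:v, u:] ^ a * [:v', u':] ^ (b - 1))"
    by (rule poly_eqI2) (simp add: pderiv_mult pderiv_power pderiv_pCons algebra_simps)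
  have "poly (pderiv (pderiv ([:v, u:] ^ a * [:v', u':] ^ b))) z =
     of_nat a * u * ((u * z + v) ^ (a - 1) * (u' * z + v') ^ b * (of_nat (a - 1) * u / (u * z + v) + of_nat b * u' / (u' * z + v')))
     + of_nat b * u' * ((u * z + v) ^ a * (u' * z + v') ^ (b - 1) * (of_nat a * u / (u * z + v) + of_nat (b - 1) * u' / (u' * z + v')))"
    unfolding d by (simp only: pderiv_add pderiv_smult poly_add poly_smult poly_pderiv_two_powers[OF Y])
  also have "\<dots> = (u * z + v) ^ a * (u' * z + v') ^ b * (of_nat a * (of_nat a - 1) * u\<^sup>2 / (u * z + v)\<^sup>2
       + 2 * of_nat a * of_nat b * u * u' / ((u * z + v) * (u' * z + v'))
       + of_nat b * (of_nat b - 1) * u'\<^sup>2 / (u' * z + v')\<^sup>2)"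
    using Y by (cases a; cases b) (simp_all add: divide_simps power2_eq_square, simp_all add: algebra_simps)
  finally show ?thesis .
qed

end

text \<open>The two components of \<open>\<sigma>\<^sub>i (u, v)\<close>.\<close>

definition sig1 :: "3 \<Rightarrow> complex \<Rightarrow> complex \<Rightarrow> complex" where
  "sig1 i u v = su2_of (axis i 1) $ 1 $ 1 * u + su2_of (axis i 1) $ 1 $ 2 * v"

definition sig2 :: "3 \<Rightarrow> complex \<Rightarrow> complex \<Rightarrow> complex" where
  "sig2 i u v = su2_of (axis i 1) $ 2 $ 1 * u + su2_of (axis i 1) $ 2 $ 2 * v"

lemma sig_simps:
  "sig1 1 u v = \<i> * u" "sig1 2 u v = v" "sig1 3 u v = \<i> * v"
  "sig2 1 u v = - \<i> * v" "sig2 2 u v = - u" "sig2 3 u v = \<i> * u"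
  by (simp_all add: sig1_def sig2_def axis3_nth Complex_units)

lemma poly_rho_zero_axis:
  "poly (rho_zero m (axis 1 1) f) z = \<i> * (2 * z * poly (pderiv f) z - of_int m * poly f z)"
  "poly (rho_zero m (axis 2 1) f) z = of_int m * z * poly f z - (1 + z\<^sup>2) * poly (pderiv f) z"
  "poly (rho_zero m (axis 3 1) f) z = \<i> * (of_int m * z * poly f z + (1 - z\<^sup>2) * poly (pderiv f) z)"
  unfolding rho_zero_eq by (simp_all add: axis3_nth Complex_units algebra_simps power2_eq_square)

lemma poly_rho_minus_axis:
  "poly (rho_minus m (axis 1 1) f) z = 2 * \<i> * ((of_int m - 1) * poly (pderiv f) z - z * poly (pderiv (pderiv f)) z)"
  "poly (rho_minus m (axis 2 1) f) z = of_int m * (of_int m - 1) * poly f z - 2 * (of_int m - 1) * z * poly (pderiv f) z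
     + (1 + z\<^sup>2) * poly (pderiv (pderiv f)) z"
  "poly (rho_minus m (axis 3 1) f) z = \<i> * (of_int m * (of_int m - 1) * poly f z - 2 * (of_int m - 1) * z * poly (pderiv f) z
     + (z\<^sup>2 - 1) * poly (pderiv (pderiv f)) z)"
  unfolding rho_minus_eq by (simp_all add: axis3_nth Complex_units algebra_simps power2_eq_square)

lemma poly_rho_plus_axis:
  "poly (rho_plus m (axis 1 1) f) z = 2 * \<i> * z * poly f z"
  "poly (rho_plus m (axis 2 1) f) z = - (1 + z\<^sup>2) * poly f z"
  "poly (rho_plus m (axis 3 1) f) z = \<i> * (1 - z\<^sup>2) * poly f z"
  unfolding rho_plus_eq quad_def by (simp_all add: axis3_nth Complex_units algebra_simps power2_eq_square)

lemma linear_times_derivatives: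
  fixes a b z :: complex
  shows "poly (pderiv ([:a, b:] * q)) z = b * poly q z + (a + b * z) * poly (pderiv q) z"
  "poly (pderiv (pderiv ([:a, b:] * q))) z = 2 * b * poly (pderiv q) z + (a + b * z) * poly (pderiv (pderiv q)) z"
proof -
  have 1: "pderiv ([:a, b:] * q) = smult b q + [:a, b:] * pderiv q" for q
    by (rule poly_eqI2) (simp add: pderiv_mult pderiv_pCons algebra_simps del: mult_pCons_left mult_pCons_right)
  have 2: "pderiv (pderiv ([:a, b:] * q)) = smult (2 * b) (pderiv q) + [:a, b:] * pderiv (pderiv q)"
    unfolding 1 pderiv_add pderiv_smult by (rule poly_eqI2) (simp add: algebra_simps)
  show "poly (pderiv ([:a, b:] * q)) z = b * poly q z + (a + b * z) * poly (pderiv q) z"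
    unfolding 1 by (simp add: algebra_simps)
  show "poly (pderiv (pderiv ([:a, b:] * q))) z = 2 * b * poly (pderiv q) z + (a + b * z) * poly (pderiv (pderiv q)) z"
    unfolding 2 by (simp add: algebra_simps)
qed

context
  fixes u v u' v' :: complex and A B :: nat
  assumes nz: "[:v, u:] * [:v', u':] \<noteq> 0"
begin

lemma clifford_sum_zero1:
  "(\<Sum>i\<in>UNIV. rho_zero (int (A + B)) (axis i 1) (smult (sig1 i u v * v' - u' * sig2 i u v) ([:v, u:] ^ A * [:v', u':] ^ B)))
     = smult ((of_nat B - of_nat A) * (u * v' - u' * v)) ([:v, u:] ^ A * [:v', u':] ^ B)"
proof (rule poly_eqI_generic[OF nz])
  fix z assume "poly ([:v, u:] * [:v', u':]) z \<noteq> 0"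
  then have "poly [:v, u:] z \<noteq> 0" "poly [:v', u':] z \<noteq> 0" unfolding poly_mult mult_eq_0_iff by blast+
  then have Y: "u * z + v \<noteq> 0" "u' * z + v' \<noteq> 0" by (simp_all add: algebra_simps)
  define Y Z where YZ: "Y = u * z + v" "Z = u' * z + v'"
  have v: "v = Y - u * z" "v' = Z - u' * z" by (simp_all add: YZ)
  define F where "F = Y ^ A * Z ^ B"
  have e: "poly ([:v, u:] ^ A * [:v', u':] ^ B) z = F" by (simp add: F_def YZ algebra_simps)
  note d = poly_pderiv_two_powers[OF Y, of A B, folded YZ, folded F_def]
  show "poly (\<Sum>i\<in>UNIV. rho_zero (int (A + B)) (axis i 1) (smult (sig1 i u v * v' - u' * sig2 i u v) ([:v, u:] ^ A * [:v', u':] ^ B))) z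
     = poly (smult ((of_nat B - of_nat A) * (u * v' - u' * v)) ([:v, u:] ^ A * [:v', u':] ^ B)) z"
    unfolding sum_3 poly_add poly_rho_zero_axis pderiv_smult poly_smult sig_simps d e
    using Y unfolding YZ[symmetric] v by (simp add: field_simps power2_eq_square)
qed

lemma clifford_sum_zero2:
  "(\<Sum>i\<in>UNIV. rho_zero (int (Suc A + B)) (axis i 1) ([:sig2 i u v, sig1 i u v:] * ([:v, u:] ^ A * [:v', u':] ^ B)))
     = smult (- (of_nat (Suc A + B) + 2)) ([:v, u:] ^ Suc A * [:v', u':] ^ B)"
proof (rule poly_eqI_generic[OF nz])
  fix z assume "poly ([:v, u:] * [:v', u':]) z \<noteq> 0"
  then have "poly [:v, u:] z \<noteq> 0" "poly [:v', u':] z \<noteq> 0" unfolding poly_mult mult_eq_0_iff by blast+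
  then have Y: "u * z + v \<noteq> 0" "u' * z + v' \<noteq> 0" by (simp_all add: algebra_simps)
  define Y Z where YZ: "Y = u * z + v" "Z = u' * z + v'"
  have v: "v = Y - u * z" "v' = Z - u' * z" by (simp_all add: YZ)
  define F where "F = Y ^ A * Z ^ B"
  have e: "poly ([:v, u:] ^ A * [:v', u':] ^ B) z = F" "poly ([:v, u:] ^ Suc A * [:v', u':] ^ B) z = Y * F"
    by (simp_all add: F_def YZ algebra_simps)
  note d = poly_pderiv_two_powers[OF Y, of A B, folded YZ, folded F_def]
  show "poly (\<Sum>i\<in>UNIV. rho_zero (int (Suc A + B)) (axis i 1) ([:sig2 i u v, sig1 i u v:] * ([:v, u:] ^ A * [:v', u':] ^ B))) z
     = poly (smult (- (of_nat (Suc A + B) + 2)) ([:v, u:] ^ Suc A * [:v', u':] ^ B)) z"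
    unfolding sum_3 poly_add poly_rho_zero_axis linear_times_derivatives poly_mult[of "[:_, _:]"] poly_smult sig_simps d e
    using Y unfolding YZ[symmetric] v by (simp add: field_simps power2_eq_square)
qed

lemma clifford_sum_minus1:
  "(\<Sum>i\<in>UNIV. rho_minus (int (A + B)) (axis i 1) (smult (sig1 i u v * v' - u' * sig2 i u v) ([:v, u:] ^ A * [:v', u':] ^ B)))
     = smult (- 2 * of_nat A * of_nat B * (u * v' - u' * v)\<^sup>2) ([:v, u:] ^ (A - 1) * [:v', u':] ^ (B - 1))"
proof (rule poly_eqI_generic[OF nz])
  fix z assume "poly ([:v, u:] * [:v', u':]) z \<noteq> 0"
  then have "poly [:v, u:] z \<noteq> 0" "poly [:v', u':] z \<noteq> 0" unfolding poly_mult mult_eq_0_iff by blast+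
  then have Y: "u * z + v \<noteq> 0" "u' * z + v' \<noteq> 0" by (simp_all add: algebra_simps)
  define Y Z where YZ: "Y = u * z + v" "Z = u' * z + v'"
  have v: "v = Y - u * z" "v' = Z - u' * z" by (simp_all add: YZ)
  define F where "F = Y ^ A * Z ^ B"
  have e: "poly ([:v, u:] ^ A * [:v', u':] ^ B) z = F" by (simp add: F_def YZ algebra_simps)
  have n: "of_nat n * x ^ (n - 1) = of_nat n * x ^ n / x" if "x \<noteq> 0" for x :: complex and n
    using that by (cases n) auto
  have "poly (smult (- 2 * of_nat A * of_nat B * (u * v' - u' * v)\<^sup>2) ([:v, u:] ^ (A - 1) * [:v', u':] ^ (B - 1))) z
    = - 2 * (u * v' - u' * v)\<^sup>2 * (of_nat A * Y ^ (A - 1)) * (of_nat B * Z ^ (B - 1))"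
    by (simp add: YZ algebra_simps)
  also have "\<dots> = - 2 * (u * v' - u' * v)\<^sup>2 * of_nat A * of_nat B * F / (Y * Z)"
    unfolding n[OF Y(1), folded YZ] n[OF Y(2), folded YZ] F_def by simp
  finally have R: "poly (smult (- 2 * of_nat A * of_nat B * (u * v' - u' * v)\<^sup>2) ([:v, u:] ^ (A - 1) * [:v', u':] ^ (B - 1))) z
    = - 2 * (u * v' - u' * v)\<^sup>2 * of_nat A * of_nat B * F / (Y * Z)" .
  note d = poly_pderiv_two_powers[OF Y, of A B, folded YZ, folded F_def] poly_pderiv2_two_powers[OF Y, of A B, folded YZ, folded F_def]
  show "poly (\<Sum>i\<in>UNIV. rho_minus (int (A + B)) (axis i 1) (smult (sig1 i u v * v' - u' * sig2 i u v) ([:v, u:] ^ A * [:v', u':] ^ B))) z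
     = poly (smult (- 2 * of_nat A * of_nat B * (u * v' - u' * v)\<^sup>2) ([:v, u:] ^ (A - 1) * [:v', u':] ^ (B - 1))) z"
    unfolding R unfolding sum_3 poly_add poly_rho_minus_axis pderiv_smult poly_smult sig_simps d e
    using Y unfolding YZ[symmetric] v by (simp add: divide_simps power2_eq_square) (simp add: algebra_simps)?
qed

lemma clifford_sum_minus2:
  "(\<Sum>i\<in>UNIV. rho_minus (int (Suc A + B)) (axis i 1) ([:sig2 i u v, sig1 i u v:] * ([:v, u:] ^ A * [:v', u':] ^ B)))
     = smult (- 2 * of_nat B * (of_nat (Suc A + B) + 1) * (u * v' - u' * v)) ([:v, u:] ^ A * [:v', u':] ^ (B - 1))"
proof (rule poly_eqI_generic[OF nz])
  fix z assume "poly ([:v, u:] * [:v', u':]) z \<noteq> 0"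
  then have "poly [:v, u:] z \<noteq> 0" "poly [:v', u':] z \<noteq> 0" unfolding poly_mult mult_eq_0_iff by blast+
  then have Y: "u * z + v \<noteq> 0" "u' * z + v' \<noteq> 0" by (simp_all add: algebra_simps)
  define Y Z where YZ: "Y = u * z + v" "Z = u' * z + v'"
  have v: "v = Y - u * z" "v' = Z - u' * z" by (simp_all add: YZ)
  define F where "F = Y ^ A * Z ^ B"
  have e: "poly ([:v, u:] ^ A * [:v', u':] ^ B) z = F" by (simp add: F_def YZ algebra_simps)
  have n: "of_nat n * x ^ (n - 1) = of_nat n * x ^ n / x" if "x \<noteq> 0" for x :: complex and n
    using that by (cases n) auto
  have "poly (smult (- 2 * of_nat B * (of_nat (Suc A + B) + 1) * (u * v' - u' * v)) ([:v, u:] ^ A * [:v', u':] ^ (B - 1))) z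
    = - 2 * (of_nat (Suc A + B) + 1) * (u * v' - u' * v) * Y ^ A * (of_nat B * Z ^ (B - 1))"
    by (simp add: YZ algebra_simps)
  also have "\<dots> = - 2 * (of_nat (Suc A + B) + 1) * (u * v' - u' * v) * of_nat B * F / Z"
    unfolding n[OF Y(2), folded YZ] F_def by simp
  finally have R: "poly (smult (- 2 * of_nat B * (of_nat (Suc A + B) + 1) * (u * v' - u' * v)) ([:v, u:] ^ A * [:v', u':] ^ (B - 1))) z
    = - 2 * (of_nat (Suc A + B) + 1) * (u * v' - u' * v) * of_nat B * F / Z" .
  note d = poly_pderiv_two_powers[OF Y, of A B, folded YZ, folded F_def] poly_pderiv2_two_powers[OF Y, of A B, folded YZ, folded F_def]
  show "poly (\<Sum>i\<in>UNIV. rho_minus (int (Suc A + B)) (axis i 1) ([:sig2 i u v, sig1 i u v:] * ([:v, u:] ^ A * [:v', u':] ^ B))) z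
     = poly (smult (- 2 * of_nat B * (of_nat (Suc A + B) + 1) * (u * v' - u' * v)) ([:v, u:] ^ A * [:v', u':] ^ (B - 1))) z"
    unfolding R unfolding sum_3 poly_add poly_rho_minus_axis linear_times_derivatives poly_mult[of "[:_, _:]"] sig_simps d e
    using Y unfolding YZ[symmetric] v by (simp add: divide_simps power2_eq_square) (simp add: algebra_simps)?
qed

end

lemma clifford_sum_plus1:
  fixes u v u' v' :: complex
  shows "(\<Sum>i\<in>UNIV. rho_plus m (axis i 1) (smult (sig1 i u v * v' - u' * sig2 i u v) ([:v, u:] ^ A * [:v', u':] ^ B)))
     = smult (- 2) ([:v, u:] ^ Suc A * [:v', u':] ^ Suc B)"
  by (rule poly_eqI2, unfold sum_3 poly_add poly_rho_plus_axis sig_simps) (simp add: algebra_simps power2_eq_square)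

lemma clifford_sum_plus2:
  fixes u v u' v' :: complex
  shows "(\<Sum>i\<in>UNIV. rho_plus m (axis i 1) ([:sig2 i u v, sig1 i u v:] * ([:v, u:] ^ A * [:v', u':] ^ B))) = 0"
  by (rule poly_eqI2, unfold sum_3 poly_add poly_rho_plus_axis sig_simps) (simp add: algebra_simps power2_eq_square)

text \<open>
  By the product rule, \<open>\<rho>\<^sup>0(e\<^sub>i)\<close> differentiates either the determinant or the linear form \<open>u z + v\<close>. Summation over \<open>i\<close>
  leaves the two kinds of sums that are evaluated above.
\<close>

lemma clifford_transvectant_pw:
  fixes u v u' v' :: complex
  assumes R: "\<And>i. plin (R i)"
  defines "\<delta> \<equiv> u * v' - u' * v"
  shows "(\<Sum>i\<in>UNIV. R i (transvectant A B r (rho_zero (int (A + r)) (axis i 1) (pw (A + r) u v)) (pw (B + r) u' v'))) =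
     smult (of_nat r * \<delta> ^ (r - 1)) (\<Sum>i\<in>UNIV. R i (smult (sig1 i u v * v' - u' * sig2 i u v) ([:v, u:] ^ A * [:v', u':] ^ B)))
     + smult (of_nat A * \<delta> ^ r) (\<Sum>i\<in>UNIV. R i ([:sig2 i u v, sig1 i u v:] * ([:v, u:] ^ (A - 1) * [:v', u':] ^ B)))"
  unfolding transvectant_rho_zero sig1_def[symmetric] sig2_def[symmetric] \<delta>_def[symmetric]
    plin_add[OF R] sum.distrib smult_sum_right
  by (simp only: plin_smult[OF R] smult_smult mult.assoc)

lemma nonzero_form: "[:1, s:] * [:1, t:] \<noteq> (0 :: complex poly)"
  by simp

lemma plin_clifford_transvectant:
  assumes "\<And>i. plin (R i)"
  shows "plin (\<lambda>f. \<Sum>i\<in>UNIV. R i (transvectant A B r (rho_zero n (axis i 1) f) g))"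
    "plin (\<lambda>g. \<Sum>i\<in>UNIV. R i (transvectant A B r (rho_zero n (axis i 1) f) g))"
  using assms
  by (auto intro!: plin_sum_maps plin_compose[OF assms] plin_compose[OF plin_transvectant_left plin_rho_zero] plin_transvectant_right)

lemma power_pred_mult: "of_nat r * \<delta> ^ (r - 1) * \<delta> = of_nat r * (\<delta> :: complex) ^ r"
  by (cases r) auto

lemma zero_transvectant:
  assumes f: "f \<in> V (int (A + r))" and g: "g \<in> V (int (B + r))"
  shows "(\<Sum>i\<in>UNIV. rho_zero (int (A + B)) (axis i 1) (transvectant A B r (rho_zero (int (A + r)) (axis i 1) f) g)) =
     smult (of_nat r * of_nat B - of_nat A * (of_nat A + of_nat B + of_nat r + 2)) (transvectant A B r f g)"
proof (rule plin2_eq_on_pw[OF plin_clifford_transvectant(1) plin_clifford_transvectant(2) _ _ _ f g, OF plin_rho_zero plin_rho_zero])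
  fix t s :: complex
  let ?d = "t - s" and ?T = "[:1, t:] ^ A * [:1, s:] ^ B"
  have 2: "smult (of_nat A * ?d ^ r) (\<Sum>i\<in>UNIV. rho_zero (int (A + B)) (axis i 1) ([:sig2 i t 1, sig1 i t 1:] * ([:1, t:] ^ (A - 1) * [:1, s:] ^ B)))
     = smult (- of_nat A * ?d ^ r * (of_nat A + of_nat B + 2)) ?T"
  proof (cases A)
    case (Suc A')
    show ?thesis
      unfolding Suc diff_Suc_1 clifford_sum_zero2[OF nonzero_form] smult_smult
      by (rule arg_cong2[where f = smult]) (simp_all add: algebra_simps)
  qed simp
  have "(\<Sum>i\<in>UNIV. rho_zero (int (A + B)) (axis i 1) (transvectant A B r (rho_zero (int (A + r)) (axis i 1) (pw (A + r) t 1)) (pw (B + r) s 1)))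
     = smult (of_nat r * ?d ^ (r - 1)) (smult ((of_nat B - of_nat A) * ?d) ?T) + smult (- of_nat A * ?d ^ r * (of_nat A + of_nat B + 2)) ?T"
    unfolding clifford_transvectant_pw[OF plin_rho_zero] mult_1_right 2 clifford_sum_zero1[OF nonzero_form, unfolded mult_1_right] ..
  also have "\<dots> = smult ((of_nat r * ?d ^ (r - 1) * ?d) * (of_nat B - of_nat A) - of_nat A * ?d ^ r * (of_nat A + of_nat B + 2)) ?T"
    by (simp add: smult_diff_left smult_add_left[symmetric] mult_ac)
  also have "\<dots> = smult (of_nat r * of_nat B - of_nat A * (of_nat A + of_nat B + of_nat r + 2)) (smult (?d ^ r) ?T)"
    unfolding power_pred_mult smult_smult by (rule arg_cong2[where f = smult]) (auto simp: algebra_simps)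
  finally show "(\<Sum>i\<in>UNIV. rho_zero (int (A + B)) (axis i 1) (transvectant A B r (rho_zero (int (A + r)) (axis i 1) (pw (A + r) t 1)) (pw (B + r) s 1)))
     = smult (of_nat r * of_nat B - of_nat A * (of_nat A + of_nat B + of_nat r + 2)) (transvectant A B r (pw (A + r) t 1) (pw (B + r) s 1))"
    by (simp add: transvectant_pw)
qed (intro plin_smult_map plin_transvectant_left plin_transvectant_right)+

lemma plus_transvectant_Suc:
  assumes f: "f \<in> V (int (A + Suc r))" and g: "g \<in> V (int (B + Suc r))"
  shows "(\<Sum>i\<in>UNIV. rho_plus m (axis i 1) (transvectant A B (Suc r) (rho_zero (int (A + Suc r)) (axis i 1) f) g)) =
     smult (- 2 * of_nat (Suc r)) (transvectant (Suc A) (Suc B) r f g)"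
proof (rule plin2_eq_on_pw[OF plin_clifford_transvectant(1) plin_clifford_transvectant(2) _ _ _ f g, OF plin_rho_plus plin_rho_plus])
  fix t s :: complex
  have e: "Suc A + r = A + Suc r" "Suc B + r = B + Suc r" by simp_all
  show "(\<Sum>i\<in>UNIV. rho_plus m (axis i 1) (transvectant A B (Suc r) (rho_zero (int (A + Suc r)) (axis i 1) (pw (A + Suc r) t 1)) (pw (B + Suc r) s 1)))
     = smult (- 2 * of_nat (Suc r)) (transvectant (Suc A) (Suc B) r (pw (A + Suc r) t 1) (pw (B + Suc r) s 1))"
    unfolding clifford_transvectant_pw[OF plin_rho_plus] clifford_sum_plus1 clifford_sum_plus2
      transvectant_pw[of "Suc A" "Suc B" r, unfolded e]
    by (simp add: mult_ac del: power_Suc of_nat_Suc mult_pCons_left mult_pCons_right)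
qed (intro plin_smult_map plin_transvectant_left plin_transvectant_right)+

lemma plus_transvectant_0:
  assumes f: "f \<in> V (int (A + 0))" and g: "g \<in> V (int (B + 0))"
  shows "(\<Sum>i\<in>UNIV. rho_plus m (axis i 1) (transvectant A B 0 (rho_zero (int (A + 0)) (axis i 1) f) g)) = 0"
  by (rule plin2_eq_on_pw[OF plin_clifford_transvectant(1) plin_clifford_transvectant(2) plin_zero_map plin_zero_map _ f g, OF plin_rho_plus plin_rho_plus])
    (simp only: clifford_transvectant_pw[OF plin_rho_plus] clifford_sum_plus2, simp)

lemma minus_transvectant:
  assumes f: "f \<in> V (int (Suc A + r))" and g: "g \<in> V (int (Suc B + r))"
  shows "(\<Sum>i\<in>UNIV. rho_minus (int (Suc A + Suc B)) (axis i 1) (transvectant (Suc A) (Suc B) r (rho_zero (int (Suc A + r)) (axis i 1) f) g)) =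
     smult (- 2 * of_nat (Suc A) * of_nat (Suc B) * of_nat (A + B + r + 3)) (transvectant A B (Suc r) f g)"
proof (rule plin2_eq_on_pw[OF plin_clifford_transvectant(1) plin_clifford_transvectant(2) _ _ _ f g, OF plin_rho_minus plin_rho_minus])
  fix t s :: complex
  let ?d = "t - s" and ?T = "[:1, t:] ^ A * [:1, s:] ^ B"
  have e: "A + Suc r = Suc A + r" "B + Suc r = Suc B + r" by simp_all
  have 1: "(\<Sum>i\<in>UNIV. rho_minus (int (Suc A + Suc B)) (axis i 1) (smult (sig1 i t 1 - s * sig2 i t 1) ([:1, t:] ^ Suc A * [:1, s:] ^ Suc B)))
     = smult (- 2 * of_nat (Suc A) * of_nat (Suc B) * ?d\<^sup>2) ?T"
    using clifford_sum_minus1[OF nonzero_form, of "Suc A" "Suc B" t s] by (simp only: mult_1_right diff_Suc_1)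
  have 2: "(\<Sum>i\<in>UNIV. rho_minus (int (Suc A + Suc B)) (axis i 1) ([:sig2 i t 1, sig1 i t 1:] * ([:1, t:] ^ A * [:1, s:] ^ Suc B)))
     = smult (- 2 * of_nat (Suc B) * (of_nat (Suc A + Suc B) + 1) * ?d) ?T"
    using clifford_sum_minus2[OF nonzero_form, of A "Suc B" t s] by (simp only: mult_1_right diff_Suc_1)
  have "(\<Sum>i\<in>UNIV. rho_minus (int (Suc A + Suc B)) (axis i 1) (transvectant (Suc A) (Suc B) r (rho_zero (int (Suc A + r)) (axis i 1) (pw (Suc A + r) t 1)) (pw (Suc B + r) s 1)))
     = smult (of_nat r * ?d ^ (r - 1)) (smult (- 2 * of_nat (Suc A) * of_nat (Suc B) * ?d\<^sup>2) ?T)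
     + smult (of_nat (Suc A) * ?d ^ r) (smult (- 2 * of_nat (Suc B) * (of_nat (Suc A + Suc B) + 1) * ?d) ?T)"
    unfolding clifford_transvectant_pw[OF plin_rho_minus] mult_1_right diff_Suc_1 1 2 ..
  also have "\<dots> = smult ((of_nat r * ?d ^ (r - 1) * ?d) * ?d * (- 2 * of_nat (Suc A) * of_nat (Suc B))
      + ?d ^ r * ?d * (- 2 * of_nat (Suc A) * of_nat (Suc B) * (of_nat (Suc A + Suc B) + 1))) ?T"
    unfolding smult_smult smult_add_left[symmetric] by (rule arg_cong2[where f = smult]) (simp_all add: power2_eq_square mult_ac del: of_nat_Suc of_nat_add)
  also have "\<dots> = smult (- 2 * of_nat (Suc A) * of_nat (Suc B) * of_nat (A + B + r + 3)) (smult (?d ^ Suc r) ?T)"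
    unfolding power_pred_mult smult_smult by (rule arg_cong2[where f = smult]) (auto simp: algebra_simps)
  finally show "(\<Sum>i\<in>UNIV. rho_minus (int (Suc A + Suc B)) (axis i 1) (transvectant (Suc A) (Suc B) r (rho_zero (int (Suc A + r)) (axis i 1) (pw (Suc A + r) t 1)) (pw (Suc B + r) s 1)))
     = smult (- 2 * of_nat (Suc A) * of_nat (Suc B) * of_nat (A + B + r + 3)) (transvectant A B (Suc r) (pw (Suc A + r) t 1) (pw (Suc B + r) s 1))"
    unfolding transvectant_pw[of A B "Suc r", unfolded e] by simp
qed (intro plin_smult_map plin_transvectant_left plin_transvectant_right)+

lemma minus_transvectant_0:
  assumes f: "f \<in> V (int (A + r))" and g: "g \<in> V (int (B + r))" and AB: "A = 0 \<or> B = 0"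
  shows "(\<Sum>i\<in>UNIV. rho_minus (int (A + B)) (axis i 1) (transvectant A B r (rho_zero (int (A + r)) (axis i 1) f) g)) = 0"
proof (rule plin2_eq_on_pw[OF plin_clifford_transvectant(1) plin_clifford_transvectant(2) plin_zero_map plin_zero_map _ f g, OF plin_rho_minus plin_rho_minus])
  fix t s :: complex
  have 1: "(\<Sum>i\<in>UNIV. rho_minus (int (A + B)) (axis i 1) (smult (sig1 i t 1 * 1 - s * sig2 i t 1) ([:1, t:] ^ A * [:1, s:] ^ B))) = 0"
    using AB unfolding clifford_sum_minus1[OF nonzero_form] by auto
  have 2: "smult (of_nat A * (t * 1 - s * 1) ^ r) (\<Sum>i\<in>UNIV. rho_minus (int (A + B)) (axis i 1) ([:sig2 i t 1, sig1 i t 1:] * ([:1, t:] ^ (A - 1) * [:1, s:] ^ B))) = 0"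
  proof (cases A)
    case (Suc A')
    then have "B = 0" using AB by simp
    then show ?thesis using clifford_sum_minus2[OF nonzero_form, of A' B t s] Suc by simp
  qed simp
  show "(\<Sum>i\<in>UNIV. rho_minus (int (A + B)) (axis i 1) (transvectant A B r (rho_zero (int (A + r)) (axis i 1) (pw (A + r) t 1)) (pw (B + r) s 1))) = 0"
    unfolding clifford_transvectant_pw[OF plin_rho_minus] 1 2 by simp
qed

section \<open>Smooth functions\<close>

lemma Ck_on_Suc_imp: "Ck_on (Suc n) U f \<Longrightarrow> Ck_on n U f"
proof (induction n arbitrary: f)
  case 0
  then show ?case
    by (auto intro!: continuous_at_imp_continuous_on differentiable_imp_continuous_within)
next
  case (Suc n)
  then show ?case by (metis Ck_on.simps(2))
qed

lemma Ck_on_cong: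
  assumes U: "open U"
  shows "(\<And>x. x \<in> U \<Longrightarrow> f x = g x) \<Longrightarrow> Ck_on n U f \<Longrightarrow> Ck_on n U g"
proof (induction n arbitrary: f g)
  case 0
  then show ?case by (simp cong: continuous_on_cong)
next
  case (Suc n)
  have d: "(g has_derivative frechet_derivative f (at x)) (at x)" if x: "x \<in> U" for x
  proof -
    have "(f has_derivative frechet_derivative f (at x)) (at x)"
      using Suc.prems(2) x frechet_derivative_works by auto
    then show ?thesis
      by (rule has_derivative_transform_within_open[OF _ U x]) (rule Suc.prems(1))
  qed
  have e: "frechet_derivative f (at x) = frechet_derivative g (at x)" if "x \<in> U" for x
    using frechet_derivative_at[OF d[OF that]] .
  have "Ck_on n U (\<lambda>x. frechet_derivative g (at x) v)" for v
    by (rule Suc.IH[where f = "\<lambda>x. frechet_derivative f (at x) v"]) (use e Suc.prems(2) in auto)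
  then show ?case using d by (auto simp: differentiable_def)
qed

lemma Ck_on_D: "Ck_on (Suc n) U f \<Longrightarrow> x \<in> U \<Longrightarrow> (f has_derivative frechet_derivative f (at x)) (at x)"
  using frechet_derivative_works by auto

lemma Ck_on_derivative: "Ck_on (Suc n) U f \<Longrightarrow> Ck_on n U (\<lambda>x. frechet_derivative f (at x) v)"
  by simp

lemma Ck_on_SucI:
  assumes U: "open U" and d: "\<And>x. x \<in> U \<Longrightarrow> (f has_derivative D x) (at x)" and D: "\<And>v. Ck_on n U (\<lambda>x. D x v)"
  shows "Ck_on (Suc n) U f"
proof -
  have "Ck_on n U (\<lambda>x. frechet_derivative f (at x) v)" for v
    by (rule Ck_on_cong[OF U _ D[of v]]) (simp add: frechet_derivative_at[OF d, symmetric])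
  then show ?thesis using d by (auto simp: differentiable_def)
qed

lemma Ck_on_const: "open U \<Longrightarrow> Ck_on n U (\<lambda>x. c)"
proof (induction n arbitrary: c)
  case (Suc n)
  show ?case by (rule Ck_on_SucI[OF Suc.prems has_derivative_const Suc.IH[OF Suc.prems]])
qed simp

lemma Ck_on_add: "open U \<Longrightarrow> Ck_on n U f \<Longrightarrow> Ck_on n U g \<Longrightarrow> Ck_on n U (\<lambda>x. f x + g x)"
proof (induction n arbitrary: f g)
  case (Suc n)
  show ?case
    by (rule Ck_on_SucI[OF Suc.prems(1) has_derivative_add[OF Ck_on_D[OF Suc.prems(2)] Ck_on_D[OF Suc.prems(3)]]
        Suc.IH[OF Suc.prems(1) Ck_on_derivative[OF Suc.prems(2)] Ck_on_derivative[OF Suc.prems(3)]]])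
qed (auto intro: continuous_on_add)

lemma Ck_on_mult:
  fixes f g :: "_ \<Rightarrow> 'b :: real_normed_algebra"
  shows "open U \<Longrightarrow> Ck_on n U f \<Longrightarrow> Ck_on n U g \<Longrightarrow> Ck_on n U (\<lambda>x. f x * g x)"
proof (induction n arbitrary: f g)
  case (Suc n)
  show ?case
    by (rule Ck_on_SucI[OF Suc.prems(1) has_derivative_mult[OF Ck_on_D[OF Suc.prems(2)] Ck_on_D[OF Suc.prems(3)]]
        Ck_on_add[OF Suc.prems(1) Suc.IH[OF Suc.prems(1) Ck_on_Suc_imp[OF Suc.prems(2)] Ck_on_derivative[OF Suc.prems(3)]]
          Suc.IH[OF Suc.prems(1) Ck_on_derivative[OF Suc.prems(2)] Ck_on_Suc_imp[OF Suc.prems(3)]]]])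
qed (auto intro: continuous_on_mult)

lemma Ck_on_bounded_linear: "open U \<Longrightarrow> bounded_linear f \<Longrightarrow> Ck_on n U f"
proof (cases n)
  case (Suc k)
  assume "open U" "bounded_linear f"
  then show ?thesis unfolding Suc
    by (intro Ck_on_SucI[where D = "\<lambda>x. f"] bounded_linear_imp_has_derivative Ck_on_const)
qed (auto intro: linear_continuous_on)

lemma Ck_on_linear_image: "open U \<Longrightarrow> bounded_linear L \<Longrightarrow> Ck_on n U f \<Longrightarrow> Ck_on n U (\<lambda>x. L (f x))"
proof (induction n arbitrary: f)
  case (Suc n)
  show ?case
    by (rule Ck_on_SucI[OF Suc.prems(1) bounded_linear.has_derivative[OF Suc.prems(2) Ck_on_D[OF Suc.prems(3)]]
        Suc.IH[OF Suc.prems(1,2) Ck_on_derivative[OF Suc.prems(3)]]])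
qed (auto intro: bounded_linear.continuous_on)

lemma Ck_on_sum: "open U \<Longrightarrow> (\<And>i. i \<in> I \<Longrightarrow> Ck_on n U (f i)) \<Longrightarrow> Ck_on n U (\<lambda>x. \<Sum>i\<in>I. f i x)"
  by (induction I rule: infinite_finite_induct) (auto intro: Ck_on_const Ck_on_add)

lemma Ck_on_compose:
  fixes F :: "'b::euclidean_space \<Rightarrow> real"
  assumes W: "open W" and PU: "P ` W \<subseteq> U" and P: "\<And>b n. b \<in> Basis \<Longrightarrow> Ck_on n W (\<lambda>x. P x \<bullet> b)"
  shows "Ck_on n U F \<Longrightarrow> Ck_on n W (\<lambda>x. F (P x))"
proof (induction n arbitrary: F)
  case 0
  have "continuous_on W P"
    using P[of _ 0] by (subst continuous_on_componentwise) auto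
  then show ?case using 0 PU by (auto intro: continuous_on_compose2)
next
  case (Suc n)
  let ?p = "\<lambda>b x. frechet_derivative (\<lambda>x. P x \<bullet> b) (at x)"
  let ?P = "\<lambda>x v. \<Sum>b\<in>Basis. ?p b x v *\<^sub>R b"
  have dP: "(P has_derivative ?P x) (at x)" if x: "x \<in> W" for x
    unfolding has_derivative_componentwise_within[of P]
  proof
    fix b :: 'b assume b: "b \<in> Basis"
    have "((\<lambda>x. P x \<bullet> b) has_derivative ?p b x) (at x)" using Ck_on_D[OF P[OF b, of "Suc 0"] x] .
    then show "((\<lambda>x. P x \<bullet> b) has_derivative (\<lambda>v. ?P x v \<bullet> b)) (at x)"
      using b by (simp add: inner_sum_left inner_Basis if_distrib cong: if_cong)
  qed
  show ?case
  proof (rule Ck_on_SucI[OF W])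
    fix x assume x: "x \<in> W"
    then have "P x \<in> U" using PU by auto
    then have dF: "(F has_derivative frechet_derivative F (at (P x))) (at (P x))" by (rule Ck_on_D[OF Suc.prems])
    have lin: "linear (frechet_derivative F (at (P x)))" using dF by (rule has_derivative_linear)
    have "((\<lambda>x. F (P x)) has_derivative (\<lambda>v. frechet_derivative F (at (P x)) (?P x v))) (at x)"
      by (rule has_derivative_compose[OF dP[OF x] dF])
    then show "((\<lambda>x. F (P x)) has_derivative (\<lambda>v. \<Sum>b\<in>Basis. ?p b x v * frechet_derivative F (at (P x)) b)) (at x)"
      by (simp add: linear_sum[OF lin] linear_cmul[OF lin])
  next
    fix v
    show "Ck_on n W (\<lambda>x. \<Sum>b\<in>Basis. ?p b x v * frechet_derivative F (at (P x)) b)"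
      by (intro Ck_on_sum[OF W] Ck_on_mult[OF W] Suc.IH Ck_on_derivative[OF P] Ck_on_derivative[OF Suc.prems])
  qed
qed

lemma smooth_on_extensionI: "(\<And>n. Ck_on n UNIV F) \<Longrightarrow> (\<And>x. x \<in> S \<Longrightarrow> F x = f x) \<Longrightarrow> smooth_on S f"
  unfolding smooth_on_def using open_UNIV by blast

lemma Ck_on_subset: "open U' \<Longrightarrow> U' \<subseteq> U \<Longrightarrow> Ck_on n U f \<Longrightarrow> Ck_on n U' f"
  by (induction n arbitrary: f) (auto intro: continuous_on_subset)

text \<open>Local extensions of two functions can be combined on the intersection of their domains.\<close>

lemma smooth_on_binop:
  fixes S :: "'a :: real_normed_vector set"
  assumes f: "smooth_on S f" and g: "smooth_on S g"
    and op: "\<And>(U :: 'a set) F G n. open U \<Longrightarrow> Ck_on n U F \<Longrightarrow> Ck_on n U G \<Longrightarrow> Ck_on n U (\<lambda>x. op (F x) (G x))"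
  shows "smooth_on S (\<lambda>x. op (f x) (g x))"
  unfolding smooth_on_def
proof
  fix x assume x: "x \<in> S"
  obtain U F where F: "open U" "x \<in> U" "\<forall>n. Ck_on n U F" "\<forall>y\<in>U \<inter> S. F y = f y"
    using f x unfolding smooth_on_def by meson
  obtain W G where G: "open W" "x \<in> W" "\<forall>n. Ck_on n W G" "\<forall>y\<in>W \<inter> S. G y = g y"
    using g x unfolding smooth_on_def by meson
  have UW: "open (U \<inter> W)" using F G by auto
  have "Ck_on n (U \<inter> W) (\<lambda>x. op (F x) (G x))" for n
    by (rule op[where F = F and G = G, OF UW Ck_on_subset[OF UW _ F(3)[rule_format]] Ck_on_subset[OF UW _ G(3)[rule_format]]]) auto
  then show "\<exists>U H. open U \<and> x \<in> U \<and> (\<forall>n. Ck_on n U H) \<and> (\<forall>y\<in>U \<inter> S. H y = op (f y) (g y))"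
    using UW F G by (intro exI[of _ "U \<inter> W"] exI[of _ "\<lambda>x. op (F x) (G x)"]) auto
qed

lemma smooth_on_const: "smooth_on S (\<lambda>x. c)"
  by (rule smooth_on_extensionI[where F = "\<lambda>x. c"]) (auto intro: Ck_on_const)

lemma smooth_on_add: "smooth_on S f \<Longrightarrow> smooth_on S g \<Longrightarrow> smooth_on S (\<lambda>x. f x + g x)"
  by (rule smooth_on_binop[where op = "(+)"]) (auto intro: Ck_on_add)

lemma smooth_on_mult:
  fixes f g :: "_ \<Rightarrow> 'b :: real_normed_algebra"
  shows "smooth_on S f \<Longrightarrow> smooth_on S g \<Longrightarrow> smooth_on S (\<lambda>x. f x * g x)"
  by (rule smooth_on_binop[where op = "(*)"]) (auto intro: Ck_on_mult)

lemma smooth_on_sum: "(\<And>i. i \<in> I \<Longrightarrow> smooth_on S (f i)) \<Longrightarrow> smooth_on S (\<lambda>x. \<Sum>i\<in>I. f i x)"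
  by (induction I rule: infinite_finite_induct) (auto intro: smooth_on_const smooth_on_add)

lemma smooth_on_linear_image: "bounded_linear L \<Longrightarrow> smooth_on S f \<Longrightarrow> smooth_on S (\<lambda>x. L (f x))"
  by (rule smooth_on_binop[where op = "\<lambda>x y. L x", of S f f]) (auto intro: Ck_on_linear_image)

lemma smooth_on_cong: "smooth_on S f \<Longrightarrow> (\<And>x. x \<in> S \<Longrightarrow> f x = g x) \<Longrightarrow> smooth_on S g"
  unfolding smooth_on_def by (metis IntD2)

lemma smooth_on_has_derivative:
  assumes "smooth_on S f" "x \<in> S"
  obtains F U where "open U" "x \<in> U" "\<forall>n. Ck_on n U F"
    "\<forall>y\<in>U \<inter> S. (f has_derivative frechet_derivative F (at y)) (at y within S)"
proof -
  obtain U F where F: "open U" "x \<in> U" "\<forall>n. Ck_on n U F" "\<forall>y\<in>U \<inter> S. F y = f y"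
    using assms unfolding smooth_on_def by meson
  have "(f has_derivative frechet_derivative F (at y)) (at y within S)" if y: "y \<in> U \<inter> S" for y
  proof -
    obtain d where d: "d > 0" "ball y d \<subseteq> U" using F(1) y open_contains_ball by blast
    have "(F has_derivative frechet_derivative F (at y)) (at y within S)"
      using Ck_on_D[OF F(3)[rule_format, of "Suc 0"], of y] y has_derivative_at_withinI by blast
    then show ?thesis
      by (rule has_derivative_transform_within[OF _ d(1)])
        (use F(4) d(2) y in \<open>auto simp: subset_iff dist_commute\<close>)
  qed
  then show thesis using that F by blast
qed

lemma smooth_on_differentiable:
  assumes "smooth_on S f" "x \<in> S"
  shows "(f has_derivative frechet_derivative f (at x within S)) (at x within S)"
proof -
  obtain F U where "open U" "x \<in> U" "\<forall>n. Ck_on n U F"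
    "\<forall>y\<in>U \<inter> S. (f has_derivative frechet_derivative F (at y)) (at y within S)"
    using smooth_on_has_derivative[OF assms] by metis
  then have "f differentiable (at x within S)" using assms(2) unfolding differentiable_def by blast
  then show ?thesis by (simp add: frechet_derivative_works)
qed

lemma smooth_on_continuous_on: "smooth_on S f \<Longrightarrow> continuous_on S f"
  by (meson smooth_on_differentiable has_derivative_continuous continuous_on_eq_continuous_within)

section \<open>Quaternions and the sphere\<close>

definition quat :: "mat2 \<Rightarrow> bool" where
  "quat M \<longleftrightarrow> M $ 2 $ 2 = cnj (M $ 1 $ 1) \<and> M $ 2 $ 1 = - cnj (M $ 1 $ 2)"

definition vec4 :: "mat2 \<Rightarrow> real ^ 4" where
  "vec4 M = (\<chi> i. if i = 1 then Im (M $ 1 $ 1) else if i = 2 then Re (M $ 1 $ 2)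
     else if i = 3 then Im (M $ 1 $ 2) else Re (M $ 1 $ 1))"

lemma vec4_nth [simp]:
  "vec4 M $ 1 = Im (M $ 1 $ 1)" "vec4 M $ 2 = Re (M $ 1 $ 2)" "vec4 M $ 3 = Im (M $ 1 $ 2)" "vec4 M $ 4 = Re (M $ 1 $ 1)"
  by (simp_all add: vec4_def)

lemma vec4_mat4 [simp]: "vec4 (mat4 x) = x"
  by (simp add: vec_eq_iff forall_4 mat4_def)

lemma mat4_vec4: "quat M \<Longrightarrow> mat4 (vec4 M) = M"
  by (auto simp: mat2_eq_iff mat4_def quat_def complex_eq_iff)

lemma inv_mat4: "quat M \<Longrightarrow> inv mat4 M = vec4 M"
  by (metis inv_f_f inj_on_inverseI vec4_mat4 mat4_vec4)

lemma quat_mult: "quat M \<Longrightarrow> quat N \<Longrightarrow> quat (M ** N)"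
  by (simp add: quat_def mat2_mult_nth)

lemma quat_adjoint: "quat M \<Longrightarrow> quat (adjoint_mat M)"
  by (simp add: quat_def)

lemma quat_mat4: "quat (mat4 x)"
  by (simp add: quat_def mat4_def complex_eq_iff)

lemma quat_SU2: "h \<in> SU2 \<Longrightarrow> quat h"
  by (simp add: quat_def SU2_iff)

lemma quat_su2_of: "quat (su2_of X)"
  by (simp add: quat_def complex_eq_iff)

lemma norm_vec4: "norm (x :: real ^ 4) ^ 2 = x $ 1 ^ 2 + x $ 2 ^ 2 + x $ 3 ^ 2 + x $ 4 ^ 2"
  by (simp add: norm_vec_def L2_set_def sum_4)

lemma mat4_SU2_iff: "mat4 x \<in> SU2 \<longleftrightarrow> x \<in> S3"
proof -
  have "mat4 x \<in> SU2 \<longleftrightarrow> x $ 1 ^ 2 + x $ 2 ^ 2 + x $ 3 ^ 2 + x $ 4 ^ 2 = 1"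
    by (auto simp: SU2_iff mat4_def complex_eq_iff power2_eq_square algebra_simps)
  also have "\<dots> \<longleftrightarrow> norm x ^ 2 = 1" by (simp only: norm_vec4)
  also have "\<dots> \<longleftrightarrow> x \<in> S3" by (simp add: S3_def power2_eq_1_iff) (smt (verit) norm_ge_zero)
  finally show ?thesis .
qed

lemma vec4_S3: "h \<in> SU2 \<Longrightarrow> vec4 h \<in> S3"
  by (metis mat4_SU2_iff mat4_vec4 quat_SU2)

lemma mat2_plus_nth [simp]: "((M :: mat2) + N) $ i $ j = M $ i $ j + N $ i $ j"
  and mat2_scale_nth [simp]: "(r *\<^sub>R (M :: mat2)) $ i $ j = r *\<^sub>R (M $ i $ j)"
  and mat2_minus_nth [simp]: "(- (M :: mat2)) $ i $ j = - (M $ i $ j)"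
  and mat2_diff_nth [simp]: "((M :: mat2) - N) $ i $ j = M $ i $ j - N $ i $ j"
  and mat2_zero_nth [simp]: "(0 :: mat2) $ i $ j = 0"
  by simp_all

lemma mat2_scaleR_mult:
  fixes M N :: mat2
  shows "(r *\<^sub>R M) ** N = r *\<^sub>R (M ** N)" "M ** (r *\<^sub>R N) = r *\<^sub>R (M ** N)"
  by (simp_all add: mat2_eq_iff mat2_mult_nth algebra_simps)

lemma mat2_add_mult:
  fixes M N M' N' :: mat2
  shows "(M + M') ** N = M ** N + M' ** N" "M ** (N + N') = M ** N + M ** N'"
  by (simp_all add: mat2_eq_iff mat2_mult_nth algebra_simps)

lemma su2_of_add: "su2_of (X + Y) = su2_of X + su2_of Y"
  and su2_of_scaleR: "su2_of (r *\<^sub>R X) = r *\<^sub>R su2_of X"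
  by (simp_all add: mat2_eq_iff complex_eq_iff algebra_simps)

lemma su2_of_minus: "su2_of (- X) = - su2_of X"
  using su2_of_scaleR[of "-1" X] by simp

lemma su2_of_inject: "su2_of X = su2_of Y \<longleftrightarrow> X = Y"
  by (auto simp: mat2_eq_iff vec_eq_iff forall_3 complex_eq_iff)

lemma su2_iff: "A \<in> su2 \<longleftrightarrow> (\<exists>a. A = su2_of a)"
proof
  assume A: "A \<in> su2"
  have "A = su2_of (vector [Im (A $ 1 $ 1), Re (A $ 1 $ 2), Im (A $ 1 $ 2)])"
  proof -
    have c: "cnj (A $ j $ i) = - (A $ i $ j)" for i j
      using A by (metis (mono_tags, lifting) su2_def mem_Collect_eq adjoint_mat_nth mat2_minus_nth)
    have t: "A $ 1 $ 1 + A $ 2 $ 2 = 0" using A by (simp add: su2_def trace_def sum_2)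
    have "Re (A $ 1 $ 1) = 0" using arg_cong[where f = Re, OF c[of 1 1]] by simp
    moreover have "Re (A $ 2 $ 2) = 0" using arg_cong[where f = Re, OF c[of 2 2]] by simp
    moreover have "Im (A $ 2 $ 2) = - Im (A $ 1 $ 1)" using arg_cong[where f = Im, OF t] by simp
    moreover have "Re (A $ 2 $ 1) = - Re (A $ 1 $ 2)" using arg_cong[where f = Re, OF c[of 1 2]] by simp
    moreover have "Im (A $ 2 $ 1) = Im (A $ 1 $ 2)" using arg_cong[where f = Im, OF c[of 1 2]] by simp
    ultimately show ?thesis by (simp add: mat2_eq_iff complex_eq_iff)
  qed
  then show "\<exists>a. A = su2_of a" by blast
qed (auto simp: su2_def mat2_eq_iff complex_eq_iff trace_def sum_2)

lemma su2_of_expand: "su2_of X = (\<Sum>i\<in>UNIV. X $ i *\<^sub>R su2_of (axis i 1))"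
  by (simp add: sum_3 mat2_eq_iff complex_eq_iff axis3_nth)

text \<open>The one-parameter subgroup generated by \<open>\<sigma>\<^sub>i\<close>, whose square is \<open>- 1\<close>.\<close>

definition circ :: "3 \<Rightarrow> real \<Rightarrow> mat2" where
  "circ i t = cos t *\<^sub>R mat 1 + sin t *\<^sub>R su2_of (axis i 1)"

lemma circ_SU2: "circ i t \<in> SU2"
proof -
  have "(complex_of_real (cos t))\<^sup>2 + (complex_of_real (sin t))\<^sup>2 = 1"
    by (simp flip: of_real_power of_real_add)
  then show ?thesis
    using exhaust_3[of i]
    by (auto simp: circ_def SU2_iff axis3_nth complex_eq_iff power2_eq_square)
qed

lemma circ_0: "circ i 0 = mat 1"
  by (simp add: circ_def)

lemma circ_derivative:
  fixes p r :: mat2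
  shows "((\<lambda>t. p ** circ i t ** r) has_vector_derivative p ** su2_of (axis i 1) ** r) (at 0)"
proof -
  have e: "(\<lambda>t. p ** circ i t ** r) = (\<lambda>t. cos t *\<^sub>R (p ** r) + sin t *\<^sub>R (p ** su2_of (axis i 1) ** r))"
    by (simp add: circ_def mat2_add_mult mat2_scaleR_mult fun_eq_iff)
  show ?thesis unfolding e by (auto intro!: derivative_eq_intros)
qed

lemma curve_derivative:
  assumes F: "(F has_derivative F') (at g within Spin4)" and \<gamma>: "\<And>t. \<gamma> t \<in> Spin4" "\<gamma> 0 = g"
    and d: "(\<gamma> has_vector_derivative \<xi>) (at 0)"
  shows "((\<lambda>t. F (\<gamma> t)) has_vector_derivative F' \<xi>) (at 0)"
proof -
  have "(F has_derivative F') (at (\<gamma> 0) within range \<gamma>)"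
    unfolding \<gamma>(2) by (rule has_derivative_subset[OF F]) (use \<gamma>(1) in auto)
  from vector_derivative_diff_chain_within[OF d this] show ?thesis by (simp add: o_def)
qed

lemma derivative_left_circ:
  assumes F: "(F has_derivative F') (at (p, q) within Spin4)" and pq: "p \<in> SU2" "q \<in> SU2"
  shows "((\<lambda>t. F (p ** circ i t, q)) has_vector_derivative F' (p ** su2_of (axis i 1), 0)) (at 0)"
proof (rule curve_derivative[OF F])
  show "((\<lambda>t. (p ** circ i t, q)) has_vector_derivative (p ** su2_of (axis i 1), 0)) (at 0)"
    using circ_derivative[of p i "mat 1"] by (intro has_vector_derivative_Pair) auto
qed (use pq in \<open>auto simp: Spin4_def circ_SU2 circ_0\<close>)

lemma derivative_right_circ:
  assumes F: "(F has_derivative F') (at (p, q) within Spin4)" and pq: "p \<in> SU2" "q \<in> SU2"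
  shows "((\<lambda>t. F (p, q ** circ i t)) has_vector_derivative F' (0, q ** su2_of (axis i 1))) (at 0)"
proof (rule curve_derivative[OF F])
  show "((\<lambda>t. (p, q ** circ i t)) has_vector_derivative (0, q ** su2_of (axis i 1))) (at 0)"
    using circ_derivative[of q i "mat 1"] by (intro has_vector_derivative_Pair) auto
qed (use pq in \<open>auto simp: Spin4_def circ_SU2 circ_0\<close>)

lemma linear_tangent_expand:
  fixes p q :: mat2
  assumes "linear F'"
  shows "F' (p ** su2_of a, q ** su2_of b) =
    (\<Sum>i\<in>UNIV. a $ i *\<^sub>R F' (p ** su2_of (axis i 1), 0)) + (\<Sum>i\<in>UNIV. b $ i *\<^sub>R F' (0, q ** su2_of (axis i 1)))"
proof -
  have "(p ** su2_of a, q ** su2_of b) = (\<Sum>i\<in>UNIV. a $ i *\<^sub>R (p ** su2_of (axis i 1), 0)) + (\<Sum>i\<in>UNIV. b $ i *\<^sub>R (0, q ** su2_of (axis i 1)))"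
    by (simp only: su2_of_expand[of a] su2_of_expand[of b])
      (simp add: sum_3 mat2_add_mult mat2_scaleR_mult scaleR_Pair)
  then show ?thesis by (simp only: linear_add[OF assms] linear_sum[OF assms] linear_cmul[OF assms])
qed

text \<open>
  Tangent vectors of \<open>Spin(4)\<close> are sums of velocities of curves, along which the derivative is determined by the
  values on \<open>Spin(4)\<close> alone.
\<close>

lemma tangent_derivative_unique:
  assumes F: "(F has_derivative F') (at (p, q) within Spin4)" "(F has_derivative F'') (at (p, q) within Spin4)"
    and pq: "p \<in> SU2" "q \<in> SU2"
  shows "F' (p ** su2_of a, q ** su2_of b) = F'' (p ** su2_of a, q ** su2_of b)"
proof -
  have "F' (p ** su2_of (axis i 1), 0) = F'' (p ** su2_of (axis i 1), 0)"
    "F' (0, q ** su2_of (axis i 1)) = F'' (0, q ** su2_of (axis i 1))" for i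
    using derivative_left_circ[OF F(1) pq] derivative_left_circ[OF F(2) pq]
      derivative_right_circ[OF F(1) pq] derivative_right_circ[OF F(2) pq] vector_derivative_unique_at by blast+
  then show ?thesis
    using F[THEN has_derivative_linear] by (simp only: linear_tangent_expand)
qed

lemma dSpin_eq:
  assumes F: "(F has_derivative F') (at (p, q) within Spin4)" and pq: "p \<in> SU2" "q \<in> SU2"
  shows "dSpin F (p, q) (p ** su2_of a, q ** su2_of b) = F' (p ** su2_of a, q ** su2_of b)"
  unfolding dSpin_def
  by (rule tangent_derivative_unique[OF _ F pq]) (use F frechet_derivative_works differentiable_def in blast)

lemma su2_of_zero: "su2_of 0 = 0"
  using su2_of_scaleR[of 0 0] by simp

lemma mat2_mult_zero [simp]: "(p :: mat2) ** 0 = 0" "0 ** (p :: mat2) = 0"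
  by (simp_all add: mat2_eq_iff mat2_mult_nth)

lemma dSpin_eq_left:
  assumes "(F has_derivative F') (at (p, q) within Spin4)" "p \<in> SU2" "q \<in> SU2"
  shows "dSpin F (p, q) (p ** su2_of a, 0) = F' (p ** su2_of a, 0)"
  using dSpin_eq[OF assms, of a 0] by (simp add: su2_of_zero)

section \<open>Horizontal lifts\<close>

lemma bounded_bilinear_sandwich: "bounded_bilinear (\<lambda>P Q. vec4 ((P :: mat2) ** (M :: mat2) ** adjoint_mat Q))"
  unfolding bilinear_conv_bounded_bilinear[symmetric] bilinear_def
  by (auto intro!: linearI simp: vec_eq_iff forall_4 mat2_mult_nth algebra_simps)

lemma sandwich_derivative:
  assumes F: "\<And>g. g \<in> Spin4 \<Longrightarrow> F g = vec4 (fst g ** M ** adjoint_mat (snd g))" and g: "(p, q) \<in> Spin4"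
  shows "(F has_derivative (\<lambda>\<xi>. vec4 (p ** M ** adjoint_mat (snd \<xi>)) + vec4 (fst \<xi> ** M ** adjoint_mat q))) (at (p, q) within Spin4)"
proof (rule has_derivative_transform[OF g F])
  show "((\<lambda>g. vec4 (fst g ** M ** adjoint_mat (snd g))) has_derivative
      (\<lambda>\<xi>. vec4 (p ** M ** adjoint_mat (snd \<xi>)) + vec4 (fst \<xi> ** M ** adjoint_mat q))) (at (p, q) within Spin4)"
    using bounded_bilinear.FDERIV[OF bounded_bilinear_sandwich[of M], of fst fst "(p, q)" Spin4 snd snd]
    by (simp add: bounded_linear_fst bounded_linear_snd bounded_linear_imp_has_derivative)
qed

lemma spin_frame_eq: "g \<in> Spin4 \<Longrightarrow> spin_frame g X = vec4 (fst g ** su2_of X ** adjoint_mat (snd g))"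
  by (auto simp: spin_frame_def Spin4_def SU2_matrix_inv inv_mat4 quat_mult quat_SU2 quat_su2_of)

lemma spin_proj_eq: "g \<in> Spin4 \<Longrightarrow> spin_proj g = vec4 (fst g ** mat 1 ** adjoint_mat (snd g))"
  by (auto simp: spin_proj_def Spin4_def SU2_matrix_inv inv_mat4 quat_SU2)

lemma adjoint_su2_of: "adjoint_mat (q ** su2_of b) = - (su2_of b ** adjoint_mat q)"
  by (simp add: mat2_eq_iff mat2_mult_nth complex_eq_iff algebra_simps)

lemma vec4_add: "vec4 (M + N) = vec4 M + vec4 N"
  and vec4_scaleR: "vec4 (r *\<^sub>R M) = r *\<^sub>R vec4 M"
  by (simp_all add: vec_eq_iff forall_4)

lemma dSpin_frame:
  assumes pq: "p \<in> SU2" "q \<in> SU2"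
  shows "dSpin (\<lambda>g. spin_frame g X) (p, q) (p ** su2_of a, q ** su2_of b) =
      vec4 (p ** (su2_of a ** su2_of X - su2_of X ** su2_of b) ** adjoint_mat q)"
    and "dSpin spin_proj (p, q) (p ** su2_of a, q ** su2_of b) = vec4 (p ** su2_of (a - b) ** adjoint_mat q)"
proof -
  have g: "(p, q) \<in> Spin4" using pq by (simp add: Spin4_def)
  have r: "M ** (- N) = - (M ** N)" "(- M) ** N = - (M ** N)" for M N :: mat2
    by (simp_all add: mat2_eq_iff mat2_mult_nth algebra_simps)
  have d: "M ** (N - N') = M ** N - M ** N'" "(N - N') ** M = N ** M - N' ** M" for M N N' :: mat2
    by (simp_all add: mat2_eq_iff mat2_mult_nth algebra_simps)
  have s: "su2_of (a - b) = su2_of a - su2_of b" using su2_of_add[of a "- b"] by (simp add: su2_of_minus)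
  show "dSpin (\<lambda>g. spin_frame g X) (p, q) (p ** su2_of a, q ** su2_of b) =
      vec4 (p ** (su2_of a ** su2_of X - su2_of X ** su2_of b) ** adjoint_mat q)"
    using dSpin_eq[OF sandwich_derivative[where F = "\<lambda>g. spin_frame g X" and M = "su2_of X", OF spin_frame_eq g] pq, of a b]
    by (simp add: adjoint_su2_of r d matrix_mul_assoc vec4_add[symmetric])
  show "dSpin spin_proj (p, q) (p ** su2_of a, q ** su2_of b) = vec4 (p ** su2_of (a - b) ** adjoint_mat q)"
    using dSpin_eq[OF sandwich_derivative[where F = spin_proj and M = "mat 1", OF spin_proj_eq g] pq, of a b]
    by (simp add: adjoint_su2_of r d s matrix_mul_assoc vec4_add[symmetric])
qed

lemma sandwich_cancel:
  assumes pq: "p \<in> SU2" "q \<in> SU2" and M: "quat M" "quat N"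
  shows "vec4 (p ** M ** adjoint_mat q) = vec4 (p ** N ** adjoint_mat q) \<longleftrightarrow> M = N"
proof
  assume "vec4 (p ** M ** adjoint_mat q) = vec4 (p ** N ** adjoint_mat q)"
  then have "p ** M ** adjoint_mat q = p ** N ** adjoint_mat q"
    using mat4_vec4 pq M by (metis quat_mult quat_SU2 quat_adjoint)
  then have "adjoint_mat p ** (p ** M ** adjoint_mat q) ** q = adjoint_mat p ** (p ** N ** adjoint_mat q) ** q" by simp
  moreover have "adjoint_mat p ** (p ** K ** adjoint_mat q) ** q = K" for K
  proof -
    have "adjoint_mat p ** (p ** K ** adjoint_mat q) ** q = (adjoint_mat p ** p) ** K ** (adjoint_mat q ** q)"
      by (simp add: matrix_mul_assoc)
    then show ?thesis using pq by (simp add: SU2_adjoint_left)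
  qed
  ultimately show "M = N" by simp
qed simp

lemma tangential_part_scale: "norm x = 1 \<Longrightarrow> tangential_part x (c *\<^sub>R x) = 0"
  by (simp add: tangential_part_def norm_eq_sqrt_inner)

text \<open>
  The derivative of the frame in the direction \<open>(p a, q b)\<close> is \<open>p (a X - X b) q\<^sup>-\<^sup>1\<close>. It is normal to the sphere for each \<open>X\<close> in
  \<open>su(2)\<close> iff \<open>a X - X b\<close> is always a real scalar, that is, iff \<open>b = - a\<close>.
\<close>

lemma horizontal_iff:
  assumes pq: "p \<in> SU2" "q \<in> SU2"
  shows "horizontal (p, q) (p ** su2_of a, q ** su2_of b) \<longleftrightarrow> b = - a"
proof -
  have g: "(p, q) \<in> Spin4" using pq by (simp add: Spin4_def)
  let ?M = "\<lambda>X. su2_of a ** su2_of X - su2_of X ** su2_of b"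
  let ?x = "spin_proj (p, q)"
  have x: "?x = vec4 (p ** mat 1 ** adjoint_mat q)" using spin_proj_eq[OF g] by simp
  have "norm ?x = 1"
    using vec4_S3[of "p ** adjoint_mat q"] pq by (simp add: x S3_def)
  have scal: "vec4 (p ** (c *\<^sub>R mat 1) ** adjoint_mat q) = c *\<^sub>R ?x" for c
    by (simp add: x mat2_scaleR_mult vec4_scaleR)
  have q: "quat (?M X)" for X
    using quat_mult[OF quat_su2_of quat_su2_of, of a X] quat_mult[OF quat_su2_of quat_su2_of, of X b] by (simp add: quat_def)
  have "tangential_part ?x (vec4 (p ** ?M X ** adjoint_mat q)) = 0 \<longleftrightarrow> (\<exists>c. ?M X = c *\<^sub>R mat 1)" for X
  proof
    assume "tangential_part ?x (vec4 (p ** ?M X ** adjoint_mat q)) = 0"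
    then obtain c where "vec4 (p ** ?M X ** adjoint_mat q) = c *\<^sub>R ?x" by (auto simp: tangential_part_def)
    then have "?M X = c *\<^sub>R mat 1"
      unfolding scal[symmetric] by (subst (asm) sandwich_cancel[OF pq q]) (simp_all add: quat_def)
    then show "\<exists>c. ?M X = c *\<^sub>R mat 1" ..
  next
    assume "\<exists>c. ?M X = c *\<^sub>R mat 1"
    then show "tangential_part ?x (vec4 (p ** ?M X ** adjoint_mat q)) = 0"
      using tangential_part_scale[OF \<open>norm ?x = 1\<close>] scal by auto
  qed
  moreover have "(p ** su2_of a, q ** su2_of b) \<in> tangent_Spin4 (p, q)"
    by (auto simp: tangent_Spin4_def su2_iff)
  ultimately have h: "horizontal (p, q) (p ** su2_of a, q ** su2_of b) \<longleftrightarrow> (\<forall>X. \<exists>c. ?M X = c *\<^sub>R mat 1)"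
    by (simp add: horizontal_def dSpin_frame(1)[OF pq])
  show ?thesis
  proof
    assume "horizontal (p, q) (p ** su2_of a, q ** su2_of b)"
    then obtain c1 c2 where "?M (axis 1 1) = c1 *\<^sub>R mat 1" "?M (axis 2 1) = c2 *\<^sub>R mat 1"
      unfolding h by blast
    then show "b = - a"
      by (auto simp: mat2_eq_iff mat2_mult_nth complex_eq_iff axis3_nth vec_eq_iff forall_3)
  next
    assume b: "b = - a"
    have "?M X = (- 2 * (a \<bullet> X)) *\<^sub>R mat 1" for X
      by (auto simp: b mat2_eq_iff mat2_mult_nth complex_eq_iff inner_vec_def sum_3 algebra_simps)
    then show "horizontal (p, q) (p ** su2_of a, q ** su2_of b)" unfolding h by blast
  qed
qed

lemma horizontal_lift_frame:
  assumes pq: "p \<in> SU2" "q \<in> SU2"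
  shows "horizontal_lift (p, q) (spin_frame (p, q) X) = (p ** su2_of (X /\<^sub>R 2), q ** su2_of (- (X /\<^sub>R 2)))"
  unfolding horizontal_lift_def
proof (rule the_equality)
  have g: "(p, q) \<in> Spin4" using pq by (simp add: Spin4_def)
  have f: "spin_frame (p, q) X = vec4 (p ** su2_of X ** adjoint_mat q)" using spin_frame_eq[OF g] by simp
  have h: "X /\<^sub>R 2 - - (X /\<^sub>R 2) = X" by (simp add: vec_eq_iff)
  show "horizontal (p, q) (p ** su2_of (X /\<^sub>R 2), q ** su2_of (- (X /\<^sub>R 2))) \<and>
    dSpin spin_proj (p, q) (p ** su2_of (X /\<^sub>R 2), q ** su2_of (- (X /\<^sub>R 2))) = spin_frame (p, q) X"
    unfolding horizontal_iff[OF pq] dSpin_frame(2)[OF pq] f h by simp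
  fix \<xi> assume \<xi>: "horizontal (p, q) \<xi> \<and> dSpin spin_proj (p, q) \<xi> = spin_frame (p, q) X"
  then obtain a b where ab: "\<xi> = (p ** su2_of a, q ** su2_of b)"
    by (auto simp: horizontal_def tangent_Spin4_def su2_iff)
  then have b: "b = - a" using \<xi> horizontal_iff[OF pq] by simp
  have "vec4 (p ** su2_of (a - b) ** adjoint_mat q) = vec4 (p ** su2_of X ** adjoint_mat q)"
    using \<xi> unfolding ab dSpin_frame(2)[OF pq] f by simp
  then have "a - b = X" by (simp add: sandwich_cancel[OF pq quat_su2_of quat_su2_of] su2_of_inject)
  then have "a = X /\<^sub>R 2" unfolding b by (auto simp: vec_eq_iff mult.commute)
  then show "\<xi> = (p ** su2_of (X /\<^sub>R 2), q ** su2_of (- (X /\<^sub>R 2)))" by (simp add: ab b)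
qed

section \<open>Covariant derivatives through left-invariant fields\<close>

text \<open>The derivative of a section along the left-invariant field \<open>(p X, 0)\<close>.\<close>

definition Ld :: "nat \<Rightarrow> real ^ 3 \<Rightarrow> sect \<Rightarrow> mat2 \<times> mat2 \<Rightarrow> complex poly" where
  "Ld n X \<phi> g = (\<Sum>k\<le>n. monom (dSpin (\<lambda>g'. coeff (\<phi> g') k) g (fst g ** su2_of X, 0)) k)"

lemma coeff_sum_monom: "coeff (\<Sum>k\<le>n. monom (c k) k) j = (if j \<le> n then c j else (0 :: complex))"
  by (simp add: coeff_sum coeff_monom)

lemma Ld_in_V: "Ld n X \<phi> g \<in> V (int n)"
  by (simp add: Ld_def V_def coeff_sum_monom)

abbreviation "smooth n \<equiv> smooth_sections (int n)"

lemma smooth_sections_smooth: "\<phi> \<in> smooth_sections m \<Longrightarrow> smooth_on Spin4 (\<lambda>g. coeff (\<phi> g) k)"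
  and smooth_sections_sections: "\<phi> \<in> smooth_sections m \<Longrightarrow> \<phi> \<in> sections m"
  by (auto simp: smooth_sections_def)

lemma sections_outside: "\<phi> \<in> sections m \<Longrightarrow> g \<notin> Spin4 \<Longrightarrow> \<phi> g = 0"
  by (cases g) (auto simp: sections_def)

lemma sections_in_V: "\<phi> \<in> sections m \<Longrightarrow> \<phi> g \<in> V m"
  by (cases "g \<in> Spin4") (auto simp: sections_outside, auto simp: sections_def)

lemma sections_equivariant:
  "\<phi> \<in> sections m \<Longrightarrow> p \<in> SU2 \<Longrightarrow> q \<in> SU2 \<Longrightarrow> h \<in> SU2 \<Longrightarrow> \<phi> (p ** h, q ** h) = rho m (adjoint_mat h) (\<phi> (p, q))"
  by (simp add: sections_def SU2_matrix_inv)

lemma section_derivative: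
  assumes "\<phi> \<in> smooth_sections m" "p \<in> SU2" "q \<in> SU2"
  shows "((\<lambda>g. coeff (\<phi> g) k) has_derivative frechet_derivative (\<lambda>g. coeff (\<phi> g) k) (at (p, q) within Spin4)) (at (p, q) within Spin4)"
  using smooth_on_differentiable[OF smooth_sections_smooth[OF assms(1)]] assms(2,3) by (auto simp: Spin4_def)

lemma pvd_curve:
  assumes \<phi>: "\<phi> \<in> smooth n" and pq: "p \<in> SU2" "q \<in> SU2"
    and \<gamma>: "\<And>t. \<gamma> t \<in> Spin4" "\<gamma> 0 = (p, q)" "(\<gamma> has_vector_derivative (p ** su2_of X, 0)) (at 0)"
  shows "pvd (\<lambda>t. \<phi> (\<gamma> t)) (Ld n X \<phi> (p, q))"
  unfolding pvd_def
proof
  fix k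
  show "((\<lambda>t. coeff (\<phi> (\<gamma> t)) k) has_vector_derivative coeff (Ld n X \<phi> (p, q)) k) (at 0)"
  proof (cases "k \<le> n")
    case True
    then show ?thesis
      using curve_derivative[OF section_derivative[OF \<phi> pq, of k] \<gamma>] by (simp add: Ld_def coeff_sum_monom dSpin_def)
  next
    case False
    then have "coeff (\<phi> (\<gamma> t)) k = 0" for t
      by (intro V_coeff_zero[OF sections_in_V[OF smooth_sections_sections[OF \<phi>]]]) simp
    then show ?thesis using False by (simp add: Ld_def coeff_sum_monom)
  qed
qed

lemma pvd_left_circ:
  assumes \<phi>: "\<phi> \<in> smooth n" and pq: "p \<in> SU2" "q \<in> SU2"
  shows "pvd (\<lambda>t. \<phi> (p ** circ i t, q)) (Ld n (axis i 1) \<phi> (p, q))"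
proof (rule pvd_curve[OF \<phi> pq])
  show "((\<lambda>t. (p ** circ i t, q)) has_vector_derivative (p ** su2_of (axis i 1), 0)) (at 0)"
    using circ_derivative[of p i "mat 1"] by (intro has_vector_derivative_Pair) auto
qed (use pq in \<open>auto simp: Spin4_def circ_SU2 circ_0\<close>)

lemma Ld_linear:
  assumes \<phi>: "\<phi> \<in> smooth_sections m" and pq: "p \<in> SU2" "q \<in> SU2"
  shows "Ld n X \<phi> (p, q) = (\<Sum>j\<in>UNIV. smult (complex_of_real (X $ j)) (Ld n (axis j 1) \<phi> (p, q)))"
proof (rule poly_eqI)
  fix k
  let ?F = "frechet_derivative (\<lambda>g. coeff (\<phi> g) k) (at (p, q) within Spin4)"
  have "?F (p ** su2_of X, 0) = (\<Sum>j\<in>UNIV. X $ j *\<^sub>R ?F (p ** su2_of (axis j 1), 0))"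
    using linear_tangent_expand[OF has_derivative_linear[OF section_derivative[OF \<phi> pq, of k]], of p X q 0] by (simp add: su2_of_zero)
  then show "coeff (Ld n X \<phi> (p, q)) k = coeff (\<Sum>j\<in>UNIV. smult (complex_of_real (X $ j)) (Ld n (axis j 1) \<phi> (p, q))) k"
    by (simp add: Ld_def coeff_sum_monom dSpin_def coeff_sum scaleR_conv_of_real)
qed

lemma pvd_sum: "(\<And>i. i \<in> I \<Longrightarrow> pvd (P i) (P' i)) \<Longrightarrow> pvd (\<lambda>t. \<Sum>i\<in>I. P i t) (\<Sum>i\<in>I. P' i)"
  by (induction I rule: infinite_finite_induct) (auto intro: pvd_add pvd_const)

lemma pvd_smult: "pvd P P' \<Longrightarrow> pvd (\<lambda>t. smult c (P t)) (smult c P')"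
  by (auto simp: pvd_def intro: has_vector_derivative_mult_right)

lemma adjoint_circ: "adjoint_mat (circ i t) = cos t *\<^sub>R mat 1 - sin t *\<^sub>R su2_of (axis i 1)"
  by (simp add: mat2_eq_iff circ_def complex_eq_iff)

lemma pvd_rho_circ:
  assumes f: "f \<in> V (int n)"
  shows "pvd (\<lambda>t. rho (int n) (adjoint_mat (circ i t)) f) (- rho_zero (int n) (axis i 1) f)"
proof -
  let ?S = "su2_of (axis i 1)"
  have ent: "((\<lambda>t. adjoint_mat (circ i t) $ r $ c) has_vector_derivative - (?S $ r $ c)) (at 0)" for r c
    unfolding adjoint_circ mat2_diff_nth mat2_scale_nth by (auto intro!: derivative_eq_intros)
  have mon: "pvd (\<lambda>t. rho (int n) (adjoint_mat (circ i t)) (monom 1 k)) (- rho_zero (int n) (axis i 1) (monom 1 k))" if k: "k \<le> n" for k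
  proof -
    let ?P = "\<lambda>t. [:adjoint_mat (circ i t) $ 2 $ 2, adjoint_mat (circ i t) $ 1 $ 2:]"
      and ?Q = "\<lambda>t. [:adjoint_mat (circ i t) $ 2 $ 1, adjoint_mat (circ i t) $ 1 $ 1:]"
    have P: "pvd ?P [:- (?S $ 2 $ 2), - (?S $ 1 $ 2):]" and Q: "pvd ?Q [:- (?S $ 2 $ 1), - (?S $ 1 $ 1):]"
      by (intro pvd_linear_form ent)+
    have "pvd (\<lambda>t. ?P t ^ (n - k) * ?Q t ^ k) (?P 0 ^ (n - k) * smult (of_nat k) (?Q 0 ^ (k - 1) * [:- (?S $ 2 $ 1), - (?S $ 1 $ 1):])
      + smult (of_nat (n - k)) (?P 0 ^ (n - k - 1) * [:- (?S $ 2 $ 2), - (?S $ 1 $ 2):]) * ?Q 0 ^ k)"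
      by (intro pvd_mult pvd_power P Q)
    also have "(?P 0 ^ (n - k) * smult (of_nat k) (?Q 0 ^ (k - 1) * [:- (?S $ 2 $ 1), - (?S $ 1 $ 1):])
      + smult (of_nat (n - k)) (?P 0 ^ (n - k - 1) * [:- (?S $ 2 $ 2), - (?S $ 1 $ 2):]) * ?Q 0 ^ k)
      = - rho_zero (int n) (axis i 1) (monom 1 k)"
      using k unfolding rho_zero_eq
      by (intro poly_eqI2, cases k)
        (simp_all add: circ_0 poly_monom pderiv_monom of_nat_diff algebra_simps power2_eq_square)
    finally show ?thesis by (simp only: rho_monom)
  qed
  have "pvd (\<lambda>t. \<Sum>k\<le>n. smult (coeff f k) (rho (int n) (adjoint_mat (circ i t)) (monom 1 k)))
     (\<Sum>k\<le>n. smult (coeff f k) (- rho_zero (int n) (axis i 1) (monom 1 k)))"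
    by (intro pvd_sum pvd_smult mon) simp
  then show ?thesis
    by (simp add: plin_expand[OF plin_rho f, symmetric] plin_expand[OF plin_rho_zero f] sum_negf)
qed

text \<open>Equivariance determines the derivative along the fibres, where the action is \<open>\<rho>\<close> of the inverse.\<close>

lemma vertical_derivative:
  assumes \<phi>: "\<phi> \<in> smooth n" and pq: "p \<in> SU2" "q \<in> SU2"
    and F: "((\<lambda>g. coeff (\<phi> g) k) has_derivative F') (at (p, q) within Spin4)"
  shows "F' (p ** su2_of (axis i 1), q ** su2_of (axis i 1)) = - coeff (rho_zero (int n) (axis i 1) (\<phi> (p, q))) k"
proof -
  have "((\<lambda>t. coeff (\<phi> (p ** circ i t, q ** circ i t)) k) has_vector_derivative F' (p ** su2_of (axis i 1), q ** su2_of (axis i 1))) (at 0)"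
  proof (rule curve_derivative[OF F, of "\<lambda>t. (p ** circ i t, q ** circ i t)"])
    show "((\<lambda>t. (p ** circ i t, q ** circ i t)) has_vector_derivative (p ** su2_of (axis i 1), q ** su2_of (axis i 1))) (at 0)"
      using circ_derivative[of p i "mat 1"] circ_derivative[of q i "mat 1"] by (intro has_vector_derivative_Pair) auto
  qed (use pq in \<open>auto simp: Spin4_def circ_SU2 circ_0\<close>)
  moreover have "\<phi> (p ** circ i t, q ** circ i t) = rho (int n) (adjoint_mat (circ i t)) (\<phi> (p, q))" for t
    by (rule sections_equivariant[OF smooth_sections_sections[OF \<phi>] pq circ_SU2])
  ultimately show ?thesis
    using pvd_rho_circ[OF sections_in_V[OF smooth_sections_sections[OF \<phi>], of "(p, q)"], of i]
    by (auto simp: pvd_def intro!: vector_derivative_unique_at)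
qed

text \<open>The horizontal lift \<open>(p X / 2, - q X / 2)\<close> is \<open>(p X, 0)\<close> minus half of the vertical vector \<open>(p X, q X)\<close>.\<close>

lemma nabla_frame:
  assumes \<phi>: "\<phi> \<in> smooth n" and pq: "p \<in> SU2" "q \<in> SU2"
  shows "nabla (int n) \<phi> (p, q) (spin_frame (p, q) (axis i 1)) =
     Ld n (axis i 1) \<phi> (p, q) + smult (1 / 2) (rho_zero (int n) (axis i 1) (\<phi> (p, q)))"
proof (rule poly_eqI)
  fix k
  let ?e = "axis i 1 :: real ^ 3"
  let ?c = "coeff (rho_zero (int n) ?e (\<phi> (p, q))) k"
  show "coeff (nabla (int n) \<phi> (p, q) (spin_frame (p, q) ?e)) k =
    coeff (Ld n ?e \<phi> (p, q) + smult (1 / 2) (rho_zero (int n) ?e (\<phi> (p, q)))) k"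
  proof (cases "k \<le> n")
    case False
    then show ?thesis
      using V_coeff_zero[OF rho_zero_in_V[OF sections_in_V[OF smooth_sections_sections[OF \<phi>]]]]
      by (simp add: nabla_def Ld_def coeff_sum_monom)
  next
    case True
    define F' where "F' = frechet_derivative (\<lambda>g. coeff (\<phi> g) k) (at (p, q) within Spin4)"
    have F: "((\<lambda>g. coeff (\<phi> g) k) has_derivative F') (at (p, q) within Spin4)"
      unfolding F'_def by (rule section_derivative[OF \<phi> pq])
    have lin: "linear F'" using F by (rule has_derivative_linear)
    let ?l = "F' (p ** su2_of ?e, 0)" and ?r = "F' (0, q ** su2_of ?e)"
    have "(p ** su2_of ?e, q ** su2_of ?e) = (p ** su2_of ?e, 0) + (0, q ** su2_of ?e)" by simp
    then have "?l + ?r = - ?c"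
      using vertical_derivative[OF \<phi> pq F, of i] linear_add[OF lin] by metis
    then have r: "?r = - ?c - ?l" by (simp add: algebra_simps)
    have "(p ** su2_of (?e /\<^sub>R 2), q ** su2_of (- (?e /\<^sub>R 2))) =
       (1 / 2) *\<^sub>R (p ** su2_of ?e, 0) + (- 1 / 2) *\<^sub>R (0, q ** su2_of ?e)"
      by (simp add: su2_of_scaleR su2_of_minus mat2_scaleR_mult scaleR_Pair flip: scaleR_minus_left)
    then have "F' (p ** su2_of (?e /\<^sub>R 2), q ** su2_of (- (?e /\<^sub>R 2))) = (1 / 2) *\<^sub>R ?l + (- 1 / 2) *\<^sub>R ?r"
      by (simp only: linear_add[OF lin] linear_cmul[OF lin])
    also have "\<dots> = ?l + ?c / 2"
      unfolding r by (simp add: scaleR_conv_of_real field_simps)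
    finally show ?thesis
      using True by (simp add: nabla_def Ld_def coeff_sum_monom horizontal_lift_frame[OF pq] dSpin_def F'_def)
  qed
qed

section \<open>The Dirac operators as invariant operators\<close>

text \<open>
  The first order operator with symbol \<open>R\<close> in which \<open>\<nabla>\<close> is replaced by left-invariant derivatives. It differs from the
  Dirac operator by a term of order zero.
\<close>

definition Dop :: "(real ^ 3 \<Rightarrow> complex poly \<Rightarrow> complex poly) \<Rightarrow> nat \<Rightarrow> sect \<Rightarrow> sect" where
  "Dop R n \<phi> = (\<lambda>g. if g \<in> Spin4 then \<Sum>i\<in>UNIV. R (axis i 1) (Ld n (axis i 1) \<phi> g) else 0)"

lemma dirac_of_eq:
  assumes \<phi>: "\<phi> \<in> smooth n" and R: "\<And>X. plin (R X)"
  shows "dirac_of R (int n) \<phi> = (\<lambda>g. Dop R n \<phi> g + (if g \<in> Spin4 then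
      smult (1 / 2) (\<Sum>i\<in>UNIV. R (axis i 1) (rho_zero (int n) (axis i 1) (\<phi> g))) else 0))"
proof (rule ext, clarify)
  fix p q
  show "dirac_of R (int n) \<phi> (p, q) = Dop R n \<phi> (p, q) + (if (p, q) \<in> Spin4 then
      smult (1 / 2) (\<Sum>i\<in>UNIV. R (axis i 1) (rho_zero (int n) (axis i 1) (\<phi> (p, q)))) else 0)"
  proof (cases "(p, q) \<in> Spin4")
    case True
    then have pq: "p \<in> SU2" "q \<in> SU2" by (auto simp: Spin4_def)
    show ?thesis
      using True by (simp add: dirac_of_def Dop_def nabla_frame[OF \<phi> pq] plin_add[OF R] plin_smult[OF R] sum.distrib smult_sum_right)
  qed (simp add: dirac_of_def Dop_def)
qed

lemma D_plus_eq: "\<phi> \<in> smooth n \<Longrightarrow> D_plus (int n) \<phi> = Dop (rho_plus (int n)) n \<phi>"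
  by (simp add: D_plus_def dirac_of_eq plin_rho_plus sum_rho_plus_zero cong: if_cong)

lemma D_minus_eq: "\<phi> \<in> smooth n \<Longrightarrow> D_minus (int n) \<phi> = Dop (rho_minus (int n)) n \<phi>"
  by (simp add: D_minus_def dirac_of_eq plin_rho_minus sum_rho_minus_zero cong: if_cong)

lemma D_zero_eq:
  assumes "\<phi> \<in> smooth n"
  shows "D_zero (int n) \<phi> = Dop (rho_zero (int n)) n \<phi> + sec_scale (- of_nat n * (of_nat n + 2) / 2) \<phi>"
proof -
  have "\<phi> g = 0" if "g \<notin> Spin4" for g
    using sections_outside[OF smooth_sections_sections[OF assms] that] .
  then show ?thesis
    unfolding D_zero_def dirac_of_eq[OF assms plin_rho_zero] sum_rho_zero_zero
    by (auto simp: fun_eq_iff sec_scale_def)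
qed

definition clifford :: "(real ^ 3 \<Rightarrow> complex poly \<Rightarrow> complex poly) \<Rightarrow> nat \<Rightarrow> int \<Rightarrow> bool" where
  "clifford R n m \<longleftrightarrow> (\<forall>X. plin (R X)) \<and> (\<forall>X Y f. R (X + Y) f = R X f + R Y f) \<and>
     (\<forall>r X f. R (r *\<^sub>R X) f = smult (complex_of_real r) (R X f)) \<and>
     (\<forall>X. \<forall>f\<in>V (int n). R X f \<in> V m) \<and>
     (\<forall>h\<in>SU2. \<forall>X. \<forall>f\<in>V (int n). R (Ad h X) (rho (int n) h f) = rho m h (R X f))"

lemma clifford_zero: "clifford (rho_zero (int n)) n (int n)"
  and clifford_plus: "clifford (rho_plus (int n)) n (int n + 2)"
  and clifford_minus: "clifford (rho_minus (int n)) n (int n - 2)"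
  by (auto simp: clifford_def plin_rho_zero plin_rho_plus plin_rho_minus rho_zero_in_V rho_plus_in_V rho_minus_in_V
      rho_zero_equivariant rho_plus_equivariant rho_minus_equivariant)
    (simp_all add: rho_zero_def rho_plus_def rho_minus_def cliff_ext_add cliff_ext_scaleR)

lemma clifford_expand:
  assumes "clifford R n m"
  shows "R X f = (\<Sum>j\<in>UNIV. smult (complex_of_real (X $ j)) (R (axis j 1) f))"
proof -
  have "X = (\<Sum>j\<in>UNIV. X $ j *\<^sub>R axis j 1)"
    by (simp add: sum_3 vec_eq_iff forall_3 axis3_nth)
  then have "R X f = R (\<Sum>j\<in>UNIV. X $ j *\<^sub>R axis j 1) f" by simp
  then show ?thesis using assms by (simp add: clifford_def sum_3)
qed

lemma su2_norm: "det (su2_of X) = complex_of_real (norm X ^ 2)"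
proof -
  have "norm X ^ 2 = X $ 1 ^ 2 + X $ 2 ^ 2 + X $ 3 ^ 2"
    by (simp add: norm_vec_def L2_set_def sum_3)
  then show ?thesis
    by (simp add: det_2 complex_eq_iff power2_eq_square algebra_simps)
qed

lemma Ad_linear: "h \<in> SU2 \<Longrightarrow> linear (Ad h)"
  by (rule linearI; rule su2_of_inject[THEN iffD1])
    (simp_all add: su2_of_Ad su2_of_add su2_of_scaleR mat2_add_mult mat2_scaleR_mult)

lemma Ad_orthogonal_rows:
  assumes h: "h \<in> SU2"
  shows "(\<Sum>i\<in>UNIV. Ad h (axis i 1) $ j * Ad h (axis i 1) $ k) = (if j = k then 1 else 0)"
proof -
  have "norm (Ad h X) = norm X" for X
  proof -
    have "det (su2_of (Ad h X)) = det (su2_of X)"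
      using h SU2_adjoint[OF h] by (simp add: su2_of_Ad det_mul SU2_def del: SU2_adjoint)
    then have "norm (Ad h X) ^ 2 = norm X ^ 2" by (simp only: su2_norm of_real_eq_iff)
    then show ?thesis by simp
  qed
  then have "orthogonal_transformation (Ad h)" using Ad_linear[OF h] by (simp add: orthogonal_transformation)
  then have "matrix (Ad h) ** transpose (matrix (Ad h)) = mat 1"
    using orthogonal_transformation_matrix orthogonal_matrix_def by blast
  then have "(matrix (Ad h) ** transpose (matrix (Ad h))) $ j $ k = (mat 1 :: real ^ 3 ^ 3) $ j $ k" by simp
  then show ?thesis by (simp add: matrix_matrix_mult_def matrix_def transpose_def mat_def)
qed

text \<open>Sums over the frame do not change when the orthonormal frame is rotated.\<close>

lemma clifford_sum_rotate:
  assumes R: "clifford R n m" and h: "h \<in> SU2" and L: "\<And>X. L X = (\<Sum>j\<in>UNIV. smult (complex_of_real (X $ j)) (L (axis j 1)))"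
  shows "(\<Sum>i\<in>UNIV. R (Ad h (axis i 1)) (L (Ad h (axis i 1)))) = (\<Sum>i\<in>UNIV. R (axis i 1) (L (axis i 1)))"
proof -
  let ?a = "\<lambda>j i. complex_of_real (Ad h (axis i 1) $ j)"
  have lin: "plin (R X)" for X using R by (simp add: clifford_def)
  have "R (Ad h (axis i 1)) (L (Ad h (axis i 1))) = (\<Sum>j\<in>UNIV. \<Sum>k\<in>UNIV. smult (?a j i * ?a k i) (R (axis j 1) (L (axis k 1))))" for i
    unfolding clifford_expand[OF R, of "Ad h (axis i 1)"] L[of "Ad h (axis i 1)"]
    by (simp only: plin_sum[OF lin] plin_smult[OF lin] smult_sum_right smult_smult)
  then have "(\<Sum>i\<in>UNIV. R (Ad h (axis i 1)) (L (Ad h (axis i 1)))) =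
     (\<Sum>i\<in>UNIV. \<Sum>j\<in>UNIV. \<Sum>k\<in>UNIV. smult (?a j i * ?a k i) (R (axis j 1) (L (axis k 1))))" by simp
  also have "\<dots> = (\<Sum>j\<in>UNIV. \<Sum>k\<in>UNIV. smult (\<Sum>i\<in>UNIV. ?a j i * ?a k i) (R (axis j 1) (L (axis k 1))))"
    unfolding smult_sum by (subst sum.swap) (rule sum.cong[OF refl], rule sum.swap)
  also have "\<dots> = (\<Sum>j\<in>UNIV. \<Sum>k\<in>UNIV. smult (if j = k then 1 else 0) (R (axis j 1) (L (axis k 1))))"
    using Ad_orthogonal_rows[OF h] by (simp flip: of_real_mult of_real_sum) (simp add: if_distrib cong: if_cong)
  also have "\<dots> = (\<Sum>i\<in>UNIV. R (axis i 1) (L (axis i 1)))"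
    by (simp add: sum_3)
  finally show ?thesis .
qed

lemma Ld_equivariant:
  assumes \<phi>: "\<phi> \<in> smooth n" and pq: "p \<in> SU2" "q \<in> SU2" and h: "h \<in> SU2"
  shows "Ld n (axis i 1) \<phi> (p ** h, q ** h) = rho (int n) (adjoint_mat h) (Ld n (Ad h (axis i 1)) \<phi> (p, q))"
proof (rule pvd_unique)
  let ?\<gamma> = "\<lambda>t. (p ** h ** circ i t ** adjoint_mat h, q)"
  have \<gamma>: "?\<gamma> t \<in> Spin4" for t using pq h by (auto simp: Spin4_def circ_SU2)
  have c: "p ** h ** circ i t ** adjoint_mat h ** h = p ** h ** circ i t" for t
    using h by (simp add: matrix_mul_assoc[symmetric] SU2_adjoint_left)
  show "pvd (\<lambda>t. \<phi> (p ** h ** circ i t, q ** h)) (Ld n (axis i 1) \<phi> (p ** h, q ** h))"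
    by (rule pvd_left_circ[OF \<phi>]) (use pq h in auto)
  have "pvd (\<lambda>t. \<phi> (?\<gamma> t)) (Ld n (Ad h (axis i 1)) \<phi> (p, q))"
  proof (rule pvd_curve[OF \<phi> pq \<gamma>])
    show "(p ** h ** circ i 0 ** adjoint_mat h, q) = (p, q)"
      using h by (simp add: circ_0 matrix_mul_assoc[symmetric] SU2_adjoint_right)
    have "p ** h ** su2_of (axis i 1) ** adjoint_mat h = p ** su2_of (Ad h (axis i 1))"
      using h by (simp add: su2_of_Ad matrix_mul_assoc)
    then show "(?\<gamma> has_vector_derivative (p ** su2_of (Ad h (axis i 1)), 0)) (at 0)"
      using circ_derivative[of "p ** h" i "adjoint_mat h"] by (intro has_vector_derivative_Pair) auto
  qed
  then have "pvd (\<lambda>t. rho (int n) (adjoint_mat h) (\<phi> (?\<gamma> t))) (rho (int n) (adjoint_mat h) (Ld n (Ad h (axis i 1)) \<phi> (p, q)))"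
    by (rule pvd_plin[OF _ plin_rho sections_in_V[OF smooth_sections_sections[OF \<phi>]] Ld_in_V])
  moreover have "rho (int n) (adjoint_mat h) (\<phi> (?\<gamma> t)) = \<phi> (p ** h ** circ i t, q ** h)" for t
    using sections_equivariant[OF smooth_sections_sections[OF \<phi>], of "p ** h ** circ i t ** adjoint_mat h" q h] pq h
    by (simp add: c circ_SU2)
  ultimately show "pvd (\<lambda>t. \<phi> (p ** h ** circ i t, q ** h)) (rho (int n) (adjoint_mat h) (Ld n (Ad h (axis i 1)) \<phi> (p, q)))"
    by simp
qed

lemma smooth_on_left_derivative:
  assumes F: "smooth_on Spin4 F"
  shows "smooth_on Spin4 (\<lambda>g. dSpin F g (fst g ** su2_of X, 0) :: complex)"
  unfolding smooth_on_def
proof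
  fix g assume g: "g \<in> Spin4"
  obtain G U where G: "open U" "g \<in> U" "\<forall>n. Ck_on n U G"
    "\<forall>y\<in>U \<inter> Spin4. (F has_derivative frechet_derivative G (at y)) (at y within Spin4)"
    using smooth_on_has_derivative[OF F g] by metis
  let ?H = "\<lambda>y. \<Sum>b\<in>Basis. complex_of_real ((fst y ** su2_of X, 0) \<bullet> b) * frechet_derivative G (at y) b"
  have "bounded_linear (\<lambda>y :: mat2 \<times> mat2. complex_of_real ((fst y ** su2_of X, 0 :: mat2) \<bullet> b))" for b
  proof -
    have "linear (\<lambda>y :: mat2 \<times> mat2. complex_of_real ((fst y ** su2_of X, 0 :: mat2) \<bullet> b))"
      by (rule linearI) (simp_all add: inner_prod_def mat2_add_mult mat2_scaleR_mult inner_add_left of_real_def scaleR_add_left)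
    then show ?thesis by (simp add: linear_linear)
  qed
  then have "Ck_on n U ?H" for n
    by (intro Ck_on_sum[OF G(1)] Ck_on_mult[OF G(1) Ck_on_bounded_linear[OF G(1)] Ck_on_derivative[OF G(3)[rule_format]]])
  moreover have "?H y = dSpin F y (fst y ** su2_of X, 0)" if y: "y \<in> U \<inter> Spin4" for y
  proof -
    obtain p q where pq: "y = (p, q)" "p \<in> SU2" "q \<in> SU2" using y by (auto simp: Spin4_def)
    have lin: "linear (frechet_derivative G (at y))" using G(4) y by (auto dest: has_derivative_linear)
    have "dSpin F y (fst y ** su2_of X, 0) = frechet_derivative G (at y) (fst y ** su2_of X, 0)"
      using dSpin_eq_left[OF _ pq(2,3)] G(4) y pq by auto
    also have "\<dots> = frechet_derivative G (at y) (\<Sum>b\<in>Basis. ((fst y ** su2_of X, 0) \<bullet> b) *\<^sub>R b)"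
      by (simp only: euclidean_representation)
    also have "\<dots> = ?H y" by (simp only: linear_sum[OF lin] linear_cmul[OF lin] scaleR_conv_of_real)
    finally show ?thesis ..
  qed
  ultimately show "\<exists>U H. open U \<and> g \<in> U \<and> (\<forall>n. Ck_on n U H) \<and> (\<forall>y\<in>U \<inter> Spin4. H y = dSpin F y (fst y ** su2_of X, 0))"
    using G(1,2) by blast
qed

lemma smooth_on_coeff_plin:
  assumes "\<And>k. smooth_on S (\<lambda>g. coeff (F g) k)" "plin L" "\<And>g. g \<in> S \<Longrightarrow> F g \<in> V (int n)"
  shows "smooth_on S (\<lambda>g. coeff (L (F g)) k)"
proof (rule smooth_on_cong)
  show "smooth_on S (\<lambda>g. \<Sum>j\<le>n. coeff (F g) j * coeff (L (monom 1 j)) k)"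
    by (intro smooth_on_sum smooth_on_mult assms(1) smooth_on_const)
  fix g assume "g \<in> S"
  then show "(\<Sum>j\<le>n. coeff (F g) j * coeff (L (monom 1 j)) k) = coeff (L (F g)) k"
    by (simp add: plin_expand[OF assms(2) assms(3)] coeff_sum)
qed

lemma Dop_smooth_sections:
  assumes R: "clifford R n m" and \<phi>: "\<phi> \<in> smooth n"
  shows "Dop R n \<phi> \<in> smooth_sections m"
proof -
  have lin: "plin (R X)" for X using R by (simp add: clifford_def)
  have RV: "R X f \<in> V m" if "f \<in> V (int n)" for X f using R that by (simp add: clifford_def)
  have eqv: "Dop R n \<phi> (p ** h, q ** h) = rho m (adjoint_mat h) (Dop R n \<phi> (p, q))"
    if pq: "p \<in> SU2" "q \<in> SU2" and h: "h \<in> SU2" for p q h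
  proof -
    have Ad: "Ad (adjoint_mat h) (Ad h X) = X" for X
    proof -
      have "su2_of (Ad (adjoint_mat h) (Ad h X)) = (adjoint_mat h ** h) ** su2_of X ** (adjoint_mat h ** h)"
        using h by (simp add: su2_of_Ad matrix_mul_assoc)
      then show ?thesis using h by (simp add: SU2_adjoint_left su2_of_inject)
    qed
    have "Dop R n \<phi> (p ** h, q ** h) = (\<Sum>i\<in>UNIV. R (axis i 1) (rho (int n) (adjoint_mat h) (Ld n (Ad h (axis i 1)) \<phi> (p, q))))"
      using pq h by (simp add: Dop_def Spin4_def Ld_equivariant[OF \<phi>])
    also have "\<dots> = (\<Sum>i\<in>UNIV. rho m (adjoint_mat h) (R (Ad h (axis i 1)) (Ld n (Ad h (axis i 1)) \<phi> (p, q))))"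
      using R SU2_adjoint[OF h] Ld_in_V unfolding clifford_def by (metis (no_types, lifting) Ad)
    also have "\<dots> = rho m (adjoint_mat h) (\<Sum>i\<in>UNIV. R (Ad h (axis i 1)) (Ld n (Ad h (axis i 1)) \<phi> (p, q)))"
      by (simp add: plin_sum[OF plin_rho])
    also have "(\<Sum>i\<in>UNIV. R (Ad h (axis i 1)) (Ld n (Ad h (axis i 1)) \<phi> (p, q))) = Dop R n \<phi> (p, q)"
      using clifford_sum_rotate[OF R h, of "\<lambda>X. Ld n X \<phi> (p, q)", OF Ld_linear[OF \<phi> pq]] pq by (simp add: Dop_def Spin4_def)
    finally show ?thesis .
  qed
  have "smooth_on Spin4 (\<lambda>g. coeff (Ld n X \<phi> g) j)" for X j
    unfolding Ld_def coeff_sum_monom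
    by (cases "j \<le> n") (auto intro: smooth_on_const smooth_on_left_derivative smooth_sections_smooth[OF \<phi>])
  then have "smooth_on Spin4 (\<lambda>g. \<Sum>i\<in>UNIV. coeff (R (axis i 1) (Ld n (axis i 1) \<phi> g)) k)" for k
    by (intro smooth_on_sum smooth_on_coeff_plin[OF _ lin]) (auto intro: Ld_in_V)
  then have "smooth_on Spin4 (\<lambda>g. coeff (Dop R n \<phi> g) k)" for k
    by (rule smooth_on_cong) (simp add: Dop_def coeff_sum)
  moreover have "Dop R n \<phi> g \<in> V m" for g by (auto simp: Dop_def intro!: V_sum RV Ld_in_V)
  ultimately show ?thesis
    using eqv by (auto simp: smooth_sections_def sections_def SU2_matrix_inv) (simp add: Dop_def)
qed

lemma sections_add: "\<phi> \<in> sections m \<Longrightarrow> \<psi> \<in> sections m \<Longrightarrow> \<phi> + \<psi> \<in> sections m"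
  and sections_scale: "\<phi> \<in> sections m \<Longrightarrow> sec_scale c \<phi> \<in> sections m"
  by (auto simp: sections_def sec_scale_def V_add V_smult plin_add[OF plin_rho] plin_smult[OF plin_rho])

lemma sections_zero: "0 \<in> sections m"
  by (auto simp: sections_def plin_zero[OF plin_rho])

lemma smooth_sections_add: "\<phi> \<in> smooth_sections m \<Longrightarrow> \<psi> \<in> smooth_sections m \<Longrightarrow> \<phi> + \<psi> \<in> smooth_sections m"
  and smooth_sections_scale: "\<phi> \<in> smooth_sections m \<Longrightarrow> sec_scale c \<phi> \<in> smooth_sections m"
  by (auto simp: smooth_sections_def sections_add sections_scale smooth_on_add)
    (auto simp: sec_scale_def intro: smooth_on_mult smooth_on_const)

lemma smooth_sections_zero: "0 \<in> smooth_sections m"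
  by (auto simp: smooth_sections_def sections_zero smooth_on_const)

lemma smooth_sections_sum:
  fixes \<phi> :: "'i \<Rightarrow> sect"
  shows "(\<And>i. i \<in> I \<Longrightarrow> \<phi> i \<in> smooth_sections m) \<Longrightarrow> (sum \<phi> I :: sect) \<in> smooth_sections m"
  by (induction I rule: infinite_finite_induct) (auto simp: smooth_sections_zero smooth_sections_add)

lemma D_plus_smooth: "\<phi> \<in> smooth n \<Longrightarrow> D_plus (int n) \<phi> \<in> smooth_sections (int n + 2)"
  and D_minus_smooth: "\<phi> \<in> smooth n \<Longrightarrow> D_minus (int n) \<phi> \<in> smooth_sections (int n - 2)"
  by (simp_all add: D_plus_eq D_minus_eq Dop_smooth_sections clifford_plus clifford_minus)

lemma D_zero_smooth: "\<phi> \<in> smooth n \<Longrightarrow> D_zero (int n) \<phi> \<in> smooth n"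
  by (subst D_zero_eq, assumption, intro smooth_sections_add smooth_sections_scale Dop_smooth_sections clifford_zero)

lemma Ld_add:
  assumes \<phi>: "\<phi> \<in> smooth_sections m" "\<psi> \<in> smooth_sections m" and g: "g \<in> Spin4"
  shows "Ld n X (\<phi> + \<psi>) g = Ld n X \<phi> g + Ld n X \<psi> g"
proof (rule poly_eqI)
  obtain p q where pq: "g = (p, q)" "p \<in> SU2" "q \<in> SU2" using g by (auto simp: Spin4_def)
  fix k
  show "coeff (Ld n X (\<phi> + \<psi>) g) k = coeff (Ld n X \<phi> g + Ld n X \<psi> g) k"
    using dSpin_eq_left[OF has_derivative_add[OF section_derivative[OF \<phi>(1) pq(2,3), of k] section_derivative[OF \<phi>(2) pq(2,3), of k]] pq(2,3), of X]
    by (simp add: Ld_def coeff_sum_monom pq(1) dSpin_def)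
qed

lemma Ld_scale:
  assumes \<phi>: "\<phi> \<in> smooth_sections m" and g: "g \<in> Spin4"
  shows "Ld n X (sec_scale c \<phi>) g = smult c (Ld n X \<phi> g)"
proof (rule poly_eqI)
  obtain p q where pq: "g = (p, q)" "p \<in> SU2" "q \<in> SU2" using g by (auto simp: Spin4_def)
  fix k
  show "coeff (Ld n X (sec_scale c \<phi>) g) k = coeff (smult c (Ld n X \<phi> g)) k"
    using dSpin_eq_left[OF has_derivative_mult_right[OF section_derivative[OF \<phi> pq(2,3), of k]] pq(2,3), of c X]
    by (simp add: Ld_def coeff_sum_monom pq(1) dSpin_def sec_scale_def)
qed

lemma Dop_add:
  assumes "\<And>X. plin (R X)" "\<phi> \<in> smooth_sections m" "\<psi> \<in> smooth_sections m"
  shows "Dop R n (\<phi> + \<psi>) = Dop R n \<phi> + Dop R n \<psi>"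
  by (rule ext) (simp add: Dop_def Ld_add[OF assms(2,3)] plin_add[OF assms(1)] sum.distrib)

lemma sec_scale_apply: "sec_scale c \<phi> g = smult c (\<phi> g)"
  by (simp add: sec_scale_def)

lemma Dop_scale:
  assumes "\<And>X. plin (R X)" "\<phi> \<in> smooth_sections m"
  shows "Dop R n (sec_scale c \<phi>) = sec_scale c (Dop R n \<phi>)"
  by (rule ext) (simp add: Dop_def Ld_scale[OF assms(2)] plin_smult[OF assms(1)] sec_scale_apply smult_sum_right)

text \<open>Derivatives are additive only on smooth sections, so linearity has to be restricted to them.\<close>

definition sec_linear :: "int \<Rightarrow> int \<Rightarrow> (sect \<Rightarrow> sect) \<Rightarrow> bool" where
  "sec_linear m m' P \<longleftrightarrow> (\<forall>\<phi>\<in>smooth_sections m. P \<phi> \<in> smooth_sections m') \<and>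
     (\<forall>\<phi>\<in>smooth_sections m. \<forall>\<psi>\<in>smooth_sections m. P (\<phi> + \<psi>) = P \<phi> + P \<psi>) \<and>
     (\<forall>c. \<forall>\<phi>\<in>smooth_sections m. P (sec_scale c \<phi>) = sec_scale c (P \<phi>))"

lemma sec_linear_D_plus: "sec_linear (int n) (int n + 2) (D_plus (int n))"
  unfolding sec_linear_def
  by (intro conjI ballI allI, erule D_plus_smooth)
    (simp_all add: smooth_sections_add smooth_sections_scale D_plus_eq Dop_add[OF plin_rho_plus] Dop_scale[OF plin_rho_plus])

lemma sec_linear_D_minus: "sec_linear (int n) (int n - 2) (D_minus (int n))"
  unfolding sec_linear_def
  by (intro conjI ballI allI, erule D_minus_smooth)
    (simp_all add: smooth_sections_add smooth_sections_scale D_minus_eq Dop_add[OF plin_rho_minus] Dop_scale[OF plin_rho_minus])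

lemma sec_linear_D_zero: "sec_linear (int n) (int n) (D_zero (int n))"
  unfolding sec_linear_def
  by (intro conjI ballI allI, erule D_zero_smooth)
    (simp_all add: smooth_sections_add smooth_sections_scale D_zero_eq
      Dop_add[OF plin_rho_zero] Dop_scale[OF plin_rho_zero] sec.scale_right_distrib sec.scale_right_diff_distrib algebra_simps)

lemma sec_linear_comp: "sec_linear m m' P \<Longrightarrow> sec_linear m' m'' Q \<Longrightarrow> sec_linear m m'' (Q \<circ> P)"
  by (simp add: sec_linear_def)

lemma sec_linear_zero: "sec_linear m m' P \<Longrightarrow> P 0 = 0"
  using smooth_sections_zero[of m] unfolding sec_linear_def by (metis sec.scale_zero_left)

lemma sec_linear_sum:
  fixes \<phi> :: "'i \<Rightarrow> sect"
  assumes "sec_linear m m' P" "finite I" "\<And>i. i \<in> I \<Longrightarrow> \<phi> i \<in> smooth_sections m"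
  shows "P (\<Sum>i\<in>I. \<phi> i :: sect) = (\<Sum>i\<in>I. P (\<phi> i) :: sect)"
  using assms(2,3)
proof (induction I rule: finite_induct)
  case (insert x I)
  then have "sum \<phi> I \<in> smooth_sections m" "\<phi> x \<in> smooth_sections m" by (auto intro: smooth_sections_sum)
  then have "P (\<phi> x + sum \<phi> I) = P (\<phi> x) + P (sum \<phi> I)" using assms(1) unfolding sec_linear_def by blast
  then show ?case using insert by (simp only: sum.insert insert_iff simp_thms)
qed (simp add: sec_linear_zero[OF assms(1)])

section \<open>The Dirac operators on the explicit components\<close>

lemma Ck_on_coeff_mult:
  fixes P Q :: "'a :: real_normed_vector \<Rightarrow> complex poly"
  assumes "\<And>k n. Ck_on n UNIV (\<lambda>g. coeff (P g) k)" "\<And>k n. Ck_on n UNIV (\<lambda>g. coeff (Q g) k)"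
  shows "Ck_on n UNIV (\<lambda>g. coeff (P g * Q g) k)"
  unfolding coeff_mult by (intro Ck_on_sum Ck_on_mult open_UNIV assms)

lemma Ck_on_coeff_power:
  fixes P :: "'a :: real_normed_vector \<Rightarrow> complex poly"
  assumes "\<And>k n. Ck_on n UNIV (\<lambda>g. coeff (P g) k)"
  shows "Ck_on n UNIV (\<lambda>g. coeff (P g ^ j) k)"
proof (induction j arbitrary: n k)
  case 0
  then show ?case by (simp only: power_0) (rule Ck_on_const[OF open_UNIV])
next
  case (Suc j)
  then show ?case unfolding power_Suc by (intro Ck_on_coeff_mult assms)
qed

lemma Ck_on_coeff_linear_form:
  fixes a b :: "'a :: real_normed_vector \<Rightarrow> complex"
  assumes "\<And>n. Ck_on n UNIV a" "\<And>n. Ck_on n UNIV b"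
  shows "Ck_on n UNIV (\<lambda>g. coeff [:a g, b g:] k)"
proof -
  consider "k = 0" | "k = 1" | j where "k = Suc (Suc j)" by (metis One_nat_def not0_implies_Suc)
  then show ?thesis by cases (simp_all add: assms coeff_pCons Ck_on_const)
qed

lemma Ck_on_rho:
  assumes h: "\<And>i j n. Ck_on n UNIV (\<lambda>g. h g $ i $ j)" and f: "f \<in> V (int m)"
  shows "Ck_on n UNIV (\<lambda>g. coeff (rho (int m) (h g) f) k)"
  unfolding plin_expand[OF plin_rho f] rho_monom coeff_sum coeff_smult
  by (intro Ck_on_sum Ck_on_mult Ck_on_const Ck_on_coeff_mult Ck_on_coeff_power Ck_on_coeff_linear_form h open_UNIV)

lemma Ck_on_adjoint_entries:
  "Ck_on n UNIV (\<lambda>g :: mat2 \<times> mat2. adjoint_mat (fst g) $ i $ j)"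
  "Ck_on n UNIV (\<lambda>g :: mat2 \<times> mat2. adjoint_mat (snd g) $ i $ j)"
proof -
  have "linear (\<lambda>g :: mat2 \<times> mat2. adjoint_mat (fst g) $ i $ j)" "linear (\<lambda>g :: mat2 \<times> mat2. adjoint_mat (snd g) $ i $ j)"
    by (auto intro!: linearI simp: complex_eq_iff)
  then show "Ck_on n UNIV (\<lambda>g :: mat2 \<times> mat2. adjoint_mat (fst g) $ i $ j)"
    "Ck_on n UNIV (\<lambda>g :: mat2 \<times> mat2. adjoint_mat (snd g) $ i $ j)"
    by (auto intro!: Ck_on_bounded_linear simp: linear_linear)
qed

lemma Ck_on_coeff_monom:
  fixes c :: "'a :: real_normed_vector \<Rightarrow> complex"
  assumes "Ck_on n UNIV c"
  shows "Ck_on n UNIV (\<lambda>g. coeff (monom (c g) j) k)"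
  using assms by (cases "j = k") (simp_all add: coeff_monom Ck_on_const)

lemma bsec_smooth:
  assumes f: "f \<in> V (int (A + r))" and g: "g \<in> V (int (B + r))"
  shows "bsec A B r f g \<in> smooth (A + B)"
proof -
  let ?T = "\<lambda>x. transvectant A B r (rho (int (A + r)) (adjoint_mat (fst x)) f) (rho (int (B + r)) (adjoint_mat (snd x)) g)"
  have "smooth_on Spin4 (\<lambda>x. coeff (bsec A B r f g x) k)" for k
  proof (rule smooth_on_extensionI)
    show "Ck_on n UNIV (\<lambda>x. coeff (?T x) k)" for n
      unfolding transvectant_def coeff_sum ncoeff_def divide_inverse
      by (intro Ck_on_sum Ck_on_coeff_monom Ck_on_mult Ck_on_const Ck_on_rho Ck_on_adjoint_entries f g open_UNIV)
    fix x assume "x \<in> Spin4"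
    then show "coeff (?T x) k = coeff (bsec A B r f g x) k" by (cases x) (simp add: bsec_def del: of_nat_add)
  qed
  then show ?thesis using bsec_in_sections[OF f g] by (simp add: smooth_sections_def)
qed

lemma Ld_bsec:
  assumes f: "f \<in> V (int (A + r))" and g: "g \<in> V (int (B + r))" and pq: "p \<in> SU2" "q \<in> SU2"
  shows "Ld (A + B) (axis i 1) (bsec A B r f g) (p, q) = - transvectant A B r
     (rho_zero (int (A + r)) (axis i 1) (rho (int (A + r)) (adjoint_mat p) f)) (rho (int (B + r)) (adjoint_mat q) g)"
proof (rule pvd_unique[OF pvd_left_circ[OF bsec_smooth[OF f g] pq]])
  let ?x = "rho (int (A + r)) (adjoint_mat p) f" and ?y = "rho (int (B + r)) (adjoint_mat q) g"
  have x: "?x \<in> V (int (A + r))" by (rule rho_in_V[OF f])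
  have zx: "- rho_zero (int (A + r)) (axis i 1) ?x \<in> V (int (A + r))"
    using V_smult[OF rho_zero_in_V[OF x, of "axis i 1"], of "-1"] by simp
  have "pvd (\<lambda>t. transvectant A B r (rho (int (A + r)) (adjoint_mat (circ i t)) ?x) ?y)
     (transvectant A B r (- rho_zero (int (A + r)) (axis i 1) ?x) ?y)"
    by (rule pvd_plin[OF pvd_rho_circ[OF x] plin_transvectant_left rho_in_V[OF x] zx])
  moreover have "bsec A B r f g (p ** circ i t, q) = transvectant A B r (rho (int (A + r)) (adjoint_mat (circ i t)) ?x) ?y" for t
    using pq circ_SU2[of i t] by (simp add: bsec_apply rho_right_translate[OF _ _ f] del: of_nat_add)
  moreover have "transvectant A B r (- z) ?y = - transvectant A B r z ?y" for z
    using transvectant_smult_left[of A B r "-1" z ?y] by simp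
  ultimately show "pvd (\<lambda>t. bsec A B r f g (p ** circ i t, q)) (- transvectant A B r (rho_zero (int (A + r)) (axis i 1) ?x) ?y)"
    by (simp del: of_nat_add)
qed

text \<open>The left-invariant derivative only acts on the first argument of the transvectant.\<close>

lemma Dop_bsec:
  assumes R: "\<And>X. plin (R X)" and f: "f \<in> V (int (A + r))" and g: "g \<in> V (int (B + r))"
    and T: "\<And>x y. x \<in> V (int (A + r)) \<Longrightarrow> y \<in> V (int (B + r)) \<Longrightarrow>
      (\<Sum>i\<in>UNIV. R (axis i 1) (transvectant A B r (rho_zero (int (A + r)) (axis i 1) x) y)) = smult (- c) (T x y)"
  shows "Dop R (A + B) (bsec A B r f g) = (\<lambda>(p, q). if (p, q) \<in> Spin4
     then smult c (T (rho (int (A + r)) (adjoint_mat p) f) (rho (int (B + r)) (adjoint_mat q) g)) else 0)"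
proof (rule ext, clarify)
  fix p q
  show "Dop R (A + B) (bsec A B r f g) (p, q) = (if (p, q) \<in> Spin4
     then smult c (T (rho (int (A + r)) (adjoint_mat p) f) (rho (int (B + r)) (adjoint_mat q) g)) else 0)"
  proof (cases "(p, q) \<in> Spin4")
    case True
    then have pq: "p \<in> SU2" "q \<in> SU2" by (auto simp: Spin4_def)
    have neg: "R X (- z) = - R X z" for X z using plin_smult[OF R, of X "-1" z] by simp
    show ?thesis
      using T[OF rho_in_V[OF f, of "adjoint_mat p"] rho_in_V[OF g, of "adjoint_mat q"]] True
      by (simp add: Dop_def Ld_bsec[OF f g pq] neg sum_negf del: of_nat_add)
  qed (simp add: Dop_def)
qed

lemma D_zero_bsec:
  assumes f: "f \<in> V (int (A + r))" and g: "g \<in> V (int (B + r))"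
  shows "D_zero (int (A + B)) (bsec A B r f g) =
    sec_scale ((of_nat A - of_nat B) * (of_nat A + of_nat B + 2 * of_nat r + 2) / 2) (bsec A B r f g)"
proof -
  let ?c = "of_nat A * (of_nat A + of_nat B + of_nat r + 2) - of_nat r * of_nat B :: complex"
  have "(\<Sum>i\<in>UNIV. rho_zero (int (A + B)) (axis i 1) (transvectant A B r (rho_zero (int (A + r)) (axis i 1) x) y))
      = smult (- ?c) (transvectant A B r x y)" if "x \<in> V (int (A + r))" "y \<in> V (int (B + r))" for x y
    using zero_transvectant[OF that] by simp
  from Dop_bsec[OF plin_rho_zero f g this]
  have 1: "Dop (rho_zero (int (A + B))) (A + B) (bsec A B r f g) = sec_scale ?c (bsec A B r f g)"
    by (auto simp: bsec_def sec_scale_def fun_eq_iff)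
  show ?thesis
    unfolding D_zero_eq[OF bsec_smooth[OF f g]] 1 sec.scale_left_distrib[symmetric]
    by (rule arg_cong2[where f = sec_scale]) (simp_all add: field_simps)
qed

lemma D_plus_bsec:
  assumes f: "f \<in> V (int (A + Suc r))" and g: "g \<in> V (int (B + Suc r))"
  shows "D_plus (int (A + B)) (bsec A B (Suc r) f g) = sec_scale (2 * of_nat (Suc r)) (bsec (Suc A) (Suc B) r f g)"
proof -
  have "(\<Sum>i\<in>UNIV. rho_plus (int (A + B)) (axis i 1) (transvectant A B (Suc r) (rho_zero (int (A + Suc r)) (axis i 1) x) y))
      = smult (- (2 * of_nat (Suc r))) (transvectant (Suc A) (Suc B) r x y)" if "x \<in> V (int (A + Suc r))" "y \<in> V (int (B + Suc r))" for x y
    using plus_transvectant_Suc[OF that] by simp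
  from Dop_bsec[OF plin_rho_plus f g this] show ?thesis
    unfolding D_plus_eq[OF bsec_smooth[OF f g]]
    by (auto simp: bsec_def sec_scale_def fun_eq_iff)
qed

lemma D_plus_bsec_0:
  assumes f: "f \<in> V (int (A + 0))" and g: "g \<in> V (int (B + 0))"
  shows "D_plus (int (A + B)) (bsec A B 0 f g) = 0"
proof -
  have "(\<Sum>i\<in>UNIV. rho_plus (int (A + B)) (axis i 1) (transvectant A B 0 (rho_zero (int (A + 0)) (axis i 1) x) y))
      = smult (- 0) 0" if "x \<in> V (int (A + 0))" "y \<in> V (int (B + 0))" for x y
    using plus_transvectant_0[OF that] by simp
  from Dop_bsec[OF plin_rho_plus f g, where T = "\<lambda>x y. 0", OF this] show ?thesis
    unfolding D_plus_eq[OF bsec_smooth[OF f g]]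
    by (auto simp: fun_eq_iff)
qed

lemma D_minus_bsec:
  assumes f: "f \<in> V (int (Suc A + r))" and g: "g \<in> V (int (Suc B + r))"
  shows "D_minus (int (Suc A + Suc B)) (bsec (Suc A) (Suc B) r f g) =
    sec_scale (2 * of_nat (Suc A) * of_nat (Suc B) * of_nat (A + B + r + 3)) (bsec A B (Suc r) f g)"
proof -
  have "(\<Sum>i\<in>UNIV. rho_minus (int (Suc A + Suc B)) (axis i 1) (transvectant (Suc A) (Suc B) r (rho_zero (int (Suc A + r)) (axis i 1) x) y))
      = smult (- (2 * of_nat (Suc A) * of_nat (Suc B) * of_nat (A + B + r + 3))) (transvectant A B (Suc r) x y)"
    if "x \<in> V (int (Suc A + r))" "y \<in> V (int (Suc B + r))" for x y
    using minus_transvectant[OF that] by (simp only: mult_minus_left)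
  from Dop_bsec[OF plin_rho_minus f g this] show ?thesis
    unfolding D_minus_eq[OF bsec_smooth[OF f g]]
    by (auto simp: bsec_def sec_scale_def fun_eq_iff)
qed

lemma D_minus_bsec_0:
  assumes f: "f \<in> V (int (A + r))" and g: "g \<in> V (int (B + r))" and AB: "A = 0 \<or> B = 0"
  shows "D_minus (int (A + B)) (bsec A B r f g) = 0"
proof -
  have "(\<Sum>i\<in>UNIV. rho_minus (int (A + B)) (axis i 1) (transvectant A B r (rho_zero (int (A + r)) (axis i 1) x) y))
      = smult (- 0) 0" if "x \<in> V (int (A + r))" "y \<in> V (int (B + r))" for x y
    using minus_transvectant_0[OF that AB] by simp
  from Dop_bsec[OF plin_rho_minus f g, where T = "\<lambda>x y. 0", OF this] show ?thesis
    unfolding D_minus_eq[OF bsec_smooth[OF f g]]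
    by (auto simp: fun_eq_iff)
qed

section \<open>The invariant measure on the sphere\<close>

text \<open>The cone over \<open>A\<close>, whose volume defines the measure of the sphere.\<close>

definition ray_hull :: "(real ^ 4) set \<Rightarrow> (real ^ 4) set" where
  "ray_hull A = {x \<in> cball 0 1 - {0}. x /\<^sub>R norm x \<in> A}"

lemma normalize_measurable [measurable]: "(\<lambda>x :: real ^ 4. x /\<^sub>R norm x) \<in> borel_measurable borel"
  by measurable

abbreviation "\<mu> \<equiv> sphere_measure"

lemma ray_hull_sets: "A \<in> sets borel \<Longrightarrow> ray_hull A \<in> sets borel"
proof -
  assume A: "A \<in> sets borel"
  have "ray_hull A = (cball 0 1 - {0}) \<inter> ((\<lambda>x. x /\<^sub>R norm x) -` A \<inter> space borel)" by (auto simp: ray_hull_def)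
  also have "\<dots> \<in> sets borel" using measurable_sets[OF normalize_measurable A] by (intro sets.Int) auto
  finally show ?thesis .
qed

lemma sets_sphere_measure [simp, measurable_cong]: "sets \<mu> = sets borel"
  and space_sphere_measure [simp]: "space \<mu> = UNIV"
  by (simp_all add: sphere_measure_def)

lemma emeasure_sphere: "A \<in> sets borel \<Longrightarrow> emeasure \<mu> A = 4 * emeasure lborel (ray_hull A)"
proof -
  assume A: "A \<in> sets borel"
  let ?M = "restrict_space lborel (cball 0 1 - {0 :: real ^ 4})"
  have D: "cball 0 1 - {0 :: real ^ 4} \<in> sets lborel" by auto
  have m: "(\<lambda>x. x /\<^sub>R norm x) \<in> measurable ?M borel" by (rule measurable_restrict_space1) measurable
  have "emeasure \<mu> A = 4 * emeasure (distr ?M borel (\<lambda>x. x /\<^sub>R norm x)) A"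
    unfolding sphere_measure_def using A by (subst emeasure_density_const) auto
  also have "emeasure (distr ?M borel (\<lambda>x. x /\<^sub>R norm x)) A = emeasure ?M ((\<lambda>x. x /\<^sub>R norm x) -` A \<inter> space ?M)"
    using A m by (rule emeasure_distr[rotated])
  also have "(\<lambda>x. x /\<^sub>R norm x) -` A \<inter> space ?M = ray_hull A" by (auto simp: ray_hull_def space_restrict_space)
  also have "emeasure ?M (ray_hull A) = emeasure lborel (ray_hull A)"
    by (rule emeasure_restrict_space) (use D in \<open>auto simp: ray_hull_def\<close>)
  finally show ?thesis .
qed

lemma ray_hull_bounded: "emeasure lborel (ray_hull A) < \<infinity>" if "A \<in> sets borel"
proof -
  have "emeasure lborel (ray_hull A) \<le> emeasure lborel (cball 0 1 :: (real ^ 4) set)"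
    by (rule emeasure_mono) (auto simp: ray_hull_def)
  also have "\<dots> < \<infinity>" using emeasure_lborel_cball_finite by blast
  finally show ?thesis .
qed

lemma finite_sphere_measure: "finite_measure \<mu>"
proof
  show "emeasure \<mu> (space \<mu>) \<noteq> \<infinity>"
    using ray_hull_bounded[of UNIV] by (simp add: emeasure_sphere ennreal_mult_eq_top_iff)
qed

lemma S3_closed: "closed S3" and S3_compact: "compact S3"
  by (simp_all add: S3_def)

lemma S3_sets [simp]: "S3 \<in> sets borel"
  using S3_closed by (rule borel_closed)

lemma AE_S3: "AE x in \<mu>. x \<in> S3"
proof (rule AE_I[where N = "- S3"])
  have "x \<notin> ray_hull (- S3)" for x
  proof
    assume "x \<in> ray_hull (- S3)"
    then show False using left_inverse[of "norm x"] by (auto simp: ray_hull_def S3_def)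
  qed
  then have "ray_hull (- S3) = {}" by blast
  then show "emeasure \<mu> (- S3) = 0" by (simp add: emeasure_sphere[OF borel_comp[OF S3_sets]])
qed (auto intro: borel_comp)

lemma emeasure_lborel_orthogonal:
  fixes T :: "real ^ 4 \<Rightarrow> real ^ 4"
  assumes T: "orthogonal_transformation T" and C: "C \<in> sets borel" "bounded C"
  shows "emeasure lborel (T -` C) = emeasure lborel C"
proof -
  have bij: "bij T" using T by (rule orthogonal_transformation_bij)
  have cont: "continuous_on UNIV T" using orthogonal_transformation_linear[OF T] by (intro linear_continuous_on linear_conv_bounded_linear[THEN iffD1])
  have S: "T -` C \<in> sets borel"
    using measurable_sets[OF borel_measurable_continuous_onI[OF cont] C(1)] by simp
  have im: "T ` (T -` C) = C" using bij by (simp add: bij_is_surj surj_image_vimage_eq)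
  have nrm: "norm (T x) = norm x" for x using T by (simp add: orthogonal_transformation_norm)
  have bS: "bounded (T -` C)"
  proof -
    obtain B where "\<And>x. x \<in> C \<Longrightarrow> norm x \<le> B" using C(2) bounded_iff by blast
    then have "\<And>x. x \<in> T -` C \<Longrightarrow> norm x \<le> B" using nrm by fastforce
    then show ?thesis using bounded_iff by blast
  qed
  have SC: "T -` C \<in> lmeasurable" "C \<in> lmeasurable"
    using bounded_set_imp_lmeasurable[OF bS] bounded_set_imp_lmeasurable[OF C(2)] S C(1) by auto
  have "measure lebesgue (T ` (T -` C)) = measure lebesgue (T -` C)"
    by (rule measure_orthogonal_image[OF T SC(1)])
  then have "emeasure lebesgue (T -` C) = emeasure lebesgue C"
    using SC im by (simp add: emeasure_eq_measure2)
  then show ?thesis using S C(1) by simp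
qed

lemma sphere_measure_orthogonal:
  assumes T: "orthogonal_transformation T"
  shows "distr \<mu> borel T = \<mu>"
proof (rule measure_eqI)
  fix A assume "A \<in> sets (distr \<mu> borel T)"
  then have A: "A \<in> sets borel" by simp
  have lin: "linear T" using T by (rule orthogonal_transformation_linear)
  have nrm: "norm (T x) = norm x" for x using T by (simp add: orthogonal_transformation_norm)
  have cont: "continuous_on UNIV T" using lin by (intro linear_continuous_on linear_conv_bounded_linear[THEN iffD1])
  have m: "T \<in> measurable \<mu> borel"
    using borel_measurable_continuous_onI[OF cont] by (simp cong: measurable_cong_sets)
  have SA: "T -` A \<in> sets borel" using measurable_sets[OF borel_measurable_continuous_onI[OF cont] A] by simp
  have "T x = 0 \<longleftrightarrow> x = 0" for x using nrm[of x] by (metis norm_eq_zero)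
  then have c: "ray_hull (T -` A) = T -` ray_hull A"
    by (auto simp: ray_hull_def nrm linear_cmul[OF lin])
  have "emeasure (distr \<mu> borel T) A = emeasure \<mu> (T -` A)"
    using A m by (simp add: emeasure_distr)
  also have "\<dots> = 4 * emeasure lborel (T -` ray_hull A)" by (simp add: emeasure_sphere SA c)
  also have "emeasure lborel (T -` ray_hull A) = emeasure lborel (ray_hull A)"
    by (rule emeasure_lborel_orthogonal[OF T ray_hull_sets[OF A]]) (auto simp: ray_hull_def intro: bounded_subset[OF bounded_cball[of 0 1]])
  finally show "emeasure (distr \<mu> borel T) A = emeasure \<mu> A" by (simp add: emeasure_sphere A)
qed simp

lemma integral_sphere_orthogonal:
  fixes f :: "real ^ 4 \<Rightarrow> complex"
  assumes T: "orthogonal_transformation T" and f: "f \<in> borel_measurable \<mu>"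
  shows "(LINT x|\<mu>. f (T x)) = (LINT x|\<mu>. f x)"
proof -
  have lin: "linear T" using T by (rule orthogonal_transformation_linear)
  have cont: "continuous_on UNIV T" using lin by (intro linear_continuous_on linear_conv_bounded_linear[THEN iffD1])
  have m: "T \<in> measurable \<mu> borel"
    using borel_measurable_continuous_onI[OF cont] by (simp cong: measurable_cong_sets)
  have "(LINT x|distr \<mu> borel T. f x) = (LINT x|\<mu>. f (T x))"
    by (rule integral_distr[OF m]) (use f in \<open>simp cong: measurable_cong_sets\<close>)
  then show ?thesis by (simp add: sphere_measure_orthogonal[OF T])
qed

text \<open>Nonempty open subsets of the sphere have positive measure, as the cones over them contain open sets.\<close>

lemma AE_zero_imp_zero:
  fixes f :: "real ^ 4 \<Rightarrow> complex"
  assumes f: "continuous_on S3 f" and ae: "AE x in \<mu>. f x = 0" and x: "x \<in> S3"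
  shows "f x = 0"
proof (rule ccontr)
  assume fx: "f x \<noteq> 0"
  have "open (- {0 :: complex})" by auto
  then obtain U where U: "open U" "U \<inter> S3 = f -` (- {0}) \<inter> S3"
    using f unfolding continuous_on_open_invariant by blast
  let ?N = "{y \<in> ball 0 1 - {0}. y /\<^sub>R norm y \<in> U}"
  have cont: "continuous_on (ball 0 1 - {0}) (\<lambda>y :: real ^ 4. y /\<^sub>R norm y)"
    by (intro continuous_intros) auto
  have "?N = (ball 0 1 - {0}) \<inter> (\<lambda>y. y /\<^sub>R norm y) -` U" by auto
  then have "open ?N" using continuous_open_preimage[OF cont open_delete[OF open_ball] U(1)] by simp
  moreover have "(1 / 2) *\<^sub>R x \<in> ?N"
  proof -
    have "x \<in> U" using x fx U(2) by blast
    moreover have "norm x = 1" "x \<noteq> 0" using x by (auto simp: S3_def)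
    ultimately show ?thesis by simp
  qed
  ultimately have "\<not> negligible ?N" using open_not_negligible by blast
  have "AE y in \<mu>. y \<notin> U \<inter> S3" using ae U(2) by auto
  then have "AE y in \<mu>. y \<notin> U" using AE_S3 by eventually_elim auto
  then have "emeasure \<mu> U = 0"
    using U(1) by (subst (asm) AE_iff_measurable[where N = U]) (auto intro: borel_open)
  then have "emeasure lborel (ray_hull U) = 0" using U(1) by (simp add: emeasure_sphere borel_open)
  then have "ray_hull U \<in> null_sets lborel" using U(1) ray_hull_sets by (auto simp: null_sets_def borel_open)
  then have "negligible (ray_hull U)" by (simp add: negligible_iff_null_sets null_sets_completionI)
  moreover have "?N \<subseteq> ray_hull U" by (auto simp: ray_hull_def)
  ultimately have "negligible ?N" using negligible_subset by blast
  with \<open>\<not> negligible ?N\<close> show False by simp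
qed

lemma sphere_continuous:
  fixes f :: "real ^ 4 \<Rightarrow> complex"
  assumes f: "continuous_on S3 f" and z: "\<And>x. x \<notin> S3 \<Longrightarrow> f x = 0"
  shows "f \<in> borel_measurable \<mu>" "integrable \<mu> f"
proof -
  have e: "f = (\<lambda>x. indicator S3 x *\<^sub>R f x)" using z by (auto simp: fun_eq_iff indicator_def)
  have "(\<lambda>x. indicator S3 x *\<^sub>R f x) \<in> borel_measurable borel"
    by (rule borel_measurable_continuous_on_indicator[OF S3_sets f])
  then show m: "f \<in> borel_measurable \<mu>"
    by (subst e) (simp cong: measurable_cong_sets)
  have "compact (f ` S3)" by (rule compact_continuous_image[OF f S3_compact])
  then obtain B where B: "\<And>x. x \<in> S3 \<Longrightarrow> norm (f x) \<le> B"
    unfolding compact_eq_bounded_closed bounded_iff by blast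
  then have "norm (f x) \<le> max B 0" for x using z[of x] by (cases "x \<in> S3") (auto simp: le_max_iff_disj)
  then show "integrable \<mu> f"
    by (intro finite_measure.integrable_const_bound[OF finite_sphere_measure _ m]) auto
qed

section \<open>Rotations of the sphere\<close>

lemma linear_mat4: "linear mat4"
  by (rule linearI) (simp_all add: mat2_eq_iff mat4_def complex_eq_iff)

text \<open>The action of \<open>(p, q\<^sup>-\<^sup>1)\<close> on the ambient space.\<close>

definition rot :: "mat2 \<Rightarrow> mat2 \<Rightarrow> real ^ 4 \<Rightarrow> real ^ 4" where
  "rot p q x = vec4 (p ** mat4 x ** q)"

lemma mat4_rot: "p \<in> SU2 \<Longrightarrow> q \<in> SU2 \<Longrightarrow> mat4 (rot p q x) = p ** mat4 x ** q"
  by (simp add: rot_def mat4_vec4 quat_mult quat_SU2 quat_mat4)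

lemma norm_mat4: "complex_of_real (norm x ^ 2) = det (mat4 x)"
  unfolding norm_vec4 by (simp add: det_2 mat4_def complex_eq_iff power2_eq_square)

lemma rot_orthogonal:
  assumes "p \<in> SU2" "q \<in> SU2"
  shows "orthogonal_transformation (rot p q)"
  unfolding orthogonal_transformation
proof
  show "linear (rot p q)"
    unfolding rot_def
    by (rule linearI) (simp_all add: linear_add[OF linear_mat4] linear_cmul[OF linear_mat4] mat2_add_mult mat2_scaleR_mult vec4_add vec4_scaleR)
  show "\<forall>x. norm (rot p q x) = norm x"
  proof
    fix x
    have "complex_of_real (norm (rot p q x) ^ 2) = complex_of_real (norm x ^ 2)"
      unfolding norm_mat4 mat4_rot[OF assms] det_mul using assms by (simp add: SU2_def)
    then have "norm (rot p q x) ^ 2 = norm x ^ 2" by (simp only: of_real_eq_iff)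
    then show "norm (rot p q x) = norm x" by simp
  qed
qed

lemma rot_S3_iff: "p \<in> SU2 \<Longrightarrow> q \<in> SU2 \<Longrightarrow> rot p q x \<in> S3 \<longleftrightarrow> x \<in> S3"
  using orthogonal_transformation_norm[OF rot_orthogonal] by (simp add: S3_def)

lemma continuous_on_slice:
  assumes "continuous_on Spin4 G"
  shows "continuous_on S3 (\<lambda>x. G (mat4 x, mat 1))"
proof (rule continuous_on_compose2[OF assms])
  show "continuous_on S3 (\<lambda>x. (mat4 x, mat 1 :: mat2))"
    by (intro continuous_on_Pair continuous_on_const linear_continuous_on linear_conv_bounded_linear[THEN iffD1] linear_mat4)
qed (auto simp: Spin4_def mat4_SU2_iff)

lemma circ_add: "circ i s ** circ i t = circ i (s + t)"
proof -
  have "su2_of (axis i 1) ** su2_of (axis i 1) = - mat 1"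
    using exhaust_3[of i] by (auto simp: mat2_eq_iff mat2_mult_nth axis3_nth Complex_units)
  then show ?thesis
    unfolding circ_def cos_add sin_add mat2_add_mult mat2_scaleR_mult by (simp add: algebra_simps)
qed

lemma vector_derivative_slope:
  assumes "(f has_vector_derivative D) (at a)"
  shows "((\<lambda>y. (f y - f a) /\<^sub>R (y - a)) \<longlongrightarrow> D) (at a)"
proof -
  have "((\<lambda>y. (f y - (f a + (y - a) *\<^sub>R D)) /\<^sub>R norm (y - a)) \<longlongrightarrow> 0) (at a)"
    using assms unfolding has_vector_derivative_def has_derivative_within by (simp add: inverse_eq_divide)
  then have "((\<lambda>y. norm ((f y - (f a + (y - a) *\<^sub>R D)) /\<^sub>R norm (y - a))) \<longlongrightarrow> 0) (at a)"
    by (rule tendsto_norm_zero)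
  moreover have "norm ((f y - (f a + (y - a) *\<^sub>R D)) /\<^sub>R norm (y - a)) = norm ((f y - f a) /\<^sub>R (y - a) - D)" if "y \<noteq> a" for y
  proof -
    have "(f y - f a) /\<^sub>R (y - a) - D = (f y - (f a + (y - a) *\<^sub>R D)) /\<^sub>R (y - a)"
      using that by (simp add: scaleR_diff_right scaleR_add_right)
    then show ?thesis by simp
  qed
  then have "\<forall>\<^sub>F y in at a. norm ((f y - (f a + (y - a) *\<^sub>R D)) /\<^sub>R norm (y - a)) = norm ((f y - f a) /\<^sub>R (y - a) - D)"
    by (simp add: eventually_at_filter)
  ultimately have "((\<lambda>y. norm ((f y - f a) /\<^sub>R (y - a) - D)) \<longlongrightarrow> 0) (at a)"
    by (rule Lim_transform_eventually)
  from LIM_zero_cancel[OF tendsto_norm_zero_cancel[OF this]] show ?thesis .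
qed

text \<open>
  The flow of the field, right multiplication by a one-parameter subgroup, consists of rotations of the sphere, so the
  integral of \<open>G\<close> along the flow is constant. Differentiate under the integral.
\<close>

lemma integral_left_derivative:
  fixes G :: "mat2 \<times> mat2 \<Rightarrow> complex" and i :: 3
  assumes G: "smooth_on Spin4 G"
  defines "D \<equiv> \<lambda>g. dSpin G g (fst g ** su2_of (axis i 1), 0)"
  shows "(LINT x|\<mu>. (if x \<in> S3 then D (mat4 x, mat 1) else 0)) = 0"
proof -
  let ?g = "\<lambda>t x. if x \<in> S3 then G (mat4 x ** circ i t, mat 1) else 0"
  have cD: "continuous_on S3 (\<lambda>x. D (mat4 x, mat 1))"
    by (rule continuous_on_slice[where G = D, OF smooth_on_continuous_on]) (simp only: D_def, rule smooth_on_left_derivative[OF G])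
  have "compact ((\<lambda>x. D (mat4 x, mat 1)) ` S3)" by (rule compact_continuous_image[OF cD S3_compact])
  then obtain B where B: "\<And>x. x \<in> S3 \<Longrightarrow> norm (D (mat4 x, mat 1)) \<le> B"
    unfolding compact_eq_bounded_closed bounded_iff by blast
  have BSU: "norm (D (h, mat 1)) \<le> B" if "h \<in> SU2" for h
    using B[OF vec4_S3[OF that]] by (simp add: mat4_vec4 quat_SU2 that)
  have B0: "0 \<le> B" by (rule order_trans[OF norm_ge_zero BSU[OF SU2_one]])
  have dG: "((\<lambda>t. G (h ** circ i t, mat 1)) has_vector_derivative D (h, mat 1)) (at 0)" if h: "h \<in> SU2" for h
  proof -
    have "(G has_derivative frechet_derivative G (at (h, mat 1) within Spin4)) (at (h, mat 1) within Spin4)"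
      by (rule smooth_on_differentiable[OF G]) (simp add: Spin4_def h)
    from derivative_left_circ[OF this h SU2_one] show ?thesis by (simp add: D_def dSpin_def)
  qed
  have dGs: "((\<lambda>t. G (h ** circ i t, mat 1)) has_vector_derivative D (h ** circ i s, mat 1)) (at s)" if h: "h \<in> SU2" for h s
  proof -
    have "((\<lambda>t. G (h ** circ i s ** circ i t, mat 1)) has_vector_derivative D (h ** circ i s, mat 1)) (at 0)"
      by (rule dG) (simp add: h circ_SU2)
    then have "((\<lambda>t. G (h ** circ i (s + t), mat 1)) has_vector_derivative D (h ** circ i s, mat 1)) (at 0)"
      by (simp add: circ_add matrix_mul_assoc[symmetric])
    then have "((\<lambda>t. G (h ** circ i (s + t), mat 1)) \<circ> (\<lambda>t. t - s) has_vector_derivative 1 *\<^sub>R D (h ** circ i s, mat 1)) (at s)"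
      by (intro vector_diff_chain_at) (auto intro!: derivative_eq_intros)
    then show ?thesis by (simp add: o_def)
  qed
  have bound: "norm (G (h ** circ i t, mat 1) - G (h, mat 1)) \<le> B * \<bar>t\<bar>" if h: "h \<in> SU2" for h t
  proof -
    have "norm (G (h ** circ i t, mat 1) - G (h ** circ i 0, mat 1)) \<le> B * norm (t - 0)"
    proof (rule differentiable_bound[OF convex_UNIV])
      fix s :: real
      show "((\<lambda>t. G (h ** circ i t, mat 1)) has_derivative (\<lambda>r. r *\<^sub>R D (h ** circ i s, mat 1))) (at s within UNIV)"
        using dGs[OF h, of s] by (simp add: has_vector_derivative_def)
      show "onorm (\<lambda>r. r *\<^sub>R D (h ** circ i s, mat 1)) \<le> B"
        using BSU[of "h ** circ i s"] h B0
        by (intro onorm_bound) (simp_all add: circ_SU2 mult.commute[of B] mult_left_mono)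
    qed auto
    then show ?thesis by (simp add: circ_0)
  qed
  have rotG: "?g t = (\<lambda>x. ?g 0 (rot (mat 1) (circ i t) x))" for t
    by (auto simp: fun_eq_iff mat4_rot circ_SU2 rot_S3_iff circ_0)
  have cg: "continuous_on S3 (\<lambda>x. G (mat4 x, mat 1))" by (rule continuous_on_slice[OF smooth_on_continuous_on[OF G]])
  have g0: "?g 0 \<in> borel_measurable \<mu>" "integrable \<mu> (?g 0)"
    by (rule sphere_continuous; use cg in \<open>simp add: circ_0 cong: continuous_on_cong\<close>)+
  have gt: "?g t \<in> borel_measurable \<mu>" "integrable \<mu> (?g t)" for t
  proof -
    have "continuous_on S3 (\<lambda>x. G (mat4 (rot (mat 1) (circ i t) x), mat 1))"
    proof (rule continuous_on_compose2[OF cg])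
      show "continuous_on S3 (rot (mat 1) (circ i t))"
        using orthogonal_transformation_linear[OF rot_orthogonal[OF SU2_one circ_SU2]]
        by (intro linear_continuous_on linear_conv_bounded_linear[THEN iffD1])
    qed (auto simp: rot_S3_iff circ_SU2)
    then have "continuous_on S3 (\<lambda>x. G (mat4 x ** circ i t, mat 1))" by (simp add: mat4_rot circ_SU2)
    then have "continuous_on S3 (?g t)" by (simp cong: continuous_on_cong)
    then show "?g t \<in> borel_measurable \<mu>" "integrable \<mu> (?g t)"
      by (auto intro: sphere_continuous)
  qed
  have same: "(LINT x|\<mu>. ?g t x) = (LINT x|\<mu>. ?g 0 x)" for t
    by (subst rotG) (rule integral_sphere_orthogonal[OF rot_orthogonal[OF SU2_one circ_SU2] g0(1)])
  \<comment> \<open>difference quotients along a sequence, bounded uniformly by \<open>bound\<close>\<close>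
  let ?t = "\<lambda>k. inverse (real (Suc k))"
  let ?s = "\<lambda>k x. inverse (?t k) *\<^sub>R (?g (?t k) x - ?g 0 x)"
  have mD: "(\<lambda>x. if x \<in> S3 then D (mat4 x, mat 1) else 0) \<in> borel_measurable \<mu>"
    by (rule sphere_continuous; use cD in \<open>simp cong: continuous_on_cong\<close>)
  have "(\<lambda>k. LINT x|\<mu>. ?s k x) \<longlonglongrightarrow> (LINT x|\<mu>. (if x \<in> S3 then D (mat4 x, mat 1) else 0))"
  proof (rule integral_dominated_convergence[where w = "\<lambda>x. max B 0"])
    show "?s k \<in> borel_measurable \<mu>" for k
      by (intro borel_measurable_scaleR borel_measurable_const borel_measurable_diff gt)
    show "integrable \<mu> (\<lambda>x. max B 0)"
      using finite_measure.integrable_const[OF finite_sphere_measure] .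
    show "AE x in \<mu>. norm (?s k x) \<le> max B 0" for k
    proof (rule AE_I2)
      fix x
      show "norm (?s k x) \<le> max B 0"
      proof (cases "x \<in> S3")
        case True
        then have h: "mat4 x \<in> SU2" by (simp add: mat4_SU2_iff)
        have "norm (?s k x) \<le> inverse (?t k) * (B * \<bar>?t k\<bar>)"
          using bound[OF h, of "?t k"] True by (simp add: circ_0 mult_left_mono del: of_nat_Suc)
        also have "\<dots> = B" by simp
        finally show ?thesis by simp
      qed simp
    qed
    show "AE x in \<mu>. (\<lambda>k. ?s k x) \<longlonglongrightarrow> (if x \<in> S3 then D (mat4 x, mat 1) else 0)"
    proof (rule AE_I2)
      fix x
      show "(\<lambda>k. ?s k x) \<longlonglongrightarrow> (if x \<in> S3 then D (mat4 x, mat 1) else 0)"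
      proof (cases "x \<in> S3")
        case True
        then have h: "mat4 x \<in> SU2" by (simp add: mat4_SU2_iff)
        let ?G = "\<lambda>t. G (mat4 x ** circ i t, mat 1)"
        have "((\<lambda>y. (?G y - ?G 0) /\<^sub>R (y - 0)) \<longlongrightarrow> D (mat4 x, mat 1)) (at 0)"
          using vector_derivative_slope[OF dG[OF h]] by simp
        moreover have "filterlim ?t (at 0) sequentially"
          unfolding filterlim_at using LIMSEQ_inverse_real_of_nat by auto
        ultimately have "(\<lambda>k. (?G (?t k) - ?G 0) /\<^sub>R (?t k - 0)) \<longlonglongrightarrow> D (mat4 x, mat 1)"
          by (rule filterlim_compose)
        then show ?thesis using True by (simp add: circ_0)
      qed simp
    qed
  qed (rule mD)
  moreover have "(LINT x|\<mu>. ?s k x) = 0" for k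
  proof -
    have "(LINT x|\<mu>. ?g (?t k) x - ?g 0 x) = 0"
      using same[of "?t k"] by (subst Bochner_Integration.integral_diff[OF gt(2) g0(2)]) simp
    then show ?thesis by (simp only: integral_scaleR_right scaleR_zero_right)
  qed
  ultimately have "(\<lambda>k. 0) \<longlonglongrightarrow> (LINT x|\<mu>. (if x \<in> S3 then D (mat4 x, mat 1) else 0))"
    by (simp only:)
  then show ?thesis by (rule LIMSEQ_unique[OF _ tendsto_const])
qed

section \<open>The Hilbert space of sections\<close>

lemma at_point_in_V: "\<phi> \<in> sections m \<Longrightarrow> at_point \<phi> x \<in> V m"
  by (simp add: at_point_def sections_in_V)

lemma at_point_outside: "\<phi> \<in> sections m \<Longrightarrow> x \<notin> S3 \<Longrightarrow> at_point \<phi> x = 0"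
  by (simp add: at_point_def sections_outside Spin4_def mat4_SU2_iff)

lemma at_point_add: "at_point (\<phi> + \<psi>) x = at_point \<phi> x + at_point \<psi> x"
  and at_point_diff: "at_point (\<phi> - \<psi>) x = at_point \<phi> x - at_point \<psi> x"
  and at_point_scale: "at_point (sec_scale c \<phi>) x = smult c (at_point \<phi> x)"
  and at_point_zero: "at_point 0 x = 0"
  by (simp_all add: at_point_def sec_scale_def)

lemma at_point_sum:
  fixes \<phi> :: "'i \<Rightarrow> sect"
  shows "at_point (sum \<phi> I :: sect) x = (\<Sum>i\<in>I. at_point (\<phi> i) x)"
proof (cases "finite I")
  case True
  then show ?thesis
  proof (induction I rule: finite_induct)
    case empty
    show ?case by (simp only: sum.empty at_point_zero)
  next
    case (insert y I)
    then show ?case by (simp only: sum.insert[OF insert.hyps] at_point_add)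
  qed
qed (simp only: sum.infinite at_point_zero not_False_eq_True)

lemma herm_self: "herm (int n) f f = complex_of_real (\<Sum>k\<le>n. fact k * fact (n - k) * (cmod (coeff f k))\<^sup>2)"
  unfolding herm_sum of_real_sum
  by (intro sum.cong refl) (simp only: of_real_mult complex_norm_square of_real_fact mult.assoc)

lemma herm_self_Re: "Re (herm (int n) f f) = (\<Sum>k\<le>n. fact k * fact (n - k) * (cmod (coeff f k))\<^sup>2)"
  by (simp only: herm_self Re_complex_of_real)

lemma herm_self_eq: "herm (int n) f f = complex_of_real (Re (herm (int n) f f))"
  by (simp only: herm_self Re_complex_of_real)

lemma herm_self_nonneg: "0 \<le> Re (herm (int n) f f)"
  unfolding herm_self_Re by (intro sum_nonneg) auto

lemma herm_self_zero: "f \<in> V (int n) \<Longrightarrow> Re (herm (int n) f f) = 0 \<Longrightarrow> f = 0"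
proof (rule poly_eqI)
  fix k assume f: "f \<in> V (int n)" and z: "Re (herm (int n) f f) = 0"
  have "(\<Sum>k\<le>n. fact k * fact (n - k) * (cmod (coeff f k))\<^sup>2) = 0" using z by (simp only: herm_self_Re)
  then have "\<forall>k\<in>{..n}. fact k * fact (n - k) * (cmod (coeff f k))\<^sup>2 = (0 :: real)"
    by (subst (asm) sum_nonneg_eq_0_iff) auto
  then show "coeff f k = coeff 0 k" using V_coeff_zero[OF f, of k] by (cases "k \<le> n") auto
qed

lemma herm_bound: "norm (herm (int n) f g) \<le> Re (herm (int n) f f) + Re (herm (int n) g g)"
proof -
  have "norm (herm (int n) f g) \<le> (\<Sum>k\<le>n. norm (fact k * fact (n - k) * coeff f k * cnj (coeff g k)))"
    unfolding herm_sum by (rule norm_sum)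
  also have "\<dots> \<le> (\<Sum>k\<le>n. fact k * fact (n - k) * (cmod (coeff f k))\<^sup>2 + fact k * fact (n - k) * (cmod (coeff g k))\<^sup>2)"
  proof (rule sum_mono)
    fix k
    let ?a = "cmod (coeff f k)" and ?b = "cmod (coeff g k)"
    have "?a * ?b \<le> ?a\<^sup>2 + ?b\<^sup>2"
    proof -
      have "0 \<le> ?a * ?b" by simp
      then show ?thesis using sum_squares_bound[of ?a ?b] by linarith
    qed
    then have "(fact k * fact (n - k)) * (?a * ?b) \<le> (fact k * fact (n - k)) * (?a\<^sup>2 + ?b\<^sup>2)" by (intro mult_left_mono) auto
    then show "norm (fact k * fact (n - k) * coeff f k * cnj (coeff g k)) \<le> fact k * fact (n - k) * ?a\<^sup>2 + fact k * fact (n - k) * ?b\<^sup>2"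
      by (simp add: norm_mult algebra_simps)
  qed
  finally show ?thesis by (simp only: herm_self_Re sum.distrib)
qed

lemma L2_sections: "\<phi> \<in> L2 m \<Longrightarrow> \<phi> \<in> sections m"
  and L2_measurable: "\<phi> \<in> L2 m \<Longrightarrow> (\<lambda>x. coeff (at_point \<phi> x) k) \<in> borel_measurable \<mu>"
  and L2_integrable: "\<phi> \<in> L2 m \<Longrightarrow> integrable \<mu> (\<lambda>x. herm m (at_point \<phi> x) (at_point \<phi> x))"
  by (auto simp: L2_def)

lemma cnj_measurable: "f \<in> borel_measurable M \<Longrightarrow> (\<lambda>x. cnj (f x)) \<in> borel_measurable M"
  by (rule measurable_compose[OF _ borel_measurable_continuous_onI]) (auto intro: continuous_intros)

lemma herm_measurable:
  assumes "\<And>k. (\<lambda>x. coeff (f x) k) \<in> borel_measurable M" "\<And>k. (\<lambda>x. coeff (g x) k) \<in> borel_measurable M"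
  shows "(\<lambda>x. herm (int n) (f x) (g x)) \<in> borel_measurable M"
  unfolding herm_sum by (intro borel_measurable_sum borel_measurable_times borel_measurable_const assms cnj_measurable)

lemma herm_integrable:
  assumes "\<phi> \<in> L2 (int n)" "\<psi> \<in> L2 (int n)"
  shows "integrable \<mu> (\<lambda>x. herm (int n) (at_point \<phi> x) (at_point \<psi> x))"
proof (rule Bochner_Integration.integrable_bound)
  show "integrable \<mu> (\<lambda>x. Re (herm (int n) (at_point \<phi> x) (at_point \<phi> x)) + Re (herm (int n) (at_point \<psi> x) (at_point \<psi> x)))"
    using assms by (intro Bochner_Integration.integrable_add integrable_Re L2_integrable)
  show "(\<lambda>x. herm (int n) (at_point \<phi> x) (at_point \<psi> x)) \<in> borel_measurable \<mu>"
    using assms by (intro herm_measurable L2_measurable)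
  show "AE x in \<mu>. norm (herm (int n) (at_point \<phi> x) (at_point \<psi> x)) \<le>
     norm (Re (herm (int n) (at_point \<phi> x) (at_point \<phi> x)) + Re (herm (int n) (at_point \<psi> x) (at_point \<psi> x)))"
    by (intro AE_I2 order_trans[OF herm_bound]) simp
qed

lemma L2_add:
  assumes "\<phi> \<in> L2 (int n)" "\<psi> \<in> L2 (int n)"
  shows "\<phi> + \<psi> \<in> L2 (int n)"
  using assms unfolding L2_def
  by (auto simp: sections_add at_point_add herm_add_left herm_add_right
      intro!: borel_measurable_add Bochner_Integration.integrable_add herm_integrable[OF assms] herm_integrable[OF assms(2,1)])

lemma L2_scale:
  assumes "\<phi> \<in> L2 (int n)"
  shows "sec_scale c \<phi> \<in> L2 (int n)"
  using assms unfolding L2_def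
  by (auto simp: sections_scale at_point_scale herm_smult_left herm_smult_right
      intro!: borel_measurable_times borel_measurable_const)

lemma L2_zero: "0 \<in> L2 m"
  by (simp add: L2_def sections_zero at_point_zero)

lemma L2_sum:
  fixes \<phi> :: "'i \<Rightarrow> sect"
  shows "(\<And>i. i \<in> I \<Longrightarrow> \<phi> i \<in> L2 (int n)) \<Longrightarrow> (sum \<phi> I :: sect) \<in> L2 (int n)"
  by (induction I rule: infinite_finite_induct) (auto simp: L2_zero L2_add)

lemma sec_diff: "\<phi> - \<psi> = \<phi> + sec_scale (- 1) \<psi>"
  by (simp add: sec_scale_def fun_eq_iff)

lemma L2_diff: "\<phi> \<in> L2 (int n) \<Longrightarrow> \<psi> \<in> L2 (int n) \<Longrightarrow> \<phi> - \<psi> \<in> L2 (int n)"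
  unfolding sec_diff by (intro L2_add L2_scale)

lemma smooth_continuous_coeff:
  assumes "\<phi> \<in> smooth_sections m"
  shows "continuous_on S3 (\<lambda>x. coeff (at_point \<phi> x) k)"
  unfolding at_point_def
  by (rule continuous_on_slice[where G = "\<lambda>g. coeff (\<phi> g) k", OF smooth_on_continuous_on[OF smooth_sections_smooth[OF assms]]])

lemma smooth_L2:
  assumes \<phi>: "\<phi> \<in> smooth n"
  shows "\<phi> \<in> L2 (int n)"
proof -
  note s = smooth_sections_sections[OF \<phi>]
  have "continuous_on S3 (\<lambda>x. herm (int n) (at_point \<phi> x) (at_point \<phi> x))"
    unfolding herm_sum by (intro continuous_intros smooth_continuous_coeff[OF \<phi>])
  then have "integrable \<mu> (\<lambda>x. herm (int n) (at_point \<phi> x) (at_point \<phi> x))"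
    by (rule sphere_continuous) (simp add: at_point_outside[OF s])
  moreover have "(\<lambda>x. coeff (at_point \<phi> x) k) \<in> borel_measurable \<mu>" for k
    by (rule sphere_continuous[OF smooth_continuous_coeff[OF \<phi>]]) (simp add: at_point_outside[OF s])
  ultimately show ?thesis using s by (simp add: L2_def)
qed

abbreviation "ip n \<equiv> L2_inner (int n)"
abbreviation "nrm n \<equiv> L2_norm (int n)"

lemma ip_add_left: "\<phi> \<in> L2 (int n) \<Longrightarrow> \<phi>' \<in> L2 (int n) \<Longrightarrow> \<psi> \<in> L2 (int n) \<Longrightarrow>
    ip n (\<phi> + \<phi>') \<psi> = ip n \<phi> \<psi> + ip n \<phi>' \<psi>"
  and ip_add_right: "\<phi> \<in> L2 (int n) \<Longrightarrow> \<phi>' \<in> L2 (int n) \<Longrightarrow> \<psi> \<in> L2 (int n) \<Longrightarrow>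
    ip n \<psi> (\<phi> + \<phi>') = ip n \<psi> \<phi> + ip n \<psi> \<phi>'"
  by (simp_all add: L2_inner_def at_point_add herm_add_left herm_add_right herm_integrable)

lemma ip_scale_left: "L2_inner m (sec_scale c \<phi>) \<psi> = c * L2_inner m \<phi> \<psi>"
  and ip_scale_right: "L2_inner m \<psi> (sec_scale c \<phi>) = cnj c * L2_inner m \<psi> \<phi>"
  by (simp_all add: L2_inner_def at_point_scale herm_smult_left herm_smult_right)

lemma ip_commute: "L2_inner m \<psi> \<phi> = cnj (L2_inner m \<phi> \<psi>)"
  unfolding L2_inner_def by (simp add: herm_commute[of m "at_point \<psi> _"])

lemma ip_zero_left [simp]: "L2_inner m 0 \<psi> = 0" and ip_zero_right [simp]: "L2_inner m \<psi> 0 = 0"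
  by (simp_all add: L2_inner_def at_point_zero)

lemma ip_diff_left: "\<phi> \<in> L2 (int n) \<Longrightarrow> \<phi>' \<in> L2 (int n) \<Longrightarrow> \<psi> \<in> L2 (int n) \<Longrightarrow>
    ip n (\<phi> - \<phi>') \<psi> = ip n \<phi> \<psi> - ip n \<phi>' \<psi>"
  unfolding sec_diff by (simp only: ip_add_left L2_scale ip_scale_left) simp

lemma ip_diff_right: "\<phi> \<in> L2 (int n) \<Longrightarrow> \<phi>' \<in> L2 (int n) \<Longrightarrow> \<psi> \<in> L2 (int n) \<Longrightarrow>
    ip n \<psi> (\<phi> - \<phi>') = ip n \<psi> \<phi> - ip n \<psi> \<phi>'"
  unfolding sec_diff by (simp only: ip_add_right L2_scale ip_scale_right) simp

lemma ip_sum_left: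
  fixes \<phi> :: "'i \<Rightarrow> sect"
  shows "finite I \<Longrightarrow> (\<And>i. i \<in> I \<Longrightarrow> \<phi> i \<in> L2 (int n)) \<Longrightarrow> \<psi> \<in> L2 (int n) \<Longrightarrow>
    ip n (sum \<phi> I :: sect) \<psi> = (\<Sum>i\<in>I. ip n (\<phi> i) \<psi>)"
proof (induction I rule: finite_induct)
  case (insert x I)
  then have "ip n (\<phi> x + sum \<phi> I) \<psi> = ip n (\<phi> x) \<psi> + ip n (sum \<phi> I) \<psi>"
    by (intro ip_add_left L2_sum) auto
  then show ?case using insert by (simp only: sum.insert insert_iff simp_thms)
qed simp

lemma ip_self: "\<phi> \<in> L2 (int n) \<Longrightarrow> ip n \<phi> \<phi> = complex_of_real (LINT x|\<mu>. Re (herm (int n) (at_point \<phi> x) (at_point \<phi> x)))"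
  unfolding L2_inner_def by (subst herm_self_eq) (rule integral_complex_of_real)

lemma ip_self_norm: "\<phi> \<in> L2 (int n) \<Longrightarrow> ip n \<phi> \<phi> = complex_of_real ((nrm n \<phi>)\<^sup>2)"
proof -
  assume \<phi>: "\<phi> \<in> L2 (int n)"
  have "0 \<le> (LINT x|\<mu>. Re (herm (int n) (at_point \<phi> x) (at_point \<phi> x)))"
    by (rule Bochner_Integration.integral_nonneg) (rule herm_self_nonneg)
  then show ?thesis by (simp add: L2_norm_def ip_self[OF \<phi>])
qed

lemma L2_norm_nonneg: "\<phi> \<in> L2 (int n) \<Longrightarrow> 0 \<le> nrm n \<phi>"
  unfolding L2_norm_def
  by (simp add: ip_self Bochner_Integration.integral_nonneg herm_self_nonneg)

lemma ip_self_zero: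
  assumes \<phi>: "\<phi> \<in> L2 (int n)" and z: "ip n \<phi> \<phi> = 0"
  shows "ae_eq \<phi> 0"
proof -
  have "(LINT x|\<mu>. Re (herm (int n) (at_point \<phi> x) (at_point \<phi> x))) = 0"
    using z by (simp add: ip_self[OF \<phi>])
  then have "AE x in \<mu>. Re (herm (int n) (at_point \<phi> x) (at_point \<phi> x)) = 0"
    by (subst (asm) integral_nonneg_eq_0_iff_AE) (auto intro: herm_self_nonneg integrable_Re[OF L2_integrable[OF \<phi>]])
  then show ?thesis
    unfolding ae_eq_def by eventually_elim (auto simp: at_point_zero intro: herm_self_zero[OF at_point_in_V[OF L2_sections[OF \<phi>]]])
qed

lemma ae_eq_refl: "ae_eq \<phi> \<phi>"
  by (simp add: ae_eq_def)

lemma ae_eq_sym: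
  assumes "ae_eq \<phi> \<psi>"
  shows "ae_eq \<psi> \<phi>"
  using assms unfolding ae_eq_def by eventually_elim simp

lemma ae_eq_trans:
  assumes "ae_eq \<phi> \<psi>" "ae_eq \<psi> \<eta>"
  shows "ae_eq \<phi> \<eta>"
  using assms unfolding ae_eq_def by eventually_elim simp

lemma ae_eq_add:
  assumes "ae_eq \<phi> \<phi>'" "ae_eq \<psi> \<psi>'"
  shows "ae_eq (\<phi> + \<psi>) (\<phi>' + \<psi>')"
  using assms unfolding ae_eq_def at_point_add by eventually_elim simp

lemma ae_eq_scale:
  assumes "ae_eq \<phi> \<phi>'"
  shows "ae_eq (sec_scale c \<phi>) (sec_scale c \<phi>')"
  using assms unfolding ae_eq_def at_point_scale by eventually_elim simp

lemma ae_eq_sum: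
  fixes \<phi> \<psi> :: "'i \<Rightarrow> sect"
  shows "(\<And>i. i \<in> I \<Longrightarrow> ae_eq (\<phi> i) (\<psi> i)) \<Longrightarrow> ae_eq (sum \<phi> I :: sect) (sum \<psi> I :: sect)"
  by (induction I rule: infinite_finite_induct) (auto simp: ae_eq_refl ae_eq_add)

lemma ae_eq_diff_zero: "ae_eq (\<phi> - \<psi>) 0 \<longleftrightarrow> ae_eq \<phi> \<psi>"
  by (simp add: ae_eq_def at_point_diff at_point_zero)

lemma ip_cong:
  assumes "\<phi> \<in> L2 (int n)" "\<phi>' \<in> L2 (int n)" "\<psi> \<in> L2 (int n)" "\<psi>' \<in> L2 (int n)"
    and "ae_eq \<phi> \<phi>'" "ae_eq \<psi> \<psi>'"
  shows "ip n \<phi> \<psi> = ip n \<phi>' \<psi>'"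
  unfolding L2_inner_def
proof (rule integral_cong_AE)
  show "(\<lambda>x. herm (int n) (at_point \<phi> x) (at_point \<psi> x)) \<in> borel_measurable \<mu>"
    "(\<lambda>x. herm (int n) (at_point \<phi>' x) (at_point \<psi>' x)) \<in> borel_measurable \<mu>"
    using assms by (auto intro!: herm_measurable L2_measurable)
  show "AE x in \<mu>. herm (int n) (at_point \<phi> x) (at_point \<psi> x) = herm (int n) (at_point \<phi>' x) (at_point \<psi>' x)"
    using assms(5,6) unfolding ae_eq_def by eventually_elim simp
qed

text \<open>Smooth sections are determined by their class.\<close>

lemma smooth_ae_eq:
  assumes \<phi>: "\<phi> \<in> smooth_sections m" "\<psi> \<in> smooth_sections m" and ae: "ae_eq \<phi> \<psi>"
  shows "\<phi> = \<psi>"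
proof (rule ext, clarify)
  fix p q
  show "\<phi> (p, q) = \<psi> (p, q)"
  proof (cases "(p, q) \<in> Spin4")
    case True
    then have pq: "p \<in> SU2" "q \<in> SU2" by (auto simp: Spin4_def)
    have eq: "at_point \<phi> x = at_point \<psi> x" if x: "x \<in> S3" for x
    proof (rule poly_eqI)
      fix k
      have "coeff (at_point \<phi> x) k - coeff (at_point \<psi> x) k = 0"
        by (rule AE_zero_imp_zero[OF _ _ x, where f = "\<lambda>x. coeff (at_point \<phi> x) k - coeff (at_point \<psi> x) k"])
          (use ae in \<open>auto simp: ae_eq_def intro!: continuous_on_diff smooth_continuous_coeff \<phi>\<close>)
      then show "coeff (at_point \<phi> x) k = coeff (at_point \<psi> x) k" by simp
    qed
    have h: "p ** adjoint_mat q \<in> SU2" using pq by simp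
    have pe: "(p ** adjoint_mat q) ** q = p" using pq by (simp add: matrix_mul_assoc[symmetric] SU2_adjoint_left)
    have "\<phi> (p ** adjoint_mat q, mat 1) = \<psi> (p ** adjoint_mat q, mat 1)"
      using eq[OF vec4_S3[OF h]] by (simp add: at_point_def mat4_vec4[OF quat_SU2[OF h]])
    then show ?thesis
      using sections_equivariant[OF smooth_sections_sections[OF \<phi>(1)] h SU2_one pq(2)]
        sections_equivariant[OF smooth_sections_sections[OF \<phi>(2)] h SU2_one pq(2)] by (simp add: pe)
  next
    case False
    then show ?thesis using \<phi> by (simp add: sections_outside[OF smooth_sections_sections])
  qed
qed

lemma Cauchy_Schwarz_L2:
  assumes \<phi>: "\<phi> \<in> L2 (int n)" and \<psi>: "\<psi> \<in> L2 (int n)"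
  shows "cmod (ip n \<phi> \<psi>) \<le> nrm n \<phi> * nrm n \<psi>"
proof -
  let ?c = "ip n \<phi> \<psi>" and ?a = "nrm n \<phi>" and ?b = "nrm n \<psi>"
  have key: "0 \<le> ?a\<^sup>2 - 2 * t * (cmod ?c)\<^sup>2 + t\<^sup>2 * (cmod ?c)\<^sup>2 * ?b\<^sup>2" for t :: real
  proof -
    let ?s = "complex_of_real t * ?c"
    let ?w = "\<phi> - sec_scale ?s \<psi>"
    have w: "?w \<in> L2 (int n)" by (intro L2_diff L2_scale \<phi> \<psi>)
    have "ip n ?w ?w = ip n \<phi> \<phi> - cnj ?s * ?c - ?s * cnj ?c + ?s * cnj ?s * ip n \<psi> \<psi>"
      using \<phi> \<psi> by (simp add: ip_diff_left ip_diff_right L2_diff L2_scale ip_scale_left ip_scale_right ip_commute[of "int n" \<psi> \<phi>] algebra_simps)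
    also have "\<dots> = complex_of_real (?a\<^sup>2 - 2 * t * (cmod ?c)\<^sup>2 + t\<^sup>2 * (cmod ?c)\<^sup>2 * ?b\<^sup>2)"
      using \<phi> \<psi> complex_norm_square[of ?c] by (simp add: ip_self_norm algebra_simps power2_eq_square)
    finally have "complex_of_real ((nrm n ?w)\<^sup>2) = complex_of_real (?a\<^sup>2 - 2 * t * (cmod ?c)\<^sup>2 + t\<^sup>2 * (cmod ?c)\<^sup>2 * ?b\<^sup>2)"
      unfolding ip_self_norm[OF w] .
    then show ?thesis by (metis of_real_eq_iff zero_le_power2)
  qed
  show ?thesis
  proof (cases "?b = 0")
    case True
    have "?c = 0"
    proof (rule ccontr)
      assume "?c \<noteq> 0"
      then have pos: "(cmod ?c)\<^sup>2 > 0" by simp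
      from key[of "(?a\<^sup>2 + 1) / (cmod ?c)\<^sup>2"] True pos have "0 \<le> ?a\<^sup>2 - 2 * (?a\<^sup>2 + 1)" by simp
      then show False by (smt (verit) zero_le_power2)
    qed
    then show ?thesis using True by simp
  next
    case False
    then have b: "?b\<^sup>2 > 0" by simp
    from key[of "1 / ?b\<^sup>2"] have "0 \<le> ?a\<^sup>2 - (cmod ?c)\<^sup>2 / ?b\<^sup>2" using False by (simp add: power2_eq_square field_simps)
    then have "(cmod ?c)\<^sup>2 \<le> (?a * ?b)\<^sup>2" using b by (simp add: field_simps power_mult_distrib)
    then show ?thesis by (rule power2_le_imp_le) (intro mult_nonneg_nonneg L2_norm_nonneg \<phi> \<psi>)
  qed
qed

section \<open>Invariance of the inner product and intertwining maps\<close>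

lemma at_point_spin_act:
  assumes \<phi>: "\<phi> \<in> sections (int n)" and pq: "p \<in> SU2" "q \<in> SU2"
  shows "at_point (spin_act p q \<phi>) x = rho (int n) q (at_point \<phi> (rot (adjoint_mat p) q x))"
proof (cases "x \<in> S3")
  case True
  then have h: "mat4 x \<in> SU2" by (simp add: mat4_SU2_iff)
  have e: "(adjoint_mat p ** mat4 x ** q) ** adjoint_mat q = adjoint_mat p ** mat4 x"
    using pq by (simp add: matrix_mul_assoc[symmetric] SU2_adjoint_right)
  show ?thesis
    using sections_equivariant[OF \<phi>, of "adjoint_mat p ** mat4 x ** q" "mat 1" "adjoint_mat q"] pq h
    by (simp add: at_point_def spin_act_def SU2_matrix_inv mat4_rot e)
next
  case False
  then have h: "mat4 x \<notin> SU2" by (simp add: mat4_SU2_iff)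
  have "adjoint_mat p ** mat4 x \<notin> SU2"
  proof
    assume "adjoint_mat p ** mat4 x \<in> SU2"
    then have "p ** (adjoint_mat p ** mat4 x) \<in> SU2" using pq by simp
    then show False using h pq by (simp add: matrix_mul_assoc SU2_adjoint_right)
  qed
  then have "at_point (spin_act p q \<phi>) x = 0"
    using pq by (simp add: at_point_def spin_act_def SU2_matrix_inv sections_outside[OF \<phi>] Spin4_def)
  moreover have "at_point \<phi> (rot (adjoint_mat p) q x) = 0"
    using False pq by (intro at_point_outside[OF \<phi>]) (simp add: rot_S3_iff)
  ultimately show ?thesis by (simp add: plin_zero[OF plin_rho])
qed

lemma rot_measurable:
  assumes "p \<in> SU2" "q \<in> SU2"
  shows "rot p q \<in> measurable \<mu> \<mu>"
proof -
  have "continuous_on UNIV (rot p q)"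
    using orthogonal_transformation_linear[OF rot_orthogonal[OF assms]]
    by (intro linear_continuous_on linear_conv_bounded_linear[THEN iffD1])
  then show ?thesis using borel_measurable_continuous_onI by (simp cong: measurable_cong_sets)
qed

lemma ip_spin_act:
  assumes \<phi>: "\<phi> \<in> L2 (int n)" "\<psi> \<in> L2 (int n)" and pq: "p \<in> SU2" "q \<in> SU2"
  shows "ip n (spin_act p q \<phi>) (spin_act p q \<psi>) = ip n \<phi> \<psi>"
proof -
  have "ip n (spin_act p q \<phi>) (spin_act p q \<psi>) =
    (LINT x|\<mu>. herm (int n) (at_point \<phi> (rot (adjoint_mat p) q x)) (at_point \<psi> (rot (adjoint_mat p) q x)))"
    unfolding L2_inner_def at_point_spin_act[OF L2_sections[OF \<phi>(1)] pq] at_point_spin_act[OF L2_sections[OF \<phi>(2)] pq]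
      herm_rho[OF pq(2) at_point_in_V[OF L2_sections[OF \<phi>(1)]] at_point_in_V[OF L2_sections[OF \<phi>(2)]]] ..
  also have "\<dots> = ip n \<phi> \<psi>"
    unfolding L2_inner_def
    by (rule integral_sphere_orthogonal[OF rot_orthogonal, of "adjoint_mat p" q "\<lambda>x. herm (int n) (at_point \<phi> x) (at_point \<psi> x)"])
      (use \<phi> pq in \<open>auto intro!: herm_measurable L2_measurable\<close>)
  finally show ?thesis .
qed

lemma spin_act_L2:
  assumes \<phi>: "\<phi> \<in> L2 (int n)" and pq: "p \<in> SU2" "q \<in> SU2"
  shows "spin_act p q \<phi> \<in> L2 (int n)"
proof -
  note s = L2_sections[OF \<phi>]
  have pq': "adjoint_mat p \<in> SU2" using pq by simp
  have iff: "adjoint_mat h ** h' \<in> SU2 \<longleftrightarrow> h' \<in> SU2" if h: "h \<in> SU2" for h h'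
  proof
    assume "adjoint_mat h ** h' \<in> SU2"
    then have "h ** (adjoint_mat h ** h') \<in> SU2" using h by simp
    then show "h' \<in> SU2" using h by (simp add: matrix_mul_assoc SU2_adjoint_right)
  qed (use h in simp)
  have "spin_act p q \<phi> \<in> sections (int n)"
    unfolding sections_def
  proof (intro CollectI conjI ballI allI impI)
    fix g assume "g \<notin> Spin4"
    then show "spin_act p q \<phi> g = 0"
      using pq by (cases g) (auto simp: spin_act_def SU2_matrix_inv Spin4_def iff intro!: sections_outside[OF s])
  next
    fix g assume "g \<in> Spin4"
    show "spin_act p q \<phi> g \<in> V (int n)" by (cases g) (auto simp: spin_act_def sections_in_V[OF s])
  next
    fix p' q' h assume "p' \<in> SU2" "q' \<in> SU2" "h \<in> SU2"
    then show "spin_act p q \<phi> (p' ** h, q' ** h) = rho (int n) (matrix_inv h) (spin_act p q \<phi> (p', q'))"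
      using pq sections_equivariant[OF s, of "adjoint_mat p ** p'" "adjoint_mat q ** q'" h]
      by (simp add: spin_act_def SU2_matrix_inv matrix_mul_assoc)
  qed
  moreover have "(\<lambda>x. coeff (at_point (spin_act p q \<phi>) x) k) \<in> borel_measurable \<mu>" for k
  proof -
    have "(\<lambda>x. \<Sum>j\<le>n. coeff (at_point \<phi> (rot (adjoint_mat p) q x)) j * coeff (rho (int n) q (monom 1 j)) k) \<in> borel_measurable \<mu>"
      by (intro borel_measurable_sum borel_measurable_times borel_measurable_const
          measurable_compose[OF rot_measurable[OF pq' pq(2)] L2_measurable[OF \<phi>]])
    moreover have "(\<lambda>x. \<Sum>j\<le>n. coeff (at_point \<phi> (rot (adjoint_mat p) q x)) j * coeff (rho (int n) q (monom 1 j)) k)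
       = (\<lambda>x. coeff (at_point (spin_act p q \<phi>) x) k)"
      by (simp add: fun_eq_iff at_point_spin_act[OF s pq] plin_expand[OF plin_rho at_point_in_V[OF s]] coeff_sum)
    ultimately show ?thesis by simp
  qed
  moreover have "integrable \<mu> (\<lambda>x. herm (int n) (at_point (spin_act p q \<phi>) x) (at_point (spin_act p q \<phi>) x))"
  proof -
    have "integrable (distr \<mu> borel (rot (adjoint_mat p) q)) (\<lambda>x. herm (int n) (at_point \<phi> x) (at_point \<phi> x))"
      by (simp add: sphere_measure_orthogonal rot_orthogonal pq L2_integrable[OF \<phi>])
    then have "integrable \<mu> (\<lambda>x. herm (int n) (at_point \<phi> (rot (adjoint_mat p) q x)) (at_point \<phi> (rot (adjoint_mat p) q x)))"
      by (rule integrable_distr[rotated]) (use rot_measurable[OF pq' pq(2)] in \<open>simp cong: measurable_cong_sets\<close>)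
    then show ?thesis by (simp add: at_point_spin_act[OF s pq] herm_rho[OF pq(2)] at_point_in_V[OF s])
  qed
  ultimately show ?thesis by (simp add: L2_def)
qed

text \<open>The part of the notion of a component that remains without injectivity. It suffices for orthogonality.\<close>

definition intertwiner :: "nat \<Rightarrow> nat \<Rightarrow> nat \<Rightarrow> (complex poly \<Rightarrow> complex poly \<Rightarrow> sect) \<Rightarrow> bool" where
  "intertwiner n a b \<beta> \<longleftrightarrow>
     (\<forall>v\<in>V (int a). \<forall>w\<in>V (int b). \<beta> v w \<in> L2 (int n)) \<and>
     (\<forall>v\<in>V (int a). \<forall>v'\<in>V (int a). \<forall>w\<in>V (int b). ae_eq (\<beta> (v + v') w) (\<beta> v w + \<beta> v' w)) \<and>
     (\<forall>v\<in>V (int a). \<forall>w\<in>V (int b). \<forall>w'\<in>V (int b). ae_eq (\<beta> v (w + w')) (\<beta> v w + \<beta> v w')) \<and>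
     (\<forall>c. \<forall>v\<in>V (int a). \<forall>w\<in>V (int b).
        ae_eq (\<beta> (smult c v) w) (sec_scale c (\<beta> v w)) \<and>
        ae_eq (\<beta> v (smult c w)) (sec_scale c (\<beta> v w))) \<and>
     (\<forall>p\<in>SU2. \<forall>q\<in>SU2. \<forall>v\<in>V (int a). \<forall>w\<in>V (int b).
        ae_eq (\<beta> (rho (int a) p v) (rho (int b) q w)) (spin_act p q (\<beta> v w)))"

lemma intertwiner_bsec: "intertwiner (A + B) (A + r) (B + r) (bsec A B r)"
  unfolding intertwiner_def
  by (auto simp: smooth_L2 bsec_smooth bsec_add_left bsec_add_right bsec_smult_left bsec_smult_right spin_act_bsec ae_eq_refl
      simp del: of_nat_add)

text \<open>A linear map into the space of classes of sections.\<close>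

definition ae_linear :: "nat \<Rightarrow> nat \<Rightarrow> (complex poly \<Rightarrow> sect) \<Rightarrow> bool" where
  "ae_linear n a f \<longleftrightarrow> (\<forall>v\<in>V (int a). f v \<in> L2 (int n) \<and> (\<forall>v'\<in>V (int a). ae_eq (f (v + v')) (f v + f v')) \<and>
     (\<forall>c. ae_eq (f (smult c v)) (sec_scale c (f v))))"

lemma sesq_L2_inner:
  assumes f: "ae_linear n a f" and g: "ae_linear n b g"
  shows "sesq (\<lambda>v w. ip n (f v) (g w)) a b"
proof -
  have L: "\<And>v. v \<in> V (int a) \<Longrightarrow> f v \<in> L2 (int n)" "\<And>w. w \<in> V (int b) \<Longrightarrow> g w \<in> L2 (int n)"
    using f g by (auto simp: ae_linear_def)
  have fl: "ip n (f (v + v')) x = ip n (f v + f v') x" "ip n (f (smult c v)) x = ip n (sec_scale c (f v)) x"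
    if "v \<in> V (int a)" "v' \<in> V (int a)" "x \<in> L2 (int n)" for v v' x c
    using f that by (auto intro!: ip_cong L L2_add L2_scale V_add V_smult ae_eq_refl simp: ae_linear_def)
  have gl: "ip n x (g (v + v')) = ip n x (g v + g v')" "ip n x (g (smult c v)) = ip n x (sec_scale c (g v))"
    if "v \<in> V (int b)" "v' \<in> V (int b)" "x \<in> L2 (int n)" for v v' x c
    using g that by (auto intro!: ip_cong L L2_add L2_scale V_add V_smult ae_eq_refl simp: ae_linear_def)
  show ?thesis
    unfolding sesq_def by (simp add: fl gl L ip_add_left ip_add_right ip_scale_left ip_scale_right)
qed

context
  fixes n a b a' b' :: nat and \<beta> \<beta>' :: "complex poly \<Rightarrow> complex poly \<Rightarrow> sect"
  assumes \<beta>: "intertwiner n a b \<beta>" and \<beta>': "intertwiner n a' b' \<beta>'"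
begin

lemma intertwiner_L2: "v \<in> V (int a) \<Longrightarrow> w \<in> V (int b) \<Longrightarrow> \<beta> v w \<in> L2 (int n)"
  "v \<in> V (int a') \<Longrightarrow> w \<in> V (int b') \<Longrightarrow> \<beta>' v w \<in> L2 (int n)"
  using \<beta> \<beta>' by (auto simp: intertwiner_def)

lemma intertwiner_sesq:
  shows "w \<in> V (int b) \<Longrightarrow> w' \<in> V (int b') \<Longrightarrow> sesq (\<lambda>v v'. ip n (\<beta> v w) (\<beta>' v' w')) a a'"
    and "v \<in> V (int a) \<Longrightarrow> v' \<in> V (int a') \<Longrightarrow> sesq (\<lambda>w w'. ip n (\<beta> v w) (\<beta>' v' w')) b b'"
  using \<beta> \<beta>' by (intro sesq_L2_inner; auto simp: intertwiner_def ae_linear_def)+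

lemma intertwiner_invariant:
  assumes pq: "p \<in> SU2" "q \<in> SU2" and v: "v \<in> V (int a)" "w \<in> V (int b)" "v' \<in> V (int a')" "w' \<in> V (int b')"
  shows "ip n (\<beta> (rho (int a) p v) (rho (int b) q w)) (\<beta>' (rho (int a') p v') (rho (int b') q w')) =
    ip n (\<beta> v w) (\<beta>' v' w')"
proof -
  have "ip n (\<beta> (rho (int a) p v) (rho (int b) q w)) (\<beta>' (rho (int a') p v') (rho (int b') q w')) =
    ip n (spin_act p q (\<beta> v w)) (spin_act p q (\<beta>' v' w'))"
  proof (rule ip_cong)
    show "ae_eq (\<beta> (rho (int a) p v) (rho (int b) q w)) (spin_act p q (\<beta> v w))"
      "ae_eq (\<beta>' (rho (int a') p v') (rho (int b') q w')) (spin_act p q (\<beta>' v' w'))"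
      using \<beta> \<beta>' pq v by (auto simp: intertwiner_def)
  qed (auto intro: intertwiner_L2 rho_in_V spin_act_L2 v pq)
  also have "\<dots> = ip n (\<beta> v w) (\<beta>' v' w')"
    by (rule ip_spin_act) (auto intro: intertwiner_L2 v pq)
  finally show ?thesis .
qed

lemma intertwiner_rho_inv:
  shows "w \<in> V (int b) \<Longrightarrow> w' \<in> V (int b') \<Longrightarrow> rho_inv (\<lambda>v v'. ip n (\<beta> v w) (\<beta>' v' w')) a a'"
    and "v \<in> V (int a) \<Longrightarrow> v' \<in> V (int a') \<Longrightarrow> rho_inv (\<lambda>w w'. ip n (\<beta> v w) (\<beta>' v' w')) b b'"
  using intertwiner_invariant[OF _ SU2_one] intertwiner_invariant[OF SU2_one]
  by (auto simp: rho_inv_def rho_one)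

lemma intertwiner_orthogonal:
  assumes "(a, b) \<noteq> (a', b')" and v: "v \<in> V (int a)" "w \<in> V (int b)" "v' \<in> V (int a')" "w' \<in> V (int b')"
  shows "ip n (\<beta> v w) (\<beta>' v' w') = 0"
proof (cases "a = a'")
  case False
  then show ?thesis by (rule schur_distinct[OF intertwiner_sesq(1)[OF v(2,4)] intertwiner_rho_inv(1)[OF v(2,4)] _ v(1,3)])
next
  case True
  then have "b \<noteq> b'" using assms(1) by simp
  then show ?thesis by (rule schur_distinct[OF intertwiner_sesq(2)[OF v(1,3)] intertwiner_rho_inv(2)[OF v(1,3)] _ v(2,4)])
qed

end

lemma intertwiner_proportional:
  assumes \<beta>: "intertwiner n a b \<beta>" and \<beta>': "intertwiner n a b \<beta>'"
  obtains c where "\<And>v w v' w'. v \<in> V (int a) \<Longrightarrow> w \<in> V (int b) \<Longrightarrow> v' \<in> V (int a) \<Longrightarrow> w' \<in> V (int b) \<Longrightarrow>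
    ip n (\<beta> v w) (\<beta>' v' w') = c * herm (int a) v v' * herm (int b) w w'"
proof -
  let ?a = "monom 1 a :: complex poly" and ?b = "monom 1 b :: complex poly"
  have ab: "?a \<in> V (int a)" "?b \<in> V (int b)" by (simp_all add: V_monom)
  show thesis
  proof (rule that)
    fix v w v' w' assume v: "v \<in> V (int a)" "w \<in> V (int b)" "v' \<in> V (int a)" "w' \<in> V (int b)"
    have "ip n (\<beta> v w) (\<beta>' v' w') = ip n (\<beta> ?a w) (\<beta>' ?a w') / fact a * herm (int a) v v'"
      by (rule schur_same[OF intertwiner_sesq(1)[OF \<beta> \<beta>' v(2,4)] intertwiner_rho_inv(1)[OF \<beta> \<beta>' v(2,4)] v(1,3)])
    also have "ip n (\<beta> ?a w) (\<beta>' ?a w') = ip n (\<beta> ?a ?b) (\<beta>' ?a ?b) / fact b * herm (int b) w w'"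
      by (rule schur_same[OF intertwiner_sesq(2)[OF \<beta> \<beta>' ab(1) ab(1)] intertwiner_rho_inv(2)[OF \<beta> \<beta>' ab(1) ab(1)] v(2,4)])
    finally show "ip n (\<beta> v w) (\<beta>' v' w') = (ip n (\<beta> ?a ?b) (\<beta>' ?a ?b) / (fact a * fact b)) * herm (int a) v v' * herm (int b) w w'"
      by (simp add: field_simps)
  qed
qed

text \<open>
  By Schur's lemma only \<open>c \<noteq> 0\<close> needs a proof: at the identity the section attached to \<open>z\<^bsup>A+r\<^esup>\<close> and \<open>1\<close> takes the value
  \<open>z\<^sup>A \<noteq> 0\<close>.
\<close>

lemma bsec_inner:
  obtains c where "c \<noteq> 0" "\<And>v w v' w'. v \<in> V (int (A + r)) \<Longrightarrow> w \<in> V (int (B + r)) \<Longrightarrow> v' \<in> V (int (A + r)) \<Longrightarrow> w' \<in> V (int (B + r)) \<Longrightarrow>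
    ip (A + B) (bsec A B r v w) (bsec A B r v' w') = c * herm (int (A + r)) v v' * herm (int (B + r)) w w'"
proof -
  obtain c where c: "\<And>v w v' w'. v \<in> V (int (A + r)) \<Longrightarrow> w \<in> V (int (B + r)) \<Longrightarrow> v' \<in> V (int (A + r)) \<Longrightarrow> w' \<in> V (int (B + r)) \<Longrightarrow>
    ip (A + B) (bsec A B r v w) (bsec A B r v' w') = c * herm (int (A + r)) v v' * herm (int (B + r)) w w'"
    using intertwiner_proportional[OF intertwiner_bsec intertwiner_bsec] by metis
  have "c \<noteq> 0"
  proof
    assume "c = 0"
    let ?u = "bsec A B r (pw (A + r) 1 0) (pw (B + r) 0 1)"
    have sm: "?u \<in> smooth (A + B)" by (rule bsec_smooth) (rule pw_in_V)+
    have "ae_eq ?u 0"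
      by (rule ip_self_zero[OF smooth_L2[OF sm]]) (simp only: c[OF pw_in_V pw_in_V pw_in_V pw_in_V] \<open>c = 0\<close> mult_zero_left)
    then have "?u = 0" by (rule smooth_ae_eq[OF sm smooth_sections_zero])
    then have "?u (mat 1, mat 1) = 0" by simp
    moreover have "?u (mat 1, mat 1) = [:0, 1:] ^ A"
      by (simp add: bsec_apply rho_one transvectant_pw del: of_nat_add) (simp add: one_pCons flip: one_pCons)
    ultimately show False by simp
  qed
  then show thesis using that c by blast
qed

section \<open>Density of polynomial functions in L2 of the sphere\<close>

lemma continuous_sphere_integrable:
  fixes h :: "real ^ 4 \<Rightarrow> complex"
  assumes h: "continuous_on UNIV h"
  shows "h \<in> borel_measurable \<mu>" "integrable \<mu> h" "integrable \<mu> (\<lambda>x. (norm (h x))\<^sup>2)"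
proof -
  have m: "g \<in> borel_measurable \<mu>" "integrable \<mu> g" if g: "continuous_on UNIV g" for g :: "real ^ 4 \<Rightarrow> complex"
  proof -
    show m: "g \<in> borel_measurable \<mu>" using borel_measurable_continuous_onI[OF g] by (simp cong: measurable_cong_sets)
    have "continuous_on S3 (\<lambda>x. if x \<in> S3 then g x else 0)"
      using continuous_on_subset[OF g, of S3] by (simp cong: continuous_on_cong)
    then have "integrable \<mu> (\<lambda>x. if x \<in> S3 then g x else 0)" "(\<lambda>x. if x \<in> S3 then g x else 0) \<in> borel_measurable \<mu>"
      by (rule sphere_continuous; simp)+
    moreover have "AE x in \<mu>. (if x \<in> S3 then g x else 0) = g x" using AE_S3 by eventually_elim simp
    ultimately show "integrable \<mu> g" using m integrable_cong_AE by blast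
  qed
  show "h \<in> borel_measurable \<mu>" "integrable \<mu> h" using m[OF h] by blast+
  have "continuous_on UNIV (\<lambda>x. complex_of_real ((norm (h x))\<^sup>2))" by (intro continuous_intros h)
  from integrable_Re[OF m(2)[OF this]] show "integrable \<mu> (\<lambda>x. (norm (h x))\<^sup>2)" by simp
qed

lemma norm_diff_square_bound: "(norm (a - b))\<^sup>2 \<le> 2 * (norm a)\<^sup>2 + 2 * (norm b)\<^sup>2" for a b :: complex
proof -
  have "norm (a - b) \<le> norm a + norm b" by (rule norm_triangle_ineq4)
  then have "(norm (a - b))\<^sup>2 \<le> (norm a + norm b)\<^sup>2" by (rule power_mono) simp
  also have "\<dots> \<le> 2 * (norm a)\<^sup>2 + 2 * (norm b)\<^sup>2"
    using sum_squares_bound[of "norm a" "norm b"] by (simp add: power2_sum)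
  finally show ?thesis .
qed

lemma square_diff_integrable:
  fixes f g :: "real ^ 4 \<Rightarrow> complex"
  assumes "f \<in> borel_measurable \<mu>" "g \<in> borel_measurable \<mu>" "integrable \<mu> (\<lambda>x. (norm (f x))\<^sup>2)" "integrable \<mu> (\<lambda>x. (norm (g x))\<^sup>2)"
  shows "integrable \<mu> (\<lambda>x. (norm (f x - g x))\<^sup>2)"
proof (rule Bochner_Integration.integrable_bound)
  show "integrable \<mu> (\<lambda>x. 2 * (norm (f x))\<^sup>2 + 2 * (norm (g x))\<^sup>2)"
    by (intro Bochner_Integration.integrable_add integrable_mult_right assms)
  show "(\<lambda>x. (norm (f x - g x))\<^sup>2) \<in> borel_measurable \<mu>" using assms(1,2) by measurable
  show "AE x in \<mu>. norm ((norm (f x - g x))\<^sup>2) \<le> norm (2 * (norm (f x))\<^sup>2 + 2 * (norm (g x))\<^sup>2)"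
    using norm_diff_square_bound by (intro AE_I2) simp
qed

lemma square_diff_triangle:
  fixes f g h :: "real ^ 4 \<Rightarrow> complex"
  assumes m: "f \<in> borel_measurable \<mu>" "g \<in> borel_measurable \<mu>" "h \<in> borel_measurable \<mu>"
    and i: "integrable \<mu> (\<lambda>x. (norm (f x))\<^sup>2)" "integrable \<mu> (\<lambda>x. (norm (g x))\<^sup>2)" "integrable \<mu> (\<lambda>x. (norm (h x))\<^sup>2)"
  shows "(LINT x|\<mu>. (norm (f x - h x))\<^sup>2) \<le> 2 * (LINT x|\<mu>. (norm (f x - g x))\<^sup>2) + 2 * (LINT x|\<mu>. (norm (g x - h x))\<^sup>2)"
proof -
  have "(LINT x|\<mu>. (norm (f x - h x))\<^sup>2) \<le> (LINT x|\<mu>. 2 * (norm (f x - g x))\<^sup>2 + 2 * (norm (g x - h x))\<^sup>2)"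
  proof (rule integral_mono)
    fix x
    show "(norm (f x - h x))\<^sup>2 \<le> 2 * (norm (f x - g x))\<^sup>2 + 2 * (norm (g x - h x))\<^sup>2"
      using norm_diff_square_bound[of "f x - g x" "h x - g x"] by (simp add: norm_minus_commute)
  qed (intro square_diff_integrable Bochner_Integration.integrable_add integrable_mult_right m i)+
  also have "\<dots> = 2 * (LINT x|\<mu>. (norm (f x - g x))\<^sup>2) + 2 * (LINT x|\<mu>. (norm (g x - h x))\<^sup>2)"
    by (subst Bochner_Integration.integral_add) (auto intro!: square_diff_integrable m i)
  finally show ?thesis .
qed

lemma outer_approx:
  assumes A: "A \<in> sets borel" and d: "0 < d"
  obtains U where "open U" "A \<subseteq> U" "measure \<mu> (U - A) < d"
proof -
  interpret finite_measure \<mu> by (rule finite_sphere_measure)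
  have "emeasure \<mu> A = (INF U\<in>{U. A \<subseteq> U \<and> open U}. emeasure \<mu> U)"
    by (rule outer_regular) (use A in \<open>auto simp: emeasure_eq_measure\<close>)
  moreover have "emeasure \<mu> A < emeasure \<mu> A + ennreal d"
    using d by (simp add: emeasure_eq_measure ennreal_less_iff flip: ennreal_plus)
  ultimately have "(INF U\<in>{U. A \<subseteq> U \<and> open U}. emeasure \<mu> U) < emeasure \<mu> A + ennreal d" by simp
  then obtain U where U: "A \<subseteq> U" "open U" "emeasure \<mu> U < emeasure \<mu> A + ennreal d" by (auto simp: INF_less_iff)
  have "measure \<mu> U < measure \<mu> A + d"
    using U(3) d by (simp add: emeasure_eq_measure ennreal_less_iff flip: ennreal_plus)
  moreover have "measure \<mu> (U - A) = measure \<mu> U - measure \<mu> A"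
    by (rule finite_measure_Diff) (use A U in auto)
  ultimately show thesis using that U by simp
qed

lemma borel_measurable_cmod: "f \<in> borel_measurable M \<Longrightarrow> (\<lambda>x. norm (f x :: complex)) \<in> borel_measurable M"
  by measurable

text \<open>
  By regularity of the measure a Borel set lies between a closed and an open set of nearly the same measure;
  Urysohn's lemma interpolates between their indicators.
\<close>

lemma L1_dense:
  fixes f :: "real ^ 4 \<Rightarrow> complex"
  assumes "integrable \<mu> f"
  shows "\<forall>e>0. \<exists>h. continuous_on UNIV h \<and> (LINT x|\<mu>. norm (f x - h x)) < e"
  using assms
proof (induction rule: integrable_induct)
  case (base A c)
  interpret finite_measure \<mu> by (rule finite_sphere_measure)
  have A: "A \<in> sets borel" "- A \<in> sets borel" using base by auto
  show ?case
  proof (intro allI impI)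
    fix e :: real assume e: "0 < e"
    define d where "d = e / (2 * (norm c + 1))"
    have d: "0 < d" using e by (simp add: d_def add_nonneg_pos)
    \<comment> \<open>open neighbourhoods of \<open>A\<close> and of its complement, both with excess measure below \<open>d\<close>\<close>
    obtain U where U: "open U" "A \<subseteq> U" "measure \<mu> (U - A) < d" by (rule outer_approx[OF A(1) d])
    obtain W where W: "open W" "- A \<subseteq> W" "measure \<mu> (W - - A) < d" by (rule outer_approx[OF A(2) d])
    have "closed (- W)" "closed (- U)" "- W \<inter> - U = {}" using U W by auto
    then obtain h :: "real ^ 4 \<Rightarrow> complex" where h: "continuous_on UNIV h" "\<And>x. h x \<in> closed_segment c 0"
      "\<And>x. x \<in> - W \<Longrightarrow> h x = c" "\<And>x. x \<in> - U \<Longrightarrow> h x = 0"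
      by (rule Urysohn[of "- W" "- U" c 0]) blast
    have b: "norm (indicator A x *\<^sub>R c - h x) \<le> norm c * indicator ((U - A) \<union> (W - - A)) x" for x
    proof (cases "x \<in> (U - A) \<union> (W - - A)")
      case True
      have "norm (indicator A x *\<^sub>R c - h x) \<le> norm c"
      proof -
        obtain u where u: "h x = (1 - u) *\<^sub>R c" "0 \<le> u" "u \<le> 1" using h(2)[of x] by (auto simp: closed_segment_def)
        show ?thesis
        proof (cases "x \<in> A")
          case True
          then have "indicator A x *\<^sub>R c - h x = u *\<^sub>R c" by (simp add: u algebra_simps)
          then show ?thesis using u by (simp add: mult_left_le_one_le)
        next
          case False
          then show ?thesis using u by (simp add: mult_left_le_one_le)
        qed
      qed
      then show ?thesis using True by simp
    next
      case False
      then have "indicator A x *\<^sub>R c - h x = 0" using h(3,4)[of x] U(2) W(2) by (cases "x \<in> A") auto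
      then show ?thesis using False by simp
    qed
    have sets: "U - A \<in> sets \<mu>" "W - - A \<in> sets \<mu>" using U W A by auto
    have "(LINT x|\<mu>. norm (indicator A x *\<^sub>R c - h x)) \<le> (LINT x|\<mu>. norm c * indicator ((U - A) \<union> (W - - A)) x)"
    proof (rule integral_mono)
      show "integrable \<mu> (\<lambda>x. norm (indicator A x *\<^sub>R c - h x))"
        using base by (intro integrable_norm Bochner_Integration.integrable_diff continuous_sphere_integrable h integrable_scaleR_left)
          (auto simp: emeasure_eq_measure)
      show "integrable \<mu> (\<lambda>x. norm c * indicator ((U - A) \<union> (W - - A)) x)"
        using sets by (intro integrable_mult_right integrable_real_indicator) (auto simp: emeasure_eq_measure)
    qed (rule b)
    also have "\<dots> = norm c * measure \<mu> ((U - A) \<union> (W - - A))" using sets by simp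
    also have "\<dots> \<le> norm c * (measure \<mu> (U - A) + measure \<mu> (W - - A))"
      using sets by (intro mult_left_mono measure_Un_le) auto
    also have "\<dots> \<le> norm c * (d + d)" using U(3) W(3) by (intro mult_left_mono) auto
    also have "\<dots> < e"
    proof -
      have "norm c * (d + d) = e * (norm c / (norm c + 1))"
      proof -
        have "d + d = e / (norm c + 1)" using add_nonneg_pos[of "norm c" 1] unfolding d_def
          by (metis add_divide_distrib field_sum_of_halves divide_divide_eq_left mult.commute norm_ge_zero)
        then show ?thesis by simp
      qed
      also have "\<dots> < e * 1" using e by (intro mult_strict_left_mono) (simp_all add: divide_less_eq add_nonneg_pos)
      finally show ?thesis by simp
    qed
    finally show "\<exists>h. continuous_on UNIV h \<and> (LINT x|\<mu>. norm (indicator A x *\<^sub>R c - h x)) < e" using h(1) by blast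
  qed
next
  case (add f g)
  show ?case
  proof (intro allI impI)
    fix e :: real assume e: "0 < e"
    obtain h where h: "continuous_on UNIV h" "(LINT x|\<mu>. norm (f x - h x)) < e / 2" using add.IH(1) e half_gt_zero by blast
    obtain k where k: "continuous_on UNIV k" "(LINT x|\<mu>. norm (g x - k x)) < e / 2" using add.IH(2) e half_gt_zero by blast
    have i: "integrable \<mu> (\<lambda>x. norm (f x - h x))" "integrable \<mu> (\<lambda>x. norm (g x - k x))"
      using add.hyps continuous_sphere_integrable(2)[OF h(1)] continuous_sphere_integrable(2)[OF k(1)] by auto
    have "(LINT x|\<mu>. norm ((f x + g x) - (h x + k x))) \<le> (LINT x|\<mu>. norm (f x - h x) + norm (g x - k x))"
    proof (rule integral_mono)
      show "integrable \<mu> (\<lambda>x. norm ((f x + g x) - (h x + k x)))"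
        using add.hyps continuous_sphere_integrable(2)[OF h(1)] continuous_sphere_integrable(2)[OF k(1)] by auto
      show "norm ((f x + g x) - (h x + k x)) \<le> norm (f x - h x) + norm (g x - k x)" for x
        by (simp add: norm_diff_triangle_ineq)
    qed (use i in auto)
    also have "\<dots> < e" using i h(2) k(2) by simp
    finally show "\<exists>h. continuous_on UNIV h \<and> (LINT x|\<mu>. norm ((f x + g x) - h x)) < e"
      using h(1) k(1) by (intro exI[of _ "\<lambda>x. h x + k x"]) (auto intro: continuous_on_add)
  qed
next
  case (lim f s)
  show ?case
  proof (intro allI impI)
    fix e :: real assume e: "0 < e"
    have "(\<lambda>i. LINT x|\<mu>. norm (f x - s i x)) \<longlonglongrightarrow> (LINT x|\<mu>. 0)"
    proof (rule integral_dominated_convergence[where w = "\<lambda>x. 3 * norm (f x)"])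
      show "(\<lambda>x. norm (f x - s i x)) \<in> borel_measurable \<mu>" for i
        using lim.hyps(1)[of i] lim.hyps(4) by (auto intro!: borel_measurable_cmod borel_measurable_diff dest: borel_measurable_integrable)
      show "integrable \<mu> (\<lambda>x. 3 * norm (f x))" using lim.hyps(4) by auto
      show "AE x in \<mu>. (\<lambda>i. norm (f x - s i x)) \<longlonglongrightarrow> 0"
      proof (rule AE_I2)
        fix x
        have "(\<lambda>i. f x - s i x) \<longlonglongrightarrow> f x - f x" using lim.hyps(2)[of x] by (intro tendsto_diff tendsto_const) auto
        then show "(\<lambda>i. norm (f x - s i x)) \<longlonglongrightarrow> 0" using tendsto_norm_zero by fastforce
      qed
      show "AE x in \<mu>. norm (norm (f x - s i x)) \<le> 3 * norm (f x)" for i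
      proof (rule AE_I2)
        fix x
        show "norm (norm (f x - s i x)) \<le> 3 * norm (f x)"
          using norm_triangle_ineq4[of "f x" "s i x"] lim.hyps(3)[of x i] by simp
      qed
    qed auto
    then have "(\<lambda>i. LINT x|\<mu>. norm (f x - s i x)) \<longlonglongrightarrow> 0" by simp
    then have "\<forall>\<^sub>F i in sequentially. (LINT x|\<mu>. norm (f x - s i x)) < e / 2"
      using e by (intro order_tendstoD(2)) auto
    then obtain i where i: "(LINT x|\<mu>. norm (f x - s i x)) < e / 2" by (auto simp: eventually_sequentially)
    obtain h where h: "continuous_on UNIV h" "(LINT x|\<mu>. norm (s i x - h x)) < e / 2" using lim.IH[of i] e half_gt_zero by blast
    have I: "integrable \<mu> (\<lambda>x. norm (f x - s i x))" "integrable \<mu> (\<lambda>x. norm (s i x - h x))" "integrable \<mu> (\<lambda>x. norm (f x - h x))"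
      using lim.hyps(1)[of i] lim.hyps(4) continuous_sphere_integrable(2)[OF h(1)] by auto
    have "(LINT x|\<mu>. norm (f x - h x)) \<le> (LINT x|\<mu>. norm (f x - s i x) + norm (s i x - h x))"
      by (rule integral_mono) (use I in \<open>auto intro: order_trans[OF eq_refl norm_triangle_ineq]\<close>)
    also have "\<dots> < e" using I i h(2) by simp
    finally show "\<exists>h. continuous_on UNIV h \<and> (LINT x|\<mu>. norm (f x - h x)) < e" using h(1) by blast
  qed
qed

text \<open>
  Truncate the function to a bounded one, approximate that in \<open>L1\<close> and project the approximation to the ball of the
  same radius: there the square of the distance is controlled by the distance.
\<close>

lemma L2_dense:
  fixes f :: "real ^ 4 \<Rightarrow> complex"
  assumes f: "f \<in> borel_measurable \<mu>" "integrable \<mu> (\<lambda>x. (norm (f x))\<^sup>2)" and e: "0 < e"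
  obtains h where "continuous_on UNIV h" "(LINT x|\<mu>. (norm (f x - h x))\<^sup>2) < e"
proof -
  interpret finite_measure \<mu> by (rule finite_sphere_measure)
  let ?g = "\<lambda>N x. if norm (f x) \<le> real N then f x else 0"
  have mg: "?g N \<in> borel_measurable \<mu>" for N using f(1) by measurable
  have "(\<lambda>N. LINT x|\<mu>. (norm (f x - ?g N x))\<^sup>2) \<longlonglongrightarrow> (LINT x|\<mu>. 0)"
  proof (rule integral_dominated_convergence[where w = "\<lambda>x. (norm (f x))\<^sup>2"])
    show "(\<lambda>x. (norm (f x - ?g N x))\<^sup>2) \<in> borel_measurable \<mu>" for N
      using f(1) mg[of N] by (intro borel_measurable_power borel_measurable_cmod borel_measurable_diff)
    show "AE x in \<mu>. (\<lambda>N. (norm (f x - ?g N x))\<^sup>2) \<longlonglongrightarrow> 0"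
    proof (rule AE_I2)
      fix x
      obtain N0 where "norm (f x) \<le> real N0" using real_arch_simple by blast
      then have "\<forall>\<^sub>F N in sequentially. (norm (f x - ?g N x))\<^sup>2 = 0"
        by (intro eventually_sequentiallyI[of N0]) auto
      then show "(\<lambda>N. (norm (f x - ?g N x))\<^sup>2) \<longlonglongrightarrow> 0" by (rule tendsto_eventually)
    qed
  qed (use f in auto)
  then have "\<forall>\<^sub>F N in sequentially. (LINT x|\<mu>. (norm (f x - ?g N x))\<^sup>2) < e / 4"
    using e by (intro order_tendstoD(2)) auto
  then obtain N0 where N0: "\<And>N. N \<ge> N0 \<Longrightarrow> (LINT x|\<mu>. (norm (f x - ?g N x))\<^sup>2) < e / 4" by (auto simp: eventually_sequentially)
  define N where "N = Suc N0"
  have N: "(LINT x|\<mu>. (norm (f x - ?g N x))\<^sup>2) < e / 4" "0 < real N" using N0[of N] by (auto simp: N_def)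
  let ?G = "?g N"
  have bg: "norm (?G x) \<le> real N" for x by auto
  have iG: "integrable \<mu> ?G" by (rule integrable_const_bound[OF _ mg]) (use bg in auto)
  have iG2: "integrable \<mu> (\<lambda>x. (norm (?G x))\<^sup>2)"
    by (rule integrable_const_bound[of _ "(real N)\<^sup>2"]) (use bg mg[of N] in \<open>auto intro!: AE_I2 power_mono borel_measurable_power borel_measurable_norm\<close>)
  have "0 < e / (8 * real N)" using e N(2) by simp
  then obtain h where h: "continuous_on UNIV h" "(LINT x|\<mu>. norm (?G x - h x)) < e / (8 * real N)"
    using L1_dense[OF iG] by blast
  let ?C = "cball 0 (real N) :: complex set"
  let ?h = "\<lambda>x. closest_point ?C (h x)"
  have C: "convex ?C" "closed ?C" "?C \<noteq> {}" by auto
  have ch: "continuous_on UNIV ?h"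
    by (rule continuous_on_compose2[OF continuous_on_closest_point[OF C, of UNIV] h(1)]) auto
  have le: "norm (?G x - ?h x) \<le> norm (?G x - h x)" for x
    using closest_point_lipschitz[OF C, of "?G x" "h x"] closest_point_self[of "?G x" ?C] bg[of x] by (simp add: dist_norm)
  have sq: "(norm (?G x - ?h x))\<^sup>2 \<le> 2 * real N * norm (?G x - h x)" for x
  proof -
    have "norm (?h x) \<le> real N" using closest_point_in_set[of ?C "h x"] C by (simp add: dist_norm)
    then have "norm (?G x - ?h x) \<le> 2 * real N" using norm_triangle_ineq4[of "?G x" "?h x"] bg[of x] by linarith
    then have "norm (?G x - ?h x) * norm (?G x - ?h x) \<le> 2 * real N * norm (?G x - h x)"
      by (intro mult_mono le) auto
    then show ?thesis by (simp add: power2_eq_square)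
  qed
  have "(LINT x|\<mu>. (norm (?G x - ?h x))\<^sup>2) \<le> (LINT x|\<mu>. 2 * real N * norm (?G x - h x))"
  proof (rule integral_mono)
    show "integrable \<mu> (\<lambda>x. (norm (?G x - ?h x))\<^sup>2)"
      by (rule square_diff_integrable[OF mg continuous_sphere_integrable(1)[OF ch] iG2 continuous_sphere_integrable(3)[OF ch]])
    show "integrable \<mu> (\<lambda>x. 2 * real N * norm (?G x - h x))"
      by (intro integrable_mult_right integrable_norm Bochner_Integration.integrable_diff iG continuous_sphere_integrable h)
  qed (rule sq)
  also have "\<dots> = 2 * real N * (LINT x|\<mu>. norm (?G x - h x))" by simp
  also have "\<dots> < 2 * real N * (e / (8 * real N))" using h(2) N(2) by (intro mult_strict_left_mono) auto
  also have "\<dots> = e / 4" using N(2) by simp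
  finally have "(LINT x|\<mu>. (norm (?G x - ?h x))\<^sup>2) < e / 4" .
  moreover have "(LINT x|\<mu>. (norm (f x - ?h x))\<^sup>2) \<le> 2 * (LINT x|\<mu>. (norm (f x - ?G x))\<^sup>2) + 2 * (LINT x|\<mu>. (norm (?G x - ?h x))\<^sup>2)"
    by (intro square_diff_triangle f mg iG2 continuous_sphere_integrable ch)
  ultimately have "(LINT x|\<mu>. (norm (f x - ?h x))\<^sup>2) < e" using N(1) by linarith
  then show thesis using that ch by blast
qed

lemma polynomial_dense:
  fixes f :: "real ^ 4 \<Rightarrow> complex"
  assumes f: "f \<in> borel_measurable \<mu>" "integrable \<mu> (\<lambda>x. (norm (f x))\<^sup>2)" and e: "0 < e"
  obtains g :: "real ^ 4 \<Rightarrow> complex" where "polynomial_function g" "(LINT x|\<mu>. (norm (f x - g x))\<^sup>2) < e"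
proof -
  interpret finite_measure \<mu> by (rule finite_sphere_measure)
  obtain h where h: "continuous_on UNIV h" "(LINT x|\<mu>. (norm (f x - h x))\<^sup>2) < e / 4"
    using L2_dense[OF f, of "e / 4"] e by auto
  \<comment> \<open>one is added since \<open>M\<close> occurs in a denominator\<close>
  define M where "M = measure \<mu> UNIV + 1"
  have M: "M > 0" by (simp add: M_def add_nonneg_pos)
  define d where "d = sqrt (e / (4 * M))"
  have d: "d > 0" using e M by (simp add: d_def)
  obtain g :: "real ^ 4 \<Rightarrow> complex" where g: "polynomial_function g" "\<forall>x\<in>S3. norm (h x - g x) < d"
    using Stone_Weierstrass_polynomial_function[OF S3_compact continuous_on_subset[OF h(1)] d] by auto
  have cg: "continuous_on UNIV g" using g(1) by (rule continuous_on_polymonial_function)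
  have "(LINT x|\<mu>. (norm (h x - g x))\<^sup>2) \<le> (LINT x|\<mu>. d\<^sup>2)"
  proof (rule integral_mono_AE)
    show "integrable \<mu> (\<lambda>x. (norm (h x - g x))\<^sup>2)"
      by (intro square_diff_integrable continuous_sphere_integrable h cg)
    show "AE x in \<mu>. (norm (h x - g x))\<^sup>2 \<le> d\<^sup>2"
      using AE_S3 by eventually_elim (use g(2) in \<open>auto intro!: power_mono simp: less_imp_le\<close>)
  qed auto
  also have "\<dots> = d\<^sup>2 * measure \<mu> UNIV" by simp
  also have "\<dots> \<le> d\<^sup>2 * M" by (intro mult_left_mono) (auto simp: M_def)
  also have "\<dots> = e / 4" using e M by (simp add: d_def)
  finally have "(LINT x|\<mu>. (norm (h x - g x))\<^sup>2) \<le> e / 4" .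
  moreover have "(LINT x|\<mu>. (norm (f x - g x))\<^sup>2) \<le> 2 * (LINT x|\<mu>. (norm (f x - h x))\<^sup>2) + 2 * (LINT x|\<mu>. (norm (h x - g x))\<^sup>2)"
    by (intro square_diff_triangle f continuous_sphere_integrable h cg)
  ultimately have "(LINT x|\<mu>. (norm (f x - g x))\<^sup>2) < e" using h(2) by linarith
  then show thesis using that g(1) by blast
qed

lemma entry_polys_const: "(\<lambda>h. x) \<in> entry_polys"
  using entry_polys.scale[OF entry_polys.mono[of 0 0 0 0], of x] by simp

lemma entry_polys_coordinate: "\<exists>c\<in>entry_polys. \<forall>x. complex_of_real (x $ i) = c (adjoint_mat (mat4 x))"
proof -
  have m: "(\<lambda>h :: mat2. h $ 1 $ 1) \<in> entry_polys" "(\<lambda>h :: mat2. h $ 2 $ 1) \<in> entry_polys"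
    "(\<lambda>h :: mat2. h $ 1 $ 2) \<in> entry_polys" "(\<lambda>h :: mat2. h $ 2 $ 2) \<in> entry_polys"
    using entry_polys.mono[of 1 0 0 0] entry_polys.mono[of 0 1 0 0] entry_polys.mono[of 0 0 1 0] entry_polys.mono[of 0 0 0 1] by simp_all
  note c = entry_polys.add[OF entry_polys.scale entry_polys.scale]
  consider "i = 1" | "i = 2" | "i = 3" | "i = 4" using exhaust_4 by blast
  then show ?thesis
  proof cases
    case 1
    show ?thesis by (rule bexI[OF _ c[OF m(1) m(4), of "\<i> / 2" "- \<i> / 2"]]) (simp add: 1 mat4_def complex_eq_iff)
  next
    case 2
    show ?thesis by (rule bexI[OF _ c[OF m(2) m(3), of "1 / 2" "- 1 / 2"]]) (simp add: 2 mat4_def complex_eq_iff)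
  next
    case 3
    show ?thesis by (rule bexI[OF _ c[OF m(2) m(3), of "\<i> / 2" "\<i> / 2"]]) (simp add: 3 mat4_def complex_eq_iff)
  next
    case 4
    show ?thesis by (rule bexI[OF _ c[OF m(1) m(4), of "1 / 2" "1 / 2"]]) (simp add: 4 mat4_def complex_eq_iff)
  qed
qed

lemma real_polynomial_entry_polys:
  assumes "real_polynomial_function g"
  shows "\<exists>c\<in>entry_polys. \<forall>x. complex_of_real (g x) = c (adjoint_mat (mat4 x))"
  using assms
proof (induction rule: real_polynomial_function.induct)
  case (linear f)
  obtain c where c: "\<And>i. c i \<in> entry_polys" "\<And>i x. complex_of_real (x $ i) = c i (adjoint_mat (mat4 x))"
    using entry_polys_coordinate by metis
  have lin: "linear f" using linear by (simp add: linear_conv_bounded_linear)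
  let ?f = "\<lambda>i. complex_of_real (f (axis i 1))"
  have "complex_of_real (f x) = ?f 1 * c 1 (adjoint_mat (mat4 x)) + ?f 2 * c 2 (adjoint_mat (mat4 x)) +
    ?f 3 * c 3 (adjoint_mat (mat4 x)) + ?f 4 * c 4 (adjoint_mat (mat4 x))" for x
  proof -
    have "x = (\<Sum>i\<in>UNIV. (x $ i) *\<^sub>R axis i 1)" by (simp add: vec_eq_iff axis_def sum_4 forall_4)
    then have "f x = (\<Sum>i\<in>UNIV. (x $ i) * f (axis i 1))"
      using linear_sum[OF lin, of "\<lambda>i. (x $ i) *\<^sub>R axis i 1" UNIV] by (simp add: linear_cmul[OF lin])
    then show ?thesis by (simp add: sum_4 c(2)[symmetric] mult.commute)
  qed
  moreover have "(\<lambda>h. ?f 1 * c 1 h + ?f 2 * c 2 h + ?f 3 * c 3 h + ?f 4 * c 4 h) \<in> entry_polys"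
    by (rule entry_polys.add[OF entry_polys.add[OF entry_polys.add[OF entry_polys.scale[OF c(1)] entry_polys.scale[OF c(1)]] entry_polys.scale[OF c(1)]] entry_polys.scale[OF c(1)]])
  ultimately show ?case by (rule_tac bexI[of _ "\<lambda>h. ?f 1 * c 1 h + ?f 2 * c 2 h + ?f 3 * c 3 h + ?f 4 * c 4 h"]) (rule allI)
next
  case (const c)
  show ?case using entry_polys_const[of "complex_of_real c"] by (rule bexI[rotated]) (rule allI, rule refl)
next
  case (add f g)
  then obtain c c' where c: "c \<in> entry_polys" "c' \<in> entry_polys" "\<forall>x. complex_of_real (f x) = c (adjoint_mat (mat4 x))"
    "\<forall>x. complex_of_real (g x) = c' (adjoint_mat (mat4 x))" by blast
  show ?case using entry_polys.add[OF c(1,2)] by (rule bexI[rotated]) (simp add: c(3,4))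
next
  case (mult f g)
  then obtain c c' where c: "c \<in> entry_polys" "c' \<in> entry_polys" "\<forall>x. complex_of_real (f x) = c (adjoint_mat (mat4 x))"
    "\<forall>x. complex_of_real (g x) = c' (adjoint_mat (mat4 x))" by blast
  show ?case using entry_polys_mult[OF c(1,2)] by (rule bexI[rotated]) (simp add: c(3,4))
qed

lemma polynomial_entry_polys:
  fixes g :: "real ^ 4 \<Rightarrow> complex"
  assumes "polynomial_function g"
  shows "\<exists>c\<in>entry_polys. \<forall>x. g x = c (adjoint_mat (mat4 x))"
proof -
  have "real_polynomial_function (Re \<circ> g)" "real_polynomial_function (Im \<circ> g)"
    using assms bounded_linear_Re bounded_linear_Im by (auto simp: polynomial_function_def)
  from this[THEN real_polynomial_entry_polys] obtain c c' where c: "c \<in> entry_polys" "c' \<in> entry_polys"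
    "\<forall>x. complex_of_real (Re (g x)) = c (adjoint_mat (mat4 x))" "\<forall>x. complex_of_real (Im (g x)) = c' (adjoint_mat (mat4 x))"
    unfolding comp_apply by blast
  have "g x = c (adjoint_mat (mat4 x)) + \<i> * c' (adjoint_mat (mat4 x))" for x
    using complex_eq[of "g x"] unfolding c(3,4)[rule_format] .
  then show ?thesis using entry_polys.add[OF c(1) entry_polys.scale[OF c(2), of \<i>]] by (intro bexI[of _ "\<lambda>h. c h + \<i> * c' h"] allI)
qed

section \<open>Completeness of the explicit components\<close>

lemma polysec_smooth: "u \<in> polysec n \<Longrightarrow> u \<in> smooth n"
proof -
  have "sec.subspace (smooth n)"
    by (auto simp: sec.subspace_def smooth_sections_zero smooth_sections_add smooth_sections_scale)
  moreover have "{bsec A B r f g | A B r f g. A + B = n \<and> f \<in> V (int (A + r)) \<and> g \<in> V (int (B + r))} \<subseteq> smooth n"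
    using bsec_smooth by blast
  ultimately show "u \<in> polysec n \<Longrightarrow> u \<in> smooth n"
    unfolding polysec_def using sec.span_minimal by blast
qed

lemma coeff_square_integrable:
  assumes \<phi>: "\<phi> \<in> L2 (int n)" and k: "k \<le> n"
  shows "integrable \<mu> (\<lambda>x. (norm (coeff (at_point \<phi> x) k))\<^sup>2)"
proof (rule Bochner_Integration.integrable_bound[OF integrable_Re[OF L2_integrable[OF \<phi>]]])
  show "(\<lambda>x. (norm (coeff (at_point \<phi> x) k))\<^sup>2) \<in> borel_measurable \<mu>"
    by (intro borel_measurable_power borel_measurable_cmod L2_measurable[OF \<phi>])
  show "AE x in \<mu>. norm ((norm (coeff (at_point \<phi> x) k))\<^sup>2) \<le> norm (Re (herm (int n) (at_point \<phi> x) (at_point \<phi> x)))"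
  proof (rule AE_I2)
    fix x
    let ?c = "\<lambda>k. (cmod (coeff (at_point \<phi> x) k))\<^sup>2"
    have "(1 :: real) \<le> fact k" "(1 :: real) \<le> fact (n - k)" by (simp_all add: fact_ge_1)
    then have "1 * 1 \<le> (fact k * fact (n - k) :: real)" by (intro mult_mono) auto
    then have "?c k \<le> fact k * fact (n - k) * ?c k" using mult_right_mono[of 1 "fact k * fact (n - k)" "?c k"] by simp
    also have "\<dots> \<le> (\<Sum>k\<le>n. fact k * fact (n - k) * ?c k)" using k by (intro member_le_sum) auto
    finally have "?c k \<le> Re (herm (int n) (at_point \<phi> x) (at_point \<phi> x))" by (simp only: herm_self_Re)
    then show "norm (?c k) \<le> norm (Re (herm (int n) (at_point \<phi> x) (at_point \<phi> x)))" by simp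
  qed
qed

text \<open>
  In the global trivialisation at the points \<open>(x, 1)\<close> the coefficients of a section are square-integrable functions on the
  sphere, which are approximated by polynomials in the entries of \<open>x\<^sup>-\<^sup>1\<close>.
\<close>

lemma polysec_dense:
  assumes \<phi>: "\<phi> \<in> L2 (int n)" and e: "0 < e"
  obtains u where "u \<in> polysec n" "nrm n (\<phi> - u) < e"
proof -
  let ?w = "\<lambda>k. fact k * fact (n - k) :: real"
  define W where "W = (\<Sum>k\<le>n. ?w k)"
  have W: "W > 0" unfolding W_def by (intro sum_pos) auto
  have "\<exists>c\<in>entry_polys. polynomial_function (\<lambda>x. c (adjoint_mat (mat4 x))) \<and> (LINT x|\<mu>. (norm (coeff (at_point \<phi> x) k - c (adjoint_mat (mat4 x))))\<^sup>2) < e\<^sup>2 / W" if k: "k \<le> n" for k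
  proof -
    have "0 < e\<^sup>2 / W" using e W by simp
    then obtain g :: "real ^ 4 \<Rightarrow> complex" where g: "polynomial_function g" "(LINT x|\<mu>. (norm (coeff (at_point \<phi> x) k - g x))\<^sup>2) < e\<^sup>2 / W"
      using polynomial_dense[OF L2_measurable[OF \<phi>] coeff_square_integrable[OF \<phi> k]] by blast
    obtain c where c: "c \<in> entry_polys" "\<forall>x. g x = c (adjoint_mat (mat4 x))" using polynomial_entry_polys[OF g(1)] by blast
    have "g = (\<lambda>x. c (adjoint_mat (mat4 x)))" using c(2) by (intro ext) simp
    then show ?thesis using c(1) g by blast
  qed
  then have "\<forall>k. \<exists>c. k \<le> n \<longrightarrow> c \<in> entry_polys \<and> polynomial_function (\<lambda>x. c (adjoint_mat (mat4 x))) \<and> (LINT x|\<mu>. (norm (coeff (at_point \<phi> x) k - c (adjoint_mat (mat4 x))))\<^sup>2) < e\<^sup>2 / W" by blast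
  from choice[OF this] obtain c where c: "\<And>k. k \<le> n \<Longrightarrow> c k \<in> entry_polys"
    and cp: "\<And>k. k \<le> n \<Longrightarrow> polynomial_function (\<lambda>x. c k (adjoint_mat (mat4 x)))"
    and c2:     "\<And>k. k \<le> n \<Longrightarrow> (LINT x|\<mu>. (norm (coeff (at_point \<phi> x) k - c k (adjoint_mat (mat4 x))))\<^sup>2) < e\<^sup>2 / W" by blast
  define u where "u = (\<Sum>k\<le>n. psec n (\<lambda>h. smult (c k h) (monom 1 k)))"
  have u: "u \<in> polysec n"
    unfolding u_def polysec_def
    by (intro sec.span_sum) (use entry_polys_in_entry_functions[OF c, of _ n] in \<open>auto simp: entry_functions_def polysec_def\<close>)
  note uL = smooth_L2[OF polysec_smooth[OF u]]
  have ux: "coeff (at_point u x) k = c k (adjoint_mat (mat4 x))" if x: "x \<in> S3" and k: "k \<le> n" for x k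
  proof -
    have h: "mat4 x \<in> SU2" using x by (simp add: mat4_SU2_iff)
    have "at_point u x = (\<Sum>k\<le>n. smult (c k (adjoint_mat (mat4 x))) (monom 1 k))"
      unfolding u_def at_point_sum
      by (intro sum.cong refl) (use h in \<open>auto simp: at_point_def psec_def Spin4_def rho_one V_smult V_monom simp del: smult_monom\<close>)
    then show ?thesis using k by (simp add: smult_monom coeff_sum_monom)
  qed
  have D: "\<phi> - u \<in> L2 (int n)" by (rule L2_diff[OF \<phi> uL])
  have I: "integrable \<mu> (\<lambda>x. (norm (coeff (at_point \<phi> x) k - coeff (at_point u x) k))\<^sup>2)" if k: "k \<le> n" for k
  proof -
    show ?thesis by (intro square_diff_integrable L2_measurable[OF \<phi>] L2_measurable[OF uL] coeff_square_integrable[OF \<phi> k] coeff_square_integrable[OF uL k])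
  qed
  have "(nrm n (\<phi> - u))\<^sup>2 = (LINT x|\<mu>. Re (herm (int n) (at_point (\<phi> - u) x) (at_point (\<phi> - u) x)))"
    using trans[OF ip_self_norm[OF D, symmetric] ip_self[OF D]] by (simp only: of_real_eq_iff)
  also have "\<dots> = (LINT x|\<mu>. (\<Sum>k\<le>n. ?w k * (norm (coeff (at_point \<phi> x) k - coeff (at_point u x) k))\<^sup>2))"
    unfolding herm_self_Re at_point_diff coeff_diff by (rule refl)
  also have "\<dots> = (\<Sum>k\<le>n. ?w k * (LINT x|\<mu>. (norm (coeff (at_point \<phi> x) k - coeff (at_point u x) k))\<^sup>2))"
    using I by (subst Bochner_Integration.integral_sum) auto
  also have "\<dots> = (\<Sum>k\<le>n. ?w k * (LINT x|\<mu>. (norm (coeff (at_point \<phi> x) k - c k (adjoint_mat (mat4 x))))\<^sup>2))"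
  proof (intro sum.cong refl arg_cong2[where f = "(*)"] integral_cong_AE)
    fix k assume k: "k \<in> {..n}"
    show "AE x in \<mu>. (norm (coeff (at_point \<phi> x) k - coeff (at_point u x) k))\<^sup>2 = (norm (coeff (at_point \<phi> x) k - c k (adjoint_mat (mat4 x))))\<^sup>2"
      using AE_S3 by eventually_elim (use k ux in auto)
    show "(\<lambda>x. (norm (coeff (at_point \<phi> x) k - coeff (at_point u x) k))\<^sup>2) \<in> borel_measurable \<mu>"
      by (intro borel_measurable_power borel_measurable_cmod borel_measurable_diff L2_measurable[OF \<phi>] L2_measurable[OF uL])
    have "(\<lambda>x. c k (adjoint_mat (mat4 x))) \<in> borel_measurable \<mu>"
      using cp[of k] k by (intro continuous_sphere_integrable continuous_on_polymonial_function) auto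
    then show "(\<lambda>x. (norm (coeff (at_point \<phi> x) k - c k (adjoint_mat (mat4 x))))\<^sup>2) \<in> borel_measurable \<mu>"
      by (intro borel_measurable_power borel_measurable_cmod borel_measurable_diff L2_measurable[OF \<phi>])
  qed
  also have "\<dots> < (\<Sum>k\<le>n. ?w k * (e\<^sup>2 / W))"
    by (intro sum_strict_mono mult_strict_left_mono c2) auto
  also have "\<dots> = W * (e\<^sup>2 / W)" unfolding W_def by (rule sum_distrib_right[symmetric])
  also have "\<dots> = e\<^sup>2" using W by simp
  finally have "(nrm n (\<phi> - u))\<^sup>2 < e\<^sup>2" .
  then have "nrm n (\<phi> - u) < e" by (rule power2_less_imp_less) (use e in simp)
  then show thesis using that u by blast
qed


section \<open>The orthogonal basis\<close>

text \<open>An index \<open>(A, B, r, k, l)\<close> stands for the vector \<open>z\<^sup>k \<otimes> z\<^sup>l\<close> of the block \<open>(A, B, r)\<close>.\<close>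

definition idx :: "nat \<Rightarrow> (nat \<times> nat \<times> nat \<times> nat \<times> nat) set" where
  "idx n = {(A, B, r, k, l). A + B = n \<and> k \<le> A + r \<and> l \<le> B + r}"

definition eb :: "nat \<times> nat \<times> nat \<times> nat \<times> nat \<Rightarrow> sect" where
  "eb = (\<lambda>(A, B, r, k, l). bsec A B r (monom 1 k) (monom 1 l))"

lemma idx_iff: "(A, B, r, k, l) \<in> idx n \<longleftrightarrow> A + B = n \<and> k \<le> A + r \<and> l \<le> B + r"
  by (simp add: idx_def)

lemma monom_in_V: "k \<le> n \<Longrightarrow> monom 1 k \<in> V (int n)"
  by (rule V_monom) simp

lemma eb_smooth: "\<iota> \<in> idx n \<Longrightarrow> eb \<iota> \<in> smooth n"
  using bsec_smooth[OF monom_in_V monom_in_V] by (auto simp: idx_def eb_def simp del: of_nat_add)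

lemma eb_L2: "\<iota> \<in> idx n \<Longrightarrow> eb \<iota> \<in> L2 (int n)"
  by (rule smooth_L2[OF eb_smooth])

lemma herm_monom: "k \<le> n \<Longrightarrow> herm (int n) (monom 1 k) (monom 1 l) = (if k = l then fact k * fact (n - k) else 0)"
  unfolding herm_sum by (simp add: coeff_monom if_distrib[where f = cnj] if_distrib[where f = "\<lambda>x. _ * x"] cong: if_cong)

lemma type_determines_block:
  assumes "A + B = A' + B'" "A + r = A' + r'" "B + r = B' + (r' :: nat)"
  shows "A = A'" "B = B'" "r = r'"
  using assms by linarith+

lemma eb_orthogonal:
  assumes "\<iota> \<in> idx n" "\<kappa> \<in> idx n" "\<iota> \<noteq> \<kappa>"
  shows "ip n (eb \<iota>) (eb \<kappa>) = 0"
proof -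
  obtain A B r k l where \<iota>: "\<iota> = (A, B, r, k, l)" by (metis prod_cases5)
  obtain A' B' r' k' l' where \<kappa>: "\<kappa> = (A', B', r', k', l')" by (metis prod_cases5)
  have i: "A + B = n" "k \<le> A + r" "l \<le> B + r" "A' + B' = n" "k' \<le> A' + r'" "l' \<le> B' + r'"
    using assms(1,2) by (auto simp: \<iota> \<kappa> idx_iff)
  show ?thesis
  proof (cases "(A + r, B + r) = (A' + r', B' + r')")
    case False
    have "intertwiner n (A' + r') (B' + r') (bsec A' B' r')" using intertwiner_bsec[of A' B' r'] i(4) by simp
    from intertwiner_orthogonal[OF intertwiner_bsec[of A B r, unfolded i(1)] this False
        monom_in_V[OF i(2)] monom_in_V[OF i(3)] monom_in_V[OF i(5)] monom_in_V[OF i(6)]]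
    show ?thesis by (simp add: \<iota> \<kappa> eb_def)
  next
    case True
    then have e: "A' = A" "B' = B" "r' = r" using type_determines_block[of A B A' B' r r'] i(1,4) by auto
    obtain c where c: "\<And>v w v' w'. v \<in> V (int (A + r)) \<Longrightarrow> w \<in> V (int (B + r)) \<Longrightarrow> v' \<in> V (int (A + r)) \<Longrightarrow> w' \<in> V (int (B + r)) \<Longrightarrow>
      ip (A + B) (bsec A B r v w) (bsec A B r v' w') = c * herm (int (A + r)) v v' * herm (int (B + r)) w w'"
      by (rule bsec_inner[of A r B]) blast
    have "ip n (eb \<iota>) (eb \<kappa>) = c * herm (int (A + r)) (monom 1 k) (monom 1 k') * herm (int (B + r)) (monom 1 l) (monom 1 l')"
      using c[OF monom_in_V[OF i(2)] monom_in_V[OF i(3)], of "monom 1 k'" "monom 1 l'"] i e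
      by (simp add: \<iota> \<kappa> eb_def monom_in_V del: of_nat_add)
    moreover have "k \<noteq> k' \<or> l \<noteq> l'" using assms(3) by (auto simp: \<iota> \<kappa> e)
    ultimately show ?thesis by (auto simp: herm_monom i(2,3) simp del: of_nat_add)
  qed
qed

lemma eb_norm:
  assumes "\<iota> \<in> idx n"
  shows "ip n (eb \<iota>) (eb \<iota>) \<noteq> 0"
proof -
  obtain A B r k l where \<iota>: "\<iota> = (A, B, r, k, l)" by (metis prod_cases5)
  have i: "A + B = n" "k \<le> A + r" "l \<le> B + r" using assms by (auto simp: \<iota> idx_iff)
  obtain c where c: "c \<noteq> 0" "\<And>v w v' w'. v \<in> V (int (A + r)) \<Longrightarrow> w \<in> V (int (B + r)) \<Longrightarrow> v' \<in> V (int (A + r)) \<Longrightarrow> w' \<in> V (int (B + r)) \<Longrightarrow>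
    ip (A + B) (bsec A B r v w) (bsec A B r v' w') = c * herm (int (A + r)) v v' * herm (int (B + r)) w w'"
    by (rule bsec_inner[of A r B]) blast
  note m = monom_in_V[OF i(2)] monom_in_V[OF i(3)]
  have "ip n (eb \<iota>) (eb \<iota>) = c * herm (int (A + r)) (monom 1 k) (monom 1 k) * herm (int (B + r)) (monom 1 l) (monom 1 l)"
    using c(2)[OF m m] by (simp add: \<iota> eb_def i(1))
  then show ?thesis using c(1) by (simp add: herm_monom[OF i(2)] herm_monom[OF i(3)] del: of_nat_add)
qed

text \<open>The orthogonal projection onto the span of the basis sections with index in \<open>J\<close>.\<close>

definition proj :: "nat \<Rightarrow> (nat \<times> nat \<times> nat \<times> nat \<times> nat) set \<Rightarrow> sect \<Rightarrow> sect" where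
  "proj n J \<phi> = (\<Sum>\<iota>\<in>J. sec_scale (ip n \<phi> (eb \<iota>) / ip n (eb \<iota>) (eb \<iota>)) (eb \<iota>))"

context
  fixes n :: nat and J :: "(nat \<times> nat \<times> nat \<times> nat \<times> nat) set"
  assumes J: "finite J" "J \<subseteq> idx n"
begin

lemma proj_smooth: "proj n J \<phi> \<in> smooth n"
  unfolding proj_def using J by (intro smooth_sections_sum smooth_sections_scale eb_smooth) auto

lemma proj_L2: "proj n J \<phi> \<in> L2 (int n)"
  by (rule smooth_L2[OF proj_smooth])

lemma ip_proj:
  assumes \<kappa>: "\<kappa> \<in> idx n"
  shows "ip n (proj n J \<phi>) (eb \<kappa>) = (if \<kappa> \<in> J then ip n \<phi> (eb \<kappa>) else 0)"
proof -
  have "ip n (proj n J \<phi>) (eb \<kappa>) =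
    (\<Sum>\<iota>\<in>J. ip n \<phi> (eb \<iota>) / ip n (eb \<iota>) (eb \<iota>) * ip n (eb \<iota>) (eb \<kappa>))"
    unfolding proj_def using J by (subst ip_sum_left) (auto simp: ip_scale_left intro: L2_scale eb_L2 \<kappa>)
  also have "\<dots> = (\<Sum>\<iota>\<in>J. if \<iota> = \<kappa> then ip n \<phi> (eb \<kappa>) else 0)"
    using J(2) by (intro sum.cong refl) (auto simp: eb_orthogonal eb_norm \<kappa> subset_iff)
  finally show ?thesis using J(1) by simp
qed

lemma ip_span_zero:
  assumes u: "u \<in> sec.span (eb ` J)" and \<psi>: "\<psi> \<in> L2 (int n)" and z: "\<forall>\<kappa>\<in>J. ip n \<psi> (eb \<kappa>) = 0"
  shows "u \<in> L2 (int n) \<and> ip n \<psi> u = 0"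
proof -
  let ?S = "{u \<in> L2 (int n). ip n \<psi> u = 0}"
  have "sec.subspace ?S"
    by (auto simp: sec.subspace_def L2_zero L2_add L2_scale ip_add_right ip_scale_right \<psi>)
  moreover have "eb ` J \<subseteq> ?S" using z eb_L2 J by auto
  ultimately have "sec.span (eb ` J) \<subseteq> ?S" by (rule sec.span_minimal[rotated])
  then show ?thesis using u by blast
qed

lemma proj_in_span: "proj n J \<phi> \<in> sec.span (eb ` J)"
  unfolding proj_def by (intro sec.span_sum sec.span_scale sec.span_base imageI)

lemma proj_best_approximation:
  assumes \<phi>: "\<phi> \<in> L2 (int n)" and u: "u \<in> sec.span (eb ` J)"
  shows "nrm n (\<phi> - proj n J \<phi>) \<le> nrm n (\<phi> - u)"
proof -
  let ?d = "\<phi> - proj n J \<phi>" and ?w = "proj n J \<phi> - u"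
  have d: "?d \<in> L2 (int n)" by (rule L2_diff[OF \<phi> proj_L2])
  have z: "\<forall>\<kappa>\<in>J. ip n ?d (eb \<kappa>) = 0"
    using J(2) by (auto simp: ip_diff_left[OF \<phi> proj_L2 eb_L2] ip_proj subset_iff)
  have "?w \<in> sec.span (eb ` J)" by (rule sec.span_diff[OF proj_in_span u])
  note w = ip_span_zero[OF this d z]
  have w1: "?w \<in> L2 (int n)" and w2: "ip n ?d ?w = 0" using w by auto
  have w3: "ip n ?w ?d = 0" using ip_commute[of "int n" ?w ?d] w2 by simp
  have e: "\<phi> - u = ?d + ?w" by simp
  have "ip n (?d + ?w) (?d + ?w) = ip n ?d ?d + ip n ?w ?w"
    unfolding ip_add_left[OF d w1 L2_add[OF d w1]] ip_add_right[OF d w1 d] ip_add_right[OF d w1 w1] w2 w3 by simp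
  then have "complex_of_real ((nrm n (\<phi> - u))\<^sup>2) = complex_of_real ((nrm n ?d)\<^sup>2 + (nrm n ?w)\<^sup>2)"
    unfolding e of_real_add ip_self_norm[OF L2_add[OF d w1]] ip_self_norm[OF d] ip_self_norm[OF w1] .
  then have "(nrm n (\<phi> - u))\<^sup>2 = (nrm n ?d)\<^sup>2 + (nrm n ?w)\<^sup>2"
    unfolding of_real_eq_iff .
  then have "(nrm n ?d)\<^sup>2 \<le> (nrm n (\<phi> - u))\<^sup>2" by simp
  then show ?thesis using L2_norm_nonneg[OF L2_add[OF d w1]] unfolding e by (rule power2_le_imp_le)
qed

end

lemma polysec_span: "polysec n \<subseteq> sec.span (eb ` idx n)"
  unfolding polysec_def
proof (rule sec.span_minimal[OF _ sec.subspace_span], clarify)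
  fix A B r f g assume f: "f \<in> V (int (A + r))" "g \<in> V (int (B + r))" and n: "n = A + B"
  show "bsec A B r f g \<in> sec.span (eb ` idx (A + B))"
    unfolding bsec_expand[OF f]
  proof (intro sec.span_sum sec.span_scale sec.span_base)
    fix k l assume "k \<in> {..A + r}" "l \<in> {..B + r}"
    then have "(A, B, r, k, l) \<in> idx (A + B)" by (simp add: idx_iff)
    then show "bsec A B r (monom 1 k) (monom 1 l) \<in> eb ` idx (A + B)" by (force simp: eb_def)
  qed
qed

lemma proj_dense:
  assumes \<phi>: "\<phi> \<in> L2 (int n)" and e: "0 < e"
  obtains J where "finite J" "J \<subseteq> idx n" "nrm n (\<phi> - proj n J \<phi>) < e"
proof -
  obtain u where u: "u \<in> polysec n" "nrm n (\<phi> - u) < e" by (rule polysec_dense[OF \<phi> e])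
  then have "u \<in> sec.span (eb ` idx n)" using polysec_span by blast
  then obtain T where T: "finite T" "T \<subseteq> eb ` idx n" "u \<in> sec.span T"
    unfolding sec.span_explicit by (blast intro: sec.span_sum sec.span_scale sec.span_base)
  then obtain J where J: "finite J" "J \<subseteq> idx n" "T = eb ` J" by (meson finite_subset_image)
  show thesis
    using that[OF J(1,2)] proj_best_approximation[OF J(1,2) \<phi> T(3)[unfolded J(3)]] u(2) by linarith
qed

lemma basis_complete:
  assumes \<phi>: "\<phi> \<in> L2 (int n)" and z: "\<And>\<iota>. \<iota> \<in> idx n \<Longrightarrow> ip n \<phi> (eb \<iota>) = 0"
  shows "ae_eq \<phi> 0"
proof (rule ip_self_zero[OF \<phi>])
  have "nrm n \<phi> < e" if "0 < e" for e
  proof -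
    obtain J where J: "finite J" "J \<subseteq> idx n" "nrm n (\<phi> - proj n J \<phi>) < e" by (rule proj_dense[OF \<phi> \<open>0 < e\<close>])
    have "proj n J \<phi> = 0" unfolding proj_def
    proof (rule sum.neutral, rule ballI)
      fix \<iota> assume "\<iota> \<in> J"
      then have "ip n \<phi> (eb \<iota>) = 0" using z J(2) by blast
      then show "sec_scale (ip n \<phi> (eb \<iota>) / ip n (eb \<iota>) (eb \<iota>)) (eb \<iota>) = 0"
        by (simp only: div_0 sec.scale_zero_left)
    qed
    then have "\<phi> - proj n J \<phi> = \<phi>" by simp
    then show ?thesis using J(3) by simp
  qed
  then have "\<not> 0 < nrm n \<phi>" by blast
  then show "ip n \<phi> \<phi> = 0" using ip_self_norm[OF \<phi>] L2_norm_nonneg[OF \<phi>] by simp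
qed

section \<open>The components\<close>

text \<open>The image of a tensor, given by its coefficients \<open>c\<close>, under the bilinear map \<open>\<beta>\<close>.\<close>

definition dsum :: "nat \<Rightarrow> nat \<Rightarrow> (nat \<Rightarrow> nat \<Rightarrow> complex) \<Rightarrow> (complex poly \<Rightarrow> complex poly \<Rightarrow> sect) \<Rightarrow> sect" where
  "dsum a b c \<beta> = (\<Sum>k\<le>a. \<Sum>l\<le>b. sec_scale (c k l) (\<beta> (monom 1 k) (monom 1 l)))"

lemma component_iff:
  "component (int n) a b E \<longleftrightarrow> (\<exists>\<beta>. intertwiner n a b \<beta> \<and>
     (\<forall>c. ae_eq (dsum a b c \<beta>) 0 \<longrightarrow> (\<forall>k\<le>a. \<forall>l\<le>b. c k l = 0)) \<and> E = {\<psi> \<in> L2 (int n). \<exists>c. ae_eq \<psi> (dsum a b c \<beta>)})"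
  unfolding component_def intertwiner_def dsum_def by (simp only: conj_assoc)

lemma dsum_L2: "(\<And>k l. k \<le> a \<Longrightarrow> l \<le> b \<Longrightarrow> \<beta> (monom 1 k) (monom 1 l) \<in> L2 (int n)) \<Longrightarrow> dsum a b c \<beta> \<in> L2 (int n)"
  unfolding dsum_def by (intro L2_sum L2_scale) auto

lemma ip_dsum:
  assumes "\<And>k l. k \<le> a \<Longrightarrow> l \<le> b \<Longrightarrow> \<beta> (monom 1 k) (monom 1 l) \<in> L2 (int n)" "\<psi> \<in> L2 (int n)"
  shows "ip n (dsum a b c \<beta>) \<psi> = (\<Sum>k\<le>a. \<Sum>l\<le>b. c k l * ip n (\<beta> (monom 1 k) (monom 1 l)) \<psi>)"
proof -
  have "ip n (dsum a b c \<beta>) \<psi> = (\<Sum>k\<le>a. ip n (\<Sum>l\<le>b. sec_scale (c k l) (\<beta> (monom 1 k) (monom 1 l))) \<psi>)"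
    unfolding dsum_def by (rule ip_sum_left) (auto intro!: L2_sum L2_scale assms)
  also have "\<dots> = (\<Sum>k\<le>a. \<Sum>l\<le>b. ip n (sec_scale (c k l) (\<beta> (monom 1 k) (monom 1 l))) \<psi>)"
    by (rule sum.cong[OF refl], rule ip_sum_left) (auto intro!: L2_scale assms)
  finally show ?thesis by (simp only: ip_scale_left)
qed

lemma dsum_ae_eq:
  "(\<And>k l. k \<le> a \<Longrightarrow> l \<le> b \<Longrightarrow> ae_eq (sec_scale (c k l) (\<beta> (monom 1 k) (monom 1 l))) (sec_scale (c' k l) (\<beta>' (monom 1 k) (monom 1 l)))) \<Longrightarrow>
    ae_eq (dsum a b c \<beta>) (dsum a b c' \<beta>')"
  unfolding dsum_def by (intro ae_eq_sum) auto

lemma dsum_single: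
  assumes "k \<le> a" "l \<le> b"
  shows "dsum a b (\<lambda>k' l'. if k' = k \<and> l' = l then x else 0) \<beta> = sec_scale x (\<beta> (monom 1 k) (monom 1 l))"
proof -
  have eq: "(\<Sum>l'\<le>b. sec_scale (if k' = k \<and> l' = l then x else 0) (\<beta> (monom 1 k') (monom 1 l'))) =
    (if k' = k then sec_scale x (\<beta> (monom 1 k) (monom 1 l)) else 0)" for k'
  proof (cases "k' = k")
    case True
    have "(\<Sum>l'\<le>b. sec_scale (if k' = k \<and> l' = l then x else 0) (\<beta> (monom 1 k') (monom 1 l'))) =
      (\<Sum>l'\<le>b. if l' = l then sec_scale x (\<beta> (monom 1 k) (monom 1 l)) else 0)"
      by (rule sum.cong) (auto simp only: True sec.scale_zero_left simp_thms if_True if_False refl split: if_split)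
    also have "\<dots> = sec_scale x (\<beta> (monom 1 k) (monom 1 l))" using assms(2) by (subst sum.delta) auto
    finally show ?thesis using True by (simp only: if_True simp_thms)
  next
    case False
    then show ?thesis by (simp only: False simp_thms if_False sec.scale_zero_left sum.neutral_const)
  qed
  show ?thesis unfolding dsum_def eq using assms(1) by (subst sum.delta) auto
qed

definition Ecomp :: "nat \<Rightarrow> nat \<Rightarrow> nat \<Rightarrow> sect set" where
  "Ecomp A B r = {\<psi> \<in> L2 (int (A + B)). \<exists>c. ae_eq \<psi> (dsum (A + r) (B + r) c (bsec A B r))}"

lemma bsec_monom_smooth: "k \<le> A + r \<Longrightarrow> l \<le> B + r \<Longrightarrow> bsec A B r (monom 1 k) (monom 1 l) \<in> smooth (A + B)"
  by (rule bsec_smooth[OF monom_in_V monom_in_V])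

lemma bsec_monom_L2: "k \<le> A + r \<Longrightarrow> l \<le> B + r \<Longrightarrow> bsec A B r (monom 1 k) (monom 1 l) \<in> L2 (int (A + B))"
  by (rule smooth_L2[OF bsec_monom_smooth])

lemma dsum_bsec_smooth: "dsum (A + r) (B + r) c (bsec A B r) \<in> smooth (A + B)"
  unfolding dsum_def by (intro smooth_sections_sum smooth_sections_scale bsec_monom_smooth) auto

lemma bsec_independent:
  assumes "ae_eq (dsum (A + r) (B + r) c (bsec A B r)) 0" and k: "k \<le> A + r" "l \<le> B + r"
  shows "c k l = 0"
proof -
  let ?e = "\<lambda>k l. eb (A, B, r, k, l)"
  have i: "(A, B, r, k, l) \<in> idx (A + B)" if "k \<le> A + r" "l \<le> B + r" for k l using that by (simp add: idx_iff)
  have "0 = ip (A + B) (dsum (A + r) (B + r) c (bsec A B r)) (?e k l)"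
    using ip_cong[OF smooth_L2[OF dsum_bsec_smooth] L2_zero eb_L2[OF i[OF k]] eb_L2[OF i[OF k]] assms(1) ae_eq_refl] by simp
  also have "\<dots> = (\<Sum>k'\<le>A + r. \<Sum>l'\<le>B + r. c k' l' * ip (A + B) (?e k' l') (?e k l))"
    by (subst ip_dsum[where \<beta> = "bsec A B r", OF bsec_monom_L2 eb_L2[OF i[OF k]]]) (simp_all add: eb_def del: of_nat_add)
  also have "\<dots> = (\<Sum>k'\<le>A + r. \<Sum>l'\<le>B + r. if l' = l then (if k' = k then c k l * ip (A + B) (?e k l) (?e k l) else 0) else 0)"
    by (intro sum.cong refl) (use eb_orthogonal[OF i i[OF k]] in \<open>auto simp del: of_nat_add\<close>)
  also have "\<dots> = c k l * ip (A + B) (?e k l) (?e k l)" using k by simp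
  finally show ?thesis using eb_norm[OF i[OF k]] by simp
qed

lemma component_Ecomp: "component (int (A + B)) (A + r) (B + r) (Ecomp A B r)"
  unfolding component_iff Ecomp_def using intertwiner_bsec bsec_independent by blast

text \<open>
  Both maps have the same inner products with the sections of the block, up to the factor \<open>c / d\<close>, and both are orthogonal
  to the other blocks. Completeness does the rest.
\<close>

lemma intertwiner_of_block_type:
  assumes \<beta>: "intertwiner (A + B) (A + r) (B + r) \<beta>"
  obtains x where "\<And>v w. v \<in> V (int (A + r)) \<Longrightarrow> w \<in> V (int (B + r)) \<Longrightarrow> ae_eq (\<beta> v w) (sec_scale x (bsec A B r v w))"
proof -
  obtain c where c: "\<And>v w v' w'. v \<in> V (int (A + r)) \<Longrightarrow> w \<in> V (int (B + r)) \<Longrightarrow> v' \<in> V (int (A + r)) \<Longrightarrow> w' \<in> V (int (B + r)) \<Longrightarrow>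
    ip (A + B) (\<beta> v w) (bsec A B r v' w') = c * herm (int (A + r)) v v' * herm (int (B + r)) w w'"
    by (rule intertwiner_proportional[OF \<beta> intertwiner_bsec]) blast
  obtain d where d: "d \<noteq> 0" "\<And>v w v' w'. v \<in> V (int (A + r)) \<Longrightarrow> w \<in> V (int (B + r)) \<Longrightarrow> v' \<in> V (int (A + r)) \<Longrightarrow> w' \<in> V (int (B + r)) \<Longrightarrow>
    ip (A + B) (bsec A B r v w) (bsec A B r v' w') = d * herm (int (A + r)) v v' * herm (int (B + r)) w w'"
    by (rule bsec_inner[of A r B]) blast
  show thesis
  proof (rule that[of "c / d"])
    fix v w assume v: "v \<in> V (int (A + r))" "w \<in> V (int (B + r))"
    let ?s = "sec_scale (c / d) (bsec A B r v w)"
    have L: "\<beta> v w \<in> L2 (int (A + B))" "bsec A B r v w \<in> L2 (int (A + B))"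
      using intertwiner_L2(1)[OF \<beta> \<beta> v] smooth_L2[OF bsec_smooth[OF v]] by auto
    have "ae_eq (\<beta> v w - ?s) 0"
    proof (rule basis_complete)
      show "\<beta> v w - ?s \<in> L2 (int (A + B))" by (intro L2_diff L2_scale L)
      fix \<iota> assume \<iota>i: "\<iota> \<in> idx (A + B)"
      obtain A' B' r' k l where \<iota>: "\<iota> = (A', B', r', k, l)" by (metis prod_cases5)
      have i: "A' + B' = A + B" "k \<le> A' + r'" "l \<le> B' + r'" using \<iota>i by (auto simp: \<iota> idx_iff)
      note m = monom_in_V[OF i(2)] monom_in_V[OF i(3)]
      have ip: "ip (A + B) (\<beta> v w - ?s) (eb \<iota>) = ip (A + B) (\<beta> v w) (eb \<iota>) - c / d * ip (A + B) (bsec A B r v w) (eb \<iota>)"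
        by (subst ip_diff_left[OF L(1) L2_scale[OF L(2)] eb_L2[OF \<iota>i]]) (simp only: ip_scale_left)
      show "ip (A + B) (\<beta> v w - ?s) (eb \<iota>) = 0"
      proof (cases "(A + r, B + r) = (A' + r', B' + r')")
        case False
        have "intertwiner (A + B) (A' + r') (B' + r') (bsec A' B' r')" using intertwiner_bsec[of A' B' r'] i(1) by simp
        from intertwiner_orthogonal[OF \<beta> this False v m] intertwiner_orthogonal[OF intertwiner_bsec this False v m]
        show ?thesis unfolding ip by (simp add: \<iota> eb_def)
      next
        case True
        then have e: "A' = A" "B' = B" "r' = r" using type_determines_block[of A B A' B' r r'] i(1) by auto
        show ?thesis unfolding ip using c[OF v m[unfolded e]] d(2)[OF v m[unfolded e]] d(1)
          by (simp add: \<iota> eb_def e del: of_nat_add)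
      qed
    qed
    then show "ae_eq (\<beta> v w) ?s" by (simp only: ae_eq_diff_zero)
  qed
qed

text \<open>A component of a type that is not among the blocks would be orthogonal to a complete system.\<close>

lemma component_cases:
  assumes "component (int n) a b E"
  obtains A B r where "A + B = n" "a = A + r" "b = B + r" "E = Ecomp A B r"
proof -
  obtain \<beta> where \<beta>: "intertwiner n a b \<beta>" and ind: "\<And>c. ae_eq (dsum a b c \<beta>) 0 \<Longrightarrow> (\<forall>k\<le>a. \<forall>l\<le>b. c k l = 0)"
    and E: "E = {\<psi> \<in> L2 (int n). \<exists>c. ae_eq \<psi> (dsum a b c \<beta>)}" using assms unfolding component_iff by blast
  have nz: "\<not> ae_eq (\<beta> (monom 1 0) (monom 1 0)) 0"
  proof
    assume z: "ae_eq (\<beta> (monom 1 0) (monom 1 0)) 0"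
    have "dsum a b (\<lambda>k' l'. if k' = 0 \<and> l' = 0 then 1 else 0) \<beta> = \<beta> (monom 1 0) (monom 1 0)"
      by (subst dsum_single[of 0 a 0 b]) (simp_all only: le0 sec.scale_one)
    from ind[of "\<lambda>k' l'. if k' = 0 \<and> l' = 0 then 1 else 0", unfolded this, OF z] show False by (metis le0 zero_neq_one)
  qed
  have m0: "monom 1 0 \<in> V (int a)" "monom 1 0 \<in> V (int b)" by (rule monom_in_V[OF le0])+
  obtain A B r where ABr: "A + B = n" "a = A + r" "b = B + r"
  proof (rule ccontr)
    assume no: "\<not> thesis"
    have "ae_eq (\<beta> (monom 1 0) (monom 1 0)) 0"
    proof (rule basis_complete)
      show "\<beta> (monom 1 0) (monom 1 0) \<in> L2 (int n)" by (rule intertwiner_L2(1)[OF \<beta> \<beta> m0])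
      fix \<iota> assume \<iota>i: "\<iota> \<in> idx n"
      obtain A' B' r' k l where \<iota>: "\<iota> = (A', B', r', k, l)" by (metis prod_cases5)
      have i: "A' + B' = n" "k \<le> A' + r'" "l \<le> B' + r'" using \<iota>i by (auto simp: \<iota> idx_iff)
      have "(a, b) \<noteq> (A' + r', B' + r')" using no that i(1) by blast
      from intertwiner_orthogonal[OF \<beta> intertwiner_bsec[of A' B' r', unfolded i(1)] this m0 monom_in_V[OF i(2)] monom_in_V[OF i(3)]]
      show "ip n (\<beta> (monom 1 0) (monom 1 0)) (eb \<iota>) = 0" by (simp add: \<iota> eb_def del: monom_0)
    qed
    then show False using nz by blast
  qed
  obtain x where x: "\<And>v w. v \<in> V (int (A + r)) \<Longrightarrow> w \<in> V (int (B + r)) \<Longrightarrow> ae_eq (\<beta> v w) (sec_scale x (bsec A B r v w))"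
    by (rule intertwiner_of_block_type[of A B r \<beta>]) (use \<beta> ABr in auto)
  have x0: "x \<noteq> 0"
  proof
    assume "x = 0"
    with x[OF m0[unfolded ABr]] have "ae_eq (\<beta> (monom 1 0) (monom 1 0)) 0" by (simp only: sec.scale_zero_left)
    then show False using nz by blast
  qed
  have e: "ae_eq (dsum (A + r) (B + r) c \<beta>) (dsum (A + r) (B + r) (\<lambda>k l. x * c k l) (bsec A B r))" for c
  proof (rule dsum_ae_eq)
    fix k l assume "k \<le> A + r" "l \<le> B + r"
    from ae_eq_scale[OF x[OF monom_in_V[OF this(1)] monom_in_V[OF this(2)]], of "c k l"]
    show "ae_eq (sec_scale (c k l) (\<beta> (monom 1 k) (monom 1 l))) (sec_scale (x * c k l) (bsec A B r (monom 1 k) (monom 1 l)))"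
      by (simp only: sec.scale_scale mult.commute)
  qed
  have "(\<exists>c. ae_eq \<psi> (dsum (A + r) (B + r) c \<beta>)) \<longleftrightarrow> (\<exists>c. ae_eq \<psi> (dsum (A + r) (B + r) c (bsec A B r)))" for \<psi>
  proof
    assume "\<exists>c. ae_eq \<psi> (dsum (A + r) (B + r) c \<beta>)"
    then show "\<exists>c. ae_eq \<psi> (dsum (A + r) (B + r) c (bsec A B r))" using ae_eq_trans[OF _ e] by blast
  next
    assume "\<exists>c. ae_eq \<psi> (dsum (A + r) (B + r) c (bsec A B r))"
    then obtain c where "ae_eq \<psi> (dsum (A + r) (B + r) c (bsec A B r))" by blast
    moreover have "ae_eq (dsum (A + r) (B + r) (\<lambda>k l. c k l / x) \<beta>) (dsum (A + r) (B + r) c (bsec A B r))"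
      using e[of "\<lambda>k l. c k l / x"] x0 by simp
    ultimately show "\<exists>c. ae_eq \<psi> (dsum (A + r) (B + r) c \<beta>)" using ae_eq_trans ae_eq_sym by blast
  qed
  then have "E = Ecomp A B r" unfolding E Ecomp_def ABr(2,3) ABr(1)[symmetric] by blast
  then show thesis using that ABr by blast
qed

lemma component_unique: "component (int (A + B)) (A + r) (B + r) E \<Longrightarrow> E = Ecomp A B r"
  by (erule component_cases) (metis type_determines_block)

lemma Ecomp_orthogonal:
  assumes AB: "A + B = n" "A' + B' = n" and ne: "(A + r, B + r) \<noteq> (A' + r', B' + r')"
    and \<phi>: "\<phi> \<in> Ecomp A B r" and \<psi>: "\<psi> \<in> Ecomp A' B' r'"
  shows "ip n \<phi> \<psi> = 0"
proof -
  obtain c where c: "\<phi> \<in> L2 (int n)" "ae_eq \<phi> (dsum (A + r) (B + r) c (bsec A B r))" using \<phi> AB by (auto simp: Ecomp_def simp del: of_nat_add)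
  obtain c' where c': "\<psi> \<in> L2 (int n)" "ae_eq \<psi> (dsum (A' + r') (B' + r') c' (bsec A' B' r'))" using \<psi> AB by (auto simp: Ecomp_def simp del: of_nat_add)
  have L: "\<And>k l. k \<le> A + r \<Longrightarrow> l \<le> B + r \<Longrightarrow> bsec A B r (monom 1 k) (monom 1 l) \<in> L2 (int n)"
    "\<And>k l. k \<le> A' + r' \<Longrightarrow> l \<le> B' + r' \<Longrightarrow> bsec A' B' r' (monom 1 k) (monom 1 l) \<in> L2 (int n)"
    using bsec_monom_L2[of _ A r _ B] bsec_monom_L2[of _ A' r' _ B'] AB by auto
  have "ip n \<phi> \<psi> = ip n (dsum (A + r) (B + r) c (bsec A B r)) (dsum (A' + r') (B' + r') c' (bsec A' B' r'))"
    by (rule ip_cong) (auto intro: c c' dsum_L2 L)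
  also have "\<dots> = (\<Sum>k\<le>A + r. \<Sum>l\<le>B + r. c k l * ip n (bsec A B r (monom 1 k) (monom 1 l)) (dsum (A' + r') (B' + r') c' (bsec A' B' r')))"
    by (rule ip_dsum) (use L in \<open>auto intro: dsum_L2\<close>)
  also have "\<dots> = 0"
  proof (intro sum.neutral ballI)
    fix k l assume kl: "k \<in> {..A + r}" "l \<in> {..B + r}"
    have "ip n (dsum (A' + r') (B' + r') c' (bsec A' B' r')) (bsec A B r (monom 1 k) (monom 1 l)) =
      (\<Sum>k'\<le>A' + r'. \<Sum>l'\<le>B' + r'. c' k' l' * ip n (bsec A' B' r' (monom 1 k') (monom 1 l')) (bsec A B r (monom 1 k) (monom 1 l)))"
      by (rule ip_dsum) (use L kl in auto)
    also have "\<dots> = 0"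
    proof (intro sum.neutral ballI)
      fix k' l' assume kl': "k' \<in> {..A' + r'}" "l' \<in> {..B' + r'}"
      have "ip n (bsec A' B' r' (monom 1 k') (monom 1 l')) (bsec A B r (monom 1 k) (monom 1 l)) = 0"
        using intertwiner_orthogonal[OF intertwiner_bsec[of A' B' r', unfolded AB] intertwiner_bsec[of A B r, unfolded AB] ne[symmetric]] kl kl'
        by (simp add: monom_in_V del: of_nat_add)
      then show "c' k' l' * ip n (bsec A' B' r' (monom 1 k') (monom 1 l')) (bsec A B r (monom 1 k) (monom 1 l)) = 0" by simp
    qed
    finally have "ip n (dsum (A' + r') (B' + r') c' (bsec A' B' r')) (bsec A B r (monom 1 k) (monom 1 l)) = 0" .
    then have "ip n (bsec A B r (monom 1 k) (monom 1 l)) (dsum (A' + r') (B' + r') c' (bsec A' B' r')) = 0"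
      using ip_commute complex_cnj_zero by metis
    then show "c k l * ip n (bsec A B r (monom 1 k) (monom 1 l)) (dsum (A' + r') (B' + r') c' (bsec A' B' r')) = 0" by simp
  qed
  finally show ?thesis .
qed

lemma eb_in_Ecomp: "(A, B, r, k, l) \<in> idx n \<Longrightarrow> eb (A, B, r, k, l) \<in> Ecomp A B r"
proof -
  assume i: "(A, B, r, k, l) \<in> idx n"
  then have kl: "k \<le> A + r" "l \<le> B + r" "n = A + B" by (auto simp: idx_iff)
  have "dsum (A + r) (B + r) (\<lambda>k' l'. if k' = k \<and> l' = l then 1 else 0) (bsec A B r) = eb (A, B, r, k, l)"
    unfolding dsum_single[OF kl(1,2)] sec.scale_one eb_def by simp
  then show ?thesis unfolding Ecomp_def using eb_L2[OF i] ae_eq_refl kl(3) by (metis (mono_tags, lifting) mem_Collect_eq)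
qed

theorem decomposition: "decomposes (int n) {(A + r, B + r) | A B r. A + B = n}"
  unfolding decomposes_def
proof (intro conjI ballI allI impI)
  fix x assume "x \<in> {(A + r, B + r) | A B r. A + B = n}"
  then obtain A B r where x: "x = (A + r, B + r)" "A + B = n" by blast
  show "case x of (a, b) \<Rightarrow> \<exists>!E. component (int n) a b E"
    unfolding x(1) prod.case x(2)[symmetric] using component_Ecomp component_unique by blast
next
  fix a b assume "(a, b) \<notin> {(A + r, B + r) | A B r. A + B = n}"
  then show "\<nexists>E. component (int n) a b E" using component_cases by blast
next
  fix a b a' b' E E' \<phi> \<psi>
  assume h: "component (int n) a b E \<and> component (int n) a' b' E' \<and> (a, b) \<noteq> (a', b')" and m: "\<phi> \<in> E" "\<psi> \<in> E'"
  obtain A B r where 1: "A + B = n" "a = A + r" "b = B + r" "E = Ecomp A B r" using h component_cases by blast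
  obtain A' B' r' where 2: "A' + B' = n" "a' = A' + r'" "b' = B' + r'" "E' = Ecomp A' B' r'" using h component_cases by blast
  show "ip n \<phi> \<psi> = 0"
    by (rule Ecomp_orthogonal[OF 1(1) 2(1)]) (use h m 1 2 in auto)
next
  fix \<phi> and \<epsilon> :: real assume \<phi>: "\<phi> \<in> L2 (int n)" and e: "0 < \<epsilon>"
  obtain J where J: "finite J" "J \<subseteq> idx n" "nrm n (\<phi> - proj n J \<phi>) < \<epsilon>" by (rule proj_dense[OF \<phi> e])
  have "eb \<iota> \<in> \<Union> {E. \<exists>a b. component (int n) a b E}" if "\<iota> \<in> J" for \<iota>
  proof -
    obtain A B r k l where \<iota>: "\<iota> = (A, B, r, k, l)" by (metis prod_cases5)
    have i: "(A, B, r, k, l) \<in> idx n" using that J(2) \<iota> by blast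
    have "component (int n) (A + r) (B + r) (Ecomp A B r)" using component_Ecomp[of A B r] i by (simp add: idx_iff del: of_nat_add)
    then show ?thesis using eb_in_Ecomp[OF i] \<iota> by blast
  qed
  then have "proj n J \<phi> \<in> sec.span (\<Union> {E. \<exists>a b. component (int n) a b E})"
    unfolding proj_def by (intro sec.span_sum sec.span_scale sec.span_base)
  then show "\<exists>\<psi>\<in>sec.span (\<Union> {E. \<exists>a b. component (int n) a b E}). nrm n (\<phi> - \<psi>) < \<epsilon>" using J(3) by blast
qed

lemma eigenvalue_on_bsec:
  assumes n: "A + B = n" and P: "sec_linear (int n) (int n) P"
    and ev: "\<And>k l. k \<le> A + r \<Longrightarrow> l \<le> B + r \<Longrightarrow> P (eb (A, B, r, k, l)) = sec_scale (complex_of_real t) (eb (A, B, r, k, l))"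
  shows "eigenvalue_on (int n) P (A + r) (B + r) t"
  unfolding eigenvalue_on_def
proof (intro allI impI)
  fix E assume "component (int n) (A + r) (B + r) E"
  then have E: "E = Ecomp A B r" using component_unique n by blast
  note sm = dsum_bsec_smooth[of A r B, unfolded n]
  have bs: "\<And>k l. k \<le> A + r \<Longrightarrow> l \<le> B + r \<Longrightarrow> bsec A B r (monom 1 k) (monom 1 l) \<in> smooth n"
    using bsec_monom_smooth[of _ A r _ B] n by auto
  have PX: "P (dsum (A + r) (B + r) c (bsec A B r)) = sec_scale (complex_of_real t) (dsum (A + r) (B + r) c (bsec A B r))" for c
  proof -
    have "P (dsum (A + r) (B + r) c (bsec A B r)) = (\<Sum>k\<le>A + r. P (\<Sum>l\<le>B + r. sec_scale (c k l) (bsec A B r (monom 1 k) (monom 1 l))))"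
      unfolding dsum_def by (rule sec_linear_sum[OF P]) (auto intro!: smooth_sections_sum smooth_sections_scale bs)
    also have "\<dots> = (\<Sum>k\<le>A + r. \<Sum>l\<le>B + r. P (sec_scale (c k l) (bsec A B r (monom 1 k) (monom 1 l))))"
      by (rule sum.cong[OF refl], rule sec_linear_sum[OF P]) (auto intro!: smooth_sections_scale bs)
    also have "\<dots> = (\<Sum>k\<le>A + r. \<Sum>l\<le>B + r. sec_scale (complex_of_real t) (sec_scale (c k l) (bsec A B r (monom 1 k) (monom 1 l))))"
    proof (intro sum.cong refl)
      fix k l assume "k \<in> {..A + r}" "l \<in> {..B + r}"
      then have kl: "k \<le> A + r" "l \<le> B + r" by auto
      have "P (sec_scale (c k l) (bsec A B r (monom 1 k) (monom 1 l))) = sec_scale (c k l) (P (bsec A B r (monom 1 k) (monom 1 l)))"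
        using P bs[OF kl] by (auto simp only: sec_linear_def)
      also have "P (bsec A B r (monom 1 k) (monom 1 l)) = sec_scale (complex_of_real t) (bsec A B r (monom 1 k) (monom 1 l))"
        using ev[OF kl] by (simp only: eb_def prod.case)
      finally show "P (sec_scale (c k l) (bsec A B r (monom 1 k) (monom 1 l))) = sec_scale (complex_of_real t) (sec_scale (c k l) (bsec A B r (monom 1 k) (monom 1 l)))"
        by (simp only: sec.scale_left_commute)
    qed
    finally show ?thesis unfolding dsum_def by (simp only: sec.scale_sum_right)
  qed
  have mem: "dsum (A + r) (B + r) c (bsec A B r) \<in> Ecomp A B r" for c
    unfolding Ecomp_def using smooth_L2[OF dsum_bsec_smooth] ae_eq_refl by blast
  show "(\<forall>\<psi>\<in>E. \<exists>\<phi>\<in>E \<inter> smooth n. ae_eq \<phi> \<psi>) \<and> (\<forall>\<phi>\<in>E \<inter> smooth n. P \<phi> = sec_scale (complex_of_real t) \<phi>)"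
  proof (intro conjI ballI)
    fix \<psi> assume "\<psi> \<in> E"
    then obtain c where "ae_eq \<psi> (dsum (A + r) (B + r) c (bsec A B r))" by (auto simp: E Ecomp_def)
    then show "\<exists>\<phi>\<in>E \<inter> smooth n. ae_eq \<phi> \<psi>" using mem sm ae_eq_sym E by blast
  next
    fix \<phi> assume \<phi>: "\<phi> \<in> E \<inter> smooth n"
    then obtain c where "ae_eq \<phi> (dsum (A + r) (B + r) c (bsec A B r))" by (auto simp: E Ecomp_def)
    then have "\<phi> = dsum (A + r) (B + r) c (bsec A B r)" using smooth_ae_eq[OF _ sm] \<phi> by blast
    then show "P \<phi> = sec_scale (complex_of_real t) \<phi>" using PX by blast
  qed
qed

section \<open>Formal adjoints\<close>

lemma pvd_herm:
  assumes P: "pvd P P'" and Q: "pvd Q Q'"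
  shows "((\<lambda>t. herm (int n) (P t) (Q t)) has_vector_derivative herm (int n) (P 0) Q' + herm (int n) P' (Q 0)) (at 0)"
proof -
  have "((\<lambda>t. fact k * fact (n - k) * (coeff (P t) k * cnj (coeff (Q t) k))) has_vector_derivative
     fact k * fact (n - k) * (coeff (P 0) k * cnj (coeff Q' k) + coeff P' k * cnj (coeff (Q 0) k))) (at 0)" for k
    using P Q by (intro has_vector_derivative_mult_right has_vector_derivative_mult has_vector_derivative_cnj) (auto simp: pvd_def)
  then have "((\<lambda>t. \<Sum>k\<le>n. fact k * fact (n - k) * (coeff (P t) k * cnj (coeff (Q t) k))) has_vector_derivative
     (\<Sum>k\<le>n. fact k * fact (n - k) * (coeff (P 0) k * cnj (coeff Q' k) + coeff P' k * cnj (coeff (Q 0) k)))) (at 0)"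
    by (intro has_vector_derivative_sum)
  then show ?thesis unfolding herm_sum by (simp add: algebra_simps sum.distrib)
qed

lemma smooth_on_herm:
  assumes P: "\<And>k. smooth_on S (\<lambda>g. coeff (P g) k)" and Q: "\<And>k. smooth_on S (\<lambda>g. coeff (Q g) k)"
  shows "smooth_on S (\<lambda>g. herm (int n) (P g) (Q g))"
  unfolding herm_sum
  by (intro smooth_on_sum smooth_on_mult smooth_on_const P smooth_on_linear_image[OF bounded_linear_cnj] Q)

text \<open>The product rule for the function whose integral gives the integration by parts.\<close>

lemma herm_left_derivative:
  assumes L: "plin L" "\<And>f. f \<in> V (int n) \<Longrightarrow> L f \<in> V (int m)"
    and \<phi>: "\<phi> \<in> smooth n" and \<psi>: "\<psi> \<in> smooth m"
  defines "G \<equiv> \<lambda>g. herm (int m) (L (\<phi> g)) (\<psi> g)"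
  shows "smooth_on Spin4 G"
    and "g \<in> Spin4 \<Longrightarrow> dSpin G g (fst g ** su2_of (axis i 1), 0) =
      herm (int m) (L (Ld n (axis i 1) \<phi> g)) (\<psi> g) + herm (int m) (L (\<phi> g)) (Ld m (axis i 1) \<psi> g)"
proof -
  note s\<phi> = smooth_sections_sections[OF \<phi>] and s\<psi> = smooth_sections_sections[OF \<psi>]
  show sm: "smooth_on Spin4 G"
    unfolding G_def
    by (rule smooth_on_herm[OF smooth_on_coeff_plin[OF smooth_sections_smooth[OF \<phi>] L(1) sections_in_V[OF s\<phi>]] smooth_sections_smooth[OF \<psi>]])
  assume "g \<in> Spin4"
  then obtain p q where g: "g = (p, q)" and pq: "p \<in> SU2" "q \<in> SU2" by (auto simp: Spin4_def)
  have G': "(G has_derivative frechet_derivative G (at (p, q) within Spin4)) (at (p, q) within Spin4)"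
    by (rule smooth_on_differentiable[OF sm]) (use pq in \<open>simp add: Spin4_def\<close>)
  have d: "((\<lambda>t. G (p ** circ i t, q)) has_vector_derivative dSpin G (p, q) (p ** su2_of (axis i 1), 0)) (at 0)"
    unfolding dSpin_def by (rule derivative_left_circ[OF G' pq])
  have p\<phi>: "pvd (\<lambda>t. L (\<phi> (p ** circ i t, q))) (L (Ld n (axis i 1) \<phi> (p, q)))"
    by (rule pvd_plin[OF pvd_left_circ[OF \<phi> pq] L(1) sections_in_V[OF s\<phi>] Ld_in_V])
  have "((\<lambda>t. G (p ** circ i t, q)) has_vector_derivative
     herm (int m) (L (\<phi> (p, q))) (Ld m (axis i 1) \<psi> (p, q)) + herm (int m) (L (Ld n (axis i 1) \<phi> (p, q))) (\<psi> (p, q))) (at 0)"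
    using pvd_herm[OF p\<phi> pvd_left_circ[OF \<psi> pq, of i], of m] unfolding G_def by (simp add: circ_0)
  from vector_derivative_unique_at[OF d this]
  show "dSpin G g (fst g ** su2_of (axis i 1), 0) =
      herm (int m) (L (Ld n (axis i 1) \<phi> g)) (\<psi> g) + herm (int m) (L (\<phi> g)) (Ld m (axis i 1) \<psi> g)"
    by (simp add: g)
qed

text \<open>Integrate the left-invariant derivatives of \<open>(R(e\<^sub>i) \<phi>, \<psi>)\<close>.\<close>

lemma Dop_adjoint:
  assumes R: "clifford R n (int m)" and R': "clifford R' m (int n)"
    and adj: "\<And>X f g. f \<in> V (int n) \<Longrightarrow> g \<in> V (int m) \<Longrightarrow> herm (int m) (R X f) g = - herm (int n) f (R' X g)"
    and \<phi>: "\<phi> \<in> smooth n" and \<psi>: "\<psi> \<in> smooth m"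
  shows "ip m (Dop R n \<phi>) \<psi> = ip n \<phi> (Dop R' m \<psi>)"
proof -
  note s\<phi> = smooth_sections_sections[OF \<phi>] and s\<psi> = smooth_sections_sections[OF \<psi>]
  have lin: "\<And>X. plin (R X)" "\<And>X f. f \<in> V (int n) \<Longrightarrow> R X f \<in> V (int m)" using R by (auto simp: clifford_def)
  let ?G = "\<lambda>i :: 3. \<lambda>g. herm (int m) (R (axis i 1) (\<phi> g)) (\<psi> g)"
  let ?D = "\<lambda>(i :: 3) x. if x \<in> S3 then dSpin (?G i) (mat4 x, mat 1) (fst (mat4 x, mat 1 :: mat2) ** su2_of (axis i 1), 0) else 0"
  have G1: "smooth_on Spin4 (?G i)" for i
    by (rule herm_left_derivative(1)[OF lin(1) lin(2) \<phi> \<psi>])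
  have G2: "dSpin (?G i) g (fst g ** su2_of (axis i 1), 0) =
      herm (int m) (R (axis i 1) (Ld n (axis i 1) \<phi> g)) (\<psi> g) + herm (int m) (R (axis i 1) (\<phi> g)) (Ld m (axis i 1) \<psi> g)"
    if "g \<in> Spin4" for i g
    by (rule herm_left_derivative(2)[OF lin(1) _ \<phi> \<psi> that]) (rule lin(2))
  have D0: "(LINT x|\<mu>. ?D i x) = 0" for i
    by (rule integral_left_derivative[OF G1])
  have Di: "integrable \<mu> (?D i)" for i
  proof (rule sphere_continuous(2))
    have "continuous_on S3 (\<lambda>x. dSpin (?G i) (mat4 x, mat 1) (fst (mat4 x, mat 1 :: mat2) ** su2_of (axis i 1), 0))"
      by (rule continuous_on_slice[OF smooth_on_continuous_on[OF smooth_on_left_derivative[OF G1]]])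
    then show "continuous_on S3 (?D i)" by (rule continuous_on_eq) simp
  qed simp
  have e: "herm (int m) (at_point (Dop R n \<phi>) x) (at_point \<psi> x) - herm (int n) (at_point \<phi> x) (at_point (Dop R' m \<psi>) x) = (\<Sum>i\<in>UNIV. ?D i x)" for x
  proof (cases "x \<in> S3")
    case True
    then have g: "(mat4 x, mat 1) \<in> Spin4" by (simp add: Spin4_def mat4_SU2_iff)
    have "(\<Sum>i\<in>UNIV. ?D i x) = (\<Sum>i\<in>UNIV. herm (int m) (R (axis i 1) (Ld n (axis i 1) \<phi> (mat4 x, mat 1))) (\<psi> (mat4 x, mat 1)) +
        herm (int m) (R (axis i 1) (\<phi> (mat4 x, mat 1))) (Ld m (axis i 1) \<psi> (mat4 x, mat 1)))"
      using True G2[OF g] by simp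
    also have "\<dots> = (\<Sum>i\<in>UNIV. herm (int m) (R (axis i 1) (Ld n (axis i 1) \<phi> (mat4 x, mat 1))) (\<psi> (mat4 x, mat 1))) -
        (\<Sum>i\<in>UNIV. herm (int n) (\<phi> (mat4 x, mat 1)) (R' (axis i 1) (Ld m (axis i 1) \<psi> (mat4 x, mat 1))))"
      by (simp add: adj[OF sections_in_V[OF s\<phi>] Ld_in_V] sum_subtractf)
    finally show ?thesis using g by (simp add: at_point_def Dop_def herm_sum_left herm_sum_right)
  next
    case False
    then show ?thesis by (simp add: at_point_outside[OF s\<phi>] at_point_outside[OF s\<psi>])
  qed
  have L: "\<phi> \<in> L2 (int n)" "\<psi> \<in> L2 (int m)" "Dop R n \<phi> \<in> L2 (int m)" "Dop R' m \<psi> \<in> L2 (int n)"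
    by (intro smooth_L2 \<phi> \<psi> Dop_smooth_sections[OF R] Dop_smooth_sections[OF R'])+
  have "ip m (Dop R n \<phi>) \<psi> - ip n \<phi> (Dop R' m \<psi>) =
    (LINT x|\<mu>. herm (int m) (at_point (Dop R n \<phi>) x) (at_point \<psi> x) - herm (int n) (at_point \<phi> x) (at_point (Dop R' m \<psi>) x))"
    unfolding L2_inner_def by (rule Bochner_Integration.integral_diff[symmetric]) (intro herm_integrable L)+
  also have "\<dots> = (LINT x|\<mu>. (\<Sum>i\<in>UNIV. ?D i x))" unfolding e by (rule refl)
  also have "\<dots> = (\<Sum>i\<in>UNIV. (LINT x|\<mu>. ?D i x))" by (rule Bochner_Integration.integral_sum) (rule Di)
  also have "\<dots> = 0" unfolding D0 by simp
  finally show ?thesis by simp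
qed

lemma D_plus_adjoint:
  assumes \<phi>: "\<phi> \<in> smooth n" and \<psi>: "\<psi> \<in> smooth_sections (int n + 2)"
  shows "L2_inner (int n + 2) (D_plus (int n) \<phi>) \<psi> = ip n \<phi> (D_minus (int n + 2) \<psi>)"
proof -
  have n: "int n + 2 = int (n + 2)" by simp
  have "clifford (rho_minus (int (n + 2))) (n + 2) (int n)" using clifford_minus[of "n + 2"] by simp
  from Dop_adjoint[OF clifford_plus[of n, unfolded n] this _ \<phi> \<psi>[unfolded n]]
  show ?thesis
    unfolding D_plus_eq[OF \<phi>] n D_minus_eq[OF \<psi>[unfolded n]] using rho_plus_adjoint[of _ n] unfolding n by blast
qed

definition symmetric_op :: "nat \<Rightarrow> (sect \<Rightarrow> sect) \<Rightarrow> bool" where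
  "symmetric_op n P \<longleftrightarrow> (\<forall>\<phi>\<in>smooth n. \<forall>\<psi>\<in>smooth n.
     ip n (P \<phi>) \<psi> = ip n \<phi> (P \<psi>))"

lemma symmetric_D_zero: "symmetric_op n (D_zero (int n))"
  unfolding symmetric_op_def
proof (intro ballI)
  fix \<phi> \<psi> assume \<phi>: "\<phi> \<in> smooth n" and \<psi>: "\<psi> \<in> smooth n"
  let ?R = "Dop (rho_zero (int n)) n" and ?c = "- of_nat n * (of_nat n + 2) / 2 :: complex"
  have L: "\<phi> \<in> L2 (int n)" "\<psi> \<in> L2 (int n)" "?R \<phi> \<in> L2 (int n)" "?R \<psi> \<in> L2 (int n)"
    by (intro smooth_L2 \<phi> \<psi> Dop_smooth_sections[OF clifford_zero])+
  have "ip n (D_zero (int n) \<phi>) \<psi> = ip n (?R \<phi>) \<psi> + ?c * ip n \<phi> \<psi>"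
    unfolding D_zero_eq[OF \<phi>] by (simp only: ip_add_left L L2_scale ip_scale_left)
  also have "ip n (?R \<phi>) \<psi> = ip n \<phi> (?R \<psi>)"
    by (rule Dop_adjoint[OF clifford_zero clifford_zero rho_zero_adjoint \<phi> \<psi>])
  also have "ip n \<phi> (?R \<psi>) + ?c * ip n \<phi> \<psi> = ip n \<phi> (D_zero (int n) \<psi>)"
    unfolding D_zero_eq[OF \<psi>] ip_add_right[OF L(4) L2_scale[OF L(2)] L(1)] ip_scale_right by simp
  finally show "ip n (D_zero (int n) \<phi>) \<psi> = ip n \<phi> (D_zero (int n) \<psi>)" .
qed

lemma sec_linear_D_minus_plus: "sec_linear (int n) (int n) (D_minus (int n + 2) \<circ> D_plus (int n))"
  by (rule sec_linear_comp[OF sec_linear_D_plus]) (use sec_linear_D_minus[of "n + 2"] in \<open>simp add: add.commute\<close>)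

lemma symmetric_D_minus_plus: "symmetric_op n (D_minus (int n + 2) \<circ> D_plus (int n))"
  unfolding symmetric_op_def comp_apply
proof (intro ballI)
  fix \<phi> \<psi> assume \<phi>: "\<phi> \<in> smooth n" and \<psi>: "\<psi> \<in> smooth n"
  note D = D_plus_smooth[OF \<phi>] D_plus_smooth[OF \<psi>]
  show "ip n (D_minus (int n + 2) (D_plus (int n) \<phi>)) \<psi> = ip n \<phi> (D_minus (int n + 2) (D_plus (int n) \<psi>))"
    using D_plus_adjoint[OF \<phi> D(2)] D_plus_adjoint[OF \<psi> D(1)] ip_commute by metis
qed

text \<open>Used at negative indices, where the bundle is zero: the derivative of the zero function is zero on the horizontal lifts.\<close>

lemma D_plus_zero: "D_plus m 0 = 0"
proof (rule ext, clarify)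
  fix p q
  show "D_plus m 0 (p, q) = 0 (p, q)"
  proof (cases "(p, q) \<in> Spin4")
    case True
    then have pq: "p \<in> SU2" "q \<in> SU2" by (auto simp: Spin4_def)
    have "dSpin (\<lambda>g'. coeff ((0 :: sect) g') k) (p, q) (p ** su2_of a, q ** su2_of b) = 0" for k a b
    proof -
      have "((\<lambda>g'. coeff ((0 :: sect) g') k) has_derivative (\<lambda>x. 0)) (at (p, q) within Spin4)" by simp
      from dSpin_eq[OF this pq] show ?thesis .
    qed
    then have "nabla m 0 (p, q) (spin_frame (p, q) X) = 0" for X
      by (simp add: nabla_def horizontal_lift_frame[OF pq])
    then show ?thesis by (simp add: D_plus_def dirac_of_def plin_zero[OF plin_rho_plus])
  qed (simp add: D_plus_def dirac_of_def)
qed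

lemma smooth_sections_negative: "m < 0 \<Longrightarrow> \<phi> \<in> smooth_sections m \<Longrightarrow> \<phi> = 0"
  by (rule ext) (use sections_in_V[OF smooth_sections_sections, of \<phi> m] in \<open>simp add: V_neg\<close>)

lemma D_plus_minus_small:
  assumes "n < 2" "\<phi> \<in> smooth n"
  shows "(D_plus (int n - 2) \<circ> D_minus (int n)) \<phi> = 0"
proof -
  have "D_minus (int n) \<phi> = 0"
    by (rule smooth_sections_negative[OF _ D_minus_smooth]) (use assms in auto)
  then show ?thesis unfolding comp_apply by (simp only: D_plus_zero)
qed

lemma sec_linear_D_plus_minus: "sec_linear (int n) (int n) (D_plus (int n - 2) \<circ> D_minus (int n))"
proof (cases "n < 2")
  case True
  show ?thesis
    unfolding sec_linear_def
  proof (intro conjI ballI allI)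
    fix \<phi> \<psi> c assume \<phi>: "\<phi> \<in> smooth n" and \<psi>: "\<psi> \<in> smooth n"
    show "(D_plus (int n - 2) \<circ> D_minus (int n)) (\<phi> + \<psi>) = (D_plus (int n - 2) \<circ> D_minus (int n)) \<phi> + (D_plus (int n - 2) \<circ> D_minus (int n)) \<psi>"
      unfolding D_plus_minus_small[OF True \<phi>] D_plus_minus_small[OF True \<psi>] D_plus_minus_small[OF True smooth_sections_add[OF \<phi> \<psi>]]
      by (rule add_0_left[symmetric])
  next
    fix \<phi> c assume \<phi>: "\<phi> \<in> smooth n"
    show "(D_plus (int n - 2) \<circ> D_minus (int n)) (sec_scale c \<phi>) = sec_scale c ((D_plus (int n - 2) \<circ> D_minus (int n)) \<phi>)"
      unfolding D_plus_minus_small[OF True \<phi>] D_plus_minus_small[OF True smooth_sections_scale[OF \<phi>]]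
      by (rule sec.scale_zero_right[symmetric])
    show "(D_plus (int n - 2) \<circ> D_minus (int n)) \<phi> \<in> smooth n"
      unfolding D_plus_minus_small[OF True \<phi>] by (rule smooth_sections_zero)
  qed
next
  case False
  then have e: "int (n - 2) = int n - 2" by simp
  have "sec_linear (int n - 2) (int n) (D_plus (int n - 2))" using sec_linear_D_plus[of "n - 2"] unfolding e by simp
  then show ?thesis by (rule sec_linear_comp[OF sec_linear_D_minus])
qed

lemma symmetric_D_plus_minus: "symmetric_op n (D_plus (int n - 2) \<circ> D_minus (int n))"
proof (cases "n < 2")
  case True
  show ?thesis
    unfolding symmetric_op_def
  proof (intro ballI)
    fix \<phi> \<psi> assume \<phi>: "\<phi> \<in> smooth n" and \<psi>: "\<psi> \<in> smooth n"
    show "ip n ((D_plus (int n - 2) \<circ> D_minus (int n)) \<phi>) \<psi> = ip n \<phi> ((D_plus (int n - 2) \<circ> D_minus (int n)) \<psi>)"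
      unfolding D_plus_minus_small[OF True \<phi>] D_plus_minus_small[OF True \<psi>] by (simp only: ip_zero_left ip_zero_right)
  qed
next
  case False
  then obtain k where n: "n = k + 2" by (metis add.commute le_Suc_ex not_less)
  have k: "int n - 2 = int k" "int n = int k + 2" by (simp_all add: n)
  show ?thesis
    unfolding symmetric_op_def comp_apply
  proof (intro ballI)
    fix \<phi> \<psi> assume \<phi>: "\<phi> \<in> smooth n" and \<psi>: "\<psi> \<in> smooth n"
    note D = D_minus_smooth[OF \<phi>, unfolded k(1)] D_minus_smooth[OF \<psi>, unfolded k(1)]
    show "ip n (D_plus (int n - 2) (D_minus (int n) \<phi>)) \<psi> = ip n \<phi> (D_plus (int n - 2) (D_minus (int n) \<psi>))"
      using D_plus_adjoint[OF D(1) \<psi>[unfolded k(2)]] D_plus_adjoint[OF D(2) \<phi>[unfolded k(2)]] ip_commute unfolding k(1) k(2)[symmetric] by metis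
  qed
qed

section \<open>Eigenvalues on the basis\<close>

lemma D_zero_eb:
  assumes "(A, B, r, k, l) \<in> idx n"
  shows "D_zero (int n) (eb (A, B, r, k, l)) =
    sec_scale (complex_of_real ((real A - real B) * (real A + real B + 2 * real r + 2) / 2)) (eb (A, B, r, k, l))"
proof -
  have i: "A + B = n" "k \<le> A + r" "l \<le> B + r" using assms by (auto simp: idx_iff)
  show ?thesis
    using D_zero_bsec[OF monom_in_V[OF i(2)] monom_in_V[OF i(3)]] unfolding i(1) by (simp add: eb_def)
qed

lemma D_minus_plus_eb:
  assumes "(A, B, r, k, l) \<in> idx n"
  shows "(D_minus (int n + 2) \<circ> D_plus (int n)) (eb (A, B, r, k, l)) =
    sec_scale (complex_of_real (4 * real r * (real A + 1) * (real B + 1) * (real n + real r + 2))) (eb (A, B, r, k, l))"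
proof -
  have i: "A + B = n" "k \<le> A + r" "l \<le> B + r" using assms by (auto simp: idx_iff)
  note m = monom_in_V[OF i(2)] monom_in_V[OF i(3)]
  have n2: "int n + 2 = int (n + 2)" by simp
  show ?thesis
  proof (cases r)
    case 0
    have "D_plus (int n) (eb (A, B, r, k, l)) = 0"
      using D_plus_bsec_0[OF m[unfolded 0]] unfolding i(1) by (simp only: 0 eb_def prod.case)
    then show ?thesis
      unfolding comp_apply n2 by (simp only: sec_linear_zero[OF sec_linear_D_minus] 0 of_nat_0 mult_zero_left mult_zero_right of_real_0 sec.scale_zero_left)
  next
    case (Suc s)
    have m': "monom 1 k \<in> V (int (Suc A + s))" "monom 1 l \<in> V (int (Suc B + s))" using m by (simp_all add: Suc)
    have s: "bsec (Suc A) (Suc B) s (monom 1 k) (monom 1 l) \<in> smooth (n + 2)"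
      using bsec_smooth[OF m'] i(1) by (simp add: numeral_2_eq_2)
    have "D_plus (int n) (eb (A, B, r, k, l)) = sec_scale (2 * of_nat (Suc s)) (bsec (Suc A) (Suc B) s (monom 1 k) (monom 1 l))"
      using D_plus_bsec[OF m[unfolded Suc]] unfolding i(1) by (simp only: Suc eb_def prod.case)
    moreover have "D_minus (int (n + 2)) (bsec (Suc A) (Suc B) s (monom 1 k) (monom 1 l)) =
       sec_scale (2 * of_nat (Suc A) * of_nat (Suc B) * of_nat (A + B + s + 3)) (eb (A, B, r, k, l))"
    proof -
      have "Suc A + Suc B = n + 2" using i(1) by simp
      then show ?thesis using D_minus_bsec[OF m'] by (simp only: Suc eb_def prod.case)
    qed
    moreover have "D_minus (int (n + 2)) (sec_scale c (bsec (Suc A) (Suc B) s (monom 1 k) (monom 1 l))) =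
      sec_scale c (D_minus (int (n + 2)) (bsec (Suc A) (Suc B) s (monom 1 k) (monom 1 l)))" for c
      using sec_linear_D_minus[of "n + 2"] s unfolding sec_linear_def by blast
    ultimately have "(D_minus (int n + 2) \<circ> D_plus (int n)) (eb (A, B, r, k, l)) =
      sec_scale (2 * of_nat (Suc s) * (2 * of_nat (Suc A) * of_nat (Suc B) * of_nat (A + B + s + 3))) (eb (A, B, r, k, l))"
      unfolding comp_apply n2 by (simp only: sec.scale_scale)
    also have "2 * of_nat (Suc s) * (2 * of_nat (Suc A) * of_nat (Suc B) * of_nat (A + B + s + 3)) =
      complex_of_real (4 * real r * (real A + 1) * (real B + 1) * (real n + real r + 2))"
      unfolding i(1)[symmetric] Suc by (simp add: algebra_simps)
    finally show ?thesis .
  qed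
qed

lemma D_plus_minus_eb:
  assumes "(A, B, r, k, l) \<in> idx n"
  shows "(D_plus (int n - 2) \<circ> D_minus (int n)) (eb (A, B, r, k, l)) =
    sec_scale (complex_of_real (4 * real A * real B * (real r + 1) * (real n + real r + 1))) (eb (A, B, r, k, l))"
proof -
  have i: "A + B = n" "k \<le> A + r" "l \<le> B + r" using assms by (auto simp: idx_iff)
  note m = monom_in_V[OF i(2)] monom_in_V[OF i(3)]
  show ?thesis
  proof (cases "A = 0 \<or> B = 0")
    case True
    have "D_minus (int n) (eb (A, B, r, k, l)) = 0"
      using D_minus_bsec_0[OF m True] unfolding i(1) by (simp only: eb_def prod.case)
    moreover have "4 * real A * real B * (real r + 1) * (real n + real r + 1) = 0" using True by auto
    ultimately show ?thesis
      unfolding comp_apply by (simp only: D_plus_zero of_real_0 sec.scale_zero_left)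
  next
    case False
    then obtain A' B' where AB: "A = Suc A'" "B = Suc B'" using not0_implies_Suc by blast
    have n2: "int n - 2 = int (A' + B')" using i(1) AB by simp
    have m': "monom 1 k \<in> V (int (A' + Suc r))" "monom 1 l \<in> V (int (B' + Suc r))" using m by (simp_all add: AB)
    have s: "bsec A' B' (Suc r) (monom 1 k) (monom 1 l) \<in> smooth (A' + B')"
      by (rule bsec_smooth[OF m'])
    have "D_minus (int n) (eb (A, B, r, k, l)) = sec_scale (2 * of_nat (Suc A') * of_nat (Suc B') * of_nat (A' + B' + r + 3)) (bsec A' B' (Suc r) (monom 1 k) (monom 1 l))"
      using D_minus_bsec[OF m[unfolded AB]] i(1) by (simp only: AB eb_def prod.case)
    moreover have "D_plus (int (A' + B')) (bsec A' B' (Suc r) (monom 1 k) (monom 1 l)) = sec_scale (2 * of_nat (Suc r)) (eb (A, B, r, k, l))"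
      using D_plus_bsec[OF m'] by (simp only: AB eb_def prod.case)
    moreover have "D_plus (int (A' + B')) (sec_scale c (bsec A' B' (Suc r) (monom 1 k) (monom 1 l))) =
      sec_scale c (D_plus (int (A' + B')) (bsec A' B' (Suc r) (monom 1 k) (monom 1 l)))" for c
      using sec_linear_D_plus[of "A' + B'"] s unfolding sec_linear_def by blast
    ultimately have "(D_plus (int n - 2) \<circ> D_minus (int n)) (eb (A, B, r, k, l)) =
      sec_scale (2 * of_nat (Suc A') * of_nat (Suc B') * of_nat (A' + B' + r + 3) * (2 * of_nat (Suc r))) (eb (A, B, r, k, l))"
      unfolding comp_apply n2 by (simp only: sec.scale_scale)
    also have "2 * of_nat (Suc A') * of_nat (Suc B') * of_nat (A' + B' + r + 3) * (2 * of_nat (Suc r)) =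
      complex_of_real (4 * real A * real B * (real r + 1) * (real n + real r + 1))"
      unfolding i(1)[symmetric] AB by (simp add: algebra_simps)
    finally show ?thesis .
  qed
qed

section \<open>Symmetric operators that are diagonal in the basis\<close>

lemma smooth_zero_if_orthogonal:
  assumes \<phi>: "\<phi> \<in> smooth n" and z: "\<And>\<iota>. \<iota> \<in> idx n \<Longrightarrow> ip n \<phi> (eb \<iota>) = 0"
  shows "\<phi> = 0"
  by (rule smooth_ae_eq[OF \<phi> smooth_sections_zero basis_complete[OF smooth_L2[OF \<phi>] z]])

lemma eb_nonzero: "\<iota> \<in> idx n \<Longrightarrow> eb \<iota> \<noteq> 0"
proof
  assume i: "\<iota> \<in> idx n" and z: "eb \<iota> = 0"
  show False using eb_norm[OF i] unfolding z ip_zero_left by blast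
qed

context
  fixes n :: nat and P :: "sect \<Rightarrow> sect" and t :: "nat \<times> nat \<times> nat \<times> nat \<times> nat \<Rightarrow> real"
  assumes lin: "sec_linear (int n) (int n) P" and sym: "symmetric_op n P"
    and diag: "\<And>\<iota>. \<iota> \<in> idx n \<Longrightarrow> P (eb \<iota>) = sec_scale (complex_of_real (t \<iota>)) (eb \<iota>)"
begin

lemma ip_diagonal:
  assumes "\<phi> \<in> smooth n" "\<iota> \<in> idx n"
  shows "ip n (P \<phi>) (eb \<iota>) = complex_of_real (t \<iota>) * ip n \<phi> (eb \<iota>)"
proof -
  have "ip n (P \<phi>) (eb \<iota>) = ip n \<phi> (P (eb \<iota>))"
    using sym assms eb_smooth unfolding symmetric_op_def by blast
  then show ?thesis by (simp only: diag[OF assms(2)] ip_scale_right complex_cnj_complex_of_real)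
qed

lemma eigenvalues_diagonal: "eigenvalues (int n) P = complex_of_real ` t ` idx n"
proof (intro equalityI subsetI)
  fix x assume "x \<in> eigenvalues (int n) P"
  then obtain \<phi> where \<phi>: "\<phi> \<in> smooth n" "\<phi> \<noteq> 0" "P \<phi> = sec_scale x \<phi>" by (auto simp: eigenvalues_def)
  then obtain \<iota> where \<iota>: "\<iota> \<in> idx n" "ip n \<phi> (eb \<iota>) \<noteq> 0" using smooth_zero_if_orthogonal by blast
  have "x * ip n \<phi> (eb \<iota>) = complex_of_real (t \<iota>) * ip n \<phi> (eb \<iota>)"
    using ip_diagonal[OF \<phi>(1) \<iota>(1)] unfolding \<phi>(3) ip_scale_left .
  then show "x \<in> complex_of_real ` t ` idx n" using \<iota> by auto
next
  fix x assume "x \<in> complex_of_real ` t ` idx n"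
  then obtain \<iota> where "\<iota> \<in> idx n" "x = complex_of_real (t \<iota>)" by auto
  then show "x \<in> eigenvalues (int n) P" unfolding eigenvalues_def using eb_smooth eb_nonzero diag by blast
qed

lemma diagonal_kernel:
  assumes "\<phi> \<in> smooth n" "P \<phi> = 0" "\<iota> \<in> idx n" "t \<iota> \<noteq> 0"
  shows "ip n \<phi> (eb \<iota>) = 0"
  using ip_diagonal[OF assms(1,3)] assms(2,4) by simp

text \<open>If \<open>\<eta>\<close> is the weak image of \<open>\<psi>\<close> under \<open>P\<close>, its coefficients are those of \<open>\<psi>\<close> multiplied by the diagonal entries.\<close>

lemma diagonal_proj:
  assumes J: "finite J" "J \<subseteq> idx n" and \<psi>: "\<psi> \<in> L2 (int n)" and \<eta>: "\<eta> \<in> L2 (int n)"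
    and w: "\<And>\<phi>. \<phi> \<in> smooth n \<Longrightarrow> ip n (P \<phi>) \<psi> = ip n \<phi> \<eta>"
  shows "P (proj n J \<psi>) = proj n J \<eta>"
proof -
  let ?c = "\<lambda>\<psi> \<iota>. ip n \<psi> (eb \<iota>) / ip n (eb \<iota>) (eb \<iota>)"
  have "P (proj n J \<psi>) = (\<Sum>\<iota>\<in>J. P (sec_scale (?c \<psi> \<iota>) (eb \<iota>)))"
    unfolding proj_def by (rule sec_linear_sum[OF lin J(1)]) (use J(2) in \<open>auto intro: smooth_sections_scale eb_smooth\<close>)
  also have "\<dots> = (\<Sum>\<iota>\<in>J. sec_scale (?c \<eta> \<iota>) (eb \<iota>))"
  proof (rule sum.cong[OF refl])
    fix \<iota> assume "\<iota> \<in> J"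
    then have \<iota>: "\<iota> \<in> idx n" using J(2) by blast
    have "complex_of_real (t \<iota>) * ip n (eb \<iota>) \<psi> = ip n (eb \<iota>) \<eta>"
      using w[OF eb_smooth[OF \<iota>]] unfolding diag[OF \<iota>] ip_scale_left .
    then have "cnj (complex_of_real (t \<iota>) * ip n (eb \<iota>) \<psi>) = cnj (ip n (eb \<iota>) \<eta>)" by simp
    then have e: "ip n \<eta> (eb \<iota>) = ip n \<psi> (eb \<iota>) * complex_of_real (t \<iota>)"
      using ip_commute[of "int n" \<psi> "eb \<iota>"] ip_commute[of "int n" \<eta> "eb \<iota>"] by (simp add: mult.commute)
    have "P (sec_scale (?c \<psi> \<iota>) (eb \<iota>)) = sec_scale (?c \<psi> \<iota>) (P (eb \<iota>))"
      using lin eb_smooth[OF \<iota>] unfolding sec_linear_def by blast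
    also have "\<dots> = sec_scale (?c \<eta> \<iota>) (eb \<iota>)"
      unfolding diag[OF \<iota>] sec.scale_scale e by (simp only: times_divide_eq_left)
    finally show "P (sec_scale (?c \<psi> \<iota>) (eb \<iota>)) = sec_scale (?c \<eta> \<iota>) (eb \<iota>)" .
  qed
  finally show ?thesis unfolding proj_def .
qed

lemma L2_norm_minus_commute:
  assumes "\<phi> \<in> L2 (int m)" "\<psi> \<in> L2 (int m)"
  shows "nrm m (\<phi> - \<psi>) = nrm m (\<psi> - \<phi>)"
proof -
  have "\<phi> - \<psi> = sec_scale (- 1) (\<psi> - \<phi>)" by (simp only: sec.scale_minus_left sec.scale_one minus_diff_eq)
  then have "ip m (\<phi> - \<psi>) (\<phi> - \<psi>) = ip m (\<psi> - \<phi>) (\<psi> - \<phi>)"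
    by (simp only: ip_scale_left ip_scale_right) simp
  then show ?thesis by (simp add: L2_norm_def)
qed

lemma ip_limit:
  assumes F: "\<And>k. F k \<in> L2 (int m)" and \<psi>: "\<psi> \<in> L2 (int m)" and x: "x \<in> L2 (int m)"
    and lim: "(\<lambda>k. nrm m (F k - \<psi>)) \<longlonglongrightarrow> 0"
  shows "(\<lambda>k. ip m x (F k)) \<longlonglongrightarrow> ip m x \<psi>"
proof (rule LIM_zero_cancel, rule tendsto_norm_zero_cancel, rule tendsto_sandwich[OF _ _ tendsto_const])
  show "(\<lambda>k. nrm m x * nrm m (F k - \<psi>)) \<longlonglongrightarrow> 0"
    using tendsto_mult[OF tendsto_const lim, of "nrm m x"] by simp
  show "\<forall>\<^sub>F k in sequentially. norm (ip m x (F k) - ip m x \<psi>) \<le> nrm m x * nrm m (F k - \<psi>)"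
  proof (rule always_eventually, rule allI)
    fix k
    show "norm (ip m x (F k) - ip m x \<psi>) \<le> nrm m x * nrm m (F k - \<psi>)"
      using Cauchy_Schwarz_L2[OF x L2_diff[OF F \<psi>]] unfolding ip_diff_right[OF F \<psi> x] .
  qed
qed simp

lemma proj_mono:
  assumes J: "finite J" "J \<subseteq> J'" "finite J'" "J' \<subseteq> idx m" and \<phi>: "\<phi> \<in> L2 (int m)"
  shows "nrm m (\<phi> - proj m J' \<phi>) \<le> nrm m (\<phi> - proj m J \<phi>)"
proof (rule proj_best_approximation[OF J(3,4) \<phi>])
  show "proj m J \<phi> \<in> sec.span (eb ` J')"
    unfolding proj_def using J(2) by (intro sec.span_sum sec.span_scale sec.span_base) auto
qed

text \<open>
  A pair in the adjoint is the limit of its projections, which lie in the graph by \<open>diagonal_proj\<close>. Conversely, limits of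
  the graph satisfy the adjoint relation by symmetry and continuity of the inner product.
\<close>

lemma diagonal_self_adjoint: "self_adjoint (int n) P"
  unfolding self_adjoint_def
proof (intro ballI iffI)
  fix \<psi> \<eta> assume \<psi>: "\<psi> \<in> L2 (int n)" and \<eta>: "\<eta> \<in> L2 (int n)"
    and w: "\<forall>\<phi>\<in>smooth n. ip n (P \<phi>) \<psi> = ip n \<phi> \<eta>"
  have "\<exists>J. finite J \<and> J \<subseteq> idx n \<and> nrm n (proj n J \<psi> - \<psi>) < 1 / real (Suc k) \<and> nrm n (proj n J \<eta> - \<eta>) < 1 / real (Suc k)" for k
  proof -
    have pos: "0 < 1 / real (Suc k)" by simp
    obtain J where J: "finite J" "J \<subseteq> idx n" "nrm n (\<psi> - proj n J \<psi>) < 1 / real (Suc k)" by (rule proj_dense[OF \<psi> pos])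
    obtain J' where J': "finite J'" "J' \<subseteq> idx n" "nrm n (\<eta> - proj n J' \<eta>) < 1 / real (Suc k)" by (rule proj_dense[OF \<eta> pos])
    have U: "finite (J \<union> J')" "J \<union> J' \<subseteq> idx n" using J J' by auto
    have "nrm n (\<psi> - proj n (J \<union> J') \<psi>) < 1 / real (Suc k)"
      using proj_mono[OF J(1) Un_upper1 U \<psi>] J(3) by linarith
    moreover have "nrm n (\<eta> - proj n (J \<union> J') \<eta>) < 1 / real (Suc k)"
      using proj_mono[OF J'(1) Un_upper2 U \<eta>] J'(3) by linarith
    ultimately show ?thesis
      using U L2_norm_minus_commute[OF \<psi> proj_L2[OF U]] L2_norm_minus_commute[OF \<eta> proj_L2[OF U]] by metis
  qed
  then obtain J where J: "\<And>k. finite (J k)" "\<And>k. J k \<subseteq> idx n"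
    "\<And>k. nrm n (proj n (J k) \<psi> - \<psi>) < 1 / real (Suc k)" "\<And>k. nrm n (proj n (J k) \<eta> - \<eta>) < 1 / real (Suc k)"
    by metis
  have PJ: "P (proj n (J k) \<psi>) = proj n (J k) \<eta>" for k
    by (rule diagonal_proj[OF J(1,2) \<psi> \<eta>]) (use w in blast)
  have inv: "(\<lambda>k. 1 / real (Suc k)) \<longlonglongrightarrow> 0" using LIMSEQ_inverse_real_of_nat by (simp add: inverse_eq_divide)
  have lim: "(\<lambda>k. nrm n (proj n (J k) \<chi>1 - \<chi>1)) \<longlonglongrightarrow> 0"
    if "\<chi>1 \<in> L2 (int n)" "\<And>k. nrm n (proj n (J k) \<chi>1 - \<chi>1) < 1 / real (Suc k)" for \<chi>1
  proof (rule tendsto_sandwich[OF _ _ tendsto_const inv])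
    show "\<forall>\<^sub>F k in sequentially. 0 \<le> nrm n (proj n (J k) \<chi>1 - \<chi>1)"
      by (intro always_eventually allI L2_norm_nonneg L2_diff proj_L2 J that(1))
    show "\<forall>\<^sub>F k in sequentially. nrm n (proj n (J k) \<chi>1 - \<chi>1) \<le> 1 / real (Suc k)"
      by (intro always_eventually allI less_imp_le that(2))
  qed
  show "\<exists>F. (\<forall>k. F k \<in> smooth n) \<and> (\<lambda>k. nrm n (F k - \<psi>)) \<longlonglongrightarrow> 0 \<and> (\<lambda>k. nrm n (P (F k) - \<eta>)) \<longlonglongrightarrow> 0"
    by (rule exI[of _ "\<lambda>k. proj n (J k) \<psi>"], unfold PJ) (intro conjI allI proj_smooth J lim[OF \<psi>] lim[OF \<eta>])
next
  fix \<psi> \<eta> \<phi> assume \<psi>: "\<psi> \<in> L2 (int n)" and \<eta>: "\<eta> \<in> L2 (int n)" and \<phi>: "\<phi> \<in> smooth n"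
    and "\<exists>F. (\<forall>k. F k \<in> smooth n) \<and> (\<lambda>k. nrm n (F k - \<psi>)) \<longlonglongrightarrow> 0 \<and> (\<lambda>k. nrm n (P (F k) - \<eta>)) \<longlonglongrightarrow> 0"
  then obtain F where F: "\<And>k. F k \<in> smooth n" and l: "(\<lambda>k. nrm n (F k - \<psi>)) \<longlonglongrightarrow> 0"
    "(\<lambda>k. nrm n (P (F k) - \<eta>)) \<longlonglongrightarrow> 0" by blast
  have P: "P \<phi> \<in> smooth n" if "\<phi> \<in> smooth n" for \<phi> using lin that by (simp add: sec_linear_def)
  have "(\<lambda>k. ip n (P \<phi>) (F k)) \<longlonglongrightarrow> ip n (P \<phi>) \<psi>"
    by (rule ip_limit[OF smooth_L2[OF F] \<psi> smooth_L2[OF P[OF \<phi>]] l(1)])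
  moreover have "(\<lambda>k. ip n (P \<phi>) (F k)) \<longlonglongrightarrow> ip n \<phi> \<eta>"
  proof -
    have "ip n (P \<phi>) (F k) = ip n \<phi> (P (F k))" for k
      using sym \<phi> F unfolding symmetric_op_def by blast
    then show ?thesis using ip_limit[OF smooth_L2[OF P[OF F]] \<eta> smooth_L2[OF \<phi>] l(2)] by simp
  qed
  ultimately show "ip n (P \<phi>) \<psi> = ip n \<phi> \<eta>" by (rule LIMSEQ_unique)
qed

end

section \<open>The kernel of the first order operator raising the index\<close>

text \<open>The indices with \<open>r = 0\<close>, parametrised so that they can be counted.\<close>

definition idx0 :: "nat \<Rightarrow> (nat \<times> nat \<times> nat \<times> nat \<times> nat) set" where
  "idx0 n = (\<lambda>(A, k, l). (A, n - A, 0, k, l)) ` (SIGMA A:{..n}. {..A} \<times> {..n - A})"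

lemma idx0_iff: "(A, B, r, k, l) \<in> idx0 n \<longleftrightarrow> (A, B, r, k, l) \<in> idx n \<and> r = 0"
  unfolding idx0_def idx_iff by (auto simp: image_iff intro!: bexI[of _ "(A, k, l)"])

lemma finite_idx0: "finite (idx0 n)"
  unfolding idx0_def by (intro finite_imageI finite_SigmaI) auto

lemma idx0_subset: "idx0 n \<subseteq> idx n"
  using idx0_iff by auto

lemma card_idx0: "real (card (idx0 n)) = (real n + 1) * (real n + 2) * (real n + 3) / 6"
proof -
  have "card (idx0 n) = (\<Sum>A\<le>n. (A + 1) * (n - A + 1))"
    unfolding idx0_def by (subst card_image) (auto simp: inj_on_def card_SigmaI)
  then have "real (card (idx0 n)) = (\<Sum>A\<le>n. (real A + 1) * (real n + 1 - real A))"
    by (simp only: of_nat_sum of_nat_mult of_nat_add of_nat_1, intro sum.cong refl) (simp add: of_nat_diff)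
  also have "\<dots> = (real n + 2) * ((real n + 1) * (real n + 2)) / 2 - (real n + 1) * (real n + 2) * (2 * real n + 3) / 6"
  proof -
    have "(\<Sum>A\<le>j. (real A + 1) * (N + 1 - real A)) = (N + 2) * ((real j + 1) * (real j + 2)) / 2 - (real j + 1) * (real j + 2) * (2 * real j + 3) / 6"
      for j :: nat and N :: real
      by (induction j) (simp_all add: field_simps)
    then show ?thesis .
  qed
  finally show ?thesis by (simp add: field_simps)
qed

lemma independent_eb:
  assumes J: "finite J" "J \<subseteq> idx n"
  shows "sec.independent (eb ` J)"
  unfolding sec.dependent_def
proof (rule notI, elim bexE)
  fix x assume "x \<in> eb ` J" and s: "x \<in> sec.span (eb ` J - {x})"
  then obtain \<iota> where \<iota>: "\<iota> \<in> J" "x = eb \<iota>" by blast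
  have "x \<in> sec.span (eb ` (J - {\<iota>}))"
    using s sec.span_mono[of "eb ` J - {x}" "eb ` (J - {\<iota>})"] \<iota>(2) by blast
  moreover have "\<forall>\<kappa>\<in>J - {\<iota>}. ip n (eb \<iota>) (eb \<kappa>) = 0"
  proof
    fix \<kappa> assume "\<kappa> \<in> J - {\<iota>}"
    then show "ip n (eb \<iota>) (eb \<kappa>) = 0" using \<iota>(1) J(2) by (intro eb_orthogonal) auto
  qed
  ultimately have "ip n (eb \<iota>) x = 0"
    using ip_span_zero[of "J - {\<iota>}" n x "eb \<iota>"] J \<iota>(1) eb_L2[of \<iota> n] by auto
  then show False using eb_norm \<iota> J(2) by blast
qed

lemma inj_on_eb: "inj_on eb (idx n)"
proof (rule inj_onI)
  fix \<iota> \<kappa> assume h: "\<iota> \<in> idx n" "\<kappa> \<in> idx n" "eb \<iota> = eb \<kappa>"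
  show "\<iota> = \<kappa>"
  proof (rule ccontr)
    assume "\<iota> \<noteq> \<kappa>"
    then have "ip n (eb \<iota>) (eb \<kappa>) = 0" by (rule eb_orthogonal[OF h(1,2)])
    then show False using eb_norm[OF h(1)] h(3) by simp
  qed
qed

text \<open>
  If \<open>D\<^sup>+ \<phi> = 0\<close> then \<open>D\<^sup>- D\<^sup>+ \<phi> = 0\<close>, so \<open>\<phi>\<close> is orthogonal to the blocks where this operator is not zero, which
  are those with \<open>r \<noteq> 0\<close>.
\<close>

lemma kernel_D_plus: "op_kernel (int n) (D_plus (int n)) = sec.span (eb ` idx0 n)"
proof (intro equalityI subsetI)
  fix \<phi> assume "\<phi> \<in> op_kernel (int n) (D_plus (int n))"
  then have \<phi>: "\<phi> \<in> smooth n" and z: "D_plus (int n) \<phi> = 0" by (auto simp: op_kernel_def)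
  let ?t = "\<lambda>(A, B, r, k, l). 4 * real r * (real A + 1) * (real B + 1) * (real n + real r + 2)"
  have diag: "(D_minus (int n + 2) \<circ> D_plus (int n)) (eb \<iota>) = sec_scale (complex_of_real (?t \<iota>)) (eb \<iota>)" if "\<iota> \<in> idx n" for \<iota>
    using D_minus_plus_eb that by (cases \<iota>) (simp only: prod.case)
  have n2: "int n + 2 = int (n + 2)" by simp
  have z2: "(D_minus (int n + 2) \<circ> D_plus (int n)) \<phi> = 0"
    unfolding comp_apply z n2 by (rule sec_linear_zero[OF sec_linear_D_minus])
  have out: "ip n \<phi> (eb \<iota>) = 0" if \<iota>: "\<iota> \<in> idx n" "\<iota> \<notin> idx0 n" for \<iota>
  proof (rule diagonal_kernel[OF sec_linear_D_minus_plus symmetric_D_minus_plus diag \<phi> z2 \<iota>(1)])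
    obtain A B r k l where e: "\<iota> = (A, B, r, k, l)" by (metis prod_cases5)
    have "r \<noteq> 0" using \<iota> by (simp add: e idx0_iff)
    then show "?t \<iota> \<noteq> 0" by (simp add: e)
  qed
  let ?p = "proj n (idx0 n) \<phi>"
  note p = proj_smooth[OF finite_idx0 idx0_subset, of n \<phi>]
  have "\<phi> - ?p = 0"
  proof (rule smooth_zero_if_orthogonal)
    show "\<phi> - ?p \<in> smooth n"
      unfolding sec_diff by (intro smooth_sections_add smooth_sections_scale \<phi> p)
    fix \<iota> assume \<iota>: "\<iota> \<in> idx n"
    show "ip n (\<phi> - ?p) (eb \<iota>) = 0"
      unfolding ip_diff_left[OF smooth_L2[OF \<phi>] smooth_L2[OF p] eb_L2[OF \<iota>]] ip_proj[OF finite_idx0 idx0_subset \<iota>]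
      using out[OF \<iota>] by auto
  qed
  then have "\<phi> = ?p" by simp
  then show "\<phi> \<in> sec.span (eb ` idx0 n)" using proj_in_span[OF finite_idx0 idx0_subset] by metis
next
  have "sec.subspace (op_kernel (int n) (D_plus (int n)))"
    unfolding sec.subspace_def op_kernel_def
    using sec_linear_D_plus[of n] sec_linear_zero[OF sec_linear_D_plus[of n]]
    by (auto simp: smooth_sections_zero smooth_sections_add smooth_sections_scale sec_linear_def)
  moreover have "eb ` idx0 n \<subseteq> op_kernel (int n) (D_plus (int n))"
  proof (rule subsetI, elim imageE)
    fix x \<iota> assume x: "x = eb \<iota>" and \<iota>: "\<iota> \<in> idx0 n"
    obtain A B r k l where e: "\<iota> = (A, B, r, k, l)" by (metis prod_cases5)
    have i: "(A, B, 0, k, l) \<in> idx n" "r = 0" using \<iota> by (auto simp: e idx0_iff)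
    then have "A + B = n" "k \<le> A + 0" "l \<le> B + 0" by (auto simp: idx_iff)
    then have "D_plus (int n) (eb (A, B, 0, k, l)) = 0"
      using D_plus_bsec_0[OF monom_in_V monom_in_V, of k A l B] by (simp only: eb_def prod.case)
    then show "x \<in> op_kernel (int n) (D_plus (int n))"
      using eb_smooth[OF i(1)] by (simp only: op_kernel_def x e i(2) mem_Collect_eq simp_thms)
  qed
  ultimately have "sec.span (eb ` idx0 n) \<subseteq> op_kernel (int n) (D_plus (int n))" by (rule sec.span_minimal[rotated])
  then show "\<phi> \<in> sec.span (eb ` idx0 n) \<Longrightarrow> \<phi> \<in> op_kernel (int n) (D_plus (int n))" for \<phi> by blast
qed

lemma dim_kernel_D_plus:
  "real (sec.dim (op_kernel (int m) (D_plus (int m)))) = (real m + 1) * (real m + 2) * (real m + 3) / 6"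
proof -
  have "sec.dim (op_kernel (int m) (D_plus (int m))) = card (eb ` idx0 m)"
    unfolding kernel_D_plus by (rule sec.dim_span_eq_card_independent[OF independent_eb[OF finite_idx0 idx0_subset]])
  also have "\<dots> = card (idx0 m)" by (rule card_image[OF inj_on_subset[OF inj_on_eb idx0_subset]])
  finally show ?thesis by (simp only: card_idx0)
qed

section \<open>Ellipticity\<close>

lemma smooth_sections_mult:
  assumes v: "smooth_on Spin4 v" and inv: "\<And>p q h. p \<in> SU2 \<Longrightarrow> q \<in> SU2 \<Longrightarrow> h \<in> SU2 \<Longrightarrow> v (p ** h, q ** h) = (v (p, q) :: complex)"
    and \<phi>: "\<phi> \<in> smooth_sections m"
  shows "(\<lambda>g. smult (v g) (\<phi> g)) \<in> smooth_sections m"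
proof -
  note s = smooth_sections_sections[OF \<phi>]
  have "(\<lambda>g. smult (v g) (\<phi> g)) \<in> sections m"
    using s by (auto simp: sections_def V_smult inv plin_smult[OF plin_rho])
  then show ?thesis
    unfolding smooth_sections_def using smooth_sections_smooth[OF \<phi>] by (auto intro: smooth_on_mult v)
qed

lemma Ld_mult:
  assumes v: "smooth_on Spin4 v" and \<phi>: "\<phi> \<in> smooth n" and v\<phi>: "(\<lambda>g. smult (v g) (\<phi> g)) \<in> smooth n"
    and g: "g \<in> Spin4"
  shows "Ld n (axis i 1) (\<lambda>g. smult (v g) (\<phi> g)) g =
    smult (v g) (Ld n (axis i 1) \<phi> g) + smult (dSpin v g (fst g ** su2_of (axis i 1), 0)) (\<phi> g)"
proof -
  obtain p q where pq: "g = (p, q)" "p \<in> SU2" "q \<in> SU2" using g by (auto simp: Spin4_def)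
  have v': "((\<lambda>t. v (p ** circ i t, q)) has_vector_derivative dSpin v (p, q) (p ** su2_of (axis i 1), 0)) (at 0)"
    unfolding dSpin_def by (rule derivative_left_circ[OF smooth_on_differentiable[OF v] pq(2,3)]) (use g pq in simp)
  have "pvd (\<lambda>t. smult (v (p ** circ i t, q)) (\<phi> (p ** circ i t, q)))
    (smult (v (p, q)) (Ld n (axis i 1) \<phi> (p, q)) + smult (dSpin v (p, q) (p ** su2_of (axis i 1), 0)) (\<phi> (p, q)))"
    unfolding pvd_def
  proof
    fix k
    have "((\<lambda>t. coeff (\<phi> (p ** circ i t, q)) k) has_vector_derivative coeff (Ld n (axis i 1) \<phi> (p, q)) k) (at 0)"
      using pvd_left_circ[OF \<phi> pq(2,3), of i] by (simp add: pvd_def)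
    from has_vector_derivative_mult[OF v' this]
    show "((\<lambda>t. coeff (smult (v (p ** circ i t, q)) (\<phi> (p ** circ i t, q))) k) has_vector_derivative
      coeff (smult (v (p, q)) (Ld n (axis i 1) \<phi> (p, q)) + smult (dSpin v (p, q) (p ** su2_of (axis i 1), 0)) (\<phi> (p, q))) k) (at 0)"
      by (simp add: circ_0)
  qed
  from pvd_unique[OF pvd_left_circ[OF v\<phi> pq(2,3)] this] show ?thesis by (simp add: pq(1))
qed

lemma Dop_mult:
  assumes R: "clifford R n m"
    and v: "smooth_on Spin4 v" and \<phi>: "\<phi> \<in> smooth n" and v\<phi>: "(\<lambda>g. smult (v g) (\<phi> g)) \<in> smooth n"
    and g: "g \<in> Spin4" and \<xi>: "\<And>i. dSpin v g (fst g ** su2_of (axis i 1), 0) = complex_of_real (\<xi> $ i)"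
  shows "Dop R n (\<lambda>g. smult (v g) (\<phi> g)) g = smult (v g) (Dop R n \<phi> g) + R \<xi> (\<phi> g)"
proof -
  have lin: "\<And>X. plin (R X)" using R by (simp add: clifford_def)
  show ?thesis
    unfolding clifford_expand[OF R, of \<xi>] using g
    by (simp add: Dop_def Ld_mult[OF v \<phi> v\<phi> g] \<xi> plin_add[OF lin] plin_smult[OF lin] sum.distrib smult_sum_right)
qed

lemma Ck_on_entries:
  "Ck_on n UNIV (\<lambda>g :: mat2 \<times> mat2. fst g $ i $ j)"
proof -
  have "linear (\<lambda>g :: mat2 \<times> mat2. fst g $ i $ j)" by (auto intro!: linearI)
  then show ?thesis by (auto intro!: Ck_on_bounded_linear simp: linear_linear)
qed

lemma Ck_on_sandwich:
  "Ck_on n UNIV (\<lambda>g :: mat2 \<times> mat2. vec4 (fst g ** mat 1 ** adjoint_mat (snd g)) \<bullet> axis j 1)"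
proof -
  have e: "Ck_on n UNIV (\<lambda>g :: mat2 \<times> mat2. (fst g ** mat 1 ** adjoint_mat (snd g)) $ i $ j)" for i j
    unfolding matrix_mul_rid mat2_mult_nth
    by (intro Ck_on_add Ck_on_mult Ck_on_entries Ck_on_adjoint_entries open_UNIV)
  note Re = Ck_on_linear_image[OF open_UNIV bounded_linear_Re] and Im = Ck_on_linear_image[OF open_UNIV bounded_linear_Im]
  consider "j = 1" | "j = 2" | "j = 3" | "j = 4" using exhaust_4 by blast
  then show ?thesis
  proof cases
    case 1
    then show ?thesis unfolding inner_axis using Im[OF e[of 1 1]] by simp
  next
    case 2
    then show ?thesis unfolding inner_axis using Re[OF e[of 1 2]] by simp
  next
    case 3
    then show ?thesis unfolding inner_axis using Im[OF e[of 1 2]] by simp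
  next
    case 4
    then show ?thesis unfolding inner_axis using Re[OF e[of 1 1]] by simp
  qed
qed

lemma spin_proj_S3: "g \<in> Spin4 \<Longrightarrow> spin_proj g \<in> S3"
  by (auto simp: spin_proj_eq Spin4_def intro!: vec4_S3)

lemma smooth_on_pullback:
  fixes f :: "real ^ 4 \<Rightarrow> real"
  assumes f: "smooth_on S3 f"
  shows "smooth_on Spin4 (\<lambda>g. f (spin_proj g))"
  unfolding smooth_on_def
proof
  let ?P = "\<lambda>g :: mat2 \<times> mat2. vec4 (fst g ** mat 1 ** adjoint_mat (snd g))"
  have CP: "Ck_on n UNIV (\<lambda>g. ?P g \<bullet> b)" if "b \<in> Basis" for b n
    using that Ck_on_sandwich by (auto simp: Basis_vec_def)
  have cont: "continuous_on UNIV ?P"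
  proof (rule continuous_on_vec_lambda[of UNIV "\<lambda>i g. ?P g $ i", unfolded vec_nth_inverse])
    show "continuous_on UNIV (\<lambda>g. ?P g $ i)" for i
      using Ck_on_sandwich[of 0 i] by (simp add: inner_axis)
  qed
  fix g assume g: "g \<in> Spin4"
  obtain U F where F: "open U" "spin_proj g \<in> U" "\<forall>n. Ck_on n U F" "\<forall>y\<in>U \<inter> S3. F y = f y"
    using f spin_proj_S3[OF g] unfolding smooth_on_def by meson
  have W: "open (?P -` U)" by (rule open_vimage[OF F(1) cont])
  have "Ck_on n (?P -` U) (\<lambda>g. F (?P g))" for n
  proof (rule Ck_on_compose[where U = U, OF W])
    show "Ck_on n (?P -` U) (\<lambda>g. ?P g \<bullet> b)" if "b \<in> Basis" for b n
      by (rule Ck_on_subset[OF W subset_UNIV CP[OF that]])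
  qed (use F(3) in auto)
  moreover have "F (?P y) = f (spin_proj y)" if "y \<in> ?P -` U \<inter> Spin4" for y
    using that F(4) spin_proj_S3[of y] spin_proj_eq[of y] by auto
  moreover have "g \<in> ?P -` U" using F(2) spin_proj_eq[OF g] by simp
  ultimately show "\<exists>U F. open U \<and> g \<in> U \<and> (\<forall>n. Ck_on n U F) \<and> (\<forall>y\<in>U \<inter> Spin4. F y = f (spin_proj y))"
    using W by (intro exI[of _ "?P -` U"] exI[of _ "\<lambda>g. F (?P g)"]) auto
qed

lemma spin_proj_right_mult:
  assumes "p \<in> SU2" "q \<in> SU2" "h \<in> SU2"
  shows "spin_proj (p ** h, q ** h) = spin_proj (p, q)"
proof -
  have "p ** h ** (adjoint_mat h ** adjoint_mat q) = p ** (h ** adjoint_mat h) ** adjoint_mat q"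
    by (simp add: matrix_mul_assoc)
  then show ?thesis using assms by (simp add: spin_proj_eq Spin4_def adjoint_mat_mult SU2_adjoint_right)
qed

lemma pullback_derivative:
  fixes f :: "real ^ 4 \<Rightarrow> real"
  assumes f': "(f has_derivative f') (at (spin_proj (p, q)) within S3)" and pq: "p \<in> SU2" "q \<in> SU2"
  shows "dSpin (\<lambda>g. complex_of_real (f (spin_proj g))) (p, q) (p ** su2_of a, 0) = complex_of_real (f' (vec4 (p ** su2_of a ** adjoint_mat q)))"
proof -
  have g: "(p, q) \<in> Spin4" using pq by (simp add: Spin4_def)
  let ?P' = "\<lambda>\<xi>. vec4 (p ** mat 1 ** adjoint_mat (snd \<xi>)) + vec4 (fst \<xi> ** mat 1 ** adjoint_mat q)"
  have P: "(spin_proj has_derivative ?P') (at (p, q) within Spin4)"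
    by (rule sandwich_derivative[OF spin_proj_eq g])
  have "(f has_derivative f') (at (spin_proj (p, q)) within spin_proj ` Spin4)"
    by (rule has_derivative_subset[OF f']) (use spin_proj_S3 in blast)
  from has_derivative_in_compose[OF P this]
  have "((\<lambda>g. f (spin_proj g)) has_derivative (\<lambda>\<xi>. f' (?P' \<xi>))) (at (p, q) within Spin4)" .
  then have "((\<lambda>g. complex_of_real (f (spin_proj g))) has_derivative (\<lambda>\<xi>. complex_of_real (f' (?P' \<xi>)))) (at (p, q) within Spin4)"
    by (rule has_derivative_of_real)
  from dSpin_eq_left[OF this pq, of a]
  have "dSpin (\<lambda>g. complex_of_real (f (spin_proj g))) (p, q) (p ** su2_of a, 0) = complex_of_real (f' (?P' (p ** su2_of a, 0)))" .
  moreover have "adjoint_mat 0 = 0" by (simp add: mat2_eq_iff)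
  moreover have "vec4 0 = 0" by (simp add: vec_eq_iff forall_4)
  ultimately show ?thesis by simp
qed

text \<open>A quaternion orthogonal to \<open>p q\<^sup>-\<^sup>1\<close> is \<open>p M q\<^sup>-\<^sup>1\<close> with \<open>M\<close> purely imaginary.\<close>

lemma tangent_vector_form:
  assumes pq: "p \<in> SU2" "q \<in> SU2" and v: "v \<bullet> spin_proj (p, q) = 0"
  obtains X where "v = vec4 (p ** su2_of X ** adjoint_mat q)"
proof -
  let ?M = "adjoint_mat p ** mat4 v ** q"
  have x: "spin_proj (p, q) = vec4 (p ** adjoint_mat q)" using pq by (simp add: spin_proj_eq Spin4_def)
  have qM: "quat ?M" using pq by (intro quat_mult quat_adjoint quat_SU2 quat_mat4)
  have "v \<bullet> vec4 N = Re ((mat4 v ** adjoint_mat N) $ 1 $ 1)" for N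
    by (simp add: inner_vec_def sum_4 mat2_mult_nth mat4_def algebra_simps)
  then have "Re ((mat4 v ** adjoint_mat (p ** adjoint_mat q)) $ 1 $ 1) = 0" using v x by simp
  moreover have "Re (?M $ 1 $ 1) = Re ((mat4 v ** adjoint_mat (p ** adjoint_mat q)) $ 1 $ 1)"
  proof -
    have tr: "2 * Re (N $ 1 $ 1) = Re (N $ 1 $ 1 + N $ 2 $ 2)" if "quat N" for N using that by (simp add: quat_def)
    have "quat (mat4 v ** adjoint_mat (p ** adjoint_mat q))" using pq by (intro quat_mult quat_adjoint quat_SU2 quat_mat4)
    from tr[OF this] tr[OF qM] show ?thesis by (simp add: adjoint_mat_mult mat2_mult_nth algebra_simps)
  qed
  ultimately have "Re (?M $ 1 $ 1) = 0" by simp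
  then have M: "?M = su2_of (vector [vec4 ?M $ 1, vec4 ?M $ 2, vec4 ?M $ 3])"
    using qM by (simp add: mat2_eq_iff quat_def complex_eq_iff)
  have "p ** ?M ** adjoint_mat q = (p ** adjoint_mat p) ** mat4 v ** (q ** adjoint_mat q)"
    by (simp add: matrix_mul_assoc)
  then have "mat4 v = p ** ?M ** adjoint_mat q" using pq by (simp add: SU2_adjoint_right)
  then have "v = vec4 (p ** ?M ** adjoint_mat q)" by (metis vec4_mat4)
  then show thesis using that M by metis
qed

lemma quad_nonzero: "X \<noteq> 0 \<Longrightarrow> quad X \<noteq> 0"
  by (auto simp: quad_def vec_eq_iff forall_3 complex_eq_iff)

text \<open>The composition is minus the adjoint of multiplication by a nonzero polynomial after that multiplication.\<close>

lemma rho_minus_rho_plus_injective: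
  assumes f: "f \<in> V (int n)" and X: "X \<noteq> 0" and z: "rho_minus (int n + 2) X (rho_plus (int n) X f) = 0"
  shows "f = 0"
proof -
  have R: "rho_plus (int n) X f \<in> V (int n + 2)" by (rule rho_plus_in_V[OF f])
  have n: "int n + 2 = int (n + 2)" by simp
  have "herm (int n + 2) (rho_plus (int n) X f) (rho_plus (int n) X f) = 0"
    unfolding rho_plus_adjoint[OF f R] z by simp
  then have "rho_plus (int n) X f = 0" using herm_self_zero[of _ "n + 2"] R unfolding n by simp
  then show ?thesis using quad_nonzero[OF X] by (simp add: rho_plus_eq)
qed

text \<open>
  Write \<open>v\<close> for the function \<open>f\<close> on \<open>Spin(4)\<close>. The product rule gives \<open>D\<^sup>+(v \<psi>) = v D\<^sup>+ \<psi> + \<rho>\<^sup>+(dv) \<psi>\<close>. Applied twice it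
  shows that \<open>D\<^sup>+(v\<^sup>2 \<phi>) = v \<omega>\<close> with the smooth section \<open>\<omega> = 2 D\<^sup>+(v \<phi>) - v D\<^sup>+ \<phi>\<close>, so at a zero of \<open>v\<close> the operator
  \<open>D\<^sup>- D\<^sup>+\<close> maps \<open>v\<^sup>2 \<phi>\<close> to \<open>\<rho>\<^sup>-(dv) \<omega> = 2 \<rho>\<^sup>-(dv) \<rho>\<^sup>+(dv) \<phi>\<close>.
\<close>

lemma elliptic: "elliptic2 (int n) (D_minus (int n + 2) \<circ> D_plus (int n))"
  unfolding elliptic2_def
proof (intro ballI allI impI, elim conjE exE)
  fix g \<phi> and f :: "real ^ 4 \<Rightarrow> real" and w
  assume g: "g \<in> Spin4" and \<phi>: "\<phi> \<in> smooth n" and f: "smooth_on S3 f" and fx: "f (spin_proj g) = 0"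
    and w: "w \<bullet> spin_proj g = 0" "frechet_derivative f (at (spin_proj g) within S3) w \<noteq> 0"
    and z: "(D_minus (int n + 2) \<circ> D_plus (int n)) (\<lambda>g'. smult (complex_of_real ((f (spin_proj g'))\<^sup>2)) (\<phi> g')) g = 0"
  obtain p q where pq: "g = (p, q)" "p \<in> SU2" "q \<in> SU2" using g by (auto simp: Spin4_def)
  let ?f' = "frechet_derivative f (at (spin_proj g) within S3)"
  let ?v = "\<lambda>g. complex_of_real (f (spin_proj g))"
  define L where "L h = (\<chi> i. Re (dSpin ?v h (fst h ** su2_of (axis i 1), 0)))" for h
  have f': "(f has_derivative frechet_derivative f (at (spin_proj h) within S3)) (at (spin_proj h) within S3)" if "h \<in> Spin4" for h
    by (rule smooth_on_differentiable[OF f spin_proj_S3[OF that]])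
  have Lh: "dSpin ?v h (fst h ** su2_of (axis i 1), 0) = complex_of_real (L h $ i)" if hS: "h \<in> Spin4" for h i
  proof -
    obtain p q where h: "h = (p, q)" "p \<in> SU2" "q \<in> SU2" using hS by (auto simp: Spin4_def)
    show ?thesis using pullback_derivative[OF f'[OF hS, unfolded h(1)] h(2,3), of "axis i 1"] by (simp add: L_def h(1))
  qed
  have sv: "smooth_on Spin4 ?v"
    by (rule smooth_on_linear_image[OF bounded_linear_of_real smooth_on_pullback[OF f]])
  have mv: "(\<lambda>g. smult (?v g) (\<psi> g)) \<in> smooth_sections m" if "\<psi> \<in> smooth_sections m" for \<psi> m
    by (rule smooth_sections_mult[OF sv _ that]) (simp add: spin_proj_right_mult)
  have n2: "int n + 2 = int (n + 2)" by simp
  have plus: "D_plus (int n) (\<lambda>g. smult (?v g) (\<psi> g)) h = smult (?v h) (D_plus (int n) \<psi> h) + rho_plus (int n) (L h) (\<psi> h)"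
    if "\<psi> \<in> smooth n" "h \<in> Spin4" for \<psi> h
    unfolding D_plus_eq[OF that(1)] D_plus_eq[OF mv[OF that(1)]]
    by (rule Dop_mult[OF clifford_plus sv that(1) mv[OF that(1)] that(2) Lh[OF that(2)]])
  have minus: "D_minus (int n + 2) (\<lambda>g. smult (?v g) (\<psi> g)) h = smult (?v h) (D_minus (int n + 2) \<psi> h) + rho_minus (int n + 2) (L h) (\<psi> h)"
    if "\<psi> \<in> smooth_sections (int n + 2)" "h \<in> Spin4" for \<psi> h
    unfolding n2 D_minus_eq[OF that(1)[unfolded n2]] D_minus_eq[OF mv[OF that(1)[unfolded n2]]]
    by (rule Dop_mult[OF clifford_minus sv that(1)[unfolded n2] mv[OF that(1)[unfolded n2]] that(2) Lh[OF that(2)]])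
  define \<phi>1 where "\<phi>1 = (\<lambda>g. smult (?v g) (\<phi> g))"
  have \<phi>1: "\<phi>1 \<in> smooth n" unfolding \<phi>1_def by (rule mv[OF \<phi>])
  define \<omega> where "\<omega> = sec_scale 2 (D_plus (int n) \<phi>1) + sec_scale (- 1) (\<lambda>g. smult (?v g) (D_plus (int n) \<phi> g))"
  have \<omega>: "\<omega> \<in> smooth_sections (int n + 2)"
    unfolding \<omega>_def by (intro smooth_sections_add smooth_sections_scale D_plus_smooth[OF \<phi>1] mv[OF D_plus_smooth[OF \<phi>]])
  have e: "D_plus (int n) (\<lambda>g'. smult (complex_of_real ((f (spin_proj g'))\<^sup>2)) (\<phi> g')) = (\<lambda>g. smult (?v g) (\<omega> g))"
  proof (rule ext)
    fix h
    have sq: "(\<lambda>g'. smult (complex_of_real ((f (spin_proj g'))\<^sup>2)) (\<phi> g')) = (\<lambda>g. smult (?v g) (\<phi>1 g))"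
      by (simp add: \<phi>1_def power2_eq_square)
    show "D_plus (int n) (\<lambda>g'. smult (complex_of_real ((f (spin_proj g'))\<^sup>2)) (\<phi> g')) h = smult (?v h) (\<omega> h)"
    proof (cases "h \<in> Spin4")
      case True
      have "D_plus (int n) \<phi>1 h = smult (?v h) (D_plus (int n) \<phi> h) + rho_plus (int n) (L h) (\<phi> h)"
        unfolding \<phi>1_def by (rule plus[OF \<phi> True])
      moreover have "rho_plus (int n) (L h) (\<phi>1 h) = smult (?v h) (rho_plus (int n) (L h) (\<phi> h))"
        by (simp add: \<phi>1_def plin_smult[OF plin_rho_plus])
      moreover have "smult c (smult c A + B) + smult c B = smult c (smult 2 (smult c A + B) + smult (- 1) (smult c A))"
        for c and A B :: "complex poly"
        by (rule poly_eqI) (simp add: algebra_simps)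
      ultimately show ?thesis
        unfolding sq plus[OF \<phi>1 True] by (simp only: \<omega>_def sec_scale_def plus_fun_apply)
    next
      case False
      then show ?thesis
        using sections_outside[OF smooth_sections_sections[OF \<omega>] False]
        unfolding sq by (simp add: D_plus_def dirac_of_def)
    qed
  qed
  have "rho_minus (int n + 2) (L g) (\<omega> g) = 0"
    using z minus[OF \<omega> g] fx unfolding comp_apply e by simp
  moreover have "\<omega> g = smult 2 (rho_plus (int n) (L g) (\<phi> g))"
    using plus[OF \<phi> g] fx by (simp add: \<omega>_def sec_scale_def \<phi>1_def)
  ultimately have r: "rho_minus (int n + 2) (L g) (rho_plus (int n) (L g) (\<phi> g)) = 0"
    by (simp add: plin_smult[OF plin_rho_minus])
  have "L g \<noteq> 0"
  proof
    assume L0: "L g = 0"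
    have z0: "?f' (vec4 (p ** su2_of (axis i 1) ** adjoint_mat q)) = 0" for i
      using pullback_derivative[OF f'[OF g, unfolded pq(1)] pq(2,3), of "axis i 1"] Lh[OF g, of i] L0 by (simp add: pq(1))
    obtain X where X: "w = vec4 (p ** su2_of X ** adjoint_mat q)"
      using tangent_vector_form[OF pq(2,3)] w(1) pq(1) by blast
    have lin: "linear (\<lambda>X. ?f' (vec4 (p ** su2_of X ** adjoint_mat q)))"
      using has_derivative_linear[OF f'[OF g]]
      by (intro linearI) (simp_all add: su2_of_add su2_of_scaleR mat2_add_mult mat2_scaleR_mult vec4_add vec4_scaleR linear_add linear_cmul)
    have "X = (\<Sum>i\<in>UNIV. X $ i *\<^sub>R axis i 1)" by (simp add: vec_eq_iff forall_3 sum_3 axis3_nth)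
    then have "?f' w = (\<Sum>i\<in>UNIV. X $ i *\<^sub>R ?f' (vec4 (p ** su2_of (axis i 1) ** adjoint_mat q)))"
      unfolding X using linear_sum[OF lin, of "\<lambda>i. X $ i *\<^sub>R axis i 1" UNIV] by (simp add: linear_cmul[OF lin])
    then show False using w(2) z0 by simp
  qed
  then show "\<phi> g = 0"
    using rho_minus_rho_plus_injective[OF sections_in_V[OF smooth_sections_sections[OF \<phi>]] _ r] by blast
qed

section \<open>From blocks to the labels of the components\<close>

lemma block_label:
  fixes p s k e :: nat
  assumes "s \<le> p" "p - s \<le> k"
  shows "(p + s + e) + (p - s) = 2 * p + e" "(p - s) + (p + s + e) = 2 * p + e"
    and "(p + s + e) + (k - (p - s)) = k + 2 * s + e" "(p - s) + (k - (p - s)) = k"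
  using assms by linarith+

text \<open>The parity \<open>e\<close> of the index treats \<open>m = 2 p + 1\<close> and \<open>m = 2 p\<close> together.\<close>

lemma block_cases:
  fixes A B p r e :: nat
  assumes "A + B = 2 * p + e" "e \<le> 1"
  obtains s k where "s \<le> p" "p - s \<le> k" "A = p + s + e" "B = p - s" "r = k - (p - s)"
  | s k where "s \<le> p" "p - s \<le> k" "A = p - s" "B = p + s + e" "r = k - (p - s)"
proof (cases "B \<le> p")
  case True
  then show thesis using assms that(1)[of "p - B" "B + r"] by simp
next
  case False
  then show thesis using assms that(2)[of "p - A" "A + r"] by simp
qed

lemma block_values:
  fixes f :: "nat \<Rightarrow> nat \<Rightarrow> nat \<Rightarrow> 'a"
  assumes e: "e \<le> 1"
  shows "{f A B r | A B r. A + B = 2 * p + e} =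
    {f (p + s + e) (p - s) (k - (p - s)) | s k. s \<le> p \<and> p - s \<le> k} \<union> {f (p - s) (p + s + e) (k - (p - s)) | s k. s \<le> p \<and> p - s \<le> k}"
    (is "?L = ?R")
proof (intro equalityI subsetI)
  fix x assume "x \<in> ?L"
  then obtain A B r where x: "x = f A B r" "A + B = 2 * p + e" by blast
  from x(2) e show "x \<in> ?R" by (cases rule: block_cases[where r = r]) (use x(1) in blast)+
next
  fix x assume "x \<in> ?R"
  then obtain s k where h: "s \<le> p" "p - s \<le> k"
    and "x = f (p + s + e) (p - s) (k - (p - s)) \<or> x = f (p - s) (p + s + e) (k - (p - s))" by blast
  then show "x \<in> ?L" using block_label(1,2)[OF h] by blast
qed

lemma block_types:
  fixes p e :: nat
  assumes "e \<le> 1"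
  shows "{(A + r, B + r) | A B r. A + B = 2 * p + e} =
    {(k, k + 2 * s + e) | s k. s \<le> p \<and> p - s \<le> k} \<union> {(k + 2 * s + e, k) | s k. s \<le> p \<and> p - s \<le> k}"
  unfolding block_values[OF assms, of "\<lambda>A B r. (A + r, B + r)"]
  by (subst Un_commute) (simp only: block_label simp_thms cong: rev_conj_cong)

text \<open>The hypotheses under which the spectrum is read off from the blocks: \<open>\<tau> A B r\<close> is the scalar on the block \<open>(A, B, r)\<close>.\<close>

definition block_diagonal :: "nat \<Rightarrow> (sect \<Rightarrow> sect) \<Rightarrow> (nat \<Rightarrow> nat \<Rightarrow> nat \<Rightarrow> real) \<Rightarrow> bool" where
  "block_diagonal n P \<tau> \<longleftrightarrow> sec_linear (int n) (int n) P \<and> symmetric_op n P \<and>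
     (\<forall>A B r k l. (A, B, r, k, l) \<in> idx n \<longrightarrow> P (eb (A, B, r, k, l)) = sec_scale (complex_of_real (\<tau> A B r)) (eb (A, B, r, k, l)))"

context
  fixes n :: nat and P :: "sect \<Rightarrow> sect" and \<tau> :: "nat \<Rightarrow> nat \<Rightarrow> nat \<Rightarrow> real"
  assumes block: "block_diagonal n P \<tau>"
begin

lemma block_diagonal_diag: "\<iota> \<in> idx n \<Longrightarrow> P (eb \<iota>) = sec_scale (complex_of_real ((\<lambda>(A, B, r, k, l). \<tau> A B r) \<iota>)) (eb \<iota>)"
  using block unfolding block_diagonal_def by (cases \<iota>) (simp only: prod.case)

lemma block_diagonal_linear: "sec_linear (int n) (int n) P"
  and block_diagonal_symmetric: "symmetric_op n P"
  using block unfolding block_diagonal_def by blast+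

lemma eigenvalue_on_block: "A + B = n \<Longrightarrow> eigenvalue_on (int n) P (A + r) (B + r) (\<tau> A B r)"
  using block unfolding block_diagonal_def by (intro eigenvalue_on_bsec) (simp_all add: idx_iff)

lemma eigenvalues_block: "eigenvalues (int n) P = complex_of_real ` {\<tau> A B r | A B r. A + B = n}"
proof -
  let ?t = "\<lambda>(A, B, r, k, l). \<tau> A B r"
  have "eigenvalues (int n) P = complex_of_real ` ?t ` idx n"
    by (rule eigenvalues_diagonal[OF block_diagonal_linear block_diagonal_symmetric block_diagonal_diag])
  also have "?t ` idx n = {\<tau> A B r | A B r. A + B = n}"
  proof (intro equalityI subsetI)
    fix x assume "x \<in> {\<tau> A B r | A B r. A + B = n}"
    then obtain A B r where "x = \<tau> A B r" "A + B = n" by blast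
    then show "x \<in> ?t ` idx n" by (intro image_eqI[of _ _ "(A, B, r, 0, 0)"]) (simp_all add: idx_iff)
  next
    fix x assume "x \<in> ?t ` idx n"
    then obtain A B r k l where "x = \<tau> A B r" "(A, B, r, k, l) \<in> idx n" by auto
    then show "x \<in> {\<tau> A B r | A B r. A + B = n}" by (auto simp: idx_iff)
  qed
  finally show ?thesis .
qed

lemma eigenvalue_on_label:
  assumes n: "n = 2 * p + e" and h: "s \<le> p" "p - s \<le> k"
  shows "eigenvalue_on (int n) P (k + 2 * s + e) k (\<tau> (p + s + e) (p - s) (k - (p - s)))"
    and "eigenvalue_on (int n) P k (k + 2 * s + e) (\<tau> (p - s) (p + s + e) (k - (p - s)))"
  using eigenvalue_on_block[OF block_label(1)[OF h, of e, folded n], of "k - (p - s)"]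
    eigenvalue_on_block[OF block_label(2)[OF h, of e, folded n], of "k - (p - s)"]
  by (simp_all only: block_label[OF h])

lemma eigenvalues_label:
  assumes n: "n = 2 * p + e" and e: "e \<le> 1"
  shows "eigenvalues (int n) P = complex_of_real `
    ({\<tau> (p + s + e) (p - s) (k - (p - s)) | s k. s \<le> p \<and> p - s \<le> k} \<union> {\<tau> (p - s) (p + s + e) (k - (p - s)) | s k. s \<le> p \<and> p - s \<le> k})"
  unfolding eigenvalues_block unfolding n block_values[OF e] by (rule refl)

lemmas eigenvalue_on_odd = eigenvalue_on_label[where e = 1]
lemmas eigenvalue_on_even = eigenvalue_on_label[where e = 0, unfolded add_0_right]
lemmas eigenvalues_odd = eigenvalues_label[where e = 1, OF _ order_refl]
lemmas eigenvalues_even = eigenvalues_label[where e = 0, unfolded add_0_right, OF _ zero_le_one]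

end

definition ev_zero :: "nat \<Rightarrow> nat \<Rightarrow> nat \<Rightarrow> real" where
  "ev_zero A B r = (real A - real B) * (real A + real B + 2 * real r + 2) / 2"

definition ev_plus_minus :: "nat \<Rightarrow> nat \<Rightarrow> nat \<Rightarrow> nat \<Rightarrow> real" where
  "ev_plus_minus n A B r = 4 * real A * real B * (real r + 1) * (real n + real r + 1)"

definition ev_minus_plus :: "nat \<Rightarrow> nat \<Rightarrow> nat \<Rightarrow> nat \<Rightarrow> real" where
  "ev_minus_plus n A B r = 4 * real r * (real A + 1) * (real B + 1) * (real n + real r + 2)"

context
  fixes p s k :: nat
  assumes h: "s \<le> p \<and> p - s \<le> k"
begin

lemma real_diffs: "real (p - s) = real p - real s" "real (k - (p - s)) = real k - (real p - real s)"
proof -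
  show ps: "real (p - s) = real p - real s" using h by (simp add: of_nat_diff)
  have "real (k - (p - s)) = real k - real (p - s)" by (rule of_nat_diff) (use h in blast)
  then show "real (k - (p - s)) = real k - (real p - real s)" unfolding ps .
qed

lemma ev_zero_odd:
  "ev_zero (p + s + 1) (p - s) (k - (p - s)) = (2 * real s + 1) * (real k + (2 * real s + 3) / 2)"
  "ev_zero (p - s) (p + s + 1) (k - (p - s)) = - (2 * real s + 1) * (real k + (2 * real s + 3) / 2)"
  by (simp_all add: ev_zero_def real_diffs field_simps)

lemma ev_zero_even:
  "ev_zero (p + s) (p - s) (k - (p - s)) = 2 * real s * (real k + real s + 1)"
  "ev_zero (p - s) (p + s) (k - (p - s)) = - 2 * real s * (real k + real s + 1)"
  by (simp_all add: ev_zero_def real_diffs field_simps)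

lemma ev_plus_minus_odd:
  "ev_plus_minus (2 * p + 1) (p + s + 1) (p - s) (k - (p - s)) =
    4 * (real p - real s) * (real k + 1 - (real p - real s)) * (real p + real s + 1) * (real k + real p + real s + 2)"
  "ev_plus_minus (2 * p + 1) (p - s) (p + s + 1) (k - (p - s)) =
    4 * (real p - real s) * (real k + 1 - (real p - real s)) * (real p + real s + 1) * (real k + real p + real s + 2)"
  by (simp_all add: ev_plus_minus_def real_diffs algebra_simps)

lemma ev_plus_minus_even:
  "ev_plus_minus (2 * p) (p + s) (p - s) (k - (p - s)) =
    4 * (real p - real s) * (real k + 1 - (real p - real s)) * (real p + real s) * (real k + real p + real s + 1)"
  "ev_plus_minus (2 * p) (p - s) (p + s) (k - (p - s)) =
    4 * (real p - real s) * (real k + 1 - (real p - real s)) * (real p + real s) * (real k + real p + real s + 1)"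
  by (simp_all add: ev_plus_minus_def real_diffs algebra_simps)

lemma ev_minus_plus_odd:
  "ev_minus_plus (2 * p + 1) (p + s + 1) (p - s) (k - (p - s)) =
    4 * (real p - real s + 1) * (real k - (real p - real s)) * (real p + real s + 2) * (real k + real p + real s + 3)"
  "ev_minus_plus (2 * p + 1) (p - s) (p + s + 1) (k - (p - s)) =
    4 * (real p - real s + 1) * (real k - (real p - real s)) * (real p + real s + 2) * (real k + real p + real s + 3)"
  by (simp_all add: ev_minus_plus_def real_diffs algebra_simps)

lemma ev_minus_plus_even:
  "ev_minus_plus (2 * p) (p + s) (p - s) (k - (p - s)) =
    4 * (real p - real s + 1) * (real k - (real p - real s)) * (real p + real s + 1) * (real k + real p + real s + 2)"
  "ev_minus_plus (2 * p) (p - s) (p + s) (k - (p - s)) =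
    4 * (real p - real s + 1) * (real k - (real p - real s)) * (real p + real s + 1) * (real k + real p + real s + 2)"
  by (simp_all add: ev_minus_plus_def real_diffs algebra_simps)

end

lemma block_diagonal_D_zero: "block_diagonal n (D_zero (int n)) ev_zero"
  unfolding block_diagonal_def ev_zero_def using sec_linear_D_zero symmetric_D_zero D_zero_eb by blast

lemma block_diagonal_D_plus_minus: "block_diagonal n (D_plus (int n - 2) \<circ> D_minus (int n)) (ev_plus_minus n)"
  unfolding block_diagonal_def ev_plus_minus_def using sec_linear_D_plus_minus symmetric_D_plus_minus D_plus_minus_eb by blast

lemma block_diagonal_D_minus_plus: "block_diagonal n (D_minus (int n + 2) \<circ> D_plus (int n)) (ev_minus_plus n)"
  unfolding block_diagonal_def ev_minus_plus_def using sec_linear_D_minus_plus symmetric_D_minus_plus D_minus_plus_eb by blast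

lemma int_odd: "int (2 * p + 1) = 2 * int p + 1" and int_even: "int (2 * p) = 2 * int p"
  by simp_all

lemma self_adjoint_D_zero: "self_adjoint (int m) (D_zero (int m))"
  by (rule diagonal_self_adjoint[OF sec_linear_D_zero symmetric_D_zero block_diagonal_diag[OF block_diagonal_D_zero]])

lemma kernel_D_zero_odd: "op_kernel (2 * int p + 1) (D_zero (2 * int p + 1)) = {0}"
  unfolding int_odd[symmetric]
proof (intro equalityI subsetI)
  fix \<phi> assume "\<phi> \<in> op_kernel (int (2 * p + 1)) (D_zero (int (2 * p + 1)))"
  then have \<phi>: "\<phi> \<in> smooth (2 * p + 1)" and z: "D_zero (int (2 * p + 1)) \<phi> = 0" unfolding op_kernel_def by blast+
  have "\<phi> = 0"
  proof (rule smooth_zero_if_orthogonal[OF \<phi>])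
    fix \<iota> assume \<iota>: "\<iota> \<in> idx (2 * p + 1)"
    show "ip (2 * p + 1) \<phi> (eb \<iota>) = 0"
    proof (rule diagonal_kernel[OF sec_linear_D_zero symmetric_D_zero block_diagonal_diag[OF block_diagonal_D_zero] \<phi> z \<iota>])
      obtain A B r k l where e: "\<iota> = (A, B, r, k, l)" by (metis prod_cases5)
      have "A + B = 2 * p + 1" using \<iota> by (simp add: e idx_iff)
      then have "A \<noteq> B" by presburger
      then show "(\<lambda>(A, B, r, k, l). ev_zero A B r) \<iota> \<noteq> 0" by (simp add: e ev_zero_def)
    qed
  qed
  then show "\<phi> \<in> {0}" by simp
next
  fix \<phi> :: sect assume "\<phi> \<in> {0}"
  then show "\<phi> \<in> op_kernel (int (2 * p + 1)) (D_zero (int (2 * p + 1)))"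
    unfolding op_kernel_def using smooth_sections_zero sec_linear_zero[OF sec_linear_D_zero] by blast
qed

text \<open>For even \<open>n\<close> the two families of labels overlap in \<open>s = 0\<close>, which the theorem lists separately.\<close>

lemma types_even:
  fixes p :: nat
  shows "{(A + r, B + r) | A B r. A + B = 2 * p} =
    {(k, k + 2 * s) | s k. 1 \<le> s \<and> s \<le> p \<and> p - s \<le> k} \<union>
    {(k + 2 * s, k) | s k. 1 \<le> s \<and> s \<le> p \<and> p - s \<le> k} \<union> {(k, k) | k. p \<le> k}" (is "_ = ?R")
proof -
  have "{(A + r, B + r) | A B r. A + B = 2 * p} =
    {(k, k + 2 * s) | s k. s \<le> p \<and> p - s \<le> k} \<union> {(k + 2 * s, k) | s k. s \<le> p \<and> p - s \<le> k}" (is "_ = ?L")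
    using block_types[of 0 p] by (simp only: add_0_right zero_le_one simp_thms)
  also have "?L = ?R"
  proof (intro equalityI subsetI)
    fix x assume "x \<in> ?L"
    then obtain s k where "s \<le> p" "p - s \<le> k" "x = (k, k + 2 * s) \<or> x = (k + 2 * s, k)" by blast
    then show "x \<in> ?R" by (cases "s = 0") auto
  next
    fix x assume "x \<in> ?R"
    then show "x \<in> ?L"
      by (elim UnE CollectE exE conjE) (blast, blast, rule UnI1, rule CollectI, rule exI[of _ 0], force)
  qed
  finally show ?thesis .
qed

lemma eigenvalues_D_zero_even: "eigenvalues (2 * int p) (D_zero (2 * int p)) = complex_of_real `
       ({2 * real s * (real k + real s + 1) | s k. 1 \<le> s \<and> s \<le> p \<and> p - s \<le> k} \<union>
        {- 2 * real s * (real k + real s + 1) | s k. 1 \<le> s \<and> s \<le> p \<and> p - s \<le> k} \<union> {0})"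
proof -
  have "eigenvalues (2 * int p) (D_zero (2 * int p)) = complex_of_real `
     ({2 * real s * (real k + real s + 1) | s k. s \<le> p \<and> p - s \<le> k} \<union> {- 2 * real s * (real k + real s + 1) | s k. s \<le> p \<and> p - s \<le> k})"
    using eigenvalues_even[OF block_diagonal_D_zero refl, of p] unfolding int_even
    by (simp only: ev_zero_even simp_thms cong: rev_conj_cong)
  also have "{2 * real s * (real k + real s + 1) | s k. s \<le> p \<and> p - s \<le> k} \<union> {- 2 * real s * (real k + real s + 1) | s k. s \<le> p \<and> p - s \<le> k} =
    {2 * real s * (real k + real s + 1) | s k. 1 \<le> s \<and> s \<le> p \<and> p - s \<le> k} \<union>
        {- 2 * real s * (real k + real s + 1) | s k. 1 \<le> s \<and> s \<le> p \<and> p - s \<le> k} \<union> {0}" (is "?L = ?R")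
  proof (intro equalityI subsetI)
    fix x assume "x \<in> ?L"
    then obtain s k where h: "s \<le> p" "p - s \<le> k" "x = 2 * real s * (real k + real s + 1) \<or> x = - 2 * real s * (real k + real s + 1)" by blast
    show "x \<in> ?R"
    proof (cases "s = 0")
      case False
      then have "1 \<le> s" by simp
      then show ?thesis using h by blast
    qed (use h in simp)
  next
    fix x assume "x \<in> ?R"
    moreover have "0 \<in> {2 * real s * (real k + real s + 1) | s k. s \<le> p \<and> p - s \<le> k}"
      by (intro CollectI exI[of _ 0] exI[of _ p]) simp
    ultimately show "x \<in> ?L" by blast
  qed
  finally show ?thesis .
qed

lemma eigenvalues_D_zero_odd: "eigenvalues (2 * int p + 1) (D_zero (2 * int p + 1)) = complex_of_real `
       ({(2 * real s + 1) * (real k + (2 * real s + 3) / 2) | s k. s \<le> p \<and> p - s \<le> k} \<union>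
        {- (2 * real s + 1) * (real k + (2 * real s + 3) / 2) | s k. s \<le> p \<and> p - s \<le> k})"
  using eigenvalues_odd[OF block_diagonal_D_zero refl, of p] unfolding int_odd
  by (simp only: ev_zero_odd simp_thms cong: rev_conj_cong)

lemma eigenvalues_D_plus_minus_odd: "eigenvalues (2 * int p + 1) (D_plus (2 * int p + 1 - 2) \<circ> D_minus (2 * int p + 1)) =
       complex_of_real `
         {4 * (real p - real s) * (real k + 1 - (real p - real s)) * (real p + real s + 1)
            * (real k + real p + real s + 2) | s k. s \<le> p \<and> p - s \<le> k}"
  using eigenvalues_odd[OF block_diagonal_D_plus_minus refl, of p] unfolding int_odd
  by (simp only: ev_plus_minus_odd simp_thms Un_absorb cong: rev_conj_cong)

lemma eigenvalues_D_plus_minus_even: "eigenvalues (2 * int p) (D_plus (2 * int p - 2) \<circ> D_minus (2 * int p)) =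
       complex_of_real `
         {4 * (real p - real s) * (real k + 1 - (real p - real s)) * (real p + real s)
            * (real k + real p + real s + 1) | s k. s \<le> p \<and> p - s \<le> k}"
  using eigenvalues_even[OF block_diagonal_D_plus_minus refl, of p] unfolding int_even
  by (simp only: ev_plus_minus_even simp_thms Un_absorb cong: rev_conj_cong)

lemma eigenvalues_D_minus_plus_odd: "eigenvalues (2 * int p + 1) (D_minus (2 * int p + 1 + 2) \<circ> D_plus (2 * int p + 1)) =
       complex_of_real `
         {4 * (real p - real s + 1) * (real k - (real p - real s)) * (real p + real s + 2)
            * (real k + real p + real s + 3) | s k. s \<le> p \<and> p - s \<le> k}"
  using eigenvalues_odd[OF block_diagonal_D_minus_plus refl, of p] unfolding int_odd
  by (simp only: ev_minus_plus_odd simp_thms Un_absorb cong: rev_conj_cong)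

lemma eigenvalues_D_minus_plus_even: "eigenvalues (2 * int p) (D_minus (2 * int p + 2) \<circ> D_plus (2 * int p)) =
       complex_of_real `
         {4 * (real p - real s + 1) * (real k - (real p - real s)) * (real p + real s + 1)
            * (real k + real p + real s + 2) | s k. s \<le> p \<and> p - s \<le> k}"
  using eigenvalues_even[OF block_diagonal_D_minus_plus refl, of p] unfolding int_even
  by (simp only: ev_minus_plus_even simp_thms Un_absorb cong: rev_conj_cong)

theorem proposition7p4:
  shows
    "(\<forall>p::nat. decomposes (2 * int p + 1)
       ({(k, k + 2 * s + 1) | s k. s \<le> p \<and> p - s \<le> k} \<union> {(k + 2 * s + 1, k) | s k. s \<le> p \<and> p - s \<le> k})) \<and>
     (\<forall>p::nat. decomposes (2 * int p)
       ({(k, k + 2 * s) | s k. 1 \<le> s \<and> s \<le> p \<and> p - s \<le> k} \<union>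
        {(k + 2 * s, k) | s k. 1 \<le> s \<and> s \<le> p \<and> p - s \<le> k} \<union> {(k, k) | k. p \<le> k})) \<and>
     (\<forall>m::nat. self_adjoint (int m) (D_zero (int m))) \<and>
     (\<forall>p s k :: nat. s \<le> p \<and> p - s \<le> k \<longrightarrow>
       eigenvalue_on (2 * int p + 1) (D_zero (2 * int p + 1)) (k + 2 * s + 1) k
         ((2 * real s + 1) * (real k + (2 * real s + 3) / 2)) \<and>
       eigenvalue_on (2 * int p + 1) (D_zero (2 * int p + 1)) k (k + 2 * s + 1)
         (- (2 * real s + 1) * (real k + (2 * real s + 3) / 2))) \<and>
     (\<forall>p::nat. eigenvalues (2 * int p + 1) (D_zero (2 * int p + 1)) = complex_of_real `
       ({(2 * real s + 1) * (real k + (2 * real s + 3) / 2) | s k. s \<le> p \<and> p - s \<le> k} \<union>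
        {- (2 * real s + 1) * (real k + (2 * real s + 3) / 2) | s k. s \<le> p \<and> p - s \<le> k})) \<and>
     (\<forall>p::nat. op_kernel (2 * int p + 1) (D_zero (2 * int p + 1)) = {0}) \<and>
     (\<forall>p s k :: nat. 1 \<le> s \<and> s \<le> p \<and> p - s \<le> k \<longrightarrow>
       eigenvalue_on (2 * int p) (D_zero (2 * int p)) (k + 2 * s) k
         (2 * real s * (real k + real s + 1)) \<and>
       eigenvalue_on (2 * int p) (D_zero (2 * int p)) k (k + 2 * s)
         (- 2 * real s * (real k + real s + 1))) \<and>
     (\<forall>p k :: nat. p \<le> k \<longrightarrow> eigenvalue_on (2 * int p) (D_zero (2 * int p)) k k 0) \<and>
     (\<forall>p::nat. eigenvalues (2 * int p) (D_zero (2 * int p)) = complex_of_real `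
       ({2 * real s * (real k + real s + 1) | s k. 1 \<le> s \<and> s \<le> p \<and> p - s \<le> k} \<union>
        {- 2 * real s * (real k + real s + 1) | s k. 1 \<le> s \<and> s \<le> p \<and> p - s \<le> k} \<union> {0})) \<and>
     (\<forall>p s k :: nat. s \<le> p \<and> p - s \<le> k \<longrightarrow>
       (\<forall>(a, b) \<in> {(k + 2 * s + 1, k), (k, k + 2 * s + 1)}.
          eigenvalue_on (2 * int p + 1) (D_plus (2 * int p + 1 - 2) \<circ> D_minus (2 * int p + 1)) a b
            (4 * (real p - real s) * (real k + 1 - (real p - real s)) * (real p + real s + 1)
               * (real k + real p + real s + 2)))) \<and>
     (\<forall>p::nat. eigenvalues (2 * int p + 1) (D_plus (2 * int p + 1 - 2) \<circ> D_minus (2 * int p + 1)) =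
       complex_of_real `
         {4 * (real p - real s) * (real k + 1 - (real p - real s)) * (real p + real s + 1)
            * (real k + real p + real s + 2) | s k. s \<le> p \<and> p - s \<le> k}) \<and>
     (\<forall>p s k :: nat. s \<le> p \<and> p - s \<le> k \<longrightarrow>
       (\<forall>(a, b) \<in> {(k + 2 * s, k), (k, k + 2 * s)}.
          eigenvalue_on (2 * int p) (D_plus (2 * int p - 2) \<circ> D_minus (2 * int p)) a b
            (4 * (real p - real s) * (real k + 1 - (real p - real s)) * (real p + real s)
               * (real k + real p + real s + 1)))) \<and>
     (\<forall>p::nat. eigenvalues (2 * int p) (D_plus (2 * int p - 2) \<circ> D_minus (2 * int p)) =
       complex_of_real `
         {4 * (real p - real s) * (real k + 1 - (real p - real s)) * (real p + real s)
            * (real k + real p + real s + 1) | s k. s \<le> p \<and> p - s \<le> k}) \<and>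
     (\<forall>m::nat. elliptic2 (int m) (D_minus (int m + 2) \<circ> D_plus (int m))) \<and>
     (\<forall>p s k :: nat. s \<le> p \<and> p - s \<le> k \<longrightarrow>
       (\<forall>(a, b) \<in> {(k + 2 * s + 1, k), (k, k + 2 * s + 1)}.
          eigenvalue_on (2 * int p + 1) (D_minus (2 * int p + 1 + 2) \<circ> D_plus (2 * int p + 1)) a b
            (4 * (real p - real s + 1) * (real k - (real p - real s)) * (real p + real s + 2)
               * (real k + real p + real s + 3)))) \<and>
     (\<forall>p::nat. eigenvalues (2 * int p + 1) (D_minus (2 * int p + 1 + 2) \<circ> D_plus (2 * int p + 1)) =
       complex_of_real `
         {4 * (real p - real s + 1) * (real k - (real p - real s)) * (real p + real s + 2)
            * (real k + real p + real s + 3) | s k. s \<le> p \<and> p - s \<le> k}) \<and>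
     (\<forall>p s k :: nat. s \<le> p \<and> p - s \<le> k \<longrightarrow>
       (\<forall>(a, b) \<in> {(k + 2 * s, k), (k, k + 2 * s)}.
          eigenvalue_on (2 * int p) (D_minus (2 * int p + 2) \<circ> D_plus (2 * int p)) a b
            (4 * (real p - real s + 1) * (real k - (real p - real s)) * (real p + real s + 1)
               * (real k + real p + real s + 2)))) \<and>
     (\<forall>p::nat. eigenvalues (2 * int p) (D_minus (2 * int p + 2) \<circ> D_plus (2 * int p)) =
       complex_of_real `
         {4 * (real p - real s + 1) * (real k - (real p - real s)) * (real p + real s + 1)
            * (real k + real p + real s + 2) | s k. s \<le> p \<and> p - s \<le> k}) \<and>
     (\<forall>m::nat. real (sec.dim (op_kernel (int m) (D_plus (int m)))) =
       (real m + 1) * (real m + 2) * (real m + 3) / 6)"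
proof (intro conjI allI impI)
  fix p :: nat
  show "decomposes (2 * int p + 1)
       ({(k, k + 2 * s + 1) | s k. s \<le> p \<and> p - s \<le> k} \<union> {(k + 2 * s + 1, k) | s k. s \<le> p \<and> p - s \<le> k})"
    using decomposition[of "2 * p + 1"] unfolding int_odd block_types[OF order_refl] .
  show "decomposes (2 * int p)
       ({(k, k + 2 * s) | s k. 1 \<le> s \<and> s \<le> p \<and> p - s \<le> k} \<union>
        {(k + 2 * s, k) | s k. 1 \<le> s \<and> s \<le> p \<and> p - s \<le> k} \<union> {(k, k) | k. p \<le> k})"
    using decomposition[of "2 * p"] unfolding int_even types_even .
next
  fix p s k :: nat
  assume h: "s \<le> p \<and> p - s \<le> k"
  note e = eigenvalue_on_odd[OF block_diagonal_D_zero refl conjunct1[OF h] conjunct2[OF h], unfolded int_odd ev_zero_odd[OF h]]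
  show "eigenvalue_on (2 * int p + 1) (D_zero (2 * int p + 1)) (k + 2 * s + 1) k ((2 * real s + 1) * (real k + (2 * real s + 3) / 2))"
    "eigenvalue_on (2 * int p + 1) (D_zero (2 * int p + 1)) k (k + 2 * s + 1) (- (2 * real s + 1) * (real k + (2 * real s + 3) / 2))"
    by (rule e(1), rule e(2))
next
  fix p s k :: nat
  assume h1: "1 \<le> s \<and> s \<le> p \<and> p - s \<le> k"
  then have h: "s \<le> p \<and> p - s \<le> k" by blast
  note e = eigenvalue_on_even[OF block_diagonal_D_zero refl conjunct1[OF h] conjunct2[OF h], unfolded int_even ev_zero_even[OF h]]
  show "eigenvalue_on (2 * int p) (D_zero (2 * int p)) (k + 2 * s) k (2 * real s * (real k + real s + 1))"
    "eigenvalue_on (2 * int p) (D_zero (2 * int p)) k (k + 2 * s) (- 2 * real s * (real k + real s + 1))"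
    by (rule e(1), rule e(2))
next
  fix p k :: nat
  assume "p \<le> k"
  then have h: "0 \<le> p \<and> p - 0 \<le> k" by simp
  show "eigenvalue_on (2 * int p) (D_zero (2 * int p)) k k 0"
    using eigenvalue_on_even(1)[OF block_diagonal_D_zero refl conjunct1[OF h] conjunct2[OF h], unfolded int_even ev_zero_even[OF h]] by simp
next
  fix p s k :: nat
  assume h: "s \<le> p \<and> p - s \<le> k"
  note odd = conjunct1[OF h] conjunct2[OF h]
  show "\<forall>(a, b)\<in>{(k + 2 * s + 1, k), (k, k + 2 * s + 1)}.
      eigenvalue_on (2 * int p + 1) (D_plus (2 * int p + 1 - 2) \<circ> D_minus (2 * int p + 1)) a b
        (4 * (real p - real s) * (real k + 1 - (real p - real s)) * (real p + real s + 1) * (real k + real p + real s + 2))"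
    using eigenvalue_on_odd[OF block_diagonal_D_plus_minus refl odd, unfolded int_odd ev_plus_minus_odd[OF h]]
    by (simp only: ball_simps prod.case simp_thms)
  show "\<forall>(a, b)\<in>{(k + 2 * s, k), (k, k + 2 * s)}.
      eigenvalue_on (2 * int p) (D_plus (2 * int p - 2) \<circ> D_minus (2 * int p)) a b
        (4 * (real p - real s) * (real k + 1 - (real p - real s)) * (real p + real s) * (real k + real p + real s + 1))"
    using eigenvalue_on_even[OF block_diagonal_D_plus_minus refl odd, unfolded int_even ev_plus_minus_even[OF h]]
    by (simp only: ball_simps prod.case simp_thms)
  show "\<forall>(a, b)\<in>{(k + 2 * s + 1, k), (k, k + 2 * s + 1)}.
      eigenvalue_on (2 * int p + 1) (D_minus (2 * int p + 1 + 2) \<circ> D_plus (2 * int p + 1)) a b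
        (4 * (real p - real s + 1) * (real k - (real p - real s)) * (real p + real s + 2) * (real k + real p + real s + 3))"
    using eigenvalue_on_odd[OF block_diagonal_D_minus_plus refl odd, unfolded int_odd ev_minus_plus_odd[OF h]]
    by (simp only: ball_simps prod.case simp_thms)
  show "\<forall>(a, b)\<in>{(k + 2 * s, k), (k, k + 2 * s)}.
      eigenvalue_on (2 * int p) (D_minus (2 * int p + 2) \<circ> D_plus (2 * int p)) a b
        (4 * (real p - real s + 1) * (real k - (real p - real s)) * (real p + real s + 1) * (real k + real p + real s + 2))"
    using eigenvalue_on_even[OF block_diagonal_D_minus_plus refl odd, unfolded int_even ev_minus_plus_even[OF h]]
    by (simp only: ball_simps prod.case simp_thms)
qed (fact self_adjoint_D_zero eigenvalues_D_zero_odd kernel_D_zero_odd eigenvalues_D_zero_even eigenvalues_D_plus_minus_odd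
  eigenvalues_D_plus_minus_even elliptic eigenvalues_D_minus_plus_odd eigenvalues_D_minus_plus_even dim_kernel_D_plus)+

end
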